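(* Fix a positive integer $k$. There is a randomised algorithm that, given a set $Z\subseteq\mathbb{N}$ of $n$ positive integers and targets $t_1,\ldots,t_k$, decides $k$-Subset Sum on this input with high probability in time $\tilde{O}(n+t^k)$, where $t=\max\{t_1,\ldots,t_k\}$.
   Context: $k$-Subset Sum: given a set $Z$ of $n$ positive integers and $k$ targets $t_1,\ldots,t_k$, determine whether there exist $k$ pairwise disjoint subsets $Z_1,\ldots,Z_k\subseteq Z$ with $\Sigma(Z_i)=t_i$ for $i=1,\ldots,k$, where $\Sigma(X)=\sum_{x\in X}x$. The notation $\tilde{O}(\cdot)$ suppresses polylogarithmic factors. *)

theory Defs
  imports "HOL-Probability.Probability_Mass_Function" "HOL-Library.Disjoint_Sets"
begin

definition k_subset_sum :: "nat set \<Rightarrow> nat list \<Rightarrow> bool" where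
  "k_subset_sum Z ts \<longleftrightarrow>
     (\<exists>S :: nat \<Rightarrow> nat set.
        (\<forall>i<length ts. S i \<subseteq> Z \<and> \<Sum>(S i) = ts ! i) \<and>
        disjoint_family_on S {..<length ts})"


text \<open>
  The model of computation is the randomised word RAM with word size \<open>w\<close>: registers and memory
  cells hold words, i.e. naturals below \<open>2 ^ w\<close>, memory is addressed by words, and besides the
  usual word operations a uniformly random word can be drawn. Programs are structured (IMP-style)
  and do not depend on \<open>w\<close>, which is a parameter of the semantics.
\<close>

datatype binop = Plus | Minus | Times | Div | Mod | Lt | Eql

datatype expr =
    Const nat
  | Reg nat
  | Load expr
  | Bin binop expr expr

datatype prog =
    Skip
  | Assign nat expr
  | Store expr expr
  | Rand nat
  | Seq prog prog
  | Cond expr prog prog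
  | While expr prog

record state =
  regs :: "nat \<Rightarrow> nat"
  mem :: "nat \<Rightarrow> nat"

text \<open>
  Addition and multiplication wrap around, subtraction is truncated at 0, comparisons yield 0 or 1,
  and division by 0 follows the HOL conventions \<open>a div 0 = 0\<close> and \<open>a mod 0 = a\<close>.
\<close>

fun word_op :: "nat \<Rightarrow> binop \<Rightarrow> nat \<Rightarrow> nat \<Rightarrow> nat" where
  "word_op w Plus a b = (a + b) mod 2 ^ w"
| "word_op w Minus a b = a - b"
| "word_op w Times a b = (a * b) mod 2 ^ w"
| "word_op w Div a b = a div b"
| "word_op w Mod a b = a mod b"
| "word_op w Lt a b = of_bool (a < b) mod 2 ^ w"
| "word_op w Eql a b = of_bool (a = b) mod 2 ^ w"

primrec eval_expr :: "nat \<Rightarrow> expr \<Rightarrow> state \<Rightarrow> nat" where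
  "eval_expr w (Const c) s = c mod 2 ^ w"
| "eval_expr w (Reg x) s = regs s x"
| "eval_expr w (Load e) s = mem s (eval_expr w e s)"
| "eval_expr w (Bin f e1 e2) s = word_op w f (eval_expr w e1 s) (eval_expr w e2 s)"

text \<open>
  One step executes one command or one test. Evaluating an expression costs one step irrespective
  of its size; as a program is a fixed finite object, this differs from charging one step per word
  operation and per memory access only by a constant factor depending on the program.
\<close>

type_synonym config = "prog \<times> state"

primrec step :: "nat \<Rightarrow> prog \<Rightarrow> state \<Rightarrow> config pmf" where
  "step w Skip s = return_pmf (Skip, s)"
| "step w (Assign x e) s =
     return_pmf (Skip, s\<lparr>regs := (regs s)(x := eval_expr w e s)\<rparr>)"
| "step w (Store e1 e2) s =
     return_pmf (Skip, s\<lparr>mem := (mem s)(eval_expr w e1 s := eval_expr w e2 s)\<rparr>)"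
| "step w (Rand x) s =
     map_pmf (\<lambda>r. (Skip, s\<lparr>regs := (regs s)(x := r)\<rparr>)) (pmf_of_set {..<2 ^ w})"
| "step w (Seq p q) s =
     (if p = Skip then return_pmf (q, s)
      else map_pmf (\<lambda>(p', s'). (Seq p' q, s')) (step w p s))"
| "step w (Cond e p q) s = return_pmf (if eval_expr w e s \<noteq> 0 then p else q, s)"
| "step w (While e p) s =
     return_pmf (if eval_expr w e s \<noteq> 0 then Seq p (While e p) else Skip, s)"

primrec run :: "nat \<Rightarrow> nat \<Rightarrow> config \<Rightarrow> config pmf" where
  "run w 0 cf = return_pmf cf"
| "run w (Suc T) cf = bind_pmf (run w T cf) (\<lambda>(p, s). step w p s)"

definition halted :: "config \<Rightarrow> bool" where
  "halted cf \<longleftrightarrow> fst cf = Skip"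

definition accepting :: "config \<Rightarrow> bool" where
  "accepting cf \<longleftrightarrow> regs (snd cf) 0 \<noteq> 0"

definition halts_within :: "nat \<Rightarrow> prog \<Rightarrow> state \<Rightarrow> nat \<Rightarrow> bool" where
  "halts_within w P s T \<longleftrightarrow> (\<forall>cf \<in> set_pmf (run w T (P, s)). halted cf)"

text \<open>
  Halted configurations are unchanged by further steps, so the answer of a run that halts within
  \<open>T\<close> steps can be read off after exactly \<open>T\<close> steps.
\<close>

definition answer_prob :: "nat \<Rightarrow> prog \<Rightarrow> state \<Rightarrow> nat \<Rightarrow> bool \<Rightarrow> real" where
  "answer_prob w P s T b =
     measure_pmf.prob (run w T (P, s)) {cf. halted cf \<and> (accepting cf \<longleftrightarrow> b)}"

text \<open>
  Memory layout of the input: cell 0 holds the number of elements, the following cells hold the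
  targets and then the elements, in some order; everything else is zero.
\<close>

definition input_state :: "nat list \<Rightarrow> nat list \<Rightarrow> state" where
  "input_state ts xs =
     (let inp = length xs # ts @ xs
      in \<lparr>regs = (\<lambda>_. 0), mem = (\<lambda>a. if a < length inp then inp ! a else 0)\<rparr>)"

text \<open>
  Admissible word sizes: every element of the set fits into a word, and a word has at least
  \<open>\<kappa> * log 2 (n + t + 2)\<close> bits, where \<open>\<kappa>\<close> is a constant.
\<close>

definition word_size_ok :: "nat \<Rightarrow> nat \<Rightarrow> nat set \<Rightarrow> nat \<Rightarrow> nat \<Rightarrow> bool" where
  "word_size_ok w \<kappa> Z n t \<longleftrightarrow> (\<forall>z\<in>Z. z < 2 ^ w) \<and> (n + t + 2) ^ \<kappa> \<le> 2 ^ w"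

end

theory Submission
  imports Defs "HOL-Probability.Product_PMF" "HOL-Computational_Algebra.Computational_Algebra"
begin

text \<open>
  Give every element \<open>z\<close> and target index \<open>i\<close> a random weight \<open>r\<close> modulo a prime \<open>p > 4kt\<close>. The
  coefficient at the target vector of the product over \<open>z\<close> of \<open>1 + (\<Sum>i<k. r z i * X_i ^ z)\<close> is a sum over
  all solutions of distinct multilinear monomials in the weights. It vanishes identically if there is no
  solution, and otherwise it is nonzero modulo \<open>p\<close> with probability at least \<open>1 / 2\<close>. The product is
  computed from its logarithmic derivative, which has few nonzero terms: after Kronecker substitution
  the recurrence for the exponential is an online convolution, whose blocks are multiplied by a fast
  transform over a polynomial ring in which formal roots of unity are adjoined, so that no special
  prime is needed. Independent rounds amplify the probability.
\<close>

section \<open>Runs as deterministic functions of a random tape\<close>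

text \<open>Multiplying the \<open>n\<close> factors one after the other would cost about
  \<open>n * t ^ k\<close>. The logarithmic derivative of the factor of \<open>z\<close> lives on
  multiples of \<open>z\<close>, so up to the targets it has at most
  \<open>(t div z + 1) ^ k\<close> terms; as the elements are distinct, a harmonic sum bounds their
  total number by \<open>t ^ k\<close> up to a logarithm. The price is a division: the Euler
  derivation multiplies the coefficient at \<open>a\<close> by the total degree
  \<open>\<Sum>i<k. a i\<close>, which must be invertible modulo \<open>p\<close>. It is at most
  \<open>k * t\<close>, and the same number bounds the degree of the coefficient in the weights. A
  uniform word is only nearly uniform modulo \<open>p\<close>, so each degree costs
  \<open>2 / p\<close> instead of \<open>1 / p\<close>; this leads to \<open>p > 4 * k * t\<close>.
  To be found by a sieve in time, \<open>p\<close> must exceed this bound by a logarithm at most.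
  Asking for roots of unity modulo \<open>p\<close> as well would call for primes in arithmetic
  progressions. In a negacyclic ring the variable itself is a root of unity and only powers of 2
  have to be divided out, so any odd \<open>p\<close> serves. Errors are one-sided: without a
  solution the coefficient is 0 for all weights.\<close>

text \<open>The \<open>T\<close>-th word of the tape is consumed by the \<open>T\<close>-th step, whether or not that step draws
  a word; this makes the words read by different steps independent.\<close>

primrec dstep :: "nat \<Rightarrow> nat \<Rightarrow> prog \<Rightarrow> state \<Rightarrow> config" where
  "dstep w r Skip s = (Skip, s)"
| "dstep w r (Assign x e) s = (Skip, s\<lparr>regs := (regs s)(x := eval_expr w e s)\<rparr>)"
| "dstep w r (Store e1 e2) s = (Skip, s\<lparr>mem := (mem s)(eval_expr w e1 s := eval_expr w e2 s)\<rparr>)"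
| "dstep w r (Rand x) s = (Skip, s\<lparr>regs := (regs s)(x := r)\<rparr>)"
| "dstep w r (Seq p q) s =
     (if p = Skip then (q, s) else (\<lambda>(p', s'). (Seq p' q, s')) (dstep w r p s))"
| "dstep w r (Cond e p q) s = (if eval_expr w e s \<noteq> 0 then p else q, s)"
| "dstep w r (While e p) s = (if eval_expr w e s \<noteq> 0 then Seq p (While e p) else Skip, s)"

abbreviation word_pmf :: "nat \<Rightarrow> nat pmf" where
  "word_pmf w \<equiv> pmf_of_set {..<2 ^ w}"

abbreviation tape_pmf :: "nat \<Rightarrow> nat \<Rightarrow> (nat \<Rightarrow> nat) pmf" where
  "tape_pmf w T \<equiv> Pi_pmf {..<T} 0 (\<lambda>_. word_pmf w)"

lemma step_eq_map_dstep: "step w p s = map_pmf (\<lambda>r. dstep w r p s) (word_pmf w)"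
proof (induction p)
  case (Seq p q)
  then show ?case by (simp add: pmf.map_comp o_def)
qed (simp_all add: map_pmf_const)

primrec drun :: "nat \<Rightarrow> (nat \<Rightarrow> nat) \<Rightarrow> nat \<Rightarrow> config \<Rightarrow> config" where
  "drun w \<omega> 0 cf = cf"
| "drun w \<omega> (Suc T) cf = (\<lambda>(p, s). dstep w (\<omega> T) p s) (drun w \<omega> T cf)"

lemma drun_cong: "(\<And>i. i < T \<Longrightarrow> \<omega> i = \<omega>' i) \<Longrightarrow> drun w \<omega> T cf = drun w \<omega>' T cf"
  by (induction T) auto

text \<open>The word of the last step is split off from the product distribution; the earlier steps
  do not look at it, so it can be drawn after them. From here on all probabilities are taken over
  one product space.\<close>

lemma run_eq_map_drun: "run w T cf = map_pmf (\<lambda>\<omega>. drun w \<omega> T cf) (tape_pmf w T)"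
proof (induction T)
  case 0
  then show ?case by (simp add: map_pmf_const)
next
  case (Suc T)
  have upd: "drun w (f(T := y)) T cf = drun w f T cf" for f y
    by (rule drun_cong) simp
  have "map_pmf (\<lambda>\<omega>. drun w \<omega> (Suc T) cf) (tape_pmf w (Suc T)) =
    map_pmf (\<lambda>(y, f). (\<lambda>(p, s). dstep w y p s) (drun w f T cf))
      (pair_pmf (word_pmf w) (tape_pmf w T))"
    unfolding lessThan_Suc
    by (subst Pi_pmf_insert) (auto simp: pmf.map_comp o_def upd case_prod_unfold intro!: map_pmf_cong)
  also have "\<dots> = bind_pmf (tape_pmf w T)
      (\<lambda>f. map_pmf (\<lambda>y. (\<lambda>(p, s). dstep w y p s) (drun w f T cf)) (word_pmf w))"
    unfolding pair_pmf_def map_bind_pmf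
    by (subst bind_commute_pmf) (simp add: map_pmf_def bind_assoc_pmf bind_return_pmf)
  also have "\<dots> = run w (Suc T) cf"
    by (simp add: Suc bind_map_pmf step_eq_map_dstep case_prod_unfold)
  finally show ?case ..
qed

text \<open>Peels off the first step, which suits the composition of programs, whereas
  \<open>drun\<close> peels off the last one. The absolute time \<open>\<tau>\<close> is carried
  along because it selects the tape cell. Since \<open>Skip\<close> makes no step, the number of
  steps needed to reach \<open>Skip\<close> is exact and not just a bound.\<close>

inductive reach :: "nat \<Rightarrow> (nat \<Rightarrow> nat) \<Rightarrow> nat \<Rightarrow> config \<Rightarrow> nat \<Rightarrow> config \<Rightarrow> bool" for w \<omega> where
  reach_refl: "reach w \<omega> \<tau> cf 0 cf"
| reach_step: "p \<noteq> Skip \<Longrightarrow> reach w \<omega> (Suc \<tau>) (dstep w (\<omega> \<tau>) p s) n cf' \<Longrightarrow>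
    reach w \<omega> \<tau> (p, s) (Suc n) cf'"

lemma reach_trans:
  "reach w \<omega> \<tau> cf m cf' \<Longrightarrow> reach w \<omega> (\<tau> + m) cf' n cf'' \<Longrightarrow> reach w \<omega> \<tau> cf (m + n) cf''"
  by (induction rule: reach.induct) (auto intro: reach_step)

lemma reach_Seq_lift:
  "reach w \<omega> \<tau> cf n cf' \<Longrightarrow>
    reach w \<omega> \<tau> (Seq (fst cf) q, snd cf) n (Seq (fst cf') q, snd cf')"
proof (induction rule: reach.induct)
  case (reach_step p \<tau> s n cf')
  show ?case
    using reach_step by (auto intro!: reach.reach_step split: prod.splits)
qed (auto intro: reach.intros)

lemma reach_drun_aux:
  "reach w \<omega> \<tau> cf n cf' \<Longrightarrow> cf = drun w \<omega> \<tau> cf0 \<Longrightarrow> cf' = drun w \<omega> (\<tau> + n) cf0"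
proof (induction rule: reach.induct)
  case (reach_step p \<tau> s n cf')
  have "dstep w (\<omega> \<tau>) p s = drun w \<omega> (Suc \<tau>) cf0"
    using reach_step.prems by (simp flip: reach_step.prems)
  then show ?case using reach_step.IH by simp
qed auto

lemma drun_Skip:
  assumes "drun w \<omega> T cf = (Skip, s)" "T \<le> T'"
  shows "drun w \<omega> T' cf = (Skip, s)"
  using assms(2,1) by (induction rule: dec_induct) auto

abbreviation exec :: "nat \<Rightarrow> (nat \<Rightarrow> nat) \<Rightarrow> nat \<Rightarrow> prog \<Rightarrow> state \<Rightarrow> nat \<Rightarrow> state \<Rightarrow> bool" where
  "exec w \<omega> \<tau> p s n s' \<equiv> reach w \<omega> \<tau> (p, s) n (Skip, s')"

lemma exec_drun: "exec w \<omega> 0 p s n s' \<Longrightarrow> n \<le> T \<Longrightarrow> drun w \<omega> T (p, s) = (Skip, s')"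
  by (rule drun_Skip[of w \<omega> n], drule reach_drun_aux[where ?cf0.0 = "(p, s)"]) simp_all

lemma exec_dstep: "p \<noteq> Skip \<Longrightarrow> dstep w (\<omega> \<tau>) p s = (Skip, s') \<Longrightarrow> exec w \<omega> \<tau> p s 1 s'"
  using reach_step[of p w \<omega> \<tau> s 0 "(Skip, s')"] reach_refl[of w \<omega> "Suc \<tau>" "(Skip, s')"] by simp

text \<open>The additional step removes the leading \<open>Skip\<close>; it also consumes a tape
  cell, so \<open>q\<close> starts one cell later.\<close>

lemma exec_Seq:
  assumes "exec w \<omega> \<tau> p s m s'" "exec w \<omega> (\<tau> + m + 1) q s' n s''"
  shows "exec w \<omega> \<tau> (Seq p q) s (m + 1 + n) s''"
proof -
  have "reach w \<omega> \<tau> (Seq p q, s) m (Seq Skip q, s')"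
    using reach_Seq_lift[OF assms(1), of q] by simp
  moreover have "reach w \<omega> (\<tau> + m) (Seq Skip q, s') (Suc n) (Skip, s'')"
    using assms(2) by (intro reach_step) auto
  ultimately show ?thesis
    using reach_trans by fastforce
qed

lemma exec_Cond:
  assumes "exec w \<omega> (Suc \<tau>) (if eval_expr w e s \<noteq> 0 then p else q) s n s'"
  shows "exec w \<omega> \<tau> (Cond e p q) s (Suc n) s'"
  using assms by (intro reach_step) auto

lemma exec_While_False: "eval_expr w e s = 0 \<Longrightarrow> exec w \<omega> \<tau> (While e p) s 1 s"
  by (rule exec_dstep) auto

lemma exec_While_True:
  assumes "eval_expr w e s \<noteq> 0" "exec w \<omega> (\<tau> + 1) p s m s'"
    "exec w \<omega> (\<tau> + m + 2) (While e p) s' n s''"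
  shows "exec w \<omega> \<tau> (While e p) s (m + 2 + n) s''"
proof -
  have "exec w \<omega> (Suc \<tau>) (Seq p (While e p)) s (m + 1 + n) s''"
    using exec_Seq[of w \<omega> "\<tau> + 1" p s m s' "While e p" n s''] assms(2,3) by (simp add: add_ac)
  then have "exec w \<omega> \<tau> (While e p) s (Suc (m + 1 + n)) s''"
    using assms(1) by (intro reach_step) auto
  then show ?thesis by (simp add: add_ac)
qed

section \<open>A command language with striped arrays\<close>

datatype ex = Nm nat | Vr nat | Ar nat ex | Op binop ex ex

abbreviation (input) add_ex (infixl "+." 65) where "e1 +. e2 \<equiv> Op Plus e1 e2"
abbreviation (input) sub_ex (infixl "-." 65) where "e1 -. e2 \<equiv> Op Minus e1 e2"
abbreviation (input) mul_ex (infixl "*." 70) where "e1 *. e2 \<equiv> Op Times e1 e2"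
abbreviation (input) div_ex (infixl "'/." 70) where "e1 /. e2 \<equiv> Op Div e1 e2"
abbreviation (input) mod_ex (infixl "%." 70) where "e1 %. e2 \<equiv> Op Mod e1 e2"
abbreviation (input) less_ex (infix "<." 50) where "e1 <. e2 \<equiv> Op Lt e1 e2"
abbreviation (input) eq_ex (infix "=." 50) where "e1 =. e2 \<equiv> Op Eql e1 e2"

datatype cmd =
    Nop
  | Asg nat ex
  | Sto nat ex ex
  | Sq cmd cmd
  | If ex cmd cmd
  | Wh ex cmd
  | Inp nat ex
  | Get nat ex ex

text \<open>Array \<open>r < 16\<close> occupies the cells congruent to \<open>r\<close> modulo 16, counted from the address in
  register 1. Arrays are thus unbounded and never overlap.\<close>

definition adr :: "nat \<Rightarrow> expr \<Rightarrow> expr" where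
  "adr r e = Bin Plus (Reg 1) (Bin Plus (Bin Times (Const 16) e) (Const (r mod 16)))"

primrec cx :: "ex \<Rightarrow> expr" where
  "cx (Nm c) = Const c"
| "cx (Vr x) = Reg x"
| "cx (Ar r e) = Load (adr r (cx e))"
| "cx (Op f e1 e2) = Bin f (cx e1) (cx e2)"

text \<open>\<open>Get x i l\<close> loads input cell \<open>i\<close> if its content is below \<open>l\<close> and 0 otherwise, so that no large
  word ever enters a register; \<open>Inp\<close> is used for cells known to be small.\<close>

primrec cc :: "cmd \<Rightarrow> prog" where
  "cc Nop = Skip"
| "cc (Asg x e) = Assign x (cx e)"
| "cc (Sto r i e) = Store (adr r (cx i)) (cx e)"
| "cc (Sq p q) = Seq (cc p) (cc q)"
| "cc (If e p q) = Cond (cx e) (cc p) (cc q)"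
| "cc (Wh e p) = While (cx e) (cc p)"
| "cc (Inp x i) = Assign x (Load (cx i))"
| "cc (Get x i l) = Assign x (Bin Times (Bin Lt (Load (cx i)) (cx l)) (Load (cx i)))"

primrec mv :: "cmd \<Rightarrow> nat set" where
  "mv Nop = {}" | "mv (Asg x e) = {x}" | "mv (Sto r i e) = {}" | "mv (Sq p q) = mv p \<union> mv q"
| "mv (If e p q) = mv p \<union> mv q" | "mv (Wh e p) = mv p" | "mv (Inp x i) = {x}"
| "mv (Get x i l) = {x}"

primrec ma :: "cmd \<Rightarrow> nat set" where
  "ma Nop = {}" | "ma (Asg x e) = {}" | "ma (Sto r i e) = {r mod 16}" | "ma (Sq p q) = ma p \<union> ma q"
| "ma (If e p q) = ma p \<union> ma q" | "ma (Wh e p) = ma p" | "ma (Inp x i) = {}"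
| "ma (Get x i l) = {}"

type_synonym vars = "nat \<Rightarrow> nat"
type_synonym arrs = "nat \<Rightarrow> nat \<Rightarrow> nat"

primrec bop :: "binop \<Rightarrow> nat \<Rightarrow> nat \<Rightarrow> nat" where
  "bop Plus a b = a + b" | "bop Minus a b = a - b" | "bop Times a b = a * b" | "bop Div a b = a div b"
| "bop Mod a b = a mod b" | "bop Lt a b = of_bool (a < b)" | "bop Eql a b = of_bool (a = b)"

primrec ev :: "ex \<Rightarrow> vars \<Rightarrow> arrs \<Rightarrow> nat" where
  "ev (Nm c) v a = c" | "ev (Vr x) v a = v x" | "ev (Ar r e) v a = a (r mod 16) (ev e v a)"
| "ev (Op f e1 e2) v a = bop f (ev e1 v a) (ev e2 v a)"

text \<open>The value of an expression over values below \<open>X\<close> is below \<open>X\<close> to the power of its size.\<close>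

primrec lv :: "expr \<Rightarrow> nat" where
  "lv (Const c) = c + 1" | "lv (Reg x) = 1" | "lv (Load e) = lv e" | "lv (Bin f e1 e2) = lv e1 + lv e2"

primrec plv :: "prog \<Rightarrow> nat" where
  "plv Skip = 0" | "plv (Assign x e) = lv e" | "plv (Store e1 e2) = max (lv e1) (lv e2)"
| "plv (Rand x) = 0" | "plv (Seq p q) = max (plv p) (plv q)"
| "plv (Cond e p q) = max (lv e) (max (plv p) (plv q))"
| "plv (While e p) = max (lv e) (plv p)"

definition view :: "nat \<Rightarrow> state \<Rightarrow> arrs" where
  "view base s = (\<lambda>r j. if r < 16 then mem s (base + (16 * j + r)) else 0)"

text \<open>Links a machine state to what a command sees: register 1 holds \<open>base\<close>, and
  all registers and array cells stay below \<open>X\<close>. The input cells below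
  \<open>base\<close> are only kept constant and not bounded, because an element may be as large as
  a word.\<close>

definition cond_st :: "nat \<Rightarrow> nat \<Rightarrow> (nat \<Rightarrow> nat) \<Rightarrow> state \<Rightarrow> vars \<Rightarrow> arrs \<Rightarrow> bool" where
  "cond_st X base inp s v a \<longleftrightarrow> regs s = v \<and> view base s = a \<and> v 1 = base \<and>
     (\<forall>x. v x < X) \<and> (\<forall>r j. a r j < X) \<and> (\<forall>i<base. mem s i = inp i)"

section \<open>Word arithmetic without overflow\<close>

lemma lv_pos: "lv e \<ge> 1"
  by (induction e) auto

text \<open>Both bounds are at least 2, so their sum is at most their product, which settles
  addition. Quotient, remainder and difference do not exceed the first operand.\<close>

lemma bop_less:
  fixes X :: nat
  assumes "X \<ge> 2" "a < X ^ i" "b < X ^ j" "i \<ge> 1" "j \<ge> 1"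
  shows "bop f a b < X ^ (i + j)"
proof -
  have ij: "X ^ i \<ge> 2" "X ^ j \<ge> 2"
    using assms power_increasing[of 1 i X] power_increasing[of 1 j X] by auto
  have prod: "X ^ i * X ^ j = X ^ (i + j)"
    by (simp add: power_add)
  have le: "X ^ i \<le> X ^ (i + j)" "2 \<le> X ^ (i + j)"
    using assms(1) power_increasing[of i "i + j" X] le_trans[OF ij(1)] by auto
  have sum: "X ^ i + X ^ j \<le> X ^ (i + j)"
  proof -
    obtain p q where "X ^ i = p + 2" "X ^ j = q + 2"
      using ij by (metis add.commute le_Suc_ex)
    then show ?thesis
      unfolding prod[symmetric] by (simp add: algebra_simps)
  qed
  have "a div b < X ^ (i + j)" "a mod b < X ^ (i + j)" "a - b < X ^ (i + j)"
    using le_less_trans[OF div_le_dividend assms(2), of b] le_less_trans[OF mod_less_eq_dividend assms(2), of b]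
      le_less_trans[OF diff_le_self assms(2), of b] le(1) by auto
  moreover have "a * b < X ^ (i + j)"
    unfolding prod[symmetric] using assms by (intro mult_strict_mono) auto
  moreover have "a + b < X ^ (i + j)" "of_bool P < X ^ (i + j)" for P
    using assms(1-3) sum le(2) by (linarith, cases P) simp_all
  ultimately show ?thesis
    by (cases f) (simp_all only: bop.simps)
qed

lemma word_op_eq:
  assumes "X \<ge> 2" "a < X ^ i" "b < X ^ j" "i \<ge> 1" "j \<ge> 1" "X ^ (i + j) \<le> 2 ^ w"
  shows "word_op w f a b = bop f a b"
proof -
  have "bop f a b < 2 ^ w"
    using bop_less[OF assms(1-5), of f] assms(6) by linarith
  then show ?thesis by (cases f) auto
qed

lemma stripe_inject: "r < 16 \<Longrightarrow> q < 16 \<Longrightarrow> 16 * i + r = 16 * j + q \<longleftrightarrow> i = j \<and> r = (q::nat)"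
proof (rule iffI)
  assume "r < 16" "q < 16" and eq: "16 * i + r = 16 * j + q"
  then have "i = (16 * i + r) div 16" "j = (16 * j + q) div 16" by auto
  with eq show "i = j \<and> r = q" by simp
qed simp

lemma less_power_self: "X \<ge> 2 \<Longrightarrow> c < (X::nat) ^ (c + 1)"
  using less_exp[of "c + 1"] power_mono[of 2 X "c + 1"] by linarith

text \<open>\<open>X\<close> bounds what is stored between commands, \<open>E\<close> the size of
  the largest expression. Intermediate values therefore stay below \<open>X ^ E\<close>, and no word
  operation wraps around.\<close>

locale ram =
  fixes w X E base :: nat and inp :: "nat \<Rightarrow> nat"
  assumes X2: "X \<ge> 2" and XE: "X ^ E \<le> 2 ^ w"
begin

abbreviation st :: "state \<Rightarrow> vars \<Rightarrow> arrs \<Rightarrow> bool" where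
  "st \<equiv> cond_st X base inp"

lemma pow_le: "i \<le> E \<Longrightarrow> X ^ i \<le> 2 ^ w"
  using power_increasing[of i E X] X2 XE by linarith

lemma eval_adr:
  assumes "st s v a" "eval_expr w e s = i" "i < X ^ lv e" "lv (adr r e) \<le> E"
  shows "eval_expr w (adr r e) s = base + (16 * i + r mod 16)"
proof -
  have l: "lv (Const 16) + lv e \<le> E" "lv (Const 16) + lv e + lv (Const (r mod 16)) \<le> E"
    "lv (Reg 1) + (lv (Const 16) + lv e + lv (Const (r mod 16))) \<le> E"
    using assms(4) by (auto simp: adr_def)
  have c: "eval_expr w (Const 16) s = 16" "eval_expr w (Const (r mod 16)) s = r mod 16"
    using less_power_self[OF X2, of 16] less_power_self[OF X2, of "r mod 16"] l
      pow_le[of "16 + 1"] pow_le[of "r mod 16 + 1"] by auto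
  have t: "word_op w Times 16 i = bop Times 16 i"
    by (rule word_op_eq[OF X2, of _ "lv (Const 16)" _ "lv e"])
      (use assms l less_power_self[OF X2, of 16] pow_le lv_pos in \<open>auto simp del: lv.simps power_Suc simp: lv.simps(1)\<close>)
  have t2: "bop Times 16 i < X ^ (lv (Const 16) + lv e)"
    by (rule bop_less[OF X2])
      (use assms l less_power_self[OF X2, of 16] lv_pos in \<open>auto simp del: lv.simps power_Suc simp: lv.simps(1)\<close>)
  have p: "word_op w Plus (bop Times 16 i) (r mod 16) = bop Plus (bop Times 16 i) (r mod 16)"
    by (rule word_op_eq[OF X2, of _ "lv (Const 16) + lv e" _ "lv (Const (r mod 16))"])
      (use t2 l less_power_self[OF X2, of "r mod 16"] pow_le lv_pos in \<open>auto simp del: power_Suc\<close>)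
  have p2: "bop Plus (bop Times 16 i) (r mod 16) < X ^ (lv (Const 16) + lv e + lv (Const (r mod 16)))"
    by (rule bop_less[OF X2 t2])
      (use l less_power_self[OF X2, of "r mod 16"] lv_pos in \<open>auto simp del: power_Suc\<close>)
  have b: "regs s 1 = base" "base < X"
    using assms(1) by (auto simp: cond_st_def)
  have "word_op w Plus base (bop Plus (bop Times 16 i) (r mod 16)) =
      bop Plus base (bop Plus (bop Times 16 i) (r mod 16))"
    by (rule word_op_eq[OF X2 _ p2, where i = 1]) (use b l pow_le in auto)
  then show ?thesis
    unfolding adr_def eval_expr.simps(4) c assms(2) t p using b by simp
qed

lemma eval_cx:
  assumes "st s v a" "lv (cx e) \<le> E"
  shows "eval_expr w (cx e) s = ev e v a \<and> ev e v a < X ^ lv (cx e)"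
  using assms(2)
proof (induction e)
  case (Nm c)
  then show ?case
    using less_power_self[OF X2, of c] pow_le[of "c + 1"] by auto
next
  case (Vr x)
  then show ?case using assms(1) by (auto simp: cond_st_def)
next
  case (Ar r e)
  have l: "lv (cx e) \<le> E" "lv (adr r (cx e)) \<le> E"
    using Ar.prems by (auto simp: adr_def)
  have "eval_expr w (adr r (cx e)) s = base + (16 * ev e v a + r mod 16)"
    using eval_adr[OF assms(1), of "cx e"] Ar.IH l by blast
  moreover have "a (r mod 16) (ev e v a) < X"
    "a (r mod 16) (ev e v a) = mem s (base + (16 * ev e v a + r mod 16))"
    using assms(1) by (auto simp: cond_st_def view_def)
  moreover have "X \<le> X ^ lv (cx (Ar r e))"
    using X2 lv_pos[of "cx (Ar r e)"] by (metis le_trans one_le_numeral power_increasing power_one_right)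
  ultimately show ?case by simp
next
  case (Op f e1 e2)
  have l: "lv (cx e1) \<le> E" "lv (cx e2) \<le> E" "X ^ (lv (cx e1) + lv (cx e2)) \<le> 2 ^ w"
    using Op.prems pow_le by auto
  note IH = Op.IH(1)[OF l(1)] Op.IH(2)[OF l(2)]
  show ?case
    using word_op_eq[OF X2 conjunct2[OF IH(1)] conjunct2[OF IH(2)] lv_pos lv_pos l(3)]
      bop_less[OF X2 conjunct2[OF IH(1)] conjunct2[OF IH(2)] lv_pos lv_pos] IH by simp
qed

text \<open>Step count and result may not depend on the tape, since commands draw no random words.\<close>

definition runs :: "cmd \<Rightarrow> vars \<Rightarrow> arrs \<Rightarrow> nat \<Rightarrow> (vars \<Rightarrow> arrs \<Rightarrow> bool) \<Rightarrow> bool" where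
  "runs c v a T Q \<longleftrightarrow> (plv (cc c) \<le> E \<longrightarrow> (\<forall>s. st s v a \<longrightarrow>
     (\<exists>n s' v' a'. n \<le> T \<and> (\<forall>\<omega> \<tau>. exec w \<omega> \<tau> (cc c) s n s') \<and> st s' v' a' \<and> Q v' a' \<and>
        (\<forall>x. x \<notin> mv c \<longrightarrow> v' x = v x) \<and> (\<forall>r. r \<notin> ma c \<longrightarrow> a' r = a r))))"

section \<open>Proof rules for commands\<close>

lemma runsE:
  assumes "runs c v a T Q" "plv (cc c) \<le> E" "st s v a"
  obtains n s' v' a' where "n \<le> T" "\<And>\<omega> \<tau>. exec w \<omega> \<tau> (cc c) s n s'" "st s' v' a'" "Q v' a'"
    "\<And>x. x \<notin> mv c \<Longrightarrow> v' x = v x" "\<And>r. r \<notin> ma c \<Longrightarrow> a' r = a r"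
proof -
  have "\<exists>n s' v' a'. n \<le> T \<and> (\<forall>\<omega> \<tau>. exec w \<omega> \<tau> (cc c) s n s') \<and> st s' v' a' \<and> Q v' a' \<and>
        (\<forall>x. x \<notin> mv c \<longrightarrow> v' x = v x) \<and> (\<forall>r. r \<notin> ma c \<longrightarrow> a' r = a r)"
    using assms(1)[unfolded runs_def] assms(2,3) by simp
  then show ?thesis
    by (elim exE conjE) (rule that, assumption, blast, assumption+, blast+)
qed

lemma runs_weaken:
  assumes "runs c v a T Q" "T \<le> T'"
    "\<And>v' a'. Q v' a' \<Longrightarrow> (\<And>x. x \<notin> mv c \<Longrightarrow> v' x = v x) \<Longrightarrow> (\<And>r. r \<notin> ma c \<Longrightarrow> a' r = a r) \<Longrightarrow> Q' v' a'"
  shows "runs c v a T' Q'"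
  unfolding runs_def
proof (intro impI allI)
  fix s assume "plv (cc c) \<le> E" "st s v a"
  from runsE[OF assms(1) this]
  obtain n s' v' a' where h: "n \<le> T" "\<And>\<omega> \<tau>. exec w \<omega> \<tau> (cc c) s n s'" "st s' v' a'" "Q v' a'"
    "\<And>x. x \<notin> mv c \<Longrightarrow> v' x = v x" "\<And>r. r \<notin> ma c \<Longrightarrow> a' r = a r"
    by metis
  then show "\<exists>n s' v' a'. n \<le> T' \<and> (\<forall>\<omega> \<tau>. exec w \<omega> \<tau> (cc c) s n s') \<and> st s' v' a' \<and> Q' v' a' \<and>
        (\<forall>x. x \<notin> mv c \<longrightarrow> v' x = v x) \<and> (\<forall>r. r \<notin> ma c \<longrightarrow> a' r = a r)"
    using assms(2,3) by (intro exI[of _ n] exI[of _ s'] exI[of _ v'] exI[of _ a']) auto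
qed

lemma runs_time: "runs c v a T Q \<Longrightarrow> T \<le> T' \<Longrightarrow> runs c v a T' Q"
  by (rule runs_weaken)

lemma runs_Nop: "Q v a \<Longrightarrow> runs Nop v a 0 Q"
  unfolding runs_def
proof (intro impI allI, goal_cases)
  case (1 s)
  then show ?case
    by (intro exI[of _ 0] exI[of _ s] exI[of _ v] exI[of _ a]) (simp add: reach_refl)
qed

lemma st_upd_var: "st s v a \<Longrightarrow> x \<noteq> 1 \<Longrightarrow> y < X \<Longrightarrow> st (s\<lparr>regs := v(x := y)\<rparr>) (v(x := y)) a"
  by (auto simp: cond_st_def view_def cong: if_cong)

lemma runs_assign_expr:
  assumes "\<And>s. st s v a \<Longrightarrow> plv (cc c) \<le> E \<Longrightarrow> eval_expr w e s = y"
    and "cc c = Assign x e" "mv c = {x}" "x \<noteq> 1" "y < X" "Q (v(x := y)) a"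
  shows "runs c v a 1 Q"
  unfolding runs_def
proof (intro impI allI)
  fix s assume h: "plv (cc c) \<le> E" "st s v a"
  have "exec w \<omega> \<tau> (cc c) s 1 (s\<lparr>regs := v(x := y)\<rparr>)" for \<omega> \<tau>
    by (rule exec_dstep) (use assms(1)[OF h(2,1)] assms(2) h(2) in \<open>auto simp: cond_st_def\<close>)
  then show "\<exists>n s' v' a'. n \<le> 1 \<and> (\<forall>\<omega> \<tau>. exec w \<omega> \<tau> (cc c) s n s') \<and> st s' v' a' \<and> Q v' a' \<and>
        (\<forall>x. x \<notin> mv c \<longrightarrow> v' x = v x) \<and> (\<forall>r. r \<notin> ma c \<longrightarrow> a' r = a r)"
    using st_upd_var[OF h(2) assms(4,5)] assms(3,6)
    by (intro exI[of _ 1] exI[of _ "s\<lparr>regs := v(x := y)\<rparr>"] exI[of _ "v(x := y)"] exI[of _ a]) auto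
qed

lemma runs_Asg:
  assumes "x \<noteq> 1" "ev e v a < X" "Q (v(x := ev e v a)) a"
  shows "runs (Asg x e) v a 1 Q"
  by (rule runs_assign_expr[where e = "cx e" and x = x]) (use assms eval_cx in auto)

lemma runs_Inp:
  assumes "x \<noteq> 1" "ev e v a < base" "inp (ev e v a) < X" "Q (v(x := inp (ev e v a))) a"
  shows "runs (Inp x e) v a 1 Q"
  by (rule runs_assign_expr[where e = "Load (cx e)" and x = x])
    (use assms eval_cx in \<open>auto simp: cond_st_def\<close>)

lemma runs_Get:
  assumes "x \<noteq> 1" "ev i v a < base" "inp (ev i v a) < 2 ^ w"
    "Q (v(x := (if inp (ev i v a) < ev l v a then inp (ev i v a) else 0))) a" "ev l v a \<le> X"
  shows "runs (Get x i l) v a 1 Q"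
proof (rule runs_assign_expr[where x = x and y = "if inp (ev i v a) < ev l v a then inp (ev i v a) else 0"])
  fix s assume h: "st s v a" "plv (cc (Get x i l)) \<le> E"
  have "eval_expr w (cx i) s = ev i v a" "eval_expr w (cx l) s = ev l v a"
    using eval_cx[OF h(1)] h(2) by auto
  moreover have "mem s (ev i v a) = inp (ev i v a)"
    using h(1) assms(2) by (auto simp: cond_st_def)
  \<comment> \<open>The outcome of a comparison is reduced modulo \<open>2 ^ w\<close>, which would
    lose a 1 if words had no bits.\<close>
  moreover have "(1::nat) < 2 ^ w"
  proof -
    have "X \<le> 2 ^ w"
      using pow_le[of 1] h(2) lv_pos[of "cx i"] by simp
    then show ?thesis using X2 by linarith
  qed
  ultimately show "eval_expr w (Bin Times (Bin Lt (Load (cx i)) (cx l)) (Load (cx i))) s =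
      (if inp (ev i v a) < ev l v a then inp (ev i v a) else 0)"
    using assms(3) by simp
qed (use assms X2 in auto)

lemma runs_Sto:
  assumes "ev e v a < X" "Q v (a(r mod 16 := (a (r mod 16))(ev i v a := ev e v a)))"
  shows "runs (Sto r i e) v a 1 Q"
  unfolding runs_def
proof (intro impI allI)
  fix s assume h: "plv (cc (Sto r i e)) \<le> E" "st s v a"
  have l: "lv (cx i) \<le> E" "lv (adr r (cx i)) \<le> E" "lv (cx e) \<le> E"
    using h(1) by (auto simp: adr_def)
  let ?p = "base + (16 * ev i v a + r mod 16)"
  let ?s = "s\<lparr>mem := (mem s)(?p := ev e v a)\<rparr>"
  let ?a = "a(r mod 16 := (a (r mod 16))(ev i v a := ev e v a))"
  have e: "eval_expr w (adr r (cx i)) s = ?p" "eval_expr w (cx e) s = ev e v a"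
    using eval_adr[OF h(2), of "cx i"] eval_cx[OF h(2)] l by blast+
  have ex: "exec w \<omega> \<tau> (cc (Sto r i e)) s 1 ?s" for \<omega> \<tau>
    by (rule exec_dstep) (auto simp: e)
  have "view base ?s r' j = ?a r' j" for r' j
  proof (cases "r' < 16")
    case True
    have "(base + (16 * j + r') = ?p) = (j = ev i v a \<and> r' = r mod 16)"
      using stripe_inject[OF True, of "r mod 16" j "ev i v a"] by simp
    then show ?thesis
      using h(2) True by (auto simp: view_def cond_st_def)
  next
    case False
    then have "r' \<noteq> r mod 16" by (metis mod_less_divisor zero_less_numeral)
    then show ?thesis
      using h(2) False by (auto simp: view_def cond_st_def)
  qed
  then have "view base ?s = ?a"
    by (intro ext)
  then have "st ?s v ?a"
    using h(2) assms(1) unfolding cond_st_def by auto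
  then show "\<exists>n s' v' a'. n \<le> 1 \<and> (\<forall>\<omega> \<tau>. exec w \<omega> \<tau> (cc (Sto r i e)) s n s') \<and> st s' v' a' \<and> Q v' a' \<and>
        (\<forall>x. x \<notin> mv (Sto r i e) \<longrightarrow> v' x = v x) \<and> (\<forall>r'. r' \<notin> ma (Sto r i e) \<longrightarrow> a' r' = a r')"
    using ex assms(2)
    by (intro exI[of _ 1] exI[of _ ?s] exI[of _ v] exI[of _ ?a]) auto
qed

lemma runs_Sq:
  assumes "runs p v a T1 (\<lambda>v' a'. runs q v' a' T2 Q)"
  shows "runs (Sq p q) v a (T1 + 1 + T2) Q"
  unfolding runs_def
proof (intro impI allI)
  fix s assume h: "plv (cc (Sq p q)) \<le> E" "st s v a"
  then have pl: "plv (cc p) \<le> E" "plv (cc q) \<le> E" by auto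
  from runsE[OF assms pl(1) h(2)]
  obtain n s' v' a' where 1: "n \<le> T1" "\<And>\<omega> \<tau>. exec w \<omega> \<tau> (cc p) s n s'" "st s' v' a'" "runs q v' a' T2 Q"
    "\<And>x. x \<notin> mv p \<Longrightarrow> v' x = v x" "\<And>r. r \<notin> ma p \<Longrightarrow> a' r = a r"
    by metis
  from runsE[OF 1(4) pl(2) 1(3)]
  obtain m s'' v'' a'' where 2: "m \<le> T2" "\<And>\<omega> \<tau>. exec w \<omega> \<tau> (cc q) s' m s''" "st s'' v'' a''" "Q v'' a''"
    "\<And>x. x \<notin> mv q \<Longrightarrow> v'' x = v' x" "\<And>r. r \<notin> ma q \<Longrightarrow> a'' r = a' r"
    by metis
  have "exec w \<omega> \<tau> (cc (Sq p q)) s (n + 1 + m) s''" for \<omega> \<tau>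
    unfolding cc.simps by (rule exec_Seq[OF 1(2) 2(2)])
  then show "\<exists>n s' v' a'. n \<le> T1 + 1 + T2 \<and> (\<forall>\<omega> \<tau>. exec w \<omega> \<tau> (cc (Sq p q)) s n s') \<and> st s' v' a' \<and> Q v' a' \<and>
        (\<forall>x. x \<notin> mv (Sq p q) \<longrightarrow> v' x = v x) \<and> (\<forall>r. r \<notin> ma (Sq p q) \<longrightarrow> a' r = a r)"
    using 1 2 by (intro exI[of _ "n + 1 + m"] exI[of _ s''] exI[of _ v''] exI[of _ a'']) auto
qed

lemma runs_If:
  assumes "ev e v a \<noteq> 0 \<Longrightarrow> runs p v a T Q" "ev e v a = 0 \<Longrightarrow> runs q v a T Q"
  shows "runs (If e p q) v a (T + 1) Q"
  unfolding runs_def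
proof (intro impI allI)
  fix s assume h: "plv (cc (If e p q)) \<le> E" "st s v a"
  let ?c = "if ev e v a \<noteq> 0 then p else q"
  have e: "eval_expr w (cx e) s = ev e v a"
    using eval_cx[OF h(2)] h(1) by auto
  have "runs ?c v a T Q" "plv (cc ?c) \<le> E"
    using assms h(1) by auto
  from runsE[OF this h(2)]
  obtain n s' v' a' where 1: "n \<le> T" "\<And>\<omega> \<tau>. exec w \<omega> \<tau> (cc ?c) s n s'" "st s' v' a'" "Q v' a'"
    "\<And>x. x \<notin> mv ?c \<Longrightarrow> v' x = v x" "\<And>r. r \<notin> ma ?c \<Longrightarrow> a' r = a r"
    by metis
  have c: "(if eval_expr w (cx e) s \<noteq> 0 then cc p else cc q) = cc ?c"
    by (simp add: e)
  have "exec w \<omega> \<tau> (cc (If e p q)) s (Suc n) s'" for \<omega> \<tau>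
    unfolding cc.simps by (rule exec_Cond) (simp only: c 1(2))
  then show "\<exists>n s' v' a'. n \<le> T + 1 \<and> (\<forall>\<omega> \<tau>. exec w \<omega> \<tau> (cc (If e p q)) s n s') \<and> st s' v' a' \<and> Q v' a' \<and>
        (\<forall>x. x \<notin> mv (If e p q) \<longrightarrow> v' x = v x) \<and> (\<forall>r. r \<notin> ma (If e p q) \<longrightarrow> a' r = a r)"
    using 1 by (intro exI[of _ "Suc n"] exI[of _ s'] exI[of _ v'] exI[of _ a']) (auto split: if_splits)
qed

text \<open>The number \<open>n\<close> of iterations is known in advance, so termination needs no
  variant: the proof is by induction on the remaining iterations. Body and exit may use that
  everything outside the write sets of \<open>p\<close> still has its initial value.\<close>

lemma runs_Wh:
  assumes init: "Inv 0 v a"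
    and body: "\<And>j v' a'. j < n \<Longrightarrow> Inv j v' a' \<Longrightarrow> (\<And>x. x \<notin> mv p \<Longrightarrow> v' x = v x) \<Longrightarrow>
      (\<And>r. r \<notin> ma p \<Longrightarrow> a' r = a r) \<Longrightarrow> ev e v' a' \<noteq> 0 \<and> runs p v' a' (tb j) (Inv (Suc j))"
    and post: "\<And>v' a'. Inv n v' a' \<Longrightarrow> (\<And>x. x \<notin> mv p \<Longrightarrow> v' x = v x) \<Longrightarrow>
      (\<And>r. r \<notin> ma p \<Longrightarrow> a' r = a r) \<Longrightarrow> ev e v' a' = 0 \<and> Q v' a'"
  shows "runs (Wh e p) v a ((\<Sum>j<n. tb j + 2) + 1) Q"
  unfolding runs_def
proof (intro impI allI)
  fix s assume h: "plv (cc (Wh e p)) \<le> E" "st s v a"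
  then have pl: "plv (cc p) \<le> E" "lv (cx e) \<le> E" by auto
  have "\<exists>m s'' v'' a''. m \<le> (\<Sum>j=i..<n. tb j + 2) + 1 \<and> (\<forall>\<omega> \<tau>. exec w \<omega> \<tau> (cc (Wh e p)) s' m s'') \<and>
      st s'' v'' a'' \<and> Q v'' a'' \<and> (\<forall>x. x \<notin> mv p \<longrightarrow> v'' x = v x) \<and> (\<forall>r. r \<notin> ma p \<longrightarrow> a'' r = a r)"
    if "i \<le> n" "st s' v' a'" "Inv i v' a'" "\<And>x. x \<notin> mv p \<Longrightarrow> v' x = v x"
      "\<And>r. r \<notin> ma p \<Longrightarrow> a' r = a r" for i s' v' a'
    using that
  proof (induction "n - i" arbitrary: i s' v' a')
    case 0
    then have i: "i = n" by simp
    have "ev e v' a' = 0" "Q v' a'"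
      using post[of v' a'] 0 i by auto
    moreover have "eval_expr w (cx e) s' = ev e v' a'"
      using eval_cx[OF \<open>st s' v' a'\<close> pl(2)] by simp
    ultimately show ?case
      using 0 i exec_While_False
      by (intro exI[of _ 1] exI[of _ s'] exI[of _ v'] exI[of _ a']) auto
  next
    case (Suc k)
    then have i: "i < n" by simp
    have b: "ev e v' a' \<noteq> 0" "runs p v' a' (tb i) (Inv (Suc i))"
      using body[OF i Suc.prems(3-5)] by auto
    have e: "eval_expr w (cx e) s' = ev e v' a'"
      using eval_cx[OF \<open>st s' v' a'\<close> pl(2)] by simp
    from runsE[OF b(2) pl(1) Suc.prems(2)]
    obtain m1 s1 v1 a1 where 1: "m1 \<le> tb i" "\<And>\<omega> \<tau>. exec w \<omega> \<tau> (cc p) s' m1 s1" "st s1 v1 a1"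
      "Inv (Suc i) v1 a1" "\<And>x. x \<notin> mv p \<Longrightarrow> v1 x = v' x" "\<And>r. r \<notin> ma p \<Longrightarrow> a1 r = a' r"
      by metis
    obtain m2 s2 v2 a2 where 2: "m2 \<le> (\<Sum>j=Suc i..<n. tb j + 2) + 1"
      "\<forall>\<omega> \<tau>. exec w \<omega> \<tau> (cc (Wh e p)) s1 m2 s2" "st s2 v2 a2" "Q v2 a2"
      "\<forall>x. x \<notin> mv p \<longrightarrow> v2 x = v x" "\<forall>r. r \<notin> ma p \<longrightarrow> a2 r = a r"
    proof -
      have "k = n - Suc i" "Suc i \<le> n" using Suc.hyps(2) by auto
      moreover have "x \<notin> mv p \<Longrightarrow> v1 x = v x" "r \<notin> ma p \<Longrightarrow> a1 r = a r" for x r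
        using 1(5,6) Suc.prems(4,5) by auto
      ultimately show ?thesis
        using Suc.hyps(1)[of "Suc i" s1 v1 a1] 1(3,4) that by blast
    qed
    have "exec w \<omega> \<tau> (cc (Wh e p)) s' (m1 + 2 + m2) s2" for \<omega> \<tau>
      unfolding cc.simps by (rule exec_While_True) (use e b(1) 1 2 in auto)
    moreover have "m1 + 2 + m2 \<le> (\<Sum>j=i..<n. tb j + 2) + 1"
      using 1(1) 2(1) i by (simp add: sum.atLeast_Suc_lessThan)
    ultimately show ?case
      using 2 by (intro exI[of _ "m1 + 2 + m2"] exI[of _ s2] exI[of _ v2] exI[of _ a2]) auto
  qed
  from this[of 0 s v a] show "\<exists>m s'' v'' a''. m \<le> (\<Sum>j<n. tb j + 2) + 1 \<and> (\<forall>\<omega> \<tau>. exec w \<omega> \<tau> (cc (Wh e p)) s m s'') \<and>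
      st s'' v'' a'' \<and> Q v'' a'' \<and> (\<forall>x. x \<notin> mv (Wh e p) \<longrightarrow> v'' x = v x) \<and>
      (\<forall>r. r \<notin> ma (Wh e p) \<longrightarrow> a'' r = a r)"
    using init h(2) by (auto simp: atLeast0LessThan)
qed

end

definition For :: "nat \<Rightarrow> ex \<Rightarrow> cmd \<Rightarrow> cmd" where
  "For i e p = Sq (Asg i (Nm 0)) (Wh (Op Lt (Vr i) e) (Sq p (Asg i (Op Plus (Vr i) (Nm 1)))))"

lemma mv_For [simp]: "mv (For i e p) = insert i (mv p)"
  and ma_For [simp]: "ma (For i e p) = ma p"
  by (auto simp: For_def)

context ram
begin

text \<open>The invariant is asserted with the counter already advanced. The 4 additional steps per
  iteration are the test, the increment and the two steps that remove a leading
  \<open>Skip\<close>.\<close>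

lemma runs_For:
  assumes i: "i \<noteq> 1" "i \<notin> mv p" "n < X"
    and init: "Inv 0 (v(i := 0)) a"
    and bound: "\<And>j v' a'. j \<le> n \<Longrightarrow> Inv j v' a' \<Longrightarrow> v' i = j \<Longrightarrow>
      (\<And>x. x \<notin> mv p \<Longrightarrow> x \<noteq> i \<Longrightarrow> v' x = v x) \<Longrightarrow> (\<And>r. r \<notin> ma p \<Longrightarrow> a' r = a r) \<Longrightarrow> ev e v' a' = n"
    and body: "\<And>j v' a'. j < n \<Longrightarrow> Inv j v' a' \<Longrightarrow> v' i = j \<Longrightarrow>
      (\<And>x. x \<notin> mv p \<Longrightarrow> x \<noteq> i \<Longrightarrow> v' x = v x) \<Longrightarrow> (\<And>r. r \<notin> ma p \<Longrightarrow> a' r = a r) \<Longrightarrow>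
      runs p v' a' (tb j) (\<lambda>v'' a''. Inv (Suc j) (v''(i := Suc j)) a'')"
    and post: "\<And>v' a'. Inv n v' a' \<Longrightarrow> v' i = n \<Longrightarrow>
      (\<And>x. x \<notin> mv p \<Longrightarrow> x \<noteq> i \<Longrightarrow> v' x = v x) \<Longrightarrow> (\<And>r. r \<notin> ma p \<Longrightarrow> a' r = a r) \<Longrightarrow> Q v' a'"
  shows "runs (For i e p) v a ((\<Sum>j<n. tb j + 4) + 3) Q"
proof -
  let ?p = "Sq p (Asg i (Op Plus (Vr i) (Nm 1)))"
  let ?I = "\<lambda>j v' a'. Inv j v' a' \<and> v' i = j"
  have "runs (Wh (Op Lt (Vr i) e) ?p) (v(i := 0)) a ((\<Sum>j<n. (tb j + 2) + 2) + 1) Q"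
  proof (rule runs_Wh[where Inv = ?I])
    show "?I 0 (v(i := 0)) a" using init by simp
  next
    fix j v' a' assume j: "j < n" and I: "?I j v' a'" and fr: "\<And>x. x \<notin> mv ?p \<Longrightarrow> v' x = (v(i := 0)) x"
      "\<And>r. r \<notin> ma ?p \<Longrightarrow> a' r = a r"
    have fr': "\<And>x. x \<notin> mv p \<Longrightarrow> x \<noteq> i \<Longrightarrow> v' x = v x" "\<And>r. r \<notin> ma p \<Longrightarrow> a' r = a r"
      using fr by auto
    have "ev e v' a' = n"
      by (rule bound[of j]) (use j I fr' in auto)
    moreover have "runs p v' a' (tb j) (\<lambda>v'' a''. Inv (Suc j) (v''(i := Suc j)) a'')"
      by (rule body) (use j I fr' in auto)
    then have "runs p v' a' (tb j) (\<lambda>v'' a''. runs (Asg i (Op Plus (Vr i) (Nm 1))) v'' a'' 1 (?I (Suc j)))"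
      by (rule runs_weaken, simp) (rule runs_Asg, use i j I in auto)
    then have "runs ?p v' a' (tb j + 1 + 1) (?I (Suc j))"
      by (rule runs_Sq)
    ultimately show "ev (Op Lt (Vr i) e) v' a' \<noteq> 0 \<and> runs ?p v' a' (tb j + 2) (?I (Suc j))"
      using j I by simp
  next
    fix v' a' assume I: "?I n v' a'" and fr: "\<And>x. x \<notin> mv ?p \<Longrightarrow> v' x = (v(i := 0)) x"
      "\<And>r. r \<notin> ma ?p \<Longrightarrow> a' r = a r"
    have fr': "\<And>x. x \<notin> mv p \<Longrightarrow> x \<noteq> i \<Longrightarrow> v' x = v x" "\<And>r. r \<notin> ma p \<Longrightarrow> a' r = a r"
      using fr by auto
    have "ev e v' a' = n"
      by (rule bound[of n]) (use I fr' in auto)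
    moreover have "Q v' a'"
      by (rule post) (use I fr' in auto)
    ultimately show "ev (Op Lt (Vr i) e) v' a' = 0 \<and> Q v' a'"
      using I by simp
  qed
  moreover have "(0::nat) < X" using X2 by simp
  ultimately have "runs (For i e p) v a (1 + 1 + ((\<Sum>j<n. (tb j + 2) + 2) + 1)) Q"
    unfolding For_def using i(1) by (intro runs_Sq runs_Asg) auto
  moreover have "1 + 1 + ((\<Sum>j<n. (tb j + 2) + 2) + 1) = (\<Sum>j<n. tb j + 4) + 3"
    by (simp only: add.assoc) simp
  ultimately show ?thesis by metis
qed

text \<open>The array may be updated in place: when entry \<open>d + j\<close> is computed,
  everything outside the segment written so far still has its old value.\<close>

lemma runs_map:
  fixes d :: nat
  assumes i: "i \<noteq> 1" "n < X" "r < 16"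
    and bound: "\<And>j a'. ev e (v(i := j)) (a(r := a')) = n"
    and ix: "\<And>j a'. ev ix (v(i := j)) (a(r := a')) = d + j"
    and val: "\<And>j a'. j < n \<Longrightarrow> (\<And>x. x < d \<or> d + j \<le> x \<Longrightarrow> a' x = a r x) \<Longrightarrow>
      ev val (v(i := j)) (a(r := a')) = f j \<and> f j < X"
    and post: "Q (v(i := n)) (a(r := (\<lambda>x. if d \<le> x \<and> x < d + n then f (x - d) else a r x)))"
  shows "runs (For i e (Sto r ix val)) v a (5 * n + 3) Q"
proof -
  let ?g = "\<lambda>j x. if d \<le> x \<and> x < d + j then f (x - d) else a r x"
  have "runs (For i e (Sto r ix val)) v a ((\<Sum>j<n. 1 + 4) + 3) Q"
  proof (rule runs_For[where Inv = "\<lambda>j v' a'. v' = v(i := j) \<and> a' = a(r := ?g j)"])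
    fix j v' a' assume j: "j < n" "v' = v(i := j) \<and> a' = a(r := ?g j)"
    have v: "ev val v' a' = f j \<and> f j < X"
    proof -
      have "?g j x = a r x" if "x < d \<or> d + j \<le> x" for x
        using that by auto
      from val[OF j(1) this] show ?thesis using j(2) by simp
    qed
    have ix': "ev ix v' a' = d + j"
      using ix j(2) by simp
    show "runs (Sto r ix val) v' a' 1
        (\<lambda>v'' a''. v''(i := Suc j) = v(i := Suc j) \<and> a'' = a(r := ?g (Suc j)))"
    proof (rule runs_Sto)
      have "a'(r mod 16 := (a' (r mod 16))(d + j := f j)) = a(r := ?g (Suc j))"
        using j i(3) by (auto simp: fun_eq_iff)
      then show "v'(i := Suc j) = v(i := Suc j) \<and>
          a'(r mod 16 := (a' (r mod 16))(ev ix v' a' := ev val v' a')) = a(r := ?g (Suc j))"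
        using conjunct1[OF v] conjunct1[OF j(2)] ix' by simp
    qed (use v in simp)
  next
    have "?g 0 = a r" by auto
    then show "v(i := 0) = v(i := 0) \<and> a = a(r := ?g 0)" by simp
  qed (use i post bound in auto)
  then show ?thesis by (simp add: mult.commute)
qed

end

section \<open>Negacyclic products by nested Fourier transforms\<close>

text \<open>\<open>rot K e v\<close> multiplies \<open>v\<close>, read as a polynomial modulo \<open>X ^ K + 1\<close>, by \<open>X ^ e\<close>, and \<open>unrot\<close> divides.\<close>

definition rot :: "nat \<Rightarrow> nat \<Rightarrow> (nat \<Rightarrow> 'a) \<Rightarrow> nat \<Rightarrow> 'a::comm_ring_1" where
  "rot K e v i = (if i < e then - v (i + K - e) else v (i - e))"

definition unrot :: "nat \<Rightarrow> nat \<Rightarrow> (nat \<Rightarrow> 'a) \<Rightarrow> nat \<Rightarrow> 'a::comm_ring_1" where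
  "unrot K e v i = (if i + e < K then v (i + e) else - v (i + e - K))"

lemma sum_lessThan_add:
  "(\<Sum>i<m + n. g i) = (\<Sum>i<m. g i) + (\<Sum>i<n. g (m + i :: nat) :: 'a::comm_monoid_add)"
  by (induction n) (auto simp: add_ac)

lemma rot_eval:
  fixes v :: "nat \<Rightarrow> 'a::comm_ring_1"
  assumes "s ^ K = -1" "e \<le> K"
  shows "(\<Sum>i<K. rot K e v i * s ^ i) = s ^ e * (\<Sum>i<K. v i * s ^ i)"
proof -
  obtain f where K: "K = e + f"
    using assms(2) le_Suc_ex by blast
  have "(\<Sum>i<K. rot K e v i * s ^ i) = (\<Sum>i<e. - v (f + i) * s ^ i) + (\<Sum>i<f. v i * s ^ (e + i))"
    unfolding K sum_lessThan_add by (intro arg_cong2[of _ _ _ _ "(+)"] sum.cong) (auto simp: rot_def add_ac)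
  also have "(\<Sum>i<e. - v (f + i) * s ^ i) = s ^ e * (\<Sum>i<e. v (f + i) * s ^ (f + i))"
  proof -
    have "s ^ e * (v (f + i) * s ^ (f + i)) = - v (f + i) * s ^ i" for i
    proof -
      have "s ^ e * (v (f + i) * s ^ (f + i)) = s ^ K * (v (f + i) * s ^ i)"
        by (simp add: K power_add mult_ac)
      then show ?thesis by (simp add: assms(1))
    qed
    then show ?thesis by (simp add: sum_distrib_left)
  qed
  also have "(\<Sum>i<f. v i * s ^ (e + i)) = s ^ e * (\<Sum>i<f. v i * s ^ i)"
    by (simp add: sum_distrib_left power_add mult_ac)
  also have "s ^ e * (\<Sum>i<e. v (f + i) * s ^ (f + i)) + s ^ e * (\<Sum>i<f. v i * s ^ i) =
      s ^ e * (\<Sum>i<f + e. v i * s ^ i)"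
    unfolding sum_lessThan_add by (simp add: algebra_simps)
  finally show ?thesis by (simp add: K add_ac)
qed

lemma nega_root_nonzero: "s ^ K = -1 \<Longrightarrow> s \<noteq> (0 :: 'a::field_char_0)"
  by (metis power_0_left zero_neq_one zero_neq_neg_one one_neq_neg_one)

lemma unrot_eval:
  fixes v :: "nat \<Rightarrow> 'a::field_char_0"
  assumes "s ^ K = -1" "e \<le> K"
  shows "(\<Sum>i<K. unrot K e v i * s ^ i) = (\<Sum>i<K. v i * s ^ i) / s ^ e"
proof -
  have "s \<noteq> 0"
    using assms(1) by (rule nega_root_nonzero)
  have "s ^ e * (\<Sum>i<K. unrot K e v i * s ^ i) = (\<Sum>i<K. rot K e (unrot K e v) i * s ^ i)"
    using rot_eval[OF assms] by simp
  also have "\<dots> = (\<Sum>i<K. v i * s ^ i)"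
    using assms(2) by (intro sum.cong) (auto simp: rot_def unrot_def)
  finally show ?thesis using \<open>s \<noteq> 0\<close> by (simp add: field_simps)
qed

text \<open>The product modulo \<open>Y ^ M + 1\<close>. Coefficients come from any commutative ring
  because it is used both for numbers and for polynomials in an inner variable.\<close>

definition nega_conv :: "nat \<Rightarrow> (nat \<Rightarrow> 'a) \<Rightarrow> (nat \<Rightarrow> 'a) \<Rightarrow> nat \<Rightarrow> 'a::comm_ring_1" where
  "nega_conv M \<alpha> \<beta> n = (\<Sum>i<M. \<alpha> i * rot M i \<beta> n)"

lemma nega_conv_eval:
  fixes \<alpha> :: "nat \<Rightarrow> 'a::comm_ring_1"
  assumes "y ^ M = -1"
  shows "(\<Sum>n<M. nega_conv M \<alpha> \<beta> n * y ^ n) = (\<Sum>i<M. \<alpha> i * y ^ i) * (\<Sum>i<M. \<beta> i * y ^ i)"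
proof -
  have "(\<Sum>n<M. nega_conv M \<alpha> \<beta> n * y ^ n) = (\<Sum>n<M. \<Sum>i<M. \<alpha> i * (rot M i \<beta> n * y ^ n))"
    by (simp add: nega_conv_def sum_distrib_right mult.assoc)
  also have "\<dots> = (\<Sum>i<M. \<alpha> i * (\<Sum>n<M. rot M i \<beta> n * y ^ n))"
    by (subst sum.swap) (simp add: sum_distrib_left)
  also have "\<dots> = (\<Sum>i<M. \<alpha> i * (y ^ i * (\<Sum>n<M. \<beta> n * y ^ n)))"
    using rot_eval[OF assms] by (intro sum.cong) auto
  finally show ?thesis by (simp add: sum_distrib_right mult.assoc)
qed

lemma poly_nega_conv:
  "poly (nega_conv M \<alpha> \<beta> n) x = nega_conv M (\<lambda>i. poly (\<alpha> i) x) (\<lambda>i. poly (\<beta> i) x) n"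
proof -
  have "poly (rot M i \<beta> n) x = rot M i (\<lambda>i. poly (\<beta> i) x) n" for i
    by (simp add: rot_def)
  then show ?thesis
    by (simp add: nega_conv_def poly_sum)
qed

text \<open>\<open>X ^ K + 1\<close> has \<open>K\<close> distinct complex roots. Identities between
  integer arrays are thus proved by evaluation in the complex numbers, although the program computes
  modulo \<open>p\<close>.\<close>

lemma poly_eq_if_eq_at_nega_roots:
  fixes p q :: "complex poly"
  assumes "\<And>s. s ^ K = -1 \<Longrightarrow> poly p s = poly q s" "degree p < K" "degree q < K"
  shows "p = q"
proof (rule poly_eqI_degree)
  have "card {z. z ^ K = (-1::complex)} = K"
    using assms(2) by (intro card_nth_roots) auto
  then show "card {z. z ^ K = (-1::complex)} > degree p" "card {z. z ^ K = (-1::complex)} > degree q"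
    using assms by auto
qed (use assms in auto)

text \<open>Arrays hold consecutive rows of \<open>K\<close> coefficients; \<open>rv K a s r\<close> evaluates row \<open>r\<close> at \<open>s\<close>.\<close>

definition rv :: "nat \<Rightarrow> (nat \<Rightarrow> int) \<Rightarrow> complex \<Rightarrow> nat \<Rightarrow> complex" where
  "rv K a s r = (\<Sum>i<K. of_int (a (r * K + i)) * s ^ i)"

text \<open>A decimation-in-frequency butterfly on the rows \<open>r\<close> and
  \<open>r + h\<close>. For \<open>h\<close> dividing \<open>K\<close>, the polynomial
  \<open>X ^ (K div h)\<close> has order \<open>2 * h\<close> modulo \<open>X ^ K + 1\<close>, so
  the twiddle factors are powers of \<open>X\<close> and cost a rotation instead of a
  multiplication.\<close>

definition stage :: "nat \<Rightarrow> nat \<Rightarrow> (nat \<Rightarrow> int) \<Rightarrow> nat \<Rightarrow> int" where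
  "stage K h a x = (let r = x div K; e = K div h * (r mod h) in
     if even (r div h) then a x + a (x + h * K)
     else rot K e (\<lambda>i. a ((r - h) * K + i) - a (r * K + i)) (x mod K))"

text \<open>Undoes \<open>stage\<close> up to a factor 2. The halving is left to the end of the
  whole multiplication, so that integers suffice here.\<close>

definition istage :: "nat \<Rightarrow> nat \<Rightarrow> (nat \<Rightarrow> int) \<Rightarrow> nat \<Rightarrow> int" where
  "istage K h a x = (let r = x div K; e = K div h * (r mod h) in
     if even (r div h) then a x + unrot K e (\<lambda>i. a ((r + h) * K + i)) (x mod K)
     else a (x - h * K) - unrot K e (\<lambda>i. a (r * K + i)) (x mod K))"

definition cstage :: "complex \<Rightarrow> nat \<Rightarrow> nat \<Rightarrow> (nat \<Rightarrow> complex) \<Rightarrow> nat \<Rightarrow> complex" where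
  "cstage s K h \<rho> r = (if even (r div h) then \<rho> r + \<rho> (r + h)
     else s ^ (K div h * (r mod h)) * (\<rho> (r - h) - \<rho> r))"

definition icstage :: "complex \<Rightarrow> nat \<Rightarrow> nat \<Rightarrow> (nat \<Rightarrow> complex) \<Rightarrow> nat \<Rightarrow> complex" where
  "icstage s K h \<rho> r = (if even (r div h) then \<rho> r + \<rho> (r + h) / s ^ (K div h * (r mod h))
     else \<rho> (r - h) - \<rho> r / s ^ (K div h * (r mod h)))"

primrec stages :: "nat \<Rightarrow> nat \<Rightarrow> (nat \<Rightarrow> int) \<Rightarrow> nat \<Rightarrow> int" where
  "stages K 0 a = a"
| "stages K (Suc b) a = stages K b (stage K (2 ^ b) a)"

primrec istages :: "nat \<Rightarrow> nat \<Rightarrow> (nat \<Rightarrow> int) \<Rightarrow> nat \<Rightarrow> int" where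
  "istages K 0 a = a"
| "istages K (Suc b) a = istage K (2 ^ b) (istages K b a)"

primrec cstages :: "complex \<Rightarrow> nat \<Rightarrow> nat \<Rightarrow> (nat \<Rightarrow> complex) \<Rightarrow> nat \<Rightarrow> complex" where
  "cstages s K 0 \<rho> = \<rho>"
| "cstages s K (Suc b) \<rho> = cstages s K b (cstage s K (2 ^ b) \<rho>)"

primrec icstages :: "complex \<Rightarrow> nat \<Rightarrow> nat \<Rightarrow> (nat \<Rightarrow> complex) \<Rightarrow> nat \<Rightarrow> complex" where
  "icstages s K 0 \<rho> = \<rho>"
| "icstages s K (Suc b) \<rho> = icstage s K (2 ^ b) (icstages s K b \<rho>)"

lemma of_int_rot: "of_int (rot K e v i) = rot K e (\<lambda>i. of_int (v i)) i"
  by (simp add: rot_def)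

lemma of_int_unrot: "of_int (unrot K e v i) = unrot K e (\<lambda>i. of_int (v i)) i"
  by (simp add: unrot_def)

lemma div_mult_mod_le: "K div h * (r mod h) \<le> (K::nat)"
proof (cases "h = 0")
  case False
  then have "K div h * (r mod h) \<le> K div h * h"
    by (intro mult_le_mono2 less_imp_le) auto
  then show ?thesis
    by (meson div_times_less_eq_dividend le_trans)
qed simp

lemma rv_stage:
  assumes "s ^ K = -1"
  shows "rv K (stage K h a) s = cstage s K h (rv K a s)"
proof
  fix r
  let ?e = "K div h * (r mod h)"
  have K: "(r * K + i) div K = r" "(r * K + i) mod K = i" if "i < K" for i
    using that by auto
  show "rv K (stage K h a) s r = cstage s K h (rv K a s) r"
  proof (cases "even (r div h)")
    case True
    then have "rv K (stage K h a) s r = (\<Sum>i<K. of_int (a (r * K + i)) * s ^ i + of_int (a ((r + h) * K + i)) * s ^ i)"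
      unfolding rv_def by (intro sum.cong) (auto simp: stage_def K algebra_simps)
    then show ?thesis
      using True by (simp add: cstage_def rv_def sum.distrib)
  next
    case False
    have "rv K (stage K h a) s r =
        (\<Sum>i<K. rot K ?e (\<lambda>i. of_int (a ((r - h) * K + i)) - of_int (a (r * K + i))) i * s ^ i)"
      unfolding rv_def by (intro sum.cong) (use False in \<open>auto simp: stage_def K Let_def of_int_rot\<close>)
    also have "\<dots> = s ^ ?e * (\<Sum>i<K. (of_int (a ((r - h) * K + i)) - of_int (a (r * K + i))) * s ^ i)"
      by (rule rot_eval[OF assms div_mult_mod_le])
    finally show ?thesis
      using False by (simp add: cstage_def rv_def sum_subtractf algebra_simps)
  qed
qed

lemma rv_istage:
  assumes "s ^ K = -1"
  shows "rv K (istage K h a) s = icstage s K h (rv K a s)"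
proof
  fix r
  let ?e = "K div h * (r mod h)"
  have K: "(r * K + i) div K = r" "(r * K + i) mod K = i" if "i < K" for i
    using that by auto
  have un: "(\<Sum>i<K. unrot K ?e (\<lambda>i. of_int (a (q * K + i))) i * s ^ i) = rv K a s q / s ^ ?e" for q
    unfolding rv_def by (rule unrot_eval[OF assms div_mult_mod_le])
  show "rv K (istage K h a) s r = icstage s K h (rv K a s) r"
  proof (cases "even (r div h)")
    case True
    then have "rv K (istage K h a) s r = (\<Sum>i<K. of_int (a (r * K + i)) * s ^ i +
        unrot K ?e (\<lambda>i. of_int (a ((r + h) * K + i))) i * s ^ i)"
      unfolding rv_def by (intro sum.cong) (auto simp: istage_def K Let_def of_int_unrot distrib_right)
    then show ?thesis
      using True by (simp add: icstage_def sum.distrib un) (simp add: rv_def)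
  next
    case False
    then have "h \<le> r"
      by (intro leI notI) auto
    then have "r * K + i - h * K = (r - h) * K + i" for i
      by (simp add: diff_mult_distrib)
    then have "rv K (istage K h a) s r = (\<Sum>i<K. of_int (a ((r - h) * K + i)) * s ^ i -
        unrot K ?e (\<lambda>i. of_int (a (r * K + i))) i * s ^ i)"
      unfolding rv_def using False
      by (intro sum.cong) (auto simp: istage_def K Let_def of_int_unrot left_diff_distrib)
    then show ?thesis
      using False by (simp add: icstage_def sum_subtractf un) (simp add: rv_def)
  qed
qed

lemma rv_stages: "s ^ K = -1 \<Longrightarrow> rv K (stages K b a) s = cstages s K b (rv K a s)"
  by (induction b arbitrary: a) (auto simp: rv_stage)

lemma rv_istages: "s ^ K = -1 \<Longrightarrow> rv K (istages K b a) s = icstages s K b (rv K a s)"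
  by (induction b) (auto simp: rv_istage)

lemma icstage_scale: "icstage s K h (\<lambda>r. c * \<rho> r) r = c * icstage s K h \<rho> r"
  by (simp add: icstage_def algebra_simps)

lemma icstage_cstage:
  assumes "s \<noteq> 0" "h > 0"
  shows "icstage s K h (cstage s K h \<rho>) r = 2 * \<rho> r"
proof (cases "even (r div h)")
  case True
  then show ?thesis
    using assms by (simp add: icstage_def cstage_def field_simps)
next
  case False
  then have "h \<le> r"
    by (intro leI notI) auto
  then obtain q where r: "r = q + h"
    by (metis le_add_diff_inverse2)
  then show ?thesis
    using False assms by (simp add: icstage_def cstage_def field_simps)
qed

lemma icstages_scale: "icstages s K b (\<lambda>r. c * \<rho> r) r = c * icstages s K b \<rho> r"
proof (induction b arbitrary: r)
  case (Suc b)
  then have "icstages s K b (\<lambda>r. c * \<rho> r) = (\<lambda>r. c * icstages s K b \<rho> r)" by blast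
  then show ?case by (simp add: icstage_scale)
qed simp

lemma icstages_cstages: "s \<noteq> 0 \<Longrightarrow> icstages s K b (cstages s K b \<rho>) = (\<lambda>r. 2 ^ b * \<rho> r)"
proof (induction b arbitrary: \<rho>)
  case (Suc b)
  then show ?case
    by (auto simp: icstage_scale icstage_cstage)
qed simp

text \<open>A sequence of length \<open>2 ^ b\<close> is evaluated at \<open>2 ^ b\<close>-th roots of unity, in some order that
  does not matter.\<close>

lemma cstages_eval:
  assumes "s ^ K = -1" "2 ^ b dvd K"
  shows "\<exists>y. y ^ 2 ^ b = 1 \<and>
    (\<forall>\<rho>. cstages s K b \<rho> r = (\<Sum>i<2 ^ b. \<rho> (r div 2 ^ b * 2 ^ b + i) * y ^ i))"
  using assms(2)
proof (induction b)
  case 0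
  then show ?case by (intro exI[of _ 1]) auto
next
  case (Suc b)
  define h where "h = (2::nat) ^ b"
  have h: "h > 0" "2 ^ Suc b = 2 * h" by (auto simp: h_def)
  have "2 ^ b dvd K" using Suc.prems by (metis dvd_trans le_imp_power_dvd lessI less_imp_le)
  from Suc.IH[OF this] obtain y where y: "y ^ h = 1"
    "\<And>\<rho>. cstages s K b \<rho> r = (\<Sum>i<h. \<rho> (r div h * h + i) * y ^ i)"
    by (auto simp: h_def)
  have split: "(\<Sum>i<2 * h. g i) = (\<Sum>i<h. g i) + (\<Sum>i<h. g (h + i))" for g :: "nat \<Rightarrow> complex"
    using sum_lessThan_add[of g h h] by (simp add: mult_2)
  have rr: "r div (2 * h) = r div h div 2"
    by (metis div_mult2_eq mult.commute)
  have md: "(q * h + i) div h = q" "(q * h + i) mod h = i" if "i < h" for q i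
    using that by auto
  have ev: "cstages s K (Suc b) \<rho> r = (\<Sum>i<h. cstage s K h \<rho> (r div h * h + i) * y ^ i)" for \<rho>
    using y(2) by (simp add: h_def)
  show ?case
  proof (cases "even (r div h)")
    case True
    then have base: "r div (2 * h) * (2 * h) = r div h * h"
      unfolding rr by (metis dvd_mult_div_cancel mult.assoc mult.commute)
    have "cstages s K (Suc b) \<rho> r = (\<Sum>i<2 * h. \<rho> (r div (2 * h) * (2 * h) + i) * y ^ i)" for \<rho>
      unfolding ev split base using True
      by (subst sum.distrib[symmetric], intro sum.cong)
        (auto simp: cstage_def md power_add y(1) algebra_simps)
    moreover have "y ^ (2 * h) = 1"
      by (simp add: mult_2 power_add y(1))
    ultimately show ?thesis
      unfolding h(2) by blast
  next
    case False
    then obtain p where p: "r div h = 2 * p + 1" by (elim oddE)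
    \<comment> \<open>Since \<open>z ^ h = -1\<close>, the twiddle factors move the evaluation from
      an \<open>h\<close>-th root of 1 to an \<open>h\<close>-th root of -1, which is again a
      \<open>2 * h\<close>-th root of 1.\<close>
    define z where "z = s ^ (K div h)"
    have "h dvd K" using Suc.prems h by (metis dvd_mult_right)
    then have z: "z ^ h = -1"
      using assms(1) by (simp add: z_def flip: power_mult)
    have base: "r div (2 * h) * (2 * h) = 2 * p * h"
      unfolding rr p by simp
    have *: "cstage s K h \<rho> (r div h * h + i) = z ^ i * (\<rho> (2 * p * h + i) - \<rho> (2 * p * h + h + i))"
      if "i < h" for i \<rho>
    proof -
      have "odd ((r div h * h + i) div h)" "(r div h * h + i) mod h = i"
        using False md[OF that] by auto
      moreover have "r div h * h + i - h = 2 * p * h + i" "r div h * h + i = 2 * p * h + h + i"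
        unfolding p by auto
      ultimately show ?thesis
        by (simp add: cstage_def z_def power_mult)
    qed
    have "cstages s K (Suc b) \<rho> r = (\<Sum>i<2 * h. \<rho> (r div (2 * h) * (2 * h) + i) * (z * y) ^ i)" for \<rho>
      unfolding ev split base
      by (subst sum.distrib[symmetric], intro sum.cong)
        (use * in \<open>simp_all add: power_add power_mult_distrib y(1) z right_diff_distrib mult_ac add_ac\<close>)
    moreover have "(z * y) ^ (2 * h) = 1"
      by (simp add: mult_2 power_add power_mult_distrib y(1) z)
    ultimately show ?thesis
      unfolding h(2) by blast
  qed
qed

text \<open>One level rewrites rows of length \<open>M * L\<close> as \<open>M\<close> rows of length \<open>K = 2 * L\<close>. The twist turns
  the cyclic transform of the rows into one at the roots of \<open>Y ^ M = -1\<close>.\<close>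

definition pad_twist :: "nat \<Rightarrow> nat \<Rightarrow> nat \<Rightarrow> (nat \<Rightarrow> int) \<Rightarrow> nat \<Rightarrow> int" where
  "pad_twist L K M a x = (let r = x div K in
     rot K (K div M * (r mod M)) (\<lambda>i. if i < L then a (r * L + i) else 0) (x mod K))"

definition untwist :: "nat \<Rightarrow> nat \<Rightarrow> (nat \<Rightarrow> int) \<Rightarrow> nat \<Rightarrow> nat \<Rightarrow> int" where
  "untwist K M a r i = unrot K (K div M * (r mod M)) (\<lambda>i. a (r * K + i)) i"

text \<open>Removes the twist and substitutes \<open>X ^ L\<close> for the outer variable. A product
  row has length \<open>2 * L\<close>, so its upper half overlaps the next block; the overlap of the
  last block wraps around with a sign because \<open>X ^ (M * L) = -1\<close>.\<close>

definition combine :: "nat \<Rightarrow> nat \<Rightarrow> nat \<Rightarrow> (nat \<Rightarrow> int) \<Rightarrow> nat \<Rightarrow> int" where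
  "combine L K M a x = (let r = x div L; i = x mod L in
     untwist K M a r i + (if r mod M = 0 then - untwist K M a (r + M - 1) (L + i)
                          else untwist K M a (r - 1) (L + i)))"

lemma rv_pad_twist:
  assumes "s ^ K = -1" "L \<le> K"
  shows "rv K (pad_twist L K M a) s r = s ^ (K div M * (r mod M)) * rv L a s r"
proof -
  have K: "(r * K + i) div K = r" "(r * K + i) mod K = i" if "i < K" for i
    using that by auto
  obtain f where f: "K = L + f" using assms(2) le_Suc_ex by blast
  have "rv K (pad_twist L K M a) s r = (\<Sum>i<K. rot K (K div M * (r mod M))
      (\<lambda>i. if i < L then of_int (a (r * L + i)) else 0) i * s ^ i)"
    unfolding rv_def by (intro sum.cong) (auto simp: pad_twist_def K Let_def of_int_rot if_distrib cong: if_cong)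
  also have "\<dots> = s ^ (K div M * (r mod M)) * (\<Sum>i<K. (if i < L then of_int (a (r * L + i)) else 0) * s ^ i)"
    by (rule rot_eval[OF assms(1) div_mult_mod_le])
  also have "(\<Sum>i<K. (if i < L then of_int (a (r * L + i)) else 0) * s ^ i) = rv L a s r"
    unfolding f sum_lessThan_add rv_def by simp
  finally show ?thesis .
qed

lemma rv_combine:
  assumes "x ^ (M * L) = -1" "M > 0" "K = 2 * L"
  shows "rv (M * L) (combine L K M a) x q =
    (\<Sum>n<M. x ^ (L * n) * (\<Sum>i<K. of_int (untwist K M a (q * M + n) i) * x ^ i))"
proof (cases "L = 0")
  case True
  then show ?thesis using assms by simp
next
  case False
  let ?u = "\<lambda>n i. of_int (untwist K M a (q * M + n) i) :: complex"
  have sum_blocks: "(\<Sum>i<m * L. g i) = (\<Sum>n<m. \<Sum>i<L. g (n * L + i))" for g :: "nat \<Rightarrow> complex" and m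
    by (induction m) (auto simp: sum_lessThan_add add.commute[of L])
  let ?c = "\<lambda>n i. if n = 0 then - ?u (M - 1) (L + i) else ?u (n - 1) (L + i)"
  have "rv (M * L) (combine L K M a) x q =
      (\<Sum>n<M. \<Sum>i<L. of_int (combine L K M a ((q * M + n) * L + i)) * x ^ (n * L + i))"
    unfolding rv_def sum_blocks by (simp add: algebra_simps)
  also have "\<dots> = (\<Sum>n<M. \<Sum>i<L. (?u n i + ?c n i) * x ^ (n * L + i))"
  proof (intro sum.cong refl)
    fix n i assume "n \<in> {..<M}" "i \<in> {..<L}"
    then have "((q * M + n) * L + i) div L = q * M + n" "((q * M + n) * L + i) mod L = i"
      "(q * M + n) mod M = n" "q * M + (M - 1) = q * M + M - 1" by auto
    then show "of_int (combine L K M a ((q * M + n) * L + i)) * x ^ (n * L + i) =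
        (?u n i + ?c n i) * x ^ (n * L + i)"
      by (auto simp: combine_def Let_def)
  qed
  also have "\<dots> = (\<Sum>n<M. x ^ (L * n) * (\<Sum>i<L. ?u n i * x ^ i)) +
      (\<Sum>n<M. x ^ (L * n) * (\<Sum>i<L. ?c n i * x ^ i))"
    by (simp add: sum.distrib[symmetric] sum_distrib_left power_add algebra_simps)
  also have "(\<Sum>n<M. x ^ (L * n) * (\<Sum>i<L. ?c n i * x ^ i)) =
      (\<Sum>n<M. x ^ (L * n) * (\<Sum>i<L. ?u n (L + i) * x ^ (L + i)))"
  proof -
    obtain m where m: "M = Suc m" using assms(2) by (cases M) auto
    let ?g = "\<lambda>n. \<Sum>i<L. ?u n (L + i) * x ^ i"
    have w: "x ^ (L * m) * x ^ L = -1"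
      using assms(1) by (simp add: m algebra_simps flip: power_add)
    have "(\<Sum>n<M. x ^ (L * n) * (\<Sum>i<L. ?c n i * x ^ i)) =
        - ?g m + (\<Sum>n<m. x ^ (L * Suc n) * ?g n)"
      unfolding m sum.lessThan_Suc_shift by (simp add: sum_negf)
    also have "- ?g m = (x ^ (L * m) * x ^ L) * ?g m"
      by (simp add: w)
    also have "(x ^ (L * m) * x ^ L) * ?g m + (\<Sum>n<m. x ^ (L * Suc n) * ?g n) =
        (\<Sum>n<M. x ^ (L * n) * (x ^ L * ?g n))"
      by (simp add: m power_add mult_ac)
    finally show ?thesis
      by (simp add: sum_distrib_left power_add mult_ac)
  qed
  also have "(\<Sum>n<M. x ^ (L * n) * (\<Sum>i<L. ?u n i * x ^ i)) +
      (\<Sum>n<M. x ^ (L * n) * (\<Sum>i<L. ?u n (L + i) * x ^ (L + i))) =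
      (\<Sum>n<M. x ^ (L * n) * (\<Sum>i<K. ?u n i * x ^ i))"
    unfolding assms(3) mult_2 sum_lessThan_add by (simp add: sum.distrib distrib_left)
  finally show ?thesis .
qed

definition row_poly :: "nat \<Rightarrow> (nat \<Rightarrow> int) \<Rightarrow> nat \<Rightarrow> complex poly" where
  "row_poly L a r = (\<Sum>i<L. monom (of_int (a (r * L + i))) i)"

lemma poly_row_poly: "poly (row_poly L a r) s = rv L a s r"
  by (simp add: row_poly_def rv_def poly_sum poly_monom)

lemma degree_row_poly: "L > 0 \<Longrightarrow> degree (row_poly L a r) < L"
  unfolding row_poly_def by (rule degree_sum_less) (auto intro: le_less_trans[OF degree_monom_le])

text \<open>Rows multiplied at all roots of \<open>X ^ K = -1\<close> yield blocks multiplied at all roots of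
  \<open>X ^ (M * L) = -1\<close>: the product of two rows has degree below \<open>K\<close>, hence is determined there.\<close>

lemma level_mult:
  assumes L: "L > 0" "K = 2 * L" "M = 2 ^ b" "M dvd K"
    and P: "\<And>s r. s ^ K = -1 \<Longrightarrow> rv K p s r = \<sigma> *
      rv K (stages K b (pad_twist L K M a)) s r * rv K (stages K b (pad_twist L K M a)) s (r + d * M)"
    and x: "x ^ (M * L) = -1"
  shows "rv (M * L) (combine L K M (istages K b p)) x q =
    \<sigma> * 2 ^ b * rv (M * L) a x q * rv (M * L) a x (q + d)"
proof -
  have M: "M > 0" using L by simp
  define A where "A i = row_poly L a (q * M + i)" for i
  define B where "B i = row_poly L a ((q + d) * M + i)" for i
  define G where "G = nega_conv M A B"
  have deg: "degree (G n) < K" for n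
    unfolding G_def nega_conv_def
  proof (rule degree_sum_less)
    fix i
    have R: "degree (rot M i B n) < L"
      using degree_row_poly[OF L(1)] by (auto simp: rot_def B_def)
    have "degree (A i * rot M i B n) \<le> degree (A i) + degree (rot M i B n)"
      by (rule degree_mult_le)
    also have "\<dots> < K"
      using R degree_row_poly[OF L(1), of a "q * M + i"] by (simp add: A_def L(2))
    finally show "degree (A i * rot M i B n) < K" .
  qed (use L in simp)
  define U where "U n = (\<Sum>i<K. monom (of_int (untwist K M (istages K b p) (q * M + n) i)) i :: complex poly)" for n
  have "U n = smult (\<sigma> * 2 ^ b) (G n)" if n: "n < M" for n
  proof (rule poly_eq_if_eq_at_nega_roots)
    fix s :: complex assume s: "s ^ K = -1"
    then have s0: "s \<noteq> 0" by (rule nega_root_nonzero)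
    define \<psi> where "\<psi> = s ^ (K div M)"
    have \<psi>: "\<psi> ^ M = -1"
      using s L(4) by (simp add: \<psi>_def flip: power_mult)
    define tw where "tw \<alpha> r = \<psi> ^ (r mod M) * \<alpha> r" for \<alpha> :: "nat \<Rightarrow> complex" and r
    define \<gamma> where "\<gamma> r = nega_conv M (\<lambda>i. rv L a s (r div M * M + i)) (\<lambda>i. rv L a s ((r div M + d) * M + i)) (r mod M)" for r
    have tw_rows: "rv K (stages K b (pad_twist L K M a)) s = cstages s K b (tw (rv L a s))"
    proof -
      have "rv K (pad_twist L K M a) s = tw (rv L a s)"
        using rv_pad_twist[OF s, of L M a] L by (auto simp: tw_def \<psi>_def power_mult)
      then show ?thesis by (simp add: rv_stages[OF s])
    qed
    have prod: "cstages s K b (tw (rv L a s)) r * cstages s K b (tw (rv L a s)) (r + d * M) = cstages s K b (tw \<gamma>) r" for r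
    proof -
      \<comment> \<open>The point \<open>y\<close> depends on the row but not on the sequence, so
        both factors and their product are evaluated at the same point.\<close>
      from cstages_eval[OF s, of b r] L obtain y where
        y: "y ^ M = 1" "\<And>\<rho>. cstages s K b \<rho> r = (\<Sum>i<M. \<rho> (r div M * M + i) * y ^ i)"
        by auto
      \<comment> \<open>Every block length \<open>2 * h\<close> that occurs divides
        \<open>M\<close>. Moving by \<open>d * M\<close> rows therefore changes neither the parity
        of a half-block nor a twiddle exponent.\<close>
      have shift: "cstages s K b \<rho> (r + d * M) = cstages s K b (\<lambda>r. \<rho> (r + d * M)) r" for \<rho>
      proof -
        have "cstages s K b' \<rho> (r + d * M) = cstages s K b' (\<lambda>r. \<rho> (r + d * M)) r" if "b' \<le> b" for b' \<rho> r
          using that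
        proof (induction b' arbitrary: \<rho> r)
          case (Suc b')
          define h where "h = (2::nat) ^ b'"
          have "M = 2 * h * 2 ^ (b - Suc b')"
            using Suc.prems L(3) unfolding h_def by (simp flip: power_Suc power_add)
          then obtain c where c: "M = h * (2 * c)" by (auto simp: mult_ac)
          have h0: "h > 0" by (simp add: h_def)
          have rd: "r + d * M = r + h * (2 * c * d)" for r by (simp add: c mult_ac)
          have "cstage s K h \<rho> (r + d * M) = cstage s K h (\<lambda>r. \<rho> (r + d * M)) r" for r
          proof (cases "even (r div h)")
            case True
            then show ?thesis using h0 by (simp add: cstage_def rd add_ac)
          next
            case False
            then have "h \<le> r" by (intro leI notI) auto
            then show ?thesis using h0 False by (simp add: cstage_def rd add_ac)
          qed
          then show ?case using Suc by (simp add: h_def)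
        qed simp
        then show ?thesis by simp
      qed
      have m: "(r div M * M + i) mod M = i" "(r div M * M + i) div M = r div M"
        "(r div M * M + i + d * M) mod M = i" if "i < M" for i
        using that by simp_all
      have "cstages s K b (tw (rv L a s)) r = (\<Sum>i<M. rv L a s (r div M * M + i) * (\<psi> * y) ^ i)"
        unfolding y(2) by (intro sum.cong) (auto simp: tw_def m power_mult_distrib)
      moreover have "cstages s K b (tw (rv L a s)) (r + d * M) =
          (\<Sum>i<M. rv L a s ((r div M + d) * M + i) * (\<psi> * y) ^ i)"
      proof -
        have "tw (rv L a s) (r div M * M + i + d * M) = \<psi> ^ i * rv L a s ((r div M + d) * M + i)" if "i < M" for i
        proof -
          have e: "r div M * M + i + d * M = (r div M + d) * M + i"
            by (simp add: add_mult_distrib)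
          show ?thesis unfolding tw_def m(3)[OF that] unfolding e ..
        qed
        then show ?thesis
          unfolding shift y(2) by (intro sum.cong) (auto simp: power_mult_distrib)
      qed
      moreover have "cstages s K b (tw \<gamma>) r = (\<Sum>i<M. \<gamma> (r div M * M + i) * (\<psi> * y) ^ i)"
        unfolding y(2) by (intro sum.cong) (auto simp: tw_def m power_mult_distrib)
      moreover have "(\<psi> * y) ^ M = -1"
        by (simp add: power_mult_distrib y(1) \<psi>)
      moreover have "(\<Sum>i<M. \<gamma> (r div M * M + i) * (\<psi> * y) ^ i) = (\<Sum>i<M. nega_conv M (\<lambda>i. rv L a s (r div M * M + i))
         (\<lambda>i. rv L a s ((r div M + d) * M + i)) i * (\<psi> * y) ^ i)"
        by (intro sum.cong) (auto simp: \<gamma>_def m)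
      ultimately show ?thesis
        by (simp add: nega_conv_eval)
    qed
    have "rv K p s = (\<lambda>r. \<sigma> * cstages s K b (tw \<gamma>) r)"
      using P[OF s] by (auto simp: tw_rows prod[symmetric])
    then have "rv K (istages K b p) s = (\<lambda>r. \<sigma> * (2 ^ b * tw \<gamma> r))"
      by (auto simp: rv_istages[OF s] icstages_scale icstages_cstages[OF s0])
    then have "(\<Sum>i<K. of_int (untwist K M (istages K b p) r i) * s ^ i) = \<sigma> * 2 ^ b * \<gamma> r" for r
    proof -
      assume h: "rv K (istages K b p) s = (\<lambda>r. \<sigma> * (2 ^ b * tw \<gamma> r))"
      have "(\<Sum>i<K. of_int (untwist K M (istages K b p) r i) * s ^ i) =
          rv K (istages K b p) s r / s ^ (K div M * (r mod M))"
        unfolding untwist_def of_int_unrot rv_def by (rule unrot_eval[OF s div_mult_mod_le])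
      also have "\<dots> = \<sigma> * 2 ^ b * \<gamma> r"
        unfolding h tw_def \<psi>_def using s0 by (simp add: power_mult)
      finally show ?thesis .
    qed
    from this[of "q * M + n"] show "poly (U n) s = poly (smult (\<sigma> * 2 ^ b) (G n)) s"
      using n by (simp add: U_def G_def poly_sum poly_monom \<gamma>_def poly_nega_conv A_def B_def
          poly_row_poly)
  next
    show "degree (U n) < K"
      unfolding U_def by (rule degree_sum_less) (use L in \<open>auto intro: le_less_trans[OF degree_monom_le]\<close>)
    show "degree (smult (\<sigma> * 2 ^ b) (G n)) < K"
      using deg[of n] degree_smult_le[of "\<sigma> * 2 ^ b" "G n"] by simp
  qed
  \<comment> \<open>This is now an equality of polynomials, so \<open>x\<close> can be inserted,
    although it is a root of \<open>X ^ (M * L) = -1\<close> and the equality was tested at roots of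
    \<open>X ^ K = -1\<close>.\<close>
  then have U: "(\<Sum>i<K. of_int (untwist K M (istages K b p) (q * M + n) i) * x ^ i) = \<sigma> * 2 ^ b * poly (G n) x"
    if "n < M" for n
  proof -
    assume "\<And>n. n < M \<Longrightarrow> U n = smult (\<sigma> * 2 ^ b) (G n)"
    from arg_cong[OF this[OF that], of "\<lambda>p. poly p x"] show ?thesis
      by (simp add: U_def poly_sum poly_monom)
  qed
  have sum_blocks: "(\<Sum>i<m * L. g i) = (\<Sum>n<m. \<Sum>i<L. g (n * L + i))" for g :: "nat \<Rightarrow> complex" and m
    by (induction m) (auto simp: sum_lessThan_add add.commute[of L])
  have blk: "rv (M * L) a x r = (\<Sum>i<M. rv L a x (r * M + i) * (x ^ L) ^ i)" for r
    unfolding rv_def sum_blocks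
    by (simp add: sum_distrib_left power_add mult_ac add_ac distrib_left distrib_right flip: power_mult)
  have "rv (M * L) (combine L K M (istages K b p)) x q = (\<Sum>n<M. x ^ (L * n) * (\<sigma> * 2 ^ b * poly (G n) x))"
    using rv_combine[OF x M L(2)] U by simp
  also have "\<dots> = \<sigma> * 2 ^ b * (\<Sum>n<M. nega_conv M (\<lambda>i. rv L a x (q * M + i)) (\<lambda>i. rv L a x ((q + d) * M + i)) n * (x ^ L) ^ n)"
  proof -
    have "poly (G n) x = nega_conv M (\<lambda>i. rv L a x (q * M + i)) (\<lambda>i. rv L a x ((q + d) * M + i)) n" for n
      by (simp add: G_def poly_nega_conv A_def B_def poly_row_poly)
    then show ?thesis
      unfolding power_mult sum_distrib_left by (intro sum.cong) auto
  qed
  also have "\<dots> = \<sigma> * 2 ^ b * (rv (M * L) a x q * rv (M * L) a x (q + d))"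
  proof -
    have "(x ^ L) ^ M = -1"
      using x by (simp add: mult.commute flip: power_mult)
    then show ?thesis
      by (simp only: nega_conv_eval blk)
  qed
  finally show ?thesis by (simp add: mult.assoc)
qed


text \<open>Nussbaumer's splitting: a row of length \<open>2 ^ (\<mu> + 2)\<close> becomes about
  square root many rows of about square root length. The offsets make the padded length again a
  \<open>rowlen\<close>, for half of \<open>\<mu>\<close>, and let \<open>nrows \<mu>\<close> divide
  it, as stages and twist require.\<close>

definition rowlen :: "nat \<Rightarrow> nat" where "rowlen \<mu> = 2 ^ (\<mu> + 2)"
definition half :: "nat \<Rightarrow> nat" where "half \<mu> = 2 ^ (\<mu> div 2 + 1)"
definition lgrows :: "nat \<Rightarrow> nat" where "lgrows \<mu> = \<mu> - \<mu> div 2 + 1"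

abbreviation nrows :: "nat \<Rightarrow> nat" where "nrows \<mu> \<equiv> 2 ^ lgrows \<mu>"

lemma rowlen_div2: "rowlen (\<mu> div 2) = 2 * half \<mu>"
  by (simp add: rowlen_def half_def)

lemma nrows_half: "nrows \<mu> * half \<mu> = rowlen \<mu>"
  by (simp add: rowlen_def half_def lgrows_def flip: power_add)

lemma nrows_dvd: "nrows \<mu> dvd rowlen (\<mu> div 2)"
  unfolding rowlen_def lgrows_def by (rule le_imp_power_dvd) presburger

definition forward :: "nat \<Rightarrow> (nat \<Rightarrow> int) \<Rightarrow> nat \<Rightarrow> int" where
  "forward \<mu> a = stages (rowlen (\<mu> div 2)) (lgrows \<mu>) (pad_twist (half \<mu>) (rowlen (\<mu> div 2)) (nrows \<mu>) a)"

definition backward :: "nat \<Rightarrow> (nat \<Rightarrow> int) \<Rightarrow> nat \<Rightarrow> int" where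
  "backward \<mu> p = combine (half \<mu>) (rowlen (\<mu> div 2)) (nrows \<mu>) (istages (rowlen (\<mu> div 2)) (lgrows \<mu>) p)"

definition base_mult :: "nat \<Rightarrow> (nat \<Rightarrow> int) \<Rightarrow> nat \<Rightarrow> int" where
  "base_mult d a x = nega_conv 4 (\<lambda>i. a (x div 4 * 4 + i)) (\<lambda>i. a ((x div 4 + d) * 4 + i)) (x mod 4)"

text \<open>Both factors live in one array: row \<open>q\<close> is multiplied by row
  \<open>q + d\<close>. A row turns into \<open>nrows \<mu>\<close> rows, so one level deeper the
  partners are \<open>d * nrows \<mu>\<close> apart.\<close>

fun row_mult :: "nat \<Rightarrow> nat \<Rightarrow> (nat \<Rightarrow> int) \<Rightarrow> nat \<Rightarrow> int" where
  "row_mult \<mu> d a = (if \<mu> = 0 then base_mult d a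
     else backward \<mu> (row_mult (\<mu> div 2) (d * nrows \<mu>) (forward \<mu> a)))"

declare row_mult.simps [simp del]

text \<open>Counts the postponed halvings, one for each inverse stage of each level.\<close>

fun scale :: "nat \<Rightarrow> nat" where
  "scale \<mu> = (if \<mu> = 0 then 0 else scale (\<mu> div 2) + lgrows \<mu>)"

declare scale.simps [simp del]

lemma rv_row_mult:
  "x ^ rowlen \<mu> = -1 \<Longrightarrow> rv (rowlen \<mu>) (row_mult \<mu> d a) x q =
    2 ^ scale \<mu> * rv (rowlen \<mu>) a x q * rv (rowlen \<mu>) a x (q + d)"
proof (induction \<mu> d a arbitrary: q x rule: row_mult.induct)
  case (1 \<mu> d a)
  show ?case
  proof (cases "\<mu> = 0")
    case True
    have x: "x ^ 4 = -1" using 1 True by (simp add: rowlen_def)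
    let ?n = "nega_conv 4 (\<lambda>i. of_int (a (q * 4 + i))) (\<lambda>i. of_int (a ((q + d) * 4 + i)))"
    have "rv 4 (base_mult d a) x q = (\<Sum>n<4. ?n n * x ^ n)"
      unfolding rv_def
      by (intro sum.cong) (auto simp: base_mult_def nega_conv_def of_int_rot)
    also have "\<dots> = rv 4 a x q * rv 4 a x (q + d)"
      unfolding rv_def by (rule nega_conv_eval[OF x])
    finally show ?thesis
      using True by (simp add: rowlen_def row_mult.simps[of 0] scale.simps[of 0])
  next
    case False
    let ?K = "rowlen (\<mu> div 2)"
    have "rv (nrows \<mu> * half \<mu>) (combine (half \<mu>) ?K (nrows \<mu>)
        (istages ?K (lgrows \<mu>) (row_mult (\<mu> div 2) (d * nrows \<mu>) (forward \<mu> a)))) x q =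
      2 ^ scale (\<mu> div 2) * 2 ^ lgrows \<mu> * rv (nrows \<mu> * half \<mu>) a x q * rv (nrows \<mu> * half \<mu>) a x (q + d)"
    proof (rule level_mult)
      show "half \<mu> > 0" by (simp add: half_def)
      show "rv ?K (row_mult (\<mu> div 2) (d * nrows \<mu>) (forward \<mu> a)) s r =
        2 ^ scale (\<mu> div 2) * rv ?K (stages ?K (lgrows \<mu>) (pad_twist (half \<mu>) ?K (nrows \<mu>) a)) s r *
        rv ?K (stages ?K (lgrows \<mu>) (pad_twist (half \<mu>) ?K (nrows \<mu>) a)) s (r + d * nrows \<mu>)"
        if "s ^ ?K = -1" for s r
        using 1(1)[OF False that] by (simp add: forward_def)
    qed (use 1(2) in \<open>simp_all add: rowlen_div2 nrows_dvd nrows_half flip: rowlen_div2\<close>)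
    then show ?thesis
      using False by (simp add: row_mult.simps[of \<mu>] scale.simps[of \<mu>] backward_def nrows_half power_add)
  qed
qed

text \<open>If no two nonzero coefficients multiply to a degree of \<open>rowlen \<mu>\<close> or
  more, nothing wraps around and the negacyclic product is the ordinary one.\<close>

lemma row_mult_conv:
  assumes n: "n < rowlen \<mu>"
    and deg: "\<And>i j. i < rowlen \<mu> \<Longrightarrow> j < rowlen \<mu> \<Longrightarrow> rowlen \<mu> \<le> i + j \<Longrightarrow> a i * a (rowlen \<mu> + j) = 0"
  shows "row_mult \<mu> 1 a n = 2 ^ scale \<mu> * (\<Sum>i\<le>n. a i * a (rowlen \<mu> + (n - i)))"
proof -
  let ?N = "rowlen \<mu>"
  let ?c = "nega_conv ?N a (\<lambda>i. a (?N + i))"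
  define p where "p = (\<Sum>i<?N. monom (of_int (row_mult \<mu> 1 a i)) i :: complex poly)"
  define q where "q = (\<Sum>i<?N. monom (of_int (2 ^ scale \<mu> * ?c i)) i :: complex poly)"
  have N: "?N > 0" by (simp add: rowlen_def)
  have "p = q"
  proof (rule poly_eq_if_eq_at_nega_roots)
    fix s :: complex assume s: "s ^ ?N = -1"
    have "of_int (?c i) = nega_conv ?N (\<lambda>i. of_int (a i)) (\<lambda>i. of_int (a (?N + i)) :: complex) i" for i
      by (simp add: nega_conv_def of_int_rot)
    then have "poly q s = 2 ^ scale \<mu> * (rv ?N a s 0 * rv ?N a s 1)"
      by (simp add: q_def poly_sum poly_monom rv_def mult.assoc nega_conv_eval[OF s] flip: sum_distrib_left)
    moreover have "poly p s = rv ?N (row_mult \<mu> 1 a) s 0"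
      by (simp add: p_def poly_sum poly_monom rv_def)
    ultimately show "poly p s = poly q s"
      using rv_row_mult[OF s, of 1 a 0] by (simp add: mult.assoc)
  qed (unfold p_def q_def, (rule degree_sum_less, use N in \<open>auto intro: le_less_trans[OF degree_monom_le]\<close>)+)
  then have "poly.coeff p n = poly.coeff q n" by simp
  then have "(of_int (row_mult \<mu> 1 a n) :: complex) = of_int (2 ^ scale \<mu> * ?c n)"
    using n by (simp add: p_def q_def coeff_sum)
  then have "row_mult \<mu> 1 a n = 2 ^ scale \<mu> * ?c n"
    by (simp only: of_int_eq_iff)
  also have "?c n = (\<Sum>i<?N. if i \<le> n then a i * a (?N + (n - i)) else 0)"
  proof -
    have "a i * rot ?N i (\<lambda>i. a (?N + i)) n = (if i \<le> n then a i * a (?N + (n - i)) else 0)" if "i < ?N" for i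
      using deg[of i "n + ?N - i"] that n by (auto simp: rot_def)
    then show ?thesis
      unfolding nega_conv_def by (intro sum.cong) auto
  qed
  also have "\<dots> = (\<Sum>i\<le>n. a i * a (?N + (n - i)))"
    using n by (intro sum.mono_neutral_cong_right) auto
  finally show ?thesis .
qed

section \<open>The multiplication program\<close>

abbreviation (input) "rN \<equiv> 2 :: nat"
abbreviation (input) "rT \<equiv> 3 :: nat"
abbreviation (input) "rP \<equiv> 4 :: nat"
abbreviation (input) "rI2 \<equiv> 5 :: nat"
abbreviation (input) "rLen \<equiv> 10 :: nat"
abbreviation (input) "rK \<equiv> 11 :: nat"
abbreviation (input) "rL \<equiv> 12 :: nat"
abbreviation (input) "rM \<equiv> 13 :: nat"
abbreviation (input) "rH \<equiv> 14 :: nat"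
abbreviation (input) "rMu \<equiv> 15 :: nat"
abbreviation (input) "rD \<equiv> 16 :: nat"
abbreviation (input) "rSc \<equiv> 17 :: nat"
abbreviation (input) "rV \<equiv> 18 :: nat"
abbreviation (input) "rX \<equiv> 19 :: nat"
abbreviation (input) "aPOW \<equiv> 4 :: nat"
abbreviation (input) "aU \<equiv> 7 :: nat"
abbreviation (input) "aW \<equiv> 8 :: nat"

text \<open>Selection by arithmetic. Both branches are evaluated; this is harmless because
  operations and array accesses are total and the size bound covers the discarded value as
  well.\<close>

definition ite :: "ex \<Rightarrow> ex \<Rightarrow> ex \<Rightarrow> ex" where
  "ite c e1 e2 = (Nm 0 <. c) *. e1 +. (c =. Nm 0) *. e2"

lemma ev_ite [simp]: "ev (ite c e1 e2) v a = (if ev c v a \<noteq> 0 then ev e1 v a else ev e2 v a)"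
  by (simp add: ite_def)

section \<open>Residues modulo \<open>p\<close>\<close>

definition res :: "nat \<Rightarrow> int \<Rightarrow> nat" where
  "res p x = nat (x mod int p)"

lemma res_less: "p > 0 \<Longrightarrow> res p x < p"
  by (simp add: res_def nat_less_iff)

lemma int_res: "p > 0 \<Longrightarrow> int (res p x) = x mod int p"
  by (simp add: res_def)

lemma res_eqI: "p > 0 \<Longrightarrow> int m mod int p = x mod int p \<Longrightarrow> m mod p = res p x"
  by (metis int_res nat_int of_nat_mod)

lemma res_0 [simp]: "res p 0 = 0"
  by (simp add: res_def)

lemma res_add: "p > 0 \<Longrightarrow> (res p x + res p y) mod p = res p (x + y)"
  by (rule res_eqI) (simp_all add: int_res mod_simps)

lemma res_mult: "p > 0 \<Longrightarrow> (res p x * res p y) mod p = res p (x * y)"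
  by (rule res_eqI) (simp_all add: int_res mod_simps)

lemma int_diff_res: "p > 0 \<Longrightarrow> int (p - res p y) = int p - y mod int p"
  using res_less[of p y] by (simp add: of_nat_diff int_res)

lemma res_minus: "p > 0 \<Longrightarrow> (p - res p y) mod p = res p (- y)"
  by (rule res_eqI) (simp_all add: int_diff_res mod_simps)

lemma res_diff: "p > 0 \<Longrightarrow> (res p x + (p - res p y)) mod p = res p (x - y)"
proof (rule res_eqI)
  assume "p > 0"
  then have "int (res p x + (p - res p y)) = (x mod int p - y mod int p) + int p"
    by (simp add: int_res int_diff_res)
  then show "int (res p x + (p - res p y)) mod int p = (x - y) mod int p"
    by (simp only: mod_add_self2 mod_diff_eq)
qed

lemma res_mod [simp]: "p > 0 \<Longrightarrow> res p x mod p = res p x"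
  by (simp add: res_less)

text \<open>An entry depends on old entries elsewhere in the array, so all results are collected in
  \<open>aW\<close> before they overwrite \<open>aU\<close>.\<close>

definition pass :: "ex \<Rightarrow> cmd" where
  "pass e = Sq (For rX (Vr rLen) (Sto aW (Vr rX) e)) (For rX (Vr rLen) (Sto aU (Vr rX) (Ar aW (Vr rX))))"

definition rotE :: "ex \<Rightarrow> ex \<Rightarrow> ex \<Rightarrow> (ex \<Rightarrow> ex) \<Rightarrow> ex" where
  "rotE K e i f = ite (i <. e) (Vr rP -. f ((i +. K) -. e)) (f (i -. e)) %. Vr rP"

definition unrotE :: "ex \<Rightarrow> ex \<Rightarrow> ex \<Rightarrow> (ex \<Rightarrow> ex) \<Rightarrow> ex" where
  "unrotE K e i f = ite ((i +. e) <. K) (f (i +. e)) (Vr rP -. f ((i +. e) -. K)) %. Vr rP"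

lemma ev_rotE:
  assumes "p > 0" "v rP = p" "ev Ke v a = K" "ev ie v a < K" "ev ee v a \<le> K"
    "\<And>je. ev je v a < K \<Longrightarrow> ev (f je) v a = res p (w (ev je v a))"
  shows "ev (rotE Ke ee ie f) v a = res p (rot K (ev ee v a) w (ev ie v a))"
proof (cases "ev ie v a < ev ee v a")
  case True
  have j: "ev ((ie +. Ke) -. ee) v a = ev ie v a + K - ev ee v a"
    using assms(3) by simp
  have "ev (rotE Ke ee ie f) v a = (p - ev (f ((ie +. Ke) -. ee)) v a) mod p"
    using True assms(2) by (simp add: rotE_def)
  moreover have "ev (f ((ie +. Ke) -. ee)) v a = res p (w (ev ie v a + K - ev ee v a))"
    using assms(6)[of "(ie +. Ke) -. ee"] True assms(5) unfolding j by simp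
  ultimately show ?thesis
    using True assms(1) by (simp add: rot_def res_minus)
next
  case False
  have "ev (rotE Ke ee ie f) v a = ev (f (ie -. ee)) v a mod p"
    using False assms(2) by (simp add: rotE_def)
  moreover have "ev (f (ie -. ee)) v a = res p (w (ev ie v a - ev ee v a))"
    using assms(6)[of "ie -. ee"] assms(4) by simp
  ultimately show ?thesis
    using False assms(1) by (simp add: rot_def)
qed

lemma ev_unrotE:
  assumes "p > 0" "v rP = p" "ev Ke v a = K" "ev ie v a < K" "ev ee v a \<le> K"
    "\<And>je. ev je v a < K \<Longrightarrow> ev (f je) v a = res p (w (ev je v a))"
  shows "ev (unrotE Ke ee ie f) v a = res p (unrot K (ev ee v a) w (ev ie v a))"
proof (cases "ev ie v a + ev ee v a < K")
  case True
  have "ev (unrotE Ke ee ie f) v a = ev (f (ie +. ee)) v a mod p"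
    using True assms(2,3) by (simp add: unrotE_def)
  moreover have "ev (f (ie +. ee)) v a = res p (w (ev ie v a + ev ee v a))"
    using assms(6)[of "ie +. ee"] True by simp
  ultimately show ?thesis
    using True assms(1) by (simp add: unrot_def)
next
  case False
  have j: "ev ((ie +. ee) -. Ke) v a = ev ie v a + ev ee v a - K"
    using assms(3) by simp
  have "ev (unrotE Ke ee ie f) v a = (p - ev (f ((ie +. ee) -. Ke)) v a) mod p"
    using False assms(2,3) by (simp add: unrotE_def)
  moreover have "ev (f ((ie +. ee) -. Ke)) v a = res p (w (ev ie v a + ev ee v a - K))"
    using assms(6)[of "(ie +. ee) -. Ke"] assms(4,5) unfolding j by simp
  ultimately show ?thesis
    using False assms(1) by (simp add: unrot_def res_minus)
qed

section \<open>Transform stages as expressions and loops\<close>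

abbreviation (input) "eR \<equiv> Vr rX /. Vr rK"
abbreviation (input) "eI \<equiv> Vr rX %. Vr rK"
abbreviation (input) "eE \<equiv> (Vr rK /. Vr rH) *. (eR %. Vr rH)"

definition padE :: ex where
  "padE = rotE (Vr rK) ((Vr rK /. Vr rM) *. (eR %. Vr rM)) eI
     (\<lambda>i. ite (i <. Vr rL) (Ar aU (eR *. Vr rL +. i)) (Nm 0))"

definition stageE :: ex where
  "stageE = ite ((eR /. Vr rH) %. Nm 2)
     (rotE (Vr rK) eE eI (\<lambda>i. (Ar aU ((eR -. Vr rH) *. Vr rK +. i) +. (Vr rP -. Ar aU (eR *. Vr rK +. i))) %. Vr rP))
     ((Ar aU (Vr rX) +. Ar aU (Vr rX +. Vr rH *. Vr rK)) %. Vr rP)"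

definition istageE :: ex where
  "istageE = ite ((eR /. Vr rH) %. Nm 2)
     ((Ar aU (Vr rX -. Vr rH *. Vr rK) +. (Vr rP -. unrotE (Vr rK) eE eI (\<lambda>i. Ar aU (eR *. Vr rK +. i)))) %. Vr rP)
     ((Ar aU (Vr rX) +. unrotE (Vr rK) eE eI (\<lambda>i. Ar aU ((eR +. Vr rH) *. Vr rK +. i))) %. Vr rP)"

definition untwE :: "ex \<Rightarrow> ex \<Rightarrow> ex" where
  "untwE r i = unrotE (Vr rK) ((Vr rK /. Vr rM) *. (r %. Vr rM)) i (\<lambda>i. Ar aU (r *. Vr rK +. i))"

definition combE :: ex where
  "combE = (let r = Vr rX /. Vr rL; i = Vr rX %. Vr rL in
     (untwE r i +. ite (r %. Vr rM) (untwE (r -. Nm 1) (Vr rL +. i))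
        (Vr rP -. untwE ((r +. Vr rM) -. Nm 1) (Vr rL +. i))) %. Vr rP)"

definition baseE :: ex where
  "baseE = (let r = Vr rX /. Nm 4; t = (\<lambda>i. (Ar aU (r *. Nm 4 +. Nm i) *.
      rotE (Nm 4) (Nm i) (Vr rX %. Nm 4) (\<lambda>j. Ar aU ((r *. Nm 4 +. Vr rLen) +. j))) %. Vr rP)
    in (t 0 +. t 1 +. t 2 +. t 3) %. Vr rP)"

definition setlevel :: cmd where
  "setlevel = Sq (Asg rK (Ar aPOW (Vr rMu /. Nm 2 +. Nm 2))) (Sq (Asg rL (Vr rK /. Nm 2))
     (Asg rM (Ar aPOW (Vr rMu +. Nm 2) /. Vr rL)))"

definition fwd_loop :: cmd where
  "fwd_loop = Wh (Vr rH) (Sq (pass stageE) (Asg rH (Vr rH /. Nm 2)))"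

definition fwd :: cmd where
  "fwd = Sq setlevel (Sq (Asg rLen (Nm 2 *. Vr rLen)) (Sq (pass padE) (Sq (Asg rH (Vr rM /. Nm 2))
     (Sq fwd_loop (Sq (Asg rMu (Vr rMu /. Nm 2)) (Asg rD (Vr rD +. Nm 1)))))))"

definition bwd_loop :: cmd where
  "bwd_loop = Wh (Vr rH <. Vr rM) (Sq (pass istageE) (Sq (Asg rH (Nm 2 *. Vr rH))
     (Asg rSc ((Vr rSc *. Vr rI2) %. Vr rP))))"

text \<open>Level \<open>d\<close> works with \<open>V div 2 ^ d\<close>. On the way up this is
  recomputed from the table of powers of two, so the recursion needs no stack.\<close>

definition bwd :: cmd where
  "bwd = Sq (Asg rD (Vr rD -. Nm 1)) (Sq (Asg rMu (Vr rV /. Ar aPOW (Vr rD))) (Sq setlevel (Sq (Asg rH (Nm 1))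
     (Sq bwd_loop (Sq (Asg rLen (Vr rLen /. Nm 2)) (pass combE))))))"

text \<open>The recursion of \<open>row_mult\<close> unrolled into a descending and an ascending
  loop. The forward passes transform both factors at once as one array of double length; from the
  base products on only the first half matters.\<close>

definition mul :: cmd where
  "mul = Sq (Asg rMu (Vr rV)) (Sq (Asg rD (Nm 0)) (Sq (Asg rSc (Nm 1)) (Sq (Asg rLen (Ar aPOW (Vr rV +. Nm 3)))
     (Sq (Wh (Vr rMu) fwd) (Sq (Asg rLen (Vr rLen /. Nm 2)) (Sq (pass baseE) (Wh (Vr rD) bwd)))))))"

lemma mv_pass [simp]: "mv (pass e) = {rX}" and ma_pass [simp]: "ma (pass e) = {aU, aW}"
  by (auto simp: pass_def)

lemma mv_setlevel [simp]: "mv setlevel = {rK, rL, rM}" and ma_setlevel [simp]: "ma setlevel = {}"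
  by (auto simp: setlevel_def)

lemma mv_fwd_loop [simp]: "mv fwd_loop = {rX, rH}" and ma_fwd_loop [simp]: "ma fwd_loop = {aU, aW}"
  by (auto simp: fwd_loop_def)

lemma mv_fwd [simp]: "mv fwd = {rK, rL, rM, rLen, rX, rH, rMu, rD}" and ma_fwd [simp]: "ma fwd = {aU, aW}"
  by (auto simp: fwd_def)

lemma mv_bwd_loop [simp]: "mv bwd_loop = {rX, rH, rSc}" and ma_bwd_loop [simp]: "ma bwd_loop = {aU, aW}"
  by (auto simp: bwd_loop_def)

lemma mv_bwd [simp]: "mv bwd = {rK, rL, rM, rLen, rX, rH, rMu, rD, rSc}" and ma_bwd [simp]: "ma bwd = {aU, aW}"
  by (auto simp: bwd_def)

lemma mv_mul [simp]: "mv mul = {rK, rL, rM, rLen, rX, rH, rMu, rD, rSc}" and ma_mul [simp]: "ma mul = {aU, aW}"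
  by (auto simp: mul_def)

section \<open>Correctness of the expressions\<close>

definition holds :: "nat \<Rightarrow> nat \<Rightarrow> (nat \<Rightarrow> nat) \<Rightarrow> (nat \<Rightarrow> int) \<Rightarrow> bool" where
  "holds p n u A \<longleftrightarrow> (\<forall>x<n. u x = res p (A x))"

lemma holdsD: "holds p n u A \<Longrightarrow> x < n \<Longrightarrow> u x = res p (A x)"
  by (simp add: holds_def)

lemma row_less: "x < n \<Longrightarrow> K dvd n \<Longrightarrow> i < K \<Longrightarrow> x div K * K + i < (n::nat)"
proof -
  assume h: "x < n" "K dvd n" "i < K"
  then have "x div K < n div K"
    by (metis dvd_div_mult_self less_mult_imp_div_less)
  then have "x div K * K + K \<le> n div K * K"
    by (metis Suc_leI add.commute mult_Suc mult_le_mono1)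
  then show ?thesis using h by simp
qed

text \<open>The range below \<open>n\<close> consists of complete blocks of length
  \<open>2 * m\<close>, and \<open>x\<close> lies in the first half of its block.\<close>

lemma shift_less:
  assumes "x < n" "2 * m dvd n" "even (x div m)" "m > 0"
  shows "x + m < (n::nat)"
proof -
  obtain c where c: "n = 2 * m * c" using assms(2) by blast
  obtain d where d: "x div m = 2 * d" using assms(3) by blast
  have "x div m < 2 * c"
    using assms(1,4) by (simp add: c less_mult_imp_div_less mult_ac)
  then have "2 * d + 2 \<le> 2 * c" using d by simp
  then have "(2 * d + 2) * m \<le> 2 * c * m" by (rule mult_le_mono1)
  moreover have "x < 2 * d * m + m"
    using dividend_less_div_times[OF assms(4), of x] d by simp
  ultimately show ?thesis by (simp add: c algebra_simps)
qed

lemma ev_padE: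
  assumes A: "holds p (n div 2) (a aU) A" and p: "p > 0" "v rP = p"
    and K: "v rK = K" "v rL = L" "v rM = M" "K = 2 * L" "L > 0" "K dvd n" and x: "v rX = x" "x < n"
  shows "ev padE v a = res p (pad_twist L K M A x)"
proof -
  let ?r = "x div K" and ?e = "K div M * (x div K mod M)"
  obtain c where c: "n = 2 * L * c" using K by auto
  then have "L * c = n div 2" by simp
  have r: "?r < c"
    using x(2) K(4,5) by (simp add: c less_mult_imp_div_less mult_ac)
  have *: "(if i < L then a aU (?r * L + i) else 0) = res p (if i < L then A (?r * L + i) else 0)" for i
  proof (cases "i < L")
    case True
    have "(?r + 1) * L \<le> c * L" using r by (intro mult_le_mono1) simp
    then have "?r * L + i < n div 2"
      using True \<open>L * c = n div 2\<close> by (simp add: algebra_simps)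
    then show ?thesis using holdsD[OF A] True by simp
  qed simp
  show ?thesis
    unfolding padE_def pad_twist_def Let_def
    by (subst ev_rotE[where p = p and v = v and a = a and K = K and w = "\<lambda>i. if i < L then A (?r * L + i) else 0"])
      (use K x p * div_mult_mod_le in \<open>auto cong: if_cong\<close>)
qed

lemma ev_stageE:
  assumes A: "holds p n (a aU) A" and p: "p > 0" "v rP = p"
    and K: "v rK = K" "v rH = h" "K > 0" "h > 0" "2 * (h * K) dvd n" and x: "v rX = x" "x < n"
  shows "ev stageE v a = res p (stage K h A x)"
proof -
  let ?r = "x div K" and ?e = "K div h * (x div K mod h)"
  have dv: "K dvd n" using K(5) by (meson dvd_mult dvd_triv_right dvd_trans dvd_mult_left mult.commute)
  have xd: "x div K div h = x div (h * K)"
    by (metis div_mult2_eq mult.commute)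
  show ?thesis
  proof (cases "even (?r div h)")
    case True
    have "x + h * K < n"
      by (rule shift_less[OF x(2) K(5)]) (use True K xd in auto)
    then show ?thesis
      using True K x p holdsD[OF A] by (simp add: stageE_def stage_def Let_def res_add)
  next
    case False
    then have hr: "h \<le> ?r" by (intro leI notI) auto
    have 1: "?r * K + i < n" if "i < K" for i
      by (rule row_less[OF x(2) dv that])
    have 2: "(?r - h) * K + i < n" if "i < K" for i
      using 1[OF that] by (meson add_le_mono1 diff_le_self le_less_trans mult_le_mono1)
    have *: "(a aU ((?r - h) * K + i) + (p - a aU (?r * K + i))) mod p = res p (A ((?r - h) * K + i) - A (?r * K + i))"
      if "i < K" for i
      using holdsD[OF A 1[OF that]] holdsD[OF A 2[OF that]] p by (simp add: res_diff)
    have o: "?r div h mod 2 = 1" using False by presburger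
    have "ev stageE v a = ev (rotE (Vr rK) eE eI
        (\<lambda>i. (Ar aU ((eR -. Vr rH) *. Vr rK +. i) +. (Vr rP -. Ar aU (eR *. Vr rK +. i))) %. Vr rP)) v a"
      using K x o by (simp add: stageE_def)
    also have "\<dots> = res p (rot K ?e (\<lambda>i. A ((?r - h) * K + i) - A (?r * K + i)) (x mod K))"
      by (subst ev_rotE[where p = p and v = v and a = a and K = K and w = "\<lambda>i. A ((?r - h) * K + i) - A (?r * K + i)"])
        (use K x p * div_mult_mod_le in simp_all)
    finally show ?thesis using False by (simp add: stage_def Let_def)
  qed
qed

lemma ev_istageE:
  assumes A: "holds p n (a aU) A" and p: "p > 0" "v rP = p"
    and K: "v rK = K" "v rH = h" "K > 0" "h > 0" "2 * (h * K) dvd n" and x: "v rX = x" "x < n"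
  shows "ev istageE v a = res p (istage K h A x)"
proof -
  let ?r = "x div K" and ?e = "K div h * (x div K mod h)"
  have dv: "K dvd n" using K(5) by (meson dvd_mult dvd_triv_right dvd_trans dvd_mult_left mult.commute)
  have xd: "x div K div h = x div (h * K)"
    by (metis div_mult2_eq mult.commute)
  have un: "ev (unrotE (Vr rK) eE eI (\<lambda>i. Ar aU (re *. Vr rK +. i))) v a =
      res p (unrot K ?e (\<lambda>i. A (ev re v a * K + i)) (x mod K))" if "\<And>i. i < K \<Longrightarrow> ev re v a * K + i < n" for re
    by (subst ev_unrotE[where p = p and v = v and a = a and K = K and w = "\<lambda>i. A (ev re v a * K + i)"])
      (use K x p holdsD[OF A that] div_mult_mod_le in simp_all)
  show ?thesis
  proof (cases "even (?r div h)")
    case True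
    have "x + h * K < n"
      by (rule shift_less[OF x(2) K(5)]) (use True K xd in auto)
    then have "(?r + h) * K + i < n" if "i < K" for i
      using row_less[of "x + h * K" n K i] dv that K by (simp add: add.commute)
    from un[of "eR +. Vr rH"] this
    have u: "ev (unrotE (Vr rK) eE eI (\<lambda>i. Ar aU ((eR +. Vr rH) *. Vr rK +. i))) v a =
      res p (unrot K ?e (\<lambda>i. A ((?r + h) * K + i)) (x mod K))" using K x by simp
    show ?thesis
      using True K(1,2) x p \<open>x + h * K < n\<close> holdsD[OF A x(2)]
      by (simp add: istageE_def istage_def Let_def u res_add)
  next
    case False
    have o: "?r div h mod 2 = 1" using False by presburger
    have "?r * K + i < n" if "i < K" for i
      by (rule row_less[OF x(2) dv that])
    from un[of eR] this
    have u: "ev (unrotE (Vr rK) eE eI (\<lambda>i. Ar aU (eR *. Vr rK +. i))) v a =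
      res p (unrot K ?e (\<lambda>i. A (?r * K + i)) (x mod K))" using K x by simp
    show ?thesis
      using False o K(1,2) x p holdsD[OF A, of "x - h * K"]
      by (simp add: istageE_def istage_def Let_def u res_diff)
  qed
qed

lemma ev_combE:
  assumes A: "holds p (2 * n) (a aU) A" and p: "p > 0" "v rP = p"
    and K: "v rK = K" "v rL = L" "v rM = M" "K = 2 * L" "L > 0" "M > 0" "M * L dvd n" and x: "v rX = x" "x < n"
  shows "ev combE v a = res p (combine L K M A x)"
proof -
  let ?r = "x div L"
  obtain c where c: "n = c * (M * L)" using K(7) by (metis dvdE mult.commute)
  have un: "ev (untwE re ie) v a = res p (untwist K M A (ev re v a) (ev ie v a))"
    if "ev re v a < c * M" "ev ie v a < K" for re ie
  proof -
    let ?q = "ev re v a" and ?i = "ev ie v a"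
    have "(?q + 1) * K \<le> (c * M) * K" using that by (intro mult_le_mono1) simp
    then have "?q * K + i < 2 * n" if "i < K" for i
      using that K(4) by (simp add: c algebra_simps)
    then have g: "a aU (?q * K + i) = res p (A (?q * K + i))" if "i < K" for i
      using holdsD[OF A] that by simp
    have "ev (untwE re ie) v a = res p (unrot K (K div M * (?q mod M)) (\<lambda>i. A (?q * K + i)) ?i)"
      unfolding untwE_def
      by (subst ev_unrotE[where p = p and v = v and a = a and K = K and w = "\<lambda>i. A (?q * K + i)"])
        (use K p g that div_mult_mod_le in simp_all)
    then show ?thesis by (simp add: untwist_def)
  qed
  have r: "?r < c * M"
    using x(2) K by (simp add: c less_mult_imp_div_less mult_ac)
  have rM: "?r + M - 1 < c * M" if "?r mod M = 0"
  proof -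
    have d: "?r = ?r div M * M" using div_mult_mod_eq[of ?r M] that by simp
    have "(?r div M + 1) * M \<le> c * M"
      using less_mult_imp_div_less[OF r] by (intro mult_le_mono1) simp
    then have "?r div M * M + M \<le> c * M" by (simp add: add_mult_distrib)
    then show ?thesis using d K(6) by linarith
  qed
  have xL: "x mod L < 2 * L" "L + x mod L < 2 * L"
    using mod_less_divisor[OF K(5), of x] by linarith+
  show ?thesis
  proof (cases "?r mod M = 0")
    case True
    then show ?thesis
      using un[of "Vr rX /. Vr rL" "Vr rX %. Vr rL"] un[of "(Vr rX /. Vr rL +. Vr rM) -. Nm 1" "Vr rL +. Vr rX %. Vr rL"]
        r rM K x xL p by (simp add: combE_def combine_def Let_def res_diff)
  next
    case False
    then show ?thesis
      using un[of "Vr rX /. Vr rL" "Vr rX %. Vr rL"] un[of "Vr rX /. Vr rL -. Nm 1" "Vr rL +. Vr rX %. Vr rL"]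
        r K x xL p by (simp add: combE_def combine_def Let_def res_add)
  qed
qed

lemma ev_baseE:
  assumes A: "holds p (2 * n) (a aU) A" and p: "p > 0" "v rP = p"
    and n: "v rLen = n" "n = d * 4" and x: "v rX = x" "x < n"
  shows "ev baseE v a = res p (base_mult d A x)"
proof -
  let ?r = "x div 4"
  have 1: "?r * 4 + i < n" if "i < 4" for i
    by (rule row_less) (use x n that in auto)
  have g: "a aU (?r * 4 + n + i) = res p (A ((?r + d) * 4 + i))" if "i < 4" for i
  proof -
    have "?r * 4 + n + i < 2 * n" using 1[OF that] by simp
    from holdsD[OF A this] show ?thesis by (simp add: n(2) algebra_simps)
  qed
  have t: "(a aU (?r * 4 + i) * ev (rotE (Nm 4) (Nm i) (Vr rX %. Nm 4) (\<lambda>j. Ar aU ((Vr rX /. Nm 4 *. Nm 4 +. Vr rLen) +. j))) v a) mod p =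
      res p (A (?r * 4 + i) * rot 4 i (\<lambda>j. A ((?r + d) * 4 + j)) (x mod 4))" if "i < 4" for i
  proof -
    have "ev (rotE (Nm 4) (Nm i) (Vr rX %. Nm 4) (\<lambda>j. Ar aU ((Vr rX /. Nm 4 *. Nm 4 +. Vr rLen) +. j))) v a =
        res p (rot 4 i (\<lambda>j. A ((?r + d) * 4 + j)) (x mod 4))"
      by (subst ev_rotE[where p = p and v = v and a = a and K = 4 and w = "\<lambda>j. A ((?r + d) * 4 + j)"])
        (use g p n x that in simp_all)
    then show ?thesis
      using holdsD[OF A, of "?r * 4 + i"] 1[OF that] p by (simp add: res_mult)
  qed
  have s: "{..<4} = {0, 1, 2, 3 :: nat}" by auto
  have sm: "((w + x) + y + z) mod p = ((((w + x) mod p + y) mod p) + z) mod p" for w x y z :: nat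
    by (simp add: mod_simps)
  show ?thesis
    using t[of 0] t[of 1] t[of 2] t[of 3] x n p
    by (simp add: baseE_def Let_def base_mult_def nega_conv_def s sm res_add add.assoc[symmetric])
qed

context ram
begin

text \<open>If some value reaches \<open>X\<close>, no machine state corresponds to \<open>v\<close>
  and \<open>a\<close>, and the claim holds vacuously.\<close>

lemma runs_bounded:
  assumes "(\<And>x. v x < X) \<Longrightarrow> (\<And>r j. a r j < X) \<Longrightarrow> runs c v a T Q"
  shows "runs c v a T Q"
proof (cases "(\<forall>x. v x < X) \<and> (\<forall>r j. a r j < X)")
  case False
  then show ?thesis by (auto simp: runs_def cond_st_def)
qed (use assms in auto)

lemma runs_seq:
  assumes "runs p v a T1 R"
    "\<And>v' a'. R v' a' \<Longrightarrow> (\<And>x. x \<notin> mv p \<Longrightarrow> v' x = v x) \<Longrightarrow> (\<And>r. r \<notin> ma p \<Longrightarrow> a' r = a r) \<Longrightarrow> runs q v' a' T2 Q"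
    "T1 + 1 + T2 \<le> T"
  shows "runs (Sq p q) v a T Q"
  by (rule runs_time[OF runs_Sq assms(3)], rule runs_weaken[OF assms(1)]) (use assms(2) in auto)

lemma runs_asg_seq:
  assumes "x \<noteq> 1" "ev e v a < X" "runs q (v(x := ev e v a)) a T Q"
  shows "runs (Sq (Asg x e) q) v a (T + 2) Q"
proof -
  have "runs (Sq (Asg x e) q) v a (1 + 1 + T) Q"
    by (rule runs_Sq, rule runs_Asg) (use assms in auto)
  then show ?thesis by (rule runs_time) simp
qed

lemma runs_pass:
  assumes n: "v rLen = n" "n < X" and p: "p > 0" "p \<le> X"
    and val: "\<And>x a'. x < n \<Longrightarrow> a' aU = a aU \<Longrightarrow> ev e (v(rX := x)) a' = res p (B x)"
  shows "runs (pass e) v a (10 * n + 7) (\<lambda>v' a'. holds p n (a' aU) B)"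
proof -
  have B: "res p (B x) < X" for x
    using res_less[OF p(1)] p(2) by (rule less_le_trans)
  have "runs (pass e) v a (5 * n + 3 + 1 + (5 * n + 3)) (\<lambda>v' a'. holds p n (a' aU) B)"
    unfolding pass_def
  proof (rule runs_Sq, rule runs_map[where f = "\<lambda>x. res p (B x)" and d = 0 and n = n])
    let ?v = "v(rX := n)" and ?a = "a(aW := \<lambda>x. if 0 \<le> x \<and> x < 0 + n then res p (B (x - 0)) else a aW x)"
    show "runs (For rX (Vr rLen) (Sto aU (Vr rX) (Ar aW (Vr rX)))) ?v ?a (5 * n + 3) (\<lambda>v' a'. holds p n (a' aU) B)"
      by (rule runs_map[where f = "\<lambda>x. res p (B x)" and d = 0 and n = n])
        (use n B in \<open>auto simp: holds_def\<close>)
  qed (use n B val in auto)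
  then show ?thesis by (simp add: algebra_simps)
qed

lemma runs_fwd_loop:
  assumes K: "v rK = K" "K > 0" "v rH = 2 ^ b div 2" "v rLen = n" "n < X" "2 ^ b * K dvd n"
    and p: "p > 0" "p \<le> X" "v rP = p" and A: "holds p n (a aU) A"
  shows "runs fwd_loop v a (b * (10 * n + 11) + 1) (\<lambda>v' a'. holds p n (a' aU) (stages K b A))"
proof (rule runs_bounded)
  assume vX: "\<And>x. v x < X"
  let ?Inv = "\<lambda>j v' a'. v' rH = 2 ^ b div 2 div 2 ^ j \<and>
    (\<exists>A'. holds p n (a' aU) A' \<and> stages K (b - j) A' = stages K b A)"
  have "runs fwd_loop v a ((\<Sum>j<b. (10 * n + 7 + 1 + 1) + 2) + 1) (\<lambda>v' a'. holds p n (a' aU) (stages K b A))"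
    unfolding fwd_loop_def
  proof (rule runs_Wh[where Inv = ?Inv])
    show "?Inv 0 v a" using K A by auto
  next
    fix j v' a' assume j: "j < b" and I: "?Inv j v' a'"
      and fr: "\<And>x. x \<notin> mv (Sq (pass stageE) (Asg rH (Vr rH /. Nm 2))) \<Longrightarrow> v' x = v x"
    from I obtain A' where A': "holds p n (a' aU) A'" "stages K (b - j) A' = stages K b A" by blast
    define h where "h = (2::nat) ^ (b - Suc j)"
    have bj: "b - j = Suc (b - Suc j)" "b = Suc (b - Suc j) + j" using j by auto
    have "(2::nat) ^ b div 2 div 2 ^ j = h"
    proof -
      have "(2::nat) ^ b = h * 2 ^ j * 2"
        unfolding h_def by (subst bj(2)) (simp add: power_add)
      then show ?thesis by simp
    qed
    then have hj: "h div 2 = 2 ^ b div 2 div 2 ^ Suc j"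
      by (metis div_mult2_eq power_Suc2)
    have h: "v' rH = h" "h > 0" using I \<open>2 ^ b div 2 div 2 ^ j = h\<close> by (auto simp: h_def)
    have "2 * (h * K) dvd 2 ^ b * K"
      unfolding h_def by (subst bj(2)) (simp add: power_add mult_dvd_mono)
    then have dv: "2 * (h * K) dvd n" using K(6) dvd_trans by blast
    have st: "stages K (b - Suc j) (stage K h A') = stages K b A"
      using A'(2) unfolding bj(1) h_def by simp
    have v': "v' rK = K" "v' rLen = n" "v' rP = p" using fr K p by auto
    have "runs (pass stageE) v' a' (10 * n + 7) (\<lambda>v' a'. holds p n (a' aU) (stage K h A'))"
    proof (rule runs_pass)
      fix x a'' assume "x < n" "a'' aU = a' aU"
      then show "ev stageE (v'(rX := x)) a'' = res p (stage K h A' x)"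
        using A'(1) v' h K p dv by (intro ev_stageE) auto
    qed (use v' K p in auto)
    then have "runs (pass stageE) v' a' (10 * n + 7) (\<lambda>v'' a''. runs (Asg rH (Vr rH /. Nm 2)) v'' a'' 1 (?Inv (Suc j)))"
    proof (rule runs_weaken, simp)
      fix v'' a'' assume H: "holds p n (a'' aU) (stage K h A')" and f: "\<And>x. x \<notin> mv (pass stageE) \<Longrightarrow> v'' x = v' x"
      have "v'' rH = h" using f h by simp
      moreover have "h < X" "h div 2 < X"
      proof -
        have "h \<le> 2 ^ b div 2" using \<open>2 ^ b div 2 div 2 ^ j = h\<close> by (metis div_le_dividend)
        then show "h < X" using vX[of rH] K(3) by simp
        then show "h div 2 < X" by (meson div_le_dividend le_less_trans)
      qed
      ultimately show "runs (Asg rH (Vr rH /. Nm 2)) v'' a'' 1 (?Inv (Suc j))"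
        using H st hj by (intro runs_Asg) auto
    qed
    then show "ev (Vr rH) v' a' \<noteq> 0 \<and> runs (Sq (pass stageE) (Asg rH (Vr rH /. Nm 2))) v' a'
        (10 * n + 7 + 1 + 1) (?Inv (Suc j))"
      using h by (intro conjI runs_Sq) auto
  next
    fix v' :: vars and a' assume "?Inv b v' a'"
    moreover have "(2::nat) ^ b div 2 div 2 ^ b = 0" by simp
    ultimately show "ev (Vr rH) v' a' = 0 \<and> holds p n (a' aU) (stages K b A)" by auto
  qed
  then show "runs fwd_loop v a (b * (10 * n + 11) + 1) (\<lambda>v' a'. holds p n (a' aU) (stages K b A))"
    by (rule runs_time) (simp add: algebra_simps)
qed

lemma runs_bwd_loop:
  assumes K: "v rK = K" "K > 0" "v rH = 1" "v rM = 2 ^ b" "v rLen = n" "n < X" "2 ^ b * K dvd n"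
    and p: "p > 0" "p \<le> X" "v rP = p" "v rI2 = res p i2" "v rSc = res p s" and A: "holds p n (a aU) A"
  shows "runs bwd_loop v a (b * (10 * n + 13) + 1)
    (\<lambda>v' a'. holds p n (a' aU) (istages K b A) \<and> v' rSc = res p (s * i2 ^ b))"
proof (rule runs_bounded)
  assume vX: "\<And>x. v x < X"
  let ?Inv = "\<lambda>j v' a'. v' rH = 2 ^ j \<and> holds p n (a' aU) (istages K j A) \<and> v' rSc = res p (s * i2 ^ j)"
  let ?p = "Sq (pass istageE) (Sq (Asg rH (Nm 2 *. Vr rH)) (Asg rSc ((Vr rSc *. Vr rI2) %. Vr rP)))"
  have "runs bwd_loop v a ((\<Sum>j<b. (10 * n + 7 + 1 + (1 + 1 + 1)) + 2) + 1)
    (\<lambda>v' a'. holds p n (a' aU) (istages K b A) \<and> v' rSc = res p (s * i2 ^ b))"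
    unfolding bwd_loop_def
  proof (rule runs_Wh[where Inv = ?Inv])
    show "?Inv 0 v a" using K A p by auto
  next
    fix j v' a' assume j: "j < b" and I: "?Inv j v' a'" and fr: "\<And>x. x \<notin> mv ?p \<Longrightarrow> v' x = v x"
    have v': "v' rK = K" "v' rLen = n" "v' rP = p" "v' rM = 2 ^ b" "v' rI2 = res p i2" using fr K p by auto
    have "2 * (2 ^ j * K) dvd 2 ^ b * K"
      using le_imp_power_dvd[of "Suc j" b "2::nat"] j by (simp add: mult_dvd_mono mult.assoc[symmetric])
    then have dv: "2 * (2 ^ j * K) dvd n" using K(7) dvd_trans by blast
    have lt: "(2::nat) ^ Suc j < X"
    proof -
      have "(2::nat) ^ Suc j \<le> 2 ^ b" using j by (intro power_increasing) auto
      then show ?thesis using vX[of rM] K(4) by linarith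
    qed
    have "runs (pass istageE) v' a' (10 * n + 7) (\<lambda>v' a'. holds p n (a' aU) (istage K (2 ^ j) (istages K j A)))"
    proof (rule runs_pass)
      fix x a'' assume "x < n" "a'' aU = a' aU"
      then show "ev istageE (v'(rX := x)) a'' = res p (istage K (2 ^ j) (istages K j A) x)"
        using I v' K p dv by (intro ev_istageE) auto
    qed (use v' K p in auto)
    then have "runs (pass istageE) v' a' (10 * n + 7) (\<lambda>v'' a''.
      runs (Sq (Asg rH (Nm 2 *. Vr rH)) (Asg rSc ((Vr rSc *. Vr rI2) %. Vr rP))) v'' a'' (1 + 1 + 1) (?Inv (Suc j)))"
    proof (rule runs_weaken, simp)
      fix v'' a'' assume H: "holds p n (a'' aU) (istage K (2 ^ j) (istages K j A))"
        and f: "\<And>x. x \<notin> mv (pass istageE) \<Longrightarrow> v'' x = v' x"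
      have f': "v'' rH = 2 ^ j" "v'' rSc = res p (s * i2 ^ j)" "v'' rI2 = res p i2" "v'' rP = p"
        using f v' I by auto
      have r: "res p (s * i2 ^ j) * res p i2 mod p = res p (s * i2 ^ Suc j)"
        using p by (simp add: res_mult mult_ac)
      moreover have "res p (s * i2 ^ Suc j) < X"
        using res_less[OF p(1)] p(2) by (rule less_le_trans)
      ultimately show "runs (Sq (Asg rH (Nm 2 *. Vr rH)) (Asg rSc ((Vr rSc *. Vr rI2) %. Vr rP))) v'' a'' (1 + 1 + 1) (?Inv (Suc j))"
        using H f' lt by (intro runs_Sq runs_Asg) auto
    qed
    then show "ev (Vr rH <. Vr rM) v' a' \<noteq> 0 \<and> runs ?p v' a' (10 * n + 7 + 1 + (1 + 1 + 1)) (?Inv (Suc j))"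
      using I v' j by (intro conjI runs_Sq) auto
  next
    fix v' a' assume I: "?Inv b v' a'" and fr: "\<And>x. x \<notin> mv ?p \<Longrightarrow> v' x = v x"
    have "v' rM = 2 ^ b" using fr K by auto
    then show "ev (Vr rH <. Vr rM) v' a' = 0 \<and> holds p n (a' aU) (istages K b A) \<and> v' rSc = res p (s * i2 ^ b)"
      using I by auto
  qed
  then show "runs bwd_loop v a (b * (10 * n + 13) + 1)
    (\<lambda>v' a'. holds p n (a' aU) (istages K b A) \<and> v' rSc = res p (s * i2 ^ b))"
    by (rule runs_time) (simp add: algebra_simps)
qed

lemma runs_setlevel:
  assumes "v rMu = \<mu>" "\<And>i. i \<le> \<mu> + 2 \<Longrightarrow> a aPOW i = 2 ^ i"
  shows "runs setlevel v a 5 (\<lambda>v' a'. a' = a \<and> v' rK = rowlen (\<mu> div 2) \<and> v' rL = half \<mu> \<and> v' rM = nrows \<mu>)"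
proof (rule runs_bounded)
  assume aX: "\<And>r j. a r j < X"
  have 1: "a aPOW (\<mu> div 2 + 2) = rowlen (\<mu> div 2)" "a aPOW (\<mu> + 2) = rowlen \<mu>"
    using assms(2) by (auto simp: rowlen_def)
  have 2: "rowlen (\<mu> div 2) div 2 = half \<mu>" "rowlen \<mu> div half \<mu> = nrows \<mu>"
    using rowlen_div2[of \<mu>] nrows_half[of \<mu>] by (auto simp: half_def simp flip: nrows_half)
  have 3: "rowlen (\<mu> div 2) < X" "rowlen \<mu> < X"
    using aX[of aPOW] 1 by metis+
  then have 4: "half \<mu> < X" "nrows \<mu> < X"
    using 2 by (metis div_le_dividend le_less_trans)+
  have "runs setlevel v a (1 + 1 + (1 + 1 + 1))
    (\<lambda>v' a'. a' = a \<and> v' rK = rowlen (\<mu> div 2) \<and> v' rL = half \<mu> \<and> v' rM = nrows \<mu>)"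
    unfolding setlevel_def using assms(1) 1 2 3 4 by (intro runs_Sq runs_Asg) auto
  then show "runs setlevel v a 5 (\<lambda>v' a'. a' = a \<and> v' rK = rowlen (\<mu> div 2) \<and> v' rL = half \<mu> \<and> v' rM = nrows \<mu>)"
    by (rule runs_time) simp
qed

lemma runs_fwd:
  assumes v: "v rMu = \<mu>" "v rLen = n" "rowlen \<mu> dvd n" "2 * n < X"
    and pw: "\<And>i. i \<le> \<mu> + 2 \<Longrightarrow> a aPOW i = 2 ^ i"
    and p: "p > 0" "p \<le> X" "v rP = p" and A: "holds p n (a aU) A" and d: "v rD = d" "d + 1 < X"
  shows "runs fwd v a ((lgrows \<mu> + 1) * (20 * n + 11) + 30)
    (\<lambda>v' a'. holds p (2 * n) (a' aU) (forward \<mu> A) \<and> v' rMu = \<mu> div 2 \<and> v' rLen = 2 * n \<and> v' rD = d + 1)"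
    (is "runs _ _ _ _ ?Q")
proof (rule runs_bounded)
  assume vX: "\<And>x. v x < X" and aX: "\<And>r j. a r j < X"
  let ?K = "rowlen (\<mu> div 2)" and ?M = "nrows \<mu>" and ?L = "half \<mu>"
  have KM: "?K > 0" "?L > 0" "?K dvd 2 * n" "?M * ?K dvd 2 * n"
  proof -
    have "?M * ?K = 2 * rowlen \<mu>"
      using rowlen_div2[of \<mu>] nrows_half[of \<mu>] by simp
    then show "?M * ?K dvd 2 * n" using v(3) by simp
    then show "?K dvd 2 * n" by (rule dvd_mult_right)
  qed (auto simp: rowlen_def half_def)
  have MX: "?M div 2 < X"
  proof -
    have "?M \<le> rowlen \<mu>" unfolding nrows_half[symmetric] by (simp add: half_def)
    also have "\<dots> = a aPOW (\<mu> + 2)" using pw by (simp add: rowlen_def)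
    finally show ?thesis using aX[of aPOW "\<mu> + 2"] by linarith
  qed
  have "\<mu> div 2 < X" using vX[of rMu] v(1) by (metis div_le_dividend le_less_trans)
  show "runs fwd v a ((lgrows \<mu> + 1) * (20 * n + 11) + 30) ?Q"
    unfolding fwd_def
  proof (rule runs_seq, rule runs_setlevel[where \<mu> = \<mu>])
    fix v1 a1 assume s1: "a1 = a \<and> v1 rK = ?K \<and> v1 rL = ?L \<and> v1 rM = ?M"
      and f1: "\<And>x. x \<notin> mv setlevel \<Longrightarrow> v1 x = v x"
    define v2 where "v2 = v1(rLen := 2 * n)"
    have v2: "v2 rLen = 2 * n" "v2 rP = p" "v2 rK = ?K" "v2 rL = ?L" "v2 rM = ?M" "v2 rMu = \<mu>" "v2 rD = d"
      using s1 f1 v p d by (auto simp: v2_def)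
    have pd: "runs (pass padE) v2 a (10 * (2 * n) + 7) (\<lambda>v' a'. holds p (2 * n) (a' aU) (pad_twist ?L ?K ?M A))"
    proof (rule runs_pass)
      fix x a' assume "x < 2 * n" "a' aU = a aU"
      then show "ev padE (v2(rX := x)) a' = res p (pad_twist ?L ?K ?M A x)"
        using v2 A p KM rowlen_div2 by (intro ev_padE) auto
    qed (use v2 p v in auto)
    have "runs (Sq (pass padE) (Sq (Asg rH (Vr rM /. Nm 2)) (Sq fwd_loop
        (Sq (Asg rMu (Vr rMu /. Nm 2)) (Asg rD (Vr rD +. Nm 1)))))) v2 a
        (lgrows \<mu> * (20 * n + 11) + 20 * n + 18) ?Q"
    proof (rule runs_seq[OF pd])
      fix v3 a3 assume s3: "holds p (2 * n) (a3 aU) (pad_twist ?L ?K ?M A)"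
        and f3: "\<And>x. x \<notin> mv (pass padE) \<Longrightarrow> v3 x = v2 x"
      define v4 where "v4 = v3(rH := ?M div 2)"
      have v4: "v4 rH = ?M div 2" "v4 rLen = 2 * n" "v4 rP = p" "v4 rK = ?K" "v4 rMu = \<mu>" "v4 rD = d"
        using f3 v2 by (auto simp: v4_def)
      have "runs (Sq fwd_loop (Sq (Asg rMu (Vr rMu /. Nm 2)) (Asg rD (Vr rD +. Nm 1)))) v4 a3
         (lgrows \<mu> * (20 * n + 11) + 6) ?Q"
      proof (rule runs_seq[OF runs_fwd_loop[where n = "2 * n" and p = p and K = ?K and b = "lgrows \<mu>"]])
        fix v5 a5 assume s5: "holds p (2 * n) (a5 aU) (stages ?K (lgrows \<mu>) (pad_twist ?L ?K ?M A))"
          and f5: "\<And>x. x \<notin> mv fwd_loop \<Longrightarrow> v5 x = v4 x"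
        have "v5 rMu = \<mu>" "v5 rLen = 2 * n" "v5 rD = d" using f5 v4 by auto
        then show "runs (Sq (Asg rMu (Vr rMu /. Nm 2)) (Asg rD (Vr rD +. Nm 1))) v5 a5 (1 + 1 + 1) ?Q"
          using s5 \<open>\<mu> div 2 < X\<close> d by (intro runs_Sq runs_Asg) (auto simp: forward_def)
      qed (use v4 KM v p s3 in \<open>auto simp: algebra_simps\<close>)
      then have "runs (Sq (Asg rH (Vr rM /. Nm 2)) (Sq fwd_loop (Sq (Asg rMu (Vr rMu /. Nm 2)) (Asg rD (Vr rD +. Nm 1)))))
          v3 a3 (1 + 1 + (lgrows \<mu> * (20 * n + 11) + 6)) ?Q"
      proof (intro runs_Sq runs_Asg)
        have "v3 rM = ?M" using f3 v2 by simp
        then show "ev (Vr rM /. Nm 2) v3 a3 < X" "runs (Sq fwd_loop (Sq (Asg rMu (Vr rMu /. Nm 2)) (Asg rD (Vr rD +. Nm 1))))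
            (v3(rH := ev (Vr rM /. Nm 2) v3 a3)) a3 (lgrows \<mu> * (20 * n + 11) + 6) ?Q"
          if "runs (Sq fwd_loop (Sq (Asg rMu (Vr rMu /. Nm 2)) (Asg rD (Vr rD +. Nm 1)))) v4 a3
            (lgrows \<mu> * (20 * n + 11) + 6) ?Q"
          using that MX by (auto simp: v4_def)
      qed simp_all
      then show "runs (Sq (Asg rH (Vr rM /. Nm 2)) (Sq fwd_loop (Sq (Asg rMu (Vr rMu /. Nm 2)) (Asg rD (Vr rD +. Nm 1)))))
          v3 a3 (lgrows \<mu> * (20 * n + 11) + 8) ?Q"
        by (rule runs_time) simp
    qed simp
    moreover have "v1 rLen = n" using f1 v by simp
    ultimately have "runs (Sq (Asg rLen (Nm 2 *. Vr rLen)) (Sq (pass padE) (Sq (Asg rH (Vr rM /. Nm 2)) (Sq fwd_loop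
        (Sq (Asg rMu (Vr rMu /. Nm 2)) (Asg rD (Vr rD +. Nm 1))))))) v1 a1
        (1 + 1 + (lgrows \<mu> * (20 * n + 11) + 20 * n + 18)) ?Q"
      using s1 v by (intro runs_Sq runs_Asg) (auto simp: v2_def)
    then show "runs (Sq (Asg rLen (Nm 2 *. Vr rLen)) (Sq (pass padE) (Sq (Asg rH (Vr rM /. Nm 2)) (Sq fwd_loop
        (Sq (Asg rMu (Vr rMu /. Nm 2)) (Asg rD (Vr rD +. Nm 1))))))) v1 a1
        (lgrows \<mu> * (20 * n + 11) + 20 * n + 20) ?Q"
      by (rule runs_time) simp
  qed (use v pw in \<open>auto simp: algebra_simps\<close>)
qed

lemma runs_bwd:
  assumes v: "v rD = Suc d" "v rV = V" "V div 2 ^ d = \<mu>" "v rLen = 2 * n" "rowlen \<mu> dvd n"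
    and pw: "\<And>i. i \<le> max (\<mu> + 2) d \<Longrightarrow> a aPOW i = 2 ^ i"
    and p: "p > 0" "p \<le> X" "v rP = p" "v rI2 = res p i2" "v rSc = res p s" and A: "holds p (2 * n) (a aU) A"
  shows "runs bwd v a (lgrows \<mu> * (20 * n + 13) + 10 * n + 30)
    (\<lambda>v' a'. holds p n (a' aU) (backward \<mu> A) \<and> v' rD = d \<and> v' rLen = n \<and> v' rSc = res p (s * i2 ^ lgrows \<mu>))"
    (is "runs _ _ _ _ ?Q")
proof (rule runs_bounded)
  assume vX: "\<And>x. v x < X" and aX: "\<And>r j. a r j < X"
  let ?K = "rowlen (\<mu> div 2)" and ?M = "nrows \<mu>" and ?L = "half \<mu>"
  have KM: "?K > 0" "?L > 0" "?K dvd 2 * n" "?M * ?K dvd 2 * n" "?M * ?L dvd n"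
  proof -
    have "?M * ?K = 2 * rowlen \<mu>"
      using rowlen_div2[of \<mu>] nrows_half[of \<mu>] by simp
    then show "?M * ?K dvd 2 * n" using v(5) by simp
    then show "?K dvd 2 * n" by (rule dvd_mult_right)
    show "?M * ?L dvd n" using v(5) by (simp add: nrows_half)
  qed (auto simp: rowlen_def half_def)
  have n: "2 * n < X" "n < X" "d < X" "V < X"
    using vX[of rLen] vX[of rD] vX[of rV] v by auto
  have "\<mu> < X" using n(4) v(3) by (metis div_le_dividend le_less_trans)
  have X1: "1 < X" using X2 by simp
  define v1 where "v1 = v(rD := d, rMu := \<mu>)"
  have v1: "v1 rLen = 2 * n" "v1 rP = p" "v1 rMu = \<mu>" "v1 rD = d" "v1 rI2 = res p i2" "v1 rSc = res p s"
    using v p by (auto simp: v1_def)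
  have "runs (Sq setlevel (Sq (Asg rH (Nm 1)) (Sq bwd_loop (Sq (Asg rLen (Vr rLen /. Nm 2)) (pass combE))))) v1 a
     (lgrows \<mu> * (20 * n + 13) + 10 * n + 20) ?Q"
  proof (rule runs_seq, rule runs_setlevel[where \<mu> = \<mu>])
    fix v2 a2 assume s2: "a2 = a \<and> v2 rK = ?K \<and> v2 rL = ?L \<and> v2 rM = ?M"
      and f2: "\<And>x. x \<notin> mv setlevel \<Longrightarrow> v2 x = v1 x"
    define v3 where "v3 = v2(rH := 1)"
    have v3: "v3 rLen = 2 * n" "v3 rP = p" "v3 rD = d" "v3 rI2 = res p i2" "v3 rSc = res p s"
      "v3 rK = ?K" "v3 rL = ?L" "v3 rM = ?M" "v3 rH = 1"
      using s2 f2 v1 by (auto simp: v3_def)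
    have "runs (Sq bwd_loop (Sq (Asg rLen (Vr rLen /. Nm 2)) (pass combE))) v3 a
       (lgrows \<mu> * (20 * n + 13) + 10 * n + 12) ?Q"
    proof (rule runs_seq, rule runs_bwd_loop[where n = "2 * n" and p = p and K = ?K and b = "lgrows \<mu>" and A = A and s = s])
      fix v4 a4 assume s4: "holds p (2 * n) (a4 aU) (istages ?K (lgrows \<mu>) A) \<and> v4 rSc = res p (s * i2 ^ lgrows \<mu>)"
        and f4: "\<And>x. x \<notin> mv bwd_loop \<Longrightarrow> v4 x = v3 x"
      define v5 where "v5 = v4(rLen := n)"
      have v5: "v5 rLen = n" "v5 rP = p" "v5 rD = d" "v5 rSc = res p (s * i2 ^ lgrows \<mu>)"
        "v5 rK = ?K" "v5 rL = ?L" "v5 rM = ?M"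
        using s4 f4 v3 by (auto simp: v5_def)
      have "runs (pass combE) v5 a4 (10 * n + 7) (\<lambda>v' a'. holds p n (a' aU) (backward \<mu> A))"
      proof (rule runs_pass)
        fix x a' assume "x < n" "a' aU = a4 aU"
        then show "ev combE (v5(rX := x)) a' = res p (backward \<mu> A x)"
          unfolding backward_def using v5 s4 p KM rowlen_div2 by (intro ev_combE) auto
      qed (use v5 p n in auto)
      then have c: "runs (pass combE) v5 a4 (10 * n + 7) ?Q"
        by (rule runs_weaken) (use v5 in auto)
      have "v4 rLen = 2 * n" using f4 v3 by simp
      then have "runs (Sq (Asg rLen (Vr rLen /. Nm 2)) (pass combE)) v4 a4 (1 + 1 + (10 * n + 7)) ?Q"
        using c n by (intro runs_Sq runs_Asg) (auto simp: v5_def)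
      then show "runs (Sq (Asg rLen (Vr rLen /. Nm 2)) (pass combE)) v4 a4 (10 * n + 9) ?Q"
        by (rule runs_time) simp
    qed (use v3 KM A p n in \<open>auto simp: algebra_simps\<close>)
    then have "runs (Sq (Asg rH (Nm 1)) (Sq bwd_loop (Sq (Asg rLen (Vr rLen /. Nm 2)) (pass combE)))) v2 a2
       (1 + 1 + (lgrows \<mu> * (20 * n + 13) + 10 * n + 12)) ?Q"
      using s2 X1 by (intro runs_Sq runs_Asg) (auto simp: v3_def)
    then show "runs (Sq (Asg rH (Nm 1)) (Sq bwd_loop (Sq (Asg rLen (Vr rLen /. Nm 2)) (pass combE)))) v2 a2
       (lgrows \<mu> * (20 * n + 13) + 10 * n + 14) ?Q"
      by (rule runs_time) simp
  qed (use v1 pw in auto)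
  moreover have "a aPOW d = 2 ^ d" using pw by simp
  ultimately have "runs bwd v a (1 + 1 + (1 + 1 + (lgrows \<mu> * (20 * n + 13) + 10 * n + 20))) ?Q"
    unfolding bwd_def using v n \<open>\<mu> < X\<close> by (intro runs_Sq runs_Asg) (auto simp: v1_def)
  then show "runs bwd v a (lgrows \<mu> * (20 * n + 13) + 10 * n + 30) ?Q"
    by (rule runs_time) simp
qed

end

text \<open>The binary length. It is the number of levels of the recursion
  \<open>\<mu> div 2\<close> and later serves as an integer logarithm.\<close>

fun nbits :: "nat \<Rightarrow> nat" where
  "nbits v = (if v = 0 then 0 else Suc (nbits (v div 2)))"

declare nbits.simps [simp del]

lemma less_nbits_iff: "d < nbits v \<longleftrightarrow> v div 2 ^ d \<noteq> 0"
proof (induction v arbitrary: d rule: nbits.induct)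
  case (1 v)
  show ?case
  proof (cases "v = 0")
    case False
    then show ?thesis
      using 1[of "d - 1"] by (cases d) (auto simp: nbits.simps[of v] div_mult2_eq)
  qed (simp add: nbits.simps)
qed

lemma nbits_le: "nbits v \<le> v"
proof (induction v rule: nbits.induct)
  case (1 v)
  then show ?case by (cases "v = 0") (auto simp: nbits.simps[of v] nbits.simps[of 0])
qed

lemma pow_nbits_le: "v > 0 \<Longrightarrow> 2 ^ nbits v \<le> 2 * v"
proof (induction v rule: nbits.induct)
  case (1 v)
  show ?case
  proof (cases "v div 2 = 0")
    case True
    then show ?thesis using 1(2) by (simp add: nbits.simps[of v] nbits.simps[of 0])
  next
    case False
    then have "2 ^ nbits (v div 2) \<le> 2 * (v div 2)" using 1 by simp
    then show ?thesis using 1(2) by (simp add: nbits.simps[of v])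
  qed
qed

primrec fwds :: "nat \<Rightarrow> nat \<Rightarrow> (nat \<Rightarrow> int) \<Rightarrow> nat \<Rightarrow> int" where
  "fwds v 0 a = a"
| "fwds v (Suc d) a = forward (v div 2 ^ d) (fwds v d a)"

primrec blocks :: "nat \<Rightarrow> nat \<Rightarrow> nat" where
  "blocks v 0 = 1"
| "blocks v (Suc d) = blocks v d * nrows (v div 2 ^ d)"

definition prodat :: "nat \<Rightarrow> nat \<Rightarrow> (nat \<Rightarrow> int) \<Rightarrow> nat \<Rightarrow> int" where
  "prodat v d a = row_mult (v div 2 ^ d) (blocks v d) (fwds v d a)"

text \<open>Each level pads its rows to twice their length, so the amount of data per factor doubles
  from level to level.\<close>

lemma blocks_rowlen: "blocks v d * rowlen (v div 2 ^ d) = 2 ^ d * rowlen v"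
proof (induction d)
  case (Suc d)
  have "rowlen (v div 2 ^ Suc d) = 2 * half (v div 2 ^ d)"
    using rowlen_div2[of "v div 2 ^ d"] by (simp add: div_mult2_eq[symmetric] mult.commute)
  then have "blocks v (Suc d) * rowlen (v div 2 ^ Suc d) = 2 * (blocks v d * (nrows (v div 2 ^ d) * half (v div 2 ^ d)))"
    by simp
  also have "\<dots> = 2 ^ Suc d * rowlen v"
    unfolding nrows_half Suc by simp
  finally show ?case .
qed simp

lemma prodat_step: "v div 2 ^ d \<noteq> 0 \<Longrightarrow> prodat v d a = backward (v div 2 ^ d) (prodat v (Suc d) a)"
  unfolding prodat_def
  by (subst row_mult.simps) (simp add: div_mult2_eq[symmetric] mult.commute)

lemma scale_step: "v div 2 ^ d \<noteq> 0 \<Longrightarrow> scale (v div 2 ^ d) = scale (v div 2 ^ Suc d) + lgrows (v div 2 ^ d)"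
  by (subst scale.simps) (simp add: div_mult2_eq[symmetric] mult.commute)

text \<open>There are \<open>nbits v\<close> levels on the way down, as many on the way up, and one
  base pass. A level makes at most \<open>v + 2\<close> passes over an array that padding has
  extended to at most \<open>2 * 2 ^ nbits v * rowlen v\<close> entries.\<close>

definition mul_cost :: "nat \<Rightarrow> nat" where
  "mul_cost v = (2 * nbits v + 1) * ((v + 3) * (20 * (2 ^ nbits v * rowlen v) + 20) + 60)"

context ram
begin

lemma runs_mul:
  assumes v: "v rV = V" and pw: "\<And>i. i \<le> V + 3 \<Longrightarrow> a aPOW i = 2 ^ i"
    and p: "p \<ge> 2" "p \<le> X" "v rP = p" "v rI2 = res p i2"
    and A: "holds p (2 * rowlen V) (a aU) A" and big: "2 * (2 ^ nbits V * rowlen V) < X"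
  shows "runs mul v a (mul_cost V)
    (\<lambda>v' a'. holds p (rowlen V) (a' aU) (row_mult V 1 A) \<and> v' rSc = res p (i2 ^ scale V))"
    (is "runs _ _ _ _ ?Q")
proof (rule runs_bounded)
  assume vX: "\<And>x. v x < X" and aX: "\<And>r j. a r j < X"
  let ?D = "nbits V" and ?N = "2 ^ nbits V * rowlen V"
  have X1: "0 < X" "1 < X" "1 mod p = 1" using X2 p by auto
  have lg: "lgrows (V div x) \<le> V + 1" for x
  proof -
    have "V div x \<le> V" by simp
    then show ?thesis unfolding lgrows_def by linarith
  qed
  have pow: "(2::nat) ^ d * rowlen V \<le> ?N" if "d \<le> ?D" for d
    using that by (intro mult_le_mono1 power_increasing) auto
  have DX: "d < X" if "d \<le> ?D" for d
  proof -
    have "d < 2 ^ ?D" using that less_exp[of ?D] by linarith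
    also have "\<dots> \<le> ?N" by (simp add: rowlen_def)
    finally show ?thesis using big by simp
  qed
  have dv: "rowlen (V div 2 ^ d) dvd 2 ^ d * rowlen V" for d
    unfolding blocks_rowlen[symmetric] by simp
  let ?F = "\<lambda>d v' a'. v' rMu = V div 2 ^ d \<and> v' rD = d \<and> v' rLen = 2 * (2 ^ d * rowlen V) \<and>
      holds p (2 * (2 ^ d * rowlen V)) (a' aU) (fwds V d A)"
  let ?B = "\<lambda>j v' a'. v' rD = ?D - j \<and> v' rLen = 2 ^ (?D - j) * rowlen V \<and>
      holds p (2 ^ (?D - j) * rowlen V) (a' aU) (prodat V (?D - j) A) \<and>
      v' rSc = res p (i2 ^ scale (V div 2 ^ (?D - j)))"
  let ?cf = "(V + 2) * (20 * ?N + 11) + 30" and ?cb = "(V + 1) * (20 * ?N + 13) + 10 * ?N + 30"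
  have bwds: "runs (Wh (Vr rD) bwd) v1 a1 (?D * (?cb + 2) + 1) ?Q"
    if h: "?B 0 v1 a1" "v1 rV = V" "v1 rP = p" "v1 rI2 = res p i2" "a1 aPOW = a aPOW" for v1 a1
  proof -
    have "runs (Wh (Vr rD) bwd) v1 a1 ((\<Sum>j<?D. ?cb + 2) + 1) ?Q"
    proof (rule runs_Wh[where Inv = ?B])
      show "?B 0 v1 a1" by (rule h(1))
    next
      fix j v' a' assume j: "j < ?D" and I: "?B j v' a'" and f: "\<And>x. x \<notin> mv bwd \<Longrightarrow> v' x = v1 x"
        "\<And>r. r \<notin> ma bwd \<Longrightarrow> a' r = a1 r"
      define d where "d = ?D - Suc j"
      have d: "?D - j = Suc d" "d < ?D" using j by (auto simp: d_def)
      then have nz: "V div 2 ^ d \<noteq> 0" using less_nbits_iff by blast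
      have fv: "v' rV = V" "v' rP = p" "v' rI2 = res p i2" "a' aPOW = a aPOW" using f h by auto
      have "d \<le> V" using d(2) nbits_le[of V] by simp
      have "V div 2 ^ d \<le> V" by simp
      have "runs bwd v' a' (lgrows (V div 2 ^ d) * (20 * (2 ^ d * rowlen V) + 13) + 10 * (2 ^ d * rowlen V) + 30)
        (\<lambda>v' a'. holds p (2 ^ d * rowlen V) (a' aU) (backward (V div 2 ^ d) (prodat V (Suc d) A)) \<and> v' rD = d \<and>
          v' rLen = 2 ^ d * rowlen V \<and> v' rSc = res p (i2 ^ scale (V div 2 ^ Suc d) * i2 ^ lgrows (V div 2 ^ d)))"
      proof (rule runs_bwd)
        show "rowlen (V div 2 ^ d) dvd 2 ^ d * rowlen V" by (rule dv)
        fix i assume "i \<le> max (V div 2 ^ d + 2) d"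
        then have "i \<le> V + 3" using \<open>d \<le> V\<close> \<open>V div 2 ^ d \<le> V\<close> by linarith
        then show "a' aPOW i = 2 ^ i" using pw fv by simp
      qed (use I d fv p in \<open>auto simp: mult.assoc\<close>)
      then have "runs bwd v' a' ?cb (?B (Suc j))"
      proof (rule runs_weaken)
        show "lgrows (V div 2 ^ d) * (20 * (2 ^ d * rowlen V) + 13) + 10 * (2 ^ d * rowlen V) + 30 \<le> ?cb"
          using pow[of d] d(2) lg[of "2 ^ d"] by (intro add_mono mult_mono) auto
      qed (use prodat_step[OF nz] scale_step[OF nz] in \<open>auto simp: d_def[symmetric] power_add\<close>)
      then show "ev (Vr rD) v' a' \<noteq> 0 \<and> runs bwd v' a' ?cb (?B (Suc j))"
        using I d by simp
    next
      fix v' a' assume "?B ?D v' a'"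
      then show "ev (Vr rD) v' a' = 0 \<and> ?Q v' a'" by (auto simp: prodat_def)
    qed
    then show ?thesis by simp
  qed
  have mid: "runs (Sq (Asg rLen (Vr rLen /. Nm 2)) (Sq (pass baseE) (Wh (Vr rD) bwd))) v1 a1
      (10 * ?N + 7 + 1 + (?D * (?cb + 2) + 1) + 2) ?Q"
    if h: "?F ?D v1 a1" "v1 rV = V" "v1 rP = p" "v1 rI2 = res p i2" "a1 aPOW = a aPOW" "v1 rSc = 1" for v1 a1
  proof -
    have z: "V div 2 ^ ?D = 0" using less_nbits_iff[of ?D V] by simp
    define v2 where "v2 = v1(rLen := ?N)"
    have v2: "v2 rLen = ?N" "v2 rP = p" "v2 rV = V" "v2 rI2 = res p i2" "v2 rD = ?D" "v2 rSc = 1"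
      using h by (auto simp: v2_def)
    have N4: "?N = blocks V ?D * 4" using blocks_rowlen[of V ?D] z by (simp add: rowlen_def)
    have "runs (pass baseE) v2 a1 (10 * ?N + 7) (\<lambda>v' a'. holds p ?N (a' aU) (prodat V ?D A))"
    proof (rule runs_pass)
      fix x a' assume "x < ?N" "a' aU = a1 aU"
      then have "ev baseE (v2(rX := x)) a' = res p (base_mult (blocks V ?D) (fwds V ?D A) x)"
        using v2 h p N4 by (intro ev_baseE[where n = ?N]) auto
      then show "ev baseE (v2(rX := x)) a' = res p (prodat V ?D A x)"
        unfolding prodat_def z by (simp add: row_mult.simps[of 0])
    qed (use v2 p big in auto)
    then have "runs (Sq (pass baseE) (Wh (Vr rD) bwd)) v2 a1 (10 * ?N + 7 + 1 + (?D * (?cb + 2) + 1)) ?Q"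
    proof (rule runs_seq)
      fix v3 a3 assume "holds p ?N (a3 aU) (prodat V ?D A)" "\<And>x. x \<notin> mv (pass baseE) \<Longrightarrow> v3 x = v2 x"
        "\<And>r. r \<notin> ma (pass baseE) \<Longrightarrow> a3 r = a1 r"
      then show "runs (Wh (Vr rD) bwd) v3 a3 (?D * (?cb + 2) + 1) ?Q"
        using v2 z h(5) X1(3) by (intro bwds) (auto simp: scale.simps[of 0] res_def nat_mod_distrib)
    qed simp
    then show ?thesis
      using h big by (intro runs_asg_seq) (auto simp: v2_def)
  qed
  have fwdl: "runs (Wh (Vr rMu) fwd) v1 a1 (?D * (?cf + 2) + 1)
      (\<lambda>v' a'. ?F ?D v' a')"
    if h: "?F 0 v1 a1" "v1 rP = p" "a1 aPOW = a aPOW" for v1 a1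
  proof -
    have "runs (Wh (Vr rMu) fwd) v1 a1 ((\<Sum>j<?D. ?cf + 2) + 1) (\<lambda>v' a'. ?F ?D v' a')"
    proof (rule runs_Wh[where Inv = ?F])
      show "?F 0 v1 a1" by (rule h(1))
    next
      fix d v' a' assume d: "d < ?D" and I: "?F d v' a'" and f: "\<And>x. x \<notin> mv fwd \<Longrightarrow> v' x = v1 x"
        "\<And>r. r \<notin> ma fwd \<Longrightarrow> a' r = a1 r"
      have nz: "V div 2 ^ d \<noteq> 0" using less_nbits_iff d by blast
      have fv: "v' rP = p" "a' aPOW = a aPOW" using f h by auto
      have "V div 2 ^ d \<le> V" by simp
      have pd: "2 * (2 ^ d * rowlen V) \<le> ?N"
        using pow[of "Suc d"] d by simp
      have "runs fwd v' a' ((lgrows (V div 2 ^ d) + 1) * (20 * (2 * (2 ^ d * rowlen V)) + 11) + 30)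
        (\<lambda>v' a'. holds p (2 * (2 * (2 ^ d * rowlen V))) (a' aU) (forward (V div 2 ^ d) (fwds V d A)) \<and>
          v' rMu = V div 2 ^ d div 2 \<and> v' rLen = 2 * (2 * (2 ^ d * rowlen V)) \<and> v' rD = d + 1)"
      proof (rule runs_fwd)
        show "rowlen (V div 2 ^ d) dvd 2 * (2 ^ d * rowlen V)" using dv by (rule dvd_mult)
        show "2 * (2 * (2 ^ d * rowlen V)) < X" using pd big by linarith
        show "a' aPOW i = 2 ^ i" if "i \<le> V div 2 ^ d + 2" for i
        proof -
          have "i \<le> V + 3" using that \<open>V div 2 ^ d \<le> V\<close> by linarith
          then show ?thesis using pw fv by simp
        qed
        show "d + 1 < X" using DX[of "d + 1"] d by simp
      qed (use I fv p in auto)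
      then have "runs fwd v' a' ?cf (?F (Suc d))"
      proof (rule runs_weaken)
        have "lgrows (V div 2 ^ d) + 1 \<le> V + 2" using lg[of "2 ^ d"] by simp
        moreover have "20 * (2 * (2 ^ d * rowlen V)) + 11 \<le> 20 * ?N + 11" using pd by simp
        ultimately show "(lgrows (V div 2 ^ d) + 1) * (20 * (2 * (2 ^ d * rowlen V)) + 11) + 30 \<le> ?cf"
          by (intro add_le_mono1) (rule mult_le_mono)
      qed (auto simp: div_mult2_eq[symmetric] mult.commute mult.left_commute)
      then show "ev (Vr rMu) v' a' \<noteq> 0 \<and> runs fwd v' a' ?cf (?F (Suc d))"
        using I nz by simp
    next
      fix v' a' assume "?F ?D v' a'"
      moreover have "V div 2 ^ ?D = 0" using less_nbits_iff[of ?D V] by simp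
      ultimately show "ev (Vr rMu) v' a' = 0 \<and> ?F ?D v' a'" by simp
    qed
    then show ?thesis by simp
  qed
  define v0 where "v0 = v(rMu := V, rD := 0, rSc := 1, rLen := 2 * rowlen V)"
  have v0: "v0 rMu = V" "v0 rD = 0" "v0 rSc = 1" "v0 rLen = 2 * rowlen V" "v0 rP = p" "v0 rV = V" "v0 rI2 = res p i2"
    using v p by (auto simp: v0_def)
  have "runs (Sq (Wh (Vr rMu) fwd) (Sq (Asg rLen (Vr rLen /. Nm 2)) (Sq (pass baseE) (Wh (Vr rD) bwd)))) v0 a
      (?D * (?cf + 2) + 1 + 1 + (10 * ?N + 7 + 1 + (?D * (?cb + 2) + 1) + 2)) ?Q"
  proof (rule runs_seq)
    show "runs (Wh (Vr rMu) fwd) v0 a (?D * (?cf + 2) + 1) (\<lambda>v' a'. ?F ?D v' a')"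
      using v0 A by (intro fwdl) auto
    fix v1 a1 assume "?F ?D v1 a1" "\<And>x. x \<notin> mv (Wh (Vr rMu) fwd) \<Longrightarrow> v1 x = v0 x"
      "\<And>r. r \<notin> ma (Wh (Vr rMu) fwd) \<Longrightarrow> a1 r = a r"
    then show "runs (Sq (Asg rLen (Vr rLen /. Nm 2)) (Sq (pass baseE) (Wh (Vr rD) bwd))) v1 a1
      (10 * ?N + 7 + 1 + (?D * (?cb + 2) + 1) + 2) ?Q"
      using v0 by (intro mid) auto
  qed simp
  moreover have "a aPOW (V + 3) = 2 * rowlen V" "2 * rowlen V < X" "V < X"
    using pw[of "V + 3"] aX[of aPOW "V + 3"] vX[of rV] v by (auto simp: rowlen_def power_add)
  ultimately have "runs mul v a (?D * (?cf + 2) + 1 + 1 +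
      (10 * ?N + 7 + 1 + (?D * (?cb + 2) + 1) + 2) + 2 + 2 + 2 + 2) ?Q"
    unfolding mul_def using v X1 by (intro runs_asg_seq) (auto simp: v0_def)
  then show "runs mul v a (mul_cost V) ?Q"
  proof (rule runs_time)
    define c where "c = (V + 3) * (20 * ?N + 20) + 60"
    have "?cf + 2 \<le> c" "?cb + 2 \<le> c" "10 * ?N + 30 \<le> c"
      by (auto simp: c_def algebra_simps)
    then have "?D * (?cf + 2) \<le> ?D * c" "?D * (?cb + 2) \<le> ?D * c" "10 * ?N + 30 \<le> c"
      by (auto intro: mult_le_mono)
    then have "?D * (?cf + 2) + ?D * (?cb + 2) + 10 * ?N + 30 \<le> (2 * ?D + 1) * c"
      by (simp add: algebra_simps)
    then show "?D * (?cf + 2) + 1 + 1 +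
      (10 * ?N + 7 + 1 + (?D * (?cb + 2) + 1) + 2) + 2 + 2 + 2 + 2 \<le> mul_cost V"
      by (simp add: mul_cost_def c_def)
  qed
qed

end

section \<open>Online convolution\<close>

text \<open>The exponent of 2 in \<open>i\<close>, that is, the position of the lowest set bit; the
  value at 0 is a default.\<close>

fun lowexp :: "nat \<Rightarrow> nat" where
  "lowexp i = (if i = 0 \<or> odd i then 0 else Suc (lowexp (i div 2)))"

declare lowexp.simps [simp del]

abbreviation lowbit :: "nat \<Rightarrow> nat" where "lowbit i \<equiv> 2 ^ lowexp i"

lemma even_div_lowexp: "d < lowexp i \<Longrightarrow> even (i div 2 ^ d)"
proof (induction i arbitrary: d rule: lowexp.induct)
  case (1 i)
  show ?case
  proof (cases "i = 0 \<or> odd i")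
    case False
    then show ?thesis
      using 1 by (cases d) (auto simp: lowexp.simps[of i] div_mult2_eq)
  qed (use 1 in \<open>simp add: lowexp.simps[of i]\<close>)
qed

lemma lowbit_odd: "i > 0 \<Longrightarrow> \<exists>q. odd q \<and> i = lowbit i * q"
proof (induction i rule: lowexp.induct)
  case (1 i)
  show ?case
  proof (cases "odd i")
    case False
    then obtain j where j: "i = 2 * j" by blast
    with 1 False obtain q where "odd q" "j = lowbit j * q" by auto
    then show ?thesis
      using 1(2) j by (intro exI[of _ q]) (simp add: lowexp.simps[of "2 * j"])
  qed (auto simp: lowexp.simps[of i])
qed

lemma odd_div_lowbit: "i > 0 \<Longrightarrow> odd (i div lowbit i)"
  using lowbit_odd[of i] by (metis nonzero_mult_div_cancel_left power_not_zero zero_neq_numeral)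

lemma lowbit_le: "i > 0 \<Longrightarrow> lowbit i \<le> i"
  using lowbit_odd[of i] by (metis dvd_triv_left dvd_imp_le)

lemma pow2_cases: "(2::nat) ^ a \<le> 2 ^ b \<or> 2 * 2 ^ b dvd (2::nat) ^ a"
proof (cases "a \<le> b")
  case False
  then have "2 ^ Suc b dvd (2::nat) ^ a" by (intro le_imp_power_dvd) simp
  then show ?thesis by simp
qed (simp add: power_increasing)

lemma dvd_less_imp_add_le:
  fixes x y d :: nat
  assumes "d dvd x" "d dvd y" "x < y"
  shows "x + d \<le> y"
  using assms by (metis dvd_diff_nat dvd_imp_le le_diff_conv2 less_imp_le zero_less_diff add.commute)

text \<open>The intervals \<open>[i - lowbit i, i)\<close> with \<open>i \<le> m < i + lowbit i\<close> partition \<open>[0, m)\<close>: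
  they arise by clearing the set bits of \<open>m\<close> one after the other, lowest first.\<close>

lemma fenwick_step:
  assumes m: "0 < i" "i < m"
  shows "m < i + lowbit i \<longleftrightarrow> i \<le> m - lowbit m \<and> m - lowbit m < i + lowbit i"
proof -
  let ?u = "lowbit m" and ?l = "lowbit i"
  obtain q where q: "odd q" "m = ?u * q" using lowbit_odd[of m] m by auto
  obtain o' where o: "odd o'" "i = ?l * o'" using lowbit_odd[of i] m by auto
  obtain e where e: "q = 2 * e + 1" using q(1) by (elim oddE)
  have m': "m - ?u = 2 * ?u * e" 
  proof -
    have "m = 2 * ?u * e + ?u" by (subst q(2)) (simp add: e)
    then show ?thesis by simp
  qed
  have dvu: "?u dvd m" "?l dvd i" "2 * ?u dvd m - ?u" "?u dvd m - ?u"
    using dvd_triv_left[of ?u q, folded q(2)] dvd_triv_left[of ?l o', folded o(2)] unfolding m' by simp_all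
  have lm: "?u \<le> m" using lowbit_le m by simp
  have nd: "\<not> 2 * ?l dvd i"
  proof
    assume "2 * ?l dvd i"
    then have "?l * 2 dvd ?l * o'" using o(2) by (simp add: mult.commute)
    then have "2 dvd o'" by simp
    then show False using o(1) by simp
  qed
  show ?thesis
  proof
    assume r: "i \<le> m - ?u \<and> m - ?u < i + ?l"
    \<comment> \<open>The numbers compared are multiples of a common power of two, so a strict
      inequality between them leaves a gap of at least that power.\<close>
    from pow2_cases[of "lowexp i" "lowexp m"] show "m < i + ?l"
    proof
      assume "?l \<le> ?u"
      then have "?l dvd ?u" "2 * ?l dvd 2 * ?u" by (auto intro!: le_imp_power_dvd simp: mult_dvd_mono)
      then have "?l dvd m - ?u" "2 * ?l dvd m - ?u" using dvu by (meson dvd_trans)+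
      moreover have "i = m - ?u"
      proof (rule ccontr)
        assume "i \<noteq> m - ?u"
        then have "i + ?l \<le> m - ?u"
          using r by (intro dvd_less_imp_add_le[OF dvu(2) \<open>?l dvd m - ?u\<close>]) simp
        then show False using r by simp
      qed
      ultimately show ?thesis using nd by simp
    next
      assume d: "2 * ?u dvd ?l"
      then have "2 * ?u dvd i + ?l" using dvu(2) by (meson dvd_add dvd_trans)
      then have "m - ?u + 2 * ?u \<le> i + ?l"
        using r by (intro dvd_less_imp_add_le[OF dvu(3)]) auto
      moreover have "?u > 0" by simp
      ultimately show ?thesis using lm by linarith
    qed
  next
    assume r: "m < i + ?l"
    have "i \<le> m - ?u"
    proof (rule ccontr)
      assume c: "\<not> i \<le> m - ?u"
      from pow2_cases[of "lowexp m" "lowexp i"] show False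
      proof
        assume "?u \<le> ?l"
        then have "?u dvd ?l" by (intro le_imp_power_dvd) simp
        then have "?u dvd i" using dvu(2) dvd_trans by blast
        then have "m - ?u + ?u \<le> i" using c by (intro dvd_less_imp_add_le dvu) auto
        then show False using m lm by simp
      next
        assume "2 * ?l dvd ?u"
        then have "?l dvd m" using dvu(1) by (meson dvd_trans dvd_mult_right dvd_triv_right)
        then have "i + ?l \<le> m" using m dvu by (intro dvd_less_imp_add_le)
        then show False using r by simp
      qed
    qed
    then show "i \<le> m - ?u \<and> m - ?u < i + ?l" using r by simp
  qed
qed

text \<open>This is the schedule of the online convolution: step \<open>i\<close> lets the block
  \<open>[i - lowbit i, i)\<close> act on the targets \<open>[i, i + lowbit i)\<close>. Each pair
  \<open>j < m\<close> is served exactly once, by a step \<open>i\<close> with \<open>j < i\<close>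
  and \<open>i \<le> m\<close>, when entry \<open>j\<close> is already final and entry
  \<open>m\<close> is not yet.\<close>

lemma fenwick_sum:
  fixes g :: "nat \<Rightarrow> 'a::comm_monoid_add"
  shows "(\<Sum>i | 0 < i \<and> i \<le> m \<and> m < i + lowbit i. \<Sum>j = i - lowbit i..<i. g j) = (\<Sum>j<m. g j)"
proof (induction m rule: less_induct)
  case (less m)
  let ?S = "\<lambda>m. {i. 0 < i \<and> i \<le> m \<and> m < i + lowbit i}"
  show ?case
  proof (cases "m = 0")
    case True
    then have "?S m = {}" by auto
    then show ?thesis using True by simp
  next
    case False
    let ?m = "m - lowbit m"
    have lt: "?m < m" using False by simp
    have "i \<in> ?S m \<longleftrightarrow> i \<in> insert m (?S ?m)" for i
    proof -
      consider "i = m" | "i = 0" | "0 < i" "i < m" | "i > m" by linarith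
      then show ?thesis
        by cases (use fenwick_step[of i m] lt False in auto)
    qed
    then have "?S m = insert m (?S ?m)" by blast
    moreover have "m \<notin> ?S ?m" "finite (?S ?m)" using lt by (auto intro: finite_subset[of _ "{..?m}"])
    ultimately have "(\<Sum>i\<in>?S m. \<Sum>j = i - lowbit i..<i. g j) = (\<Sum>j = ?m..<m. g j) + (\<Sum>j<?m. g j)"
      using less[OF lt] by simp
    then show ?thesis
      using lt by (simp add: atLeast0LessThan[symmetric] add.commute sum.atLeastLessThan_concat)
  qed
qed

section \<open>The recurrence for weighted solution counts\<close>

text \<open>\<open>solutions k x r j a\<close> sums, over all ways to colour some of \<open>x 0, ..., x (j - 1)\<close> such that
  colour \<open>i < k\<close> has total \<open>a i\<close>, the products of the weights \<open>r\<close>; elements 0 are ignored.\<close>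

definition shift :: "nat \<Rightarrow> nat \<Rightarrow> ((nat \<Rightarrow> nat) \<Rightarrow> int) \<Rightarrow> (nat \<Rightarrow> nat) \<Rightarrow> int" where
  "shift z i c a = (if z \<le> a i then c (a(i := a i - z)) else 0)"

primrec solutions :: "nat \<Rightarrow> (nat \<Rightarrow> nat) \<Rightarrow> (nat \<Rightarrow> nat \<Rightarrow> int) \<Rightarrow> nat \<Rightarrow> (nat \<Rightarrow> nat) \<Rightarrow> int" where
  "solutions k x r 0 a = of_bool (a = (\<lambda>_. 0))"
| "solutions k x r (Suc j) a = solutions k x r j a +
     (if x j = 0 then 0 else \<Sum>i<k. r j i * shift (x j) i (solutions k x r j) a)"

text \<open>The power series \<open>1 / (1 + r 0 * X 0 + ... + r (k - 1) * X (k - 1))\<close>, by total degree.\<close>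

primrec geom_deg :: "nat \<Rightarrow> (nat \<Rightarrow> int) \<Rightarrow> nat \<Rightarrow> (nat \<Rightarrow> nat) \<Rightarrow> int" where
  "geom_deg k r 0 b = of_bool (b = (\<lambda>_. 0))"
| "geom_deg k r (Suc n) b = - (\<Sum>i<k. r i * shift 1 i (geom_deg k r n) b)"

definition geom :: "nat \<Rightarrow> (nat \<Rightarrow> int) \<Rightarrow> (nat \<Rightarrow> nat) \<Rightarrow> int" where
  "geom k r b = geom_deg k r (\<Sum>i<k. b i) b"

text \<open>\<open>logder k z r\<close> is the Euler derivative of the logarithm of \<open>1 + r 0 * X 0 ^ z + ...\<close>.\<close>

definition logder :: "nat \<Rightarrow> nat \<Rightarrow> (nat \<Rightarrow> int) \<Rightarrow> (nat \<Rightarrow> nat) \<Rightarrow> int" where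
  "logder k z r b = (if b \<noteq> (\<lambda>_. 0) \<and> (\<forall>i. z dvd b i) then - int z * geom k r (\<lambda>i. b i div z) else 0)"

definition logder_sum :: "nat \<Rightarrow> (nat \<Rightarrow> nat) \<Rightarrow> (nat \<Rightarrow> nat \<Rightarrow> int) \<Rightarrow> nat \<Rightarrow> (nat \<Rightarrow> nat) \<Rightarrow> int" where
  "logder_sum k x r j b = (\<Sum>l<j. if x l = 0 then 0 else logder k (x l) (r l) b)"

definition supp :: "nat \<Rightarrow> (nat \<Rightarrow> nat) \<Rightarrow> bool" where
  "supp k a \<longleftrightarrow> (\<forall>i\<ge>k. a i = 0)"

text \<open>The product of multivariate power series. Exponent vectors are total functions;
  \<open>supp\<close> confines them to the \<open>k\<close> variables and so makes the sum
  finite.\<close>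

definition conv :: "((nat \<Rightarrow> nat) \<Rightarrow> int) \<Rightarrow> ((nat \<Rightarrow> nat) \<Rightarrow> int) \<Rightarrow> (nat \<Rightarrow> nat) \<Rightarrow> int" where
  "conv f c a = (\<Sum>b | \<forall>i. b i \<le> a i. f b * c (\<lambda>i. a i - b i))"

lemma finite_below: "supp k a \<Longrightarrow> finite {b. \<forall>i. b i \<le> (a i :: nat)}"
proof -
  assume a: "supp k a"
  have "{b. \<forall>i. b i \<le> a i} \<subseteq> {f. \<forall>i. (i \<in> {..<k} \<longrightarrow> f i \<in> {..\<Sum>i<k. a i}) \<and> (i \<notin> {..<k} \<longrightarrow> f i = 0)}"
  proof (rule subsetI)
    fix b assume "b \<in> {b. \<forall>i. b i \<le> a i}"
    then have b: "b i \<le> a i" for i by simp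
    have "b i \<le> (\<Sum>i<k. a i)" if "i < k" for i
      using member_le_sum[of i "{..<k}" a] that b[of i] by simp
    moreover have "b i = 0" if "k \<le> i" for i
      using a b[of i] that by (simp add: supp_def)
    ultimately show "b \<in> {f. \<forall>i. (i \<in> {..<k} \<longrightarrow> f i \<in> {..\<Sum>i<k. a i}) \<and> (i \<notin> {..<k} \<longrightarrow> f i = 0)}"
      by simp
  qed
  then show ?thesis
    by (rule finite_subset) (rule finite_set_of_finite_funs, auto)
qed

lemma supp_upd: "supp k a \<Longrightarrow> supp k (a(i := a i - z))"
  by (auto simp: supp_def)

lemma conv_shift_right:
  assumes "supp k a"
  shows "conv f (shift z i c) a = shift z i (conv f c) a"
proof (cases "z \<le> a i")
  case True
  have "conv f (shift z i c) a = (\<Sum>b | \<forall>j. b j \<le> (a(i := a i - z)) j. f b * c (\<lambda>j. (a(i := a i - z)) j - b j))"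
    unfolding conv_def
  proof (rule sum.mono_neutral_cong_right[OF finite_below[OF assms]])
    show "{b. \<forall>j. b j \<le> (a(i := a i - z)) j} \<subseteq> {b. \<forall>j. b j \<le> a j}"
      by (auto split: if_splits intro: order.trans[OF _ diff_le_self])
    show "\<forall>b\<in>{b. \<forall>j. b j \<le> a j} - {b. \<forall>j. b j \<le> (a(i := a i - z)) j}. f b * shift z i c (\<lambda>i. a i - b i) = 0"
    proof
      fix b assume "b \<in> {b. \<forall>j. b j \<le> a j} - {b. \<forall>j. b j \<le> (a(i := a i - z)) j}"
      then have "b i \<le> a i" "\<not> b i \<le> a i - z" by (auto split: if_splits)
      then have "\<not> z \<le> a i - b i" by linarith
      then show "f b * shift z i c (\<lambda>i. a i - b i) = 0" by (simp add: shift_def)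
    qed
    fix b assume b: "b \<in> {b. \<forall>j. b j \<le> (a(i := a i - z)) j}"
    then have "b i \<le> a i - z" by (auto dest: spec[of _ i])
    moreover have "(\<lambda>i. a i - b i)(i := a i - b i - z) = (\<lambda>j. (a(i := a i - z)) j - b j)"
      by (auto simp: fun_eq_iff)
    ultimately show "f b * shift z i c (\<lambda>i. a i - b i) = f b * c (\<lambda>j. (a(i := a i - z)) j - b j)"
      using True by (auto simp: shift_def)
  qed
  then show ?thesis using True by (simp add: shift_def conv_def)
next
  case False
  then show ?thesis by (auto simp: conv_def shift_def intro!: sum.neutral)
qed

lemma conv_shift_left:
  assumes "supp k a"
  shows "conv (shift z i f) c a = shift z i (conv f c) a"
proof (cases "z \<le> a i")
  case True
  have "conv (shift z i f) c a = (\<Sum>b | (\<forall>j. b j \<le> a j) \<and> z \<le> b i. f (b(i := b i - z)) * c (\<lambda>j. a j - b j))"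
    unfolding conv_def
    by (rule sum.mono_neutral_cong_right[OF finite_below[OF assms]]) (auto simp: shift_def)
  also have "\<dots> = (\<Sum>b | \<forall>j. b j \<le> (a(i := a i - z)) j. f b * c (\<lambda>j. (a(i := a i - z)) j - b j))"
  proof (rule sum.reindex_bij_witness[of _ "\<lambda>b. b(i := b i + z)" "\<lambda>b. b(i := b i - z)"])
    fix b assume "b \<in> {b. (\<forall>j. b j \<le> a j) \<and> z \<le> b i}"
    then have "(\<lambda>j. (a(i := a i - z)) j - (b(i := b i - z)) j) = (\<lambda>j. a j - b j)"
      by (auto simp: fun_eq_iff)
    then show "f (b(i := b i - z)) * c (\<lambda>j. (a(i := a i - z)) j - (b(i := b i - z)) j) =
      f (b(i := b i - z)) * c (\<lambda>j. a j - b j)" by simp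
  qed (use True in \<open>auto simp: diff_le_mono le_diff_conv2 split: if_splits\<close>)
  finally show ?thesis using True by (simp add: shift_def conv_def)
next
  case False
  have "shift z i f b = 0" if "\<forall>j. b j \<le> a j" for b
    using that[rule_format, of i] False by (auto simp: shift_def)
  then show ?thesis using False by (auto simp: conv_def shift_def intro!: sum.neutral)
qed

lemma conv_add_right: "conv f (\<lambda>a. c a + d a) a = conv f c a + conv f d a"
  by (simp add: conv_def distrib_left sum.distrib)

lemma conv_add_left: "conv (\<lambda>a. f a + g a) c a = conv f c a + conv g c a"
  by (simp add: conv_def distrib_right sum.distrib)

lemma conv_sum_right: "conv f (\<lambda>a. \<Sum>i<k. r i * c i a) a = (\<Sum>i<k. r i * conv f (c i) a)"
  unfolding conv_def sum_distrib_left by (subst sum.swap) (simp add: mult_ac)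

lemma conv_sum_left: "conv (\<lambda>a. \<Sum>i<k. r i * f i a) c a = (\<Sum>i<k. r i * conv (f i) c a)"
  unfolding conv_def sum_distrib_left sum_distrib_right by (subst sum.swap) (simp add: mult_ac)

lemma conv_single:
  assumes "supp k a"
  shows "conv (\<lambda>b. of_bool (b = (\<lambda>_. 0)(i := z))) c a = shift z i c a"
proof (cases "z \<le> a i")
  case True
  let ?s = "(\<lambda>_. 0)(i := z) :: nat \<Rightarrow> nat"
  have "conv (\<lambda>b. of_bool (b = ?s)) c a = (\<Sum>b\<in>{?s}. c (\<lambda>j. a j - b j))"
    unfolding conv_def
    by (rule sum.mono_neutral_cong_right[OF finite_below[OF assms]]) (use True in auto)
  also have "\<dots> = c (a(i := a i - z))"
  proof -
    have "(\<lambda>j. a j - ?s j) = a(i := a i - z)" by auto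
    then show ?thesis by simp
  qed
  finally show ?thesis using True by (simp add: shift_def)
next
  case False
  have "b \<noteq> (\<lambda>_. 0)(i := z)" if "\<forall>j. b j \<le> a j" for b
    using that[rule_format, of i] False by auto
  then show ?thesis using False by (auto simp: conv_def shift_def intro!: sum.neutral)
qed

lemma geom_0: "geom k r (\<lambda>_. 0) = 1"
  by (simp add: geom_def)

text \<open>Compares coefficients in \<open>G * (1 + \<Sum>i<k. r i * X i) = 1\<close>. The terms on
  the right have total degree one less, which is why \<open>geom_deg\<close> recurses on the
  degree.\<close>

lemma geom_rec:
  assumes "supp k b" "b \<noteq> (\<lambda>_. 0)"
  shows "geom k r b = - (\<Sum>i<k. r i * shift 1 i (geom k r) b)"
proof -
  obtain i0 where "b i0 \<noteq> 0" using assms(2) by auto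
  then have "i0 < k" using assms(1) by (metis not_le supp_def)
  then have "(\<Sum>i<k. b i) \<noteq> 0" using \<open>b i0 \<noteq> 0\<close> by auto
  then obtain n where n: "(\<Sum>i<k. b i) = Suc n" using not0_implies_Suc by blast
  have "shift 1 i (geom_deg k r n) b = shift 1 i (geom k r) b" if i: "i < k" for i
  proof (cases "1 \<le> b i")
    case True
    have "(\<Sum>j<k. b j) = (\<Sum>j<k. (b(i := b i - 1)) j) + 1"
      using True i by (simp add: sum.remove[of "{..<k}" i])
    then have "(\<Sum>j<k. (b(i := b i - 1)) j) = n" using n by simp
    then show ?thesis by (simp add: shift_def geom_def)
  qed (simp add: shift_def)
  then show ?thesis by (simp add: geom_def n)
qed

text \<open>Let \<open>S = \<Sum>i<k. r i * X i ^ z\<close>. The Euler derivation maps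
  \<open>1 + S\<close> to \<open>z * S\<close>, and
  \<open>z * S / (1 + S) = z - z / (1 + S)\<close>; this explains the sign in \<open>logder\<close>
  and its vanishing constant term. Multiplication by \<open>1 + S\<close> gives the
  equation.\<close>

lemma logder_eq:
  assumes "supp k b" "z > 0"
  shows "logder k z r b + (\<Sum>i<k. r i * shift z i (logder k z r) b) =
    int z * (\<Sum>i<k. r i * of_bool (b = (\<lambda>_. 0)(i := z)))"
proof (cases "\<forall>i. z dvd b i")
  case False
  then obtain i0 where i0: "\<not> z dvd b i0" by blast
  have "shift z i (logder k z r) b = 0" for i
  proof -
    have "\<not> z dvd (b(i := b i - z)) i0" if "z \<le> b i"
      using i0 that dvd_diffD[of z "b i" z] by (cases "i0 = i") auto
    then show ?thesis unfolding shift_def logder_def by meson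
  qed
  moreover have "b \<noteq> (\<lambda>_. 0)(i := z)" for i
    using i0 by (cases "i0 = i") auto
  ultimately show ?thesis using i0 by (auto simp: logder_def)
next
  case True
  define c where "c i = b i div z" for i
  have b: "b i = z * c i" for i using True by (simp add: c_def)
  have c0: "b = (\<lambda>_. 0) \<longleftrightarrow> c = (\<lambda>_. 0)" using assms(2) by (auto simp: fun_eq_iff b)
  have sh: "shift z i (logder k z r) b = (if 1 \<le> c i \<and> c(i := c i - 1) \<noteq> (\<lambda>_. 0) then - int z * shift 1 i (geom k r) c else 0)" for i
  proof (cases "1 \<le> c i")
    case True
    have 1: "(b(i := b i - z)) j = z * (c(i := c i - 1)) j" for j
      using True by (auto simp: b diff_mult_distrib2)
    have 2: "(\<lambda>j. (b(i := b i - z)) j div z) = c(i := c i - 1)"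
      unfolding 1 using assms(2) by auto
    have 3: "b(i := b i - z) = (\<lambda>_. 0) \<longleftrightarrow> c(i := c i - 1) = (\<lambda>_. 0)"
      using assms(2) by (simp add: fun_eq_iff 1 del: fun_upd_apply)
    have "z \<le> b i" using True by (simp add: b)
    moreover have "\<forall>j. z dvd (b(i := b i - z)) j" unfolding 1 by simp
    ultimately show ?thesis
      using True 3 by (simp add: shift_def logder_def 2 del: fun_upd_apply)
  qed (use assms(2) in \<open>auto simp: shift_def b\<close>)
  have ind: "b = (\<lambda>_. 0)(i := z) \<longleftrightarrow> 1 \<le> c i \<and> c(i := c i - 1) = (\<lambda>_. 0)" for i
  proof
    assume e: "b = (\<lambda>_. 0)(i := z)"
    then have "c = (\<lambda>_. 0)(i := 1)" using assms(2) by (auto simp: c_def fun_eq_iff)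
    then show "1 \<le> c i \<and> c(i := c i - 1) = (\<lambda>_. 0)" by auto
  next
    assume e: "1 \<le> c i \<and> c(i := c i - 1) = (\<lambda>_. 0)"
    then have "c i = 1" by (metis fun_upd_same diff_is_0_eq le_antisym)
    moreover have "c j = 0" if "j \<noteq> i" for j using e that by (metis fun_upd_other)
    ultimately show "b = (\<lambda>_. 0)(i := z)" by (auto simp: fun_eq_iff b)
  qed
  show ?thesis
  proof (cases "b = (\<lambda>_. 0)")
    case True
    then have "c = (\<lambda>_. 0)" using c0 by simp
    then have "shift z i (logder k z r) b = 0" "b \<noteq> (\<lambda>_. 0)(i := z)" for i
      using sh[of i] ind[of i] by auto
    then have "(\<Sum>i<k. r i * shift z i (logder k z r) b) = 0" "(\<Sum>i<k. r i * of_bool (b = (\<lambda>_. 0)(i := z))) = 0"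
      by (auto intro!: sum.neutral)
    then show ?thesis
      using True by (simp add: logder_def)
  next
    case False
    have "supp k c" using assms by (auto simp: supp_def c_def)
    have "logder k z r b = - int z * geom k r c"
    proof -
      have "(\<lambda>i. b i div z) = c" by (simp add: c_def fun_eq_iff)
      then show ?thesis using False True by (simp add: logder_def)
    qed
    also have "\<dots> = int z * (\<Sum>i<k. r i * shift 1 i (geom k r) c)"
      using geom_rec[OF \<open>supp k c\<close>] False c0 by simp
    finally have "logder k z r b + (\<Sum>i<k. r i * shift z i (logder k z r) b) =
        (\<Sum>i<k. r i * (int z * shift 1 i (geom k r) c + shift z i (logder k z r) b))"
      by (simp add: sum_distrib_left sum.distrib distrib_left mult_ac)
    also have "\<dots> = (\<Sum>i<k. r i * (int z * of_bool (b = (\<lambda>_. 0)(i := z))))"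
    proof (intro sum.cong refl arg_cong2[of _ _ _ _ "(*)"])
      fix i
      have "shift 1 i (geom k r) c = (if 1 \<le> c i then geom k r (c(i := c i - 1)) else 0)"
        by (simp add: shift_def)
      moreover have "c(i := c i - 1) = (\<lambda>_. 0) \<Longrightarrow> geom k r (c(i := c i - 1)) = 1"
        by (simp only: geom_0)
      ultimately show "int z * shift 1 i (geom k r) c + shift z i (logder k z r) b = int z * of_bool (b = (\<lambda>_. 0)(i := z))"
        unfolding sh[of i] ind[of i] by (simp del: fun_upd_apply One_nat_def)
    qed
    finally show ?thesis by (simp only: sum_distrib_left mult.left_commute)
  qed
qed

lemma conv_cong:
  assumes "supp k a" "\<And>b. supp k b \<Longrightarrow> f b = g b"
  shows "conv f c a = conv g c a"
proof -
  have "supp k b" if "\<forall>i. b i \<le> a i" for b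
    using assms(1) that by (metis le_zero_eq supp_def)
  then show ?thesis
    unfolding conv_def using assms(2) by (intro sum.cong) auto
qed

text \<open>The Euler derivation \<open>D\<close> multiplies the coefficient at \<open>a\<close> by
  the total degree of \<open>a\<close>, so this is \<open>D F = (D F / F) * F\<close> for the
  product \<open>F\<close> of all factors. Logarithmic derivatives add up over factors, hence
  induction on the elements with the product rule. As the logarithmic derivative has no constant
  term, the right-hand side only involves coefficients of lower degree.\<close>

theorem solutions_rec:
  assumes "supp k a"
  shows "int (\<Sum>i<k. a i) * solutions k x r j a = conv (logder_sum k x r j) (solutions k x r j) a"
  using assms
proof (induction j arbitrary: a)
  case 0
  have "conv (\<lambda>b. 0) c a = 0" for c by (simp add: conv_def)
  then show ?case by (auto simp: logder_sum_def)
next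
  case (Suc j)
  show ?case
  proof (cases "x j = 0")
    case True
    then have "solutions k x r (Suc j) = solutions k x r j" "logder_sum k x r (Suc j) = logder_sum k x r j"
      by (auto simp: logder_sum_def)
    then show ?thesis using Suc by metis
  next
    case False
    let ?z = "x j" and ?c = "solutions k x r j" and ?G = "logder_sum k x r j" and ?g = "logder k (x j) (r j)"
    let ?s = "\<lambda>i. shift (x j) i ?c"
    have c': "solutions k x r (Suc j) = (\<lambda>a. ?c a + (\<Sum>i<k. r j i * ?s i a))"
      using False by auto
    have G': "logder_sum k x r (Suc j) = (\<lambda>b. ?G b + ?g b)"
      using False by (auto simp: logder_sum_def)
    have IH: "conv ?G (?s i) a = shift ?z i (\<lambda>a. int (\<Sum>i<k. a i) * ?c a) a" for i
      by (simp only: conv_shift_right[OF Suc.prems] shift_def Suc.IH[OF supp_upd[OF Suc.prems]])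
    have "conv ?g (\<lambda>a. ?c a + (\<Sum>i<k. r j i * ?s i a)) a =
        conv (\<lambda>b. ?g b + (\<Sum>i<k. r j i * shift ?z i ?g b)) ?c a"
      by (simp add: conv_add_right conv_add_left conv_sum_right conv_sum_left
          conv_shift_right[OF Suc.prems] conv_shift_left[OF Suc.prems])
    also have "\<dots> = conv (\<lambda>b. \<Sum>i<k. (int ?z * r j i) * of_bool (b = (\<lambda>_. 0)(i := ?z))) ?c a"
    proof (rule conv_cong[OF Suc.prems])
      fix b assume "supp k b"
      then have "?g b + (\<Sum>i<k. r j i * shift ?z i ?g b) = int ?z * (\<Sum>i<k. r j i * of_bool (b = (\<lambda>_. 0)(i := ?z)))"
        using False by (intro logder_eq) auto
      then show "?g b + (\<Sum>i<k. r j i * shift ?z i ?g b) = (\<Sum>i<k. (int ?z * r j i) * of_bool (b = (\<lambda>_. 0)(i := ?z)))"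
        by (simp only: sum_distrib_left mult.assoc)
    qed
    also have "\<dots> = (\<Sum>i<k. int ?z * r j i * ?s i a)"
      unfolding conv_sum_left conv_single[OF Suc.prems] ..
    finally have "conv (logder_sum k x r (Suc j)) (solutions k x r (Suc j)) a =
        int (\<Sum>i<k. a i) * ?c a + (\<Sum>i<k. r j i * (shift ?z i (\<lambda>a. int (\<Sum>i<k. a i) * ?c a) a + int ?z * ?s i a))"
      unfolding c' G' conv_add_left conv_add_right conv_sum_right IH Suc.IH[OF Suc.prems, symmetric]
      by (simp add: distrib_left sum.distrib mult_ac)
    also have "\<dots> = int (\<Sum>i<k. a i) * ?c a + (\<Sum>i<k. r j i * (int (\<Sum>i<k. a i) * ?s i a))"
    proof -
      \<comment> \<open>Lowering coordinate \<open>i\<close> by \<open>?z\<close> lowers the total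
        degree by \<open>?z\<close>; the derivative of the new factor contributes the missing
        multiple.\<close>
      have "shift ?z i (\<lambda>a. int (\<Sum>i<k. a i) * ?c a) a + int ?z * ?s i a = int (\<Sum>i<k. a i) * ?s i a" if "i < k" for i
      proof (cases "?z \<le> a i")
        case True
        have "(\<Sum>l<k. a l) = (\<Sum>l<k. (a(i := a i - ?z)) l) + ?z"
          using that True by (simp add: sum.remove[of "{..<k}" i])
        then have "int (\<Sum>l<k. a l) = int (\<Sum>l<k. (a(i := a i - ?z)) l) + int ?z"
          by (metis of_nat_add)
        then show ?thesis
          using True unfolding shift_def by (simp only: if_True distrib_right)
      qed (simp add: shift_def)
      then show ?thesis by simp
    qed
    finally show ?thesis
      unfolding c' by (simp add: distrib_left sum_distrib_left mult_ac)
  qed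
qed

section \<open>Encoding of vectors\<close>

definition enc :: "nat \<Rightarrow> nat \<Rightarrow> (nat \<Rightarrow> nat) \<Rightarrow> nat" where
  "enc B k a = (\<Sum>i<k. a i * B ^ i)"

definition dig :: "nat \<Rightarrow> nat \<Rightarrow> nat \<Rightarrow> nat \<Rightarrow> nat" where
  "dig B k m i = (if i < k then m div B ^ i mod B else 0)"

abbreviation small_digits :: "nat \<Rightarrow> nat \<Rightarrow> nat \<Rightarrow> nat \<Rightarrow> bool" where
  "small_digits t B k m \<equiv> (\<forall>i<k. dig B k m i \<le> t)"

lemma supp_dig [simp]: "supp k (dig B k m)"
  by (simp add: supp_def dig_def)

lemma dig_ge [simp]: "k \<le> i \<Longrightarrow> dig B k m i = 0"
  by (simp add: dig_def)

lemma enc_less: "(\<And>i. i < k \<Longrightarrow> a i < B) \<Longrightarrow> enc B k a < B ^ k"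
proof (induction k)
  case (Suc k)
  then have "enc B k a < B ^ k" "a k + 1 \<le> B" by (auto simp: less_Suc_eq intro: Suc_leI)
  then have "enc B k a + a k * B ^ k < (a k + 1) * B ^ k" "(a k + 1) * B ^ k \<le> B * B ^ k"
    by (simp, intro mult_le_mono1)
  then have "enc B k a + a k * B ^ k < B * B ^ k" by linarith
  then show ?case by (simp add: enc_def)
qed (simp add: enc_def)

lemma enc_digit: "(\<And>i. i < k \<Longrightarrow> a i < B) \<Longrightarrow> i < k \<Longrightarrow> enc B k a div B ^ i mod B = a i"
proof (induction k)
  case (Suc k)
  have S: "enc B (Suc k) a = enc B k a + B ^ k * a k" by (simp add: enc_def)
  have B: "B > 0" using Suc.prems by (metis gr0I not_less0)
  have lt: "enc B k a < B ^ k" using Suc.prems by (intro enc_less) auto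
  show ?case
  proof (cases "i = k")
    case True
    then show ?thesis using S lt B Suc.prems by simp
  next
    case False
    then have i: "i < k" using Suc.prems by simp
    then obtain d where d: "k = i + Suc d" by (metis add_Suc_right less_iff_Suc_add)
    have e: "B ^ k * a k = B ^ i * (B * (B ^ d * a k))" by (simp add: d power_add mult_ac)
    have "enc B (Suc k) a div B ^ i = enc B k a div B ^ i + B * (B ^ d * a k)"
      unfolding S e using B by simp
    then show ?thesis using Suc i by simp
  qed
qed simp

lemma dig_enc: "supp k a \<Longrightarrow> (\<And>i. i < k \<Longrightarrow> a i < B) \<Longrightarrow> dig B k (enc B k a) = a"
  by (auto simp: fun_eq_iff dig_def enc_digit supp_def)

lemma enc_dig_mod: "enc B k (dig B k m) = m mod B ^ k"
proof -
  have "(\<Sum>i<k. m div B ^ i mod B * B ^ i) = m mod B ^ k"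
    by (induction k) (simp_all add: mod_mult2_eq mult.commute[of B])
  then show ?thesis by (simp add: enc_def dig_def)
qed

lemma enc_dig: "m < B ^ k \<Longrightarrow> enc B k (dig B k m) = m"
  by (simp add: enc_dig_mod)

lemma dig_less: "B > 0 \<Longrightarrow> dig B k m i < B"
  by (simp add: dig_def)

lemma enc_add: "enc B k (\<lambda>i. a i + b i) = enc B k a + enc B k b"
  by (simp add: enc_def add_mult_distrib sum.distrib)

lemma enc_0 [simp]: "enc B k (\<lambda>_. 0) = 0"
  by (simp add: enc_def)

lemma dig_0 [simp]: "dig B k 0 = (\<lambda>_. 0)"
  by (auto simp: dig_def)

lemma enc_diff: "(\<And>i. b i \<le> a i) \<Longrightarrow> enc B k (\<lambda>i. a i - b i) = enc B k a - enc B k b"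
  using enc_add[of B k "\<lambda>i. a i - b i" b] by simp

lemma dig_add:
  assumes "B > 2 * t" "l + x < B ^ k" "small_digits t B k l" "small_digits t B k x"
  shows "dig B k (l + x) = (\<lambda>i. dig B k l i + dig B k x i)"
proof -
  have "enc B k (\<lambda>i. dig B k l i + dig B k x i) = l + x"
    using assms(2) by (simp add: enc_add enc_dig)
  moreover have "dig B k (enc B k (\<lambda>i. dig B k l i + dig B k x i)) = (\<lambda>i. dig B k l i + dig B k x i)"
  proof (rule dig_enc)
    fix i assume "i < k"
    then show "dig B k l i + dig B k x i < B"
      using assms(1) assms(3,4)[rule_format, of i] by linarith
  qed (auto simp: supp_def dig_def)
  ultimately show ?thesis by simp
qed

text \<open>The array after Kronecker substitution. Codes with a digit above \<open>t\<close> hold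
  0, which cuts off everything beyond the targets and keeps the sum of two occurring digits at most
  \<open>2 * t\<close>.\<close>

definition sol_arr :: "nat \<Rightarrow> nat \<Rightarrow> nat \<Rightarrow> ((nat \<Rightarrow> nat) \<Rightarrow> int) \<Rightarrow> nat \<Rightarrow> int" where
  "sol_arr t B k c m = (if m < B ^ k \<and> small_digits t B k m then c (dig B k m) else 0)"

text \<open>Indices with digits at most \<open>t\<close> add without carry in a base above
  \<open>2 * t\<close>, so the nonzero terms of the one-dimensional convolution correspond to the
  decompositions of the digit vector. The vanishing constant term of \<open>g\<close> removes
  \<open>l = m\<close>, and entry \<open>m\<close> depends on smaller entries only.\<close>

lemma conv_arr:
  assumes B: "B > 2 * t" and m: "m < B ^ k" "small_digits t B k m" and g0: "g (\<lambda>_. 0) = 0"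
  shows "conv g c (dig B k m) = (\<Sum>l<m. sol_arr t B k c l * sol_arr t B k g (m - l))"
proof -
  let ?a = "dig B k m"
  let ?S = "{l. l \<le> m \<and> small_digits t B k l \<and> small_digits t B k (m - l)}"
  have le: "b i < B" "b i \<le> t" if b: "\<forall>i. b i \<le> ?a i" and i: "i < k" for b i
  proof -
    show "b i \<le> t" using b[rule_format, of i] m(2)[rule_format, OF i] by (rule le_trans)
    then show "b i < B" using B by linarith
  qed
  have sp: "supp k b" if b: "\<forall>i. b i \<le> ?a i" for b
    unfolding supp_def
  proof (intro allI impI)
    fix i assume "k \<le> i"
    then show "b i = 0" using b[rule_format, of i] by simp
  qed
  have "conv g c ?a = (\<Sum>l\<in>?S. sol_arr t B k c l * sol_arr t B k g (m - l))"
    unfolding conv_def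
  proof (rule sum.reindex_bij_witness[of _ "\<lambda>l. dig B k (m - l)" "\<lambda>b. m - enc B k b"])
    fix b assume "b \<in> {b. \<forall>i. b i \<le> ?a i}"
    then have b: "\<forall>i. b i \<le> ?a i" by simp
    have "enc B k b \<le> enc B k ?a"
      unfolding enc_def using b by (intro sum_mono mult_le_mono1) auto
    then have em: "enc B k b \<le> m" using m by (simp add: enc_dig)
    have db: "dig B k (enc B k b) = b" using le[OF b] sp[OF b] by (intro dig_enc) auto
    have d: "\<forall>i. ?a i - b i \<le> ?a i" by simp
    have "enc B k (\<lambda>i. ?a i - b i) = m - enc B k b"
      using enc_diff[of b ?a B k] b m by (simp add: enc_dig)
    then have dd: "dig B k (m - enc B k b) = (\<lambda>i. ?a i - b i)"
      using dig_enc[of k "\<lambda>i. ?a i - b i" B] le[OF d] sp[OF d] by simp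
    show "dig B k (m - (m - enc B k b)) = b" using em db by simp
    show "m - enc B k b \<in> ?S"
      using em dd db le[OF b] le[OF d] by auto
    show "sol_arr t B k c (m - enc B k b) * sol_arr t B k g (m - (m - enc B k b)) = g b * c (\<lambda>i. ?a i - b i)"
      using em dd db le[OF b] le[OF d] m(1) by (simp add: sol_arr_def)
  next
    fix l assume "l \<in> ?S"
    then have l: "l \<le> m" "small_digits t B k l" "small_digits t B k (m - l)" by auto
    have "?a = (\<lambda>i. dig B k l i + dig B k (m - l) i)"
      using dig_add[OF B, of l "m - l"] l m(1) by simp
    then show "dig B k (m - l) \<in> {b. \<forall>i. b i \<le> ?a i}" by simp
    show "m - enc B k (dig B k (m - l)) = l"
      using l m(1) by (simp add: enc_dig)
  qed
  also have "\<dots> = (\<Sum>l\<le>m. sol_arr t B k c l * sol_arr t B k g (m - l))"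
    by (rule sum.mono_neutral_left) (auto simp: sol_arr_def)
  also have "\<dots> = (\<Sum>l<m. sol_arr t B k c l * sol_arr t B k g (m - l))"
    by (rule sum.mono_neutral_right) (auto simp: sol_arr_def g0)
  finally show ?thesis .
qed

lemma logder_sum_0: "logder_sum k x r j (\<lambda>_. 0) = 0"
  unfolding logder_sum_def by (rule sum.neutral) (simp add: logder_def)

lemma solutions_0: "solutions k x r j (\<lambda>_. 0) = 1"
  by (induction j) (auto simp: shift_def intro!: sum.neutral)

lemma sol_arr_rec:
  assumes "B > 2 * t" "m < B ^ k" "small_digits t B k m"
  shows "int (\<Sum>i<k. dig B k m i) * sol_arr t B k (solutions k x r j) m =
    (\<Sum>l<m. sol_arr t B k (solutions k x r j) l * sol_arr t B k (logder_sum k x r j) (m - l))"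
  using solutions_rec[of k "dig B k m" x r j] conv_arr[where g = "logder_sum k x r j" and c = "solutions k x r j", OF assms logder_sum_0] assms
  by (simp add: sol_arr_def)

text \<open>The support consists of \<open>z\<close> times the vectors with entries at most
  \<open>t div z\<close>. These are numbered by \<open>c\<close> in base \<open>q\<close>; the
  number 0 is left out as the constant term vanishes.\<close>

lemma sol_arr_logder:
  assumes z: "z > 0" "z \<le> t" and q: "q = t div z + 1" and B: "B > t"
  shows "(\<Sum>c = 1..<q ^ k. of_bool (enc B k (\<lambda>i. z * dig q k c i) = x) * (- int z * geom k r (dig q k c))) =
    sol_arr t B k (logder k z r) x"
proof -
  have qz: "z * d \<le> t" if "d < q" for d
  proof -
    have "z * d \<le> z * (t div z)" using that q by simp
    then show ?thesis by (meson le_trans times_div_less_eq_dividend)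
  qed
  have q0: "q > 0" using q by simp
  have dg: "dig B k (enc B k (\<lambda>i. z * dig q k c i)) = (\<lambda>i. z * dig q k c i)" for c
    using le_less_trans[OF qz[OF dig_less[OF q0]] B] by (intro dig_enc) (auto simp: supp_def)
  have lt: "enc B k (\<lambda>i. z * dig q k c i) < B ^ k" for c
    using le_less_trans[OF qz[OF dig_less[OF q0]] B] by (intro enc_less) auto
  show ?thesis
  proof (cases "x < B ^ k \<and> small_digits t B k x \<and> dig B k x \<noteq> (\<lambda>_. 0) \<and> (\<forall>i. z dvd dig B k x i)")
    case True
    define b where "b i = dig B k x i div z" for i
    have zb: "dig B k x = (\<lambda>i. z * b i)" using True by (auto simp: b_def)
    have bq: "b i < q" if "i < k" for i
      using True that unfolding b_def q by (simp add: div_le_mono le_imp_less_Suc)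
    have sb: "supp k b" by (simp add: supp_def b_def dig_def)
    have db: "dig q k (enc q k b) = b" using sb bq by (rule dig_enc)
    have b0: "b \<noteq> (\<lambda>_. 0)" using True zb by auto
    have "enc q k b \<noteq> 0" using db b0 by (metis dig_0)
    moreover have "enc q k b < q ^ k" using bq by (rule enc_less)
    moreover have "enc B k (\<lambda>i. z * dig q k c i) = x \<longleftrightarrow> c = enc q k b" if "c < q ^ k" for c
    proof
      assume "enc B k (\<lambda>i. z * dig q k c i) = x"
      then have "(\<lambda>i. z * dig q k c i) = (\<lambda>i. z * b i)" using dg[of c] zb by simp
      then have "dig q k c = b" using z by (auto simp: fun_eq_iff)
      then show "c = enc q k b" using enc_dig[OF that] by simp
    next
      assume "c = enc q k b"
      then show "enc B k (\<lambda>i. z * dig q k c i) = x" using db zb True by (metis enc_dig)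
    qed
    ultimately have "(\<Sum>c = 1..<q ^ k. of_bool (enc B k (\<lambda>i. z * dig q k c i) = x) * (- int z * geom k r (dig q k c))) =
        (\<Sum>c\<in>{enc q k b}. - int z * geom k r (dig q k c))"
      by (intro sum.mono_neutral_cong_right) auto
    also have "\<dots> = sol_arr t B k (logder k z r) x"
    proof -
      have "(\<lambda>i. dig B k x i div z) = b" by (simp add: b_def fun_eq_iff)
      then show ?thesis using True by (simp add: sol_arr_def logder_def db)
    qed
    finally show ?thesis .
  next
    case False
    have "enc B k (\<lambda>i. z * dig q k c i) \<noteq> x" if "c \<in> {1..<q ^ k}" for c
    proof
      assume e: "enc B k (\<lambda>i. z * dig q k c i) = x"
      have "dig q k c \<noteq> (\<lambda>_. 0)" using that enc_dig[of c q k] by auto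
      then have "(\<lambda>i. z * dig q k c i) \<noteq> (\<lambda>_. 0)" using z by (auto simp: fun_eq_iff)
      then show False using False e dg[of c] lt[of c] qz[OF dig_less[OF q0]] by auto
    qed
    moreover have "sol_arr t B k (logder k z r) x = 0"
      using False by (auto simp: sol_arr_def logder_def)
    ultimately show ?thesis by (simp add: sum.neutral)
  qed
qed

text \<open>Lowering digit \<open>i\<close> by one means subtracting \<open>q ^ i\<close> from the
  code, so the recurrence for the geometric series becomes a lookup at smaller codes.\<close>

lemma geom_code:
  assumes c: "0 < c" "c < q ^ k"
  shows "geom k r (dig q k c) =
    - (\<Sum>i<k. r i * (if 0 < c div q ^ i mod q then geom k r (dig q k (c - q ^ i)) else 0))"
proof -
  have "dig q k c \<noteq> (\<lambda>_. 0)" using c enc_dig[of c q k] by auto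
  then have "geom k r (dig q k c) = - (\<Sum>i<k. r i * shift 1 i (geom k r) (dig q k c))"
    by (intro geom_rec) auto
  moreover have "shift 1 i (geom k r) (dig q k c) =
      (if 0 < c div q ^ i mod q then geom k r (dig q k (c - q ^ i)) else 0)" if i: "i < k" for i
  proof (cases "0 < dig q k c i")
    case True
    let ?d = "(dig q k c)(i := dig q k c i - 1)"
    have q: "q > 0" using c by (cases "q = 0") (auto simp: power_0_left split: if_splits)
    have "enc q k (dig q k c) = enc q k (\<lambda>j. ?d j + of_bool (j = i))"
      using True by (intro arg_cong[of _ _ "enc q k"]) auto
    also have "\<dots> = enc q k ?d + q ^ i"
      unfolding enc_add using i by (simp add: enc_def)
    finally have "enc q k ?d = c - q ^ i" using c by (simp add: enc_dig)
    moreover have "dig q k (enc q k ?d) = ?d"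
      using dig_less[OF q, of k c] by (intro dig_enc) (auto intro: supp_upd less_imp_diff_less)
    ultimately show ?thesis
      using True i by (simp add: shift_def dig_def[of q k c i])
  qed (use i in \<open>simp add: shift_def dig_def\<close>)
  ultimately show ?thesis by simp
qed

section \<open>Existence of primes\<close>

text \<open>The sum is the integral of \<open>x ^ m * (1 - x) ^ n\<close> over the unit interval,
  expanded by the binomial theorem. Integration is avoided: the recurrence in the induction reflects
  \<open>(1 - x) ^ (n + 1) = (1 - x) ^ n - x * (1 - x) ^ n\<close>.\<close>

lemma beta_sum: "(\<Sum>j\<le>n. (-1) ^ j * real (n choose j) / real (m + j + 1)) * (real (m + n + 1) * real ((m + n) choose n)) = 1"
proof (induction n arbitrary: m)
  case 0
  then show ?case by simp
next
  case (Suc n)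
  define I where "I n m = (\<Sum>j\<le>n. (-1) ^ j * real (n choose j) / real (m + j + 1))" for n m
  have rec: "I (Suc n) m = I n m - I n (Suc m)"
  proof -
    have "I (Suc n) m = 1 / real (m + 1) + (\<Sum>j\<le>n. (-1) ^ Suc j * real (Suc n choose Suc j) / real (m + Suc j + 1))"
      unfolding I_def by (subst sum.atMost_Suc_shift) simp
    also have "(\<Sum>j\<le>n. (-1) ^ Suc j * real (Suc n choose Suc j) / real (m + Suc j + 1)) =
        (\<Sum>j\<le>n. (-1) ^ Suc j * real (n choose Suc j) / real (m + Suc j + 1)) - I n (Suc m)"
      unfolding I_def sum_subtractf[symmetric]
    proof (intro sum.cong refl)
      fix j
      have X: "Suc m + j + 1 = m + Suc j + 1" by simp
      show "(-1) ^ Suc j * real (Suc n choose Suc j) / real (m + Suc j + 1) =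
          (-1) ^ Suc j * real (n choose Suc j) / real (m + Suc j + 1) - (-1) ^ j * real (n choose j) / real (Suc m + j + 1)"
        unfolding X binomial_Suc_Suc of_nat_add[of "n choose j"]
        by (simp add: distrib_left add_divide_distrib diff_divide_distrib)
    qed
    also have "1 / real (m + 1) + ((\<Sum>j\<le>n. (-1) ^ Suc j * real (n choose Suc j) / real (m + Suc j + 1)) - I n (Suc m)) =
        (\<Sum>j\<le>Suc n. (-1) ^ j * real (n choose j) / real (m + j + 1)) - I n (Suc m)"
      by (subst sum.atMost_Suc_shift) simp
    also have "(\<Sum>j\<le>Suc n. (-1) ^ j * real (n choose j) / real (m + j + 1)) = I n m"
      by (simp add: I_def)
    finally show ?thesis .
  qed
  define c where "c = real (m + n + 1) * real ((m + n) choose n)"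
  have c0: "c > 0" unfolding c_def by simp
  have 1: "I n m = 1 / c"
    using Suc[of m] c0 by (simp add: I_def c_def field_simps)
  have e: "real (m + 1) * real ((Suc m + n) choose n) = real (m + n + 1) * real ((m + n) choose n)"
  proof -
    have "(m + 1) * ((Suc m + n) choose n) = (m + n + 1) * ((m + n) choose n)"
      using Suc_times_binomial_eq[of "m + n" m] binomial_symmetric[of n "Suc m + n"] binomial_symmetric[of n "m + n"]
      by (simp add: mult.commute)
    then show ?thesis by (metis of_nat_mult)
  qed
  have 2: "I n (Suc m) = real (m + 1) / (real (m + n + 2) * c)"
  proof -
    have "I n (Suc m) * (real (m + n + 2) * real ((Suc m + n) choose n)) = 1"
      using Suc[of "Suc m"] by (simp add: I_def)
    moreover have "I n (Suc m) * (real (m + n + 2) * c) =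
        real (m + 1) * (I n (Suc m) * (real (m + n + 2) * real ((Suc m + n) choose n)))"
      unfolding c_def e[symmetric] by (simp only: mult_ac)
    ultimately have "I n (Suc m) * (real (m + n + 2) * c) = real (m + 1)" by simp
    moreover have "real (m + n + 2) * c \<noteq> 0" using c0 by simp
    ultimately show ?thesis by (intro nonzero_eq_divide_eq[THEN iffD2])
  qed
  have 3: "real (m + Suc n + 1) * real ((m + Suc n) choose Suc n) = real (m + n + 2) * c / real (Suc n)"
  proof -
    have "Suc n * ((m + Suc n) choose Suc n) = (m + n + 1) * ((m + n) choose n)"
      using Suc_times_binomial_eq[of "m + n" n] by simp
    then have c: "real (Suc n) * real ((m + Suc n) choose Suc n) = c"
      unfolding c_def by (metis of_nat_mult)
    define b where "b = real ((m + Suc n) choose Suc n)"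
    have "m + Suc n + 1 = m + n + 2" by simp
    then show ?thesis unfolding c[symmetric] b_def[symmetric] by simp
  qed
  have "I (Suc n) m = real (Suc n) / (real (m + n + 2) * c)"
  proof -
    have "1 / c = real (m + n + 2) / (real (m + n + 2) * c)" by simp
    moreover have "real (m + n + 2) - real (m + 1) = real (Suc n)" by simp
    ultimately show ?thesis
      unfolding rec 1 2 by (simp only: diff_divide_distrib[symmetric])
  qed
  then show ?case
    unfolding I_def[symmetric] 3 using c0 by simp
qed

text \<open>Nair's argument: \<open>D\<close> clears all denominators of the beta sum with
  \<open>n = m\<close>. The result is a positive integer, hence \<open>D\<close> is at least the
  reciprocal \<open>(2 * m + 1) * ((2 * m) choose m)\<close> of that sum.\<close>

lemma lcm_lower_bound:
  assumes D: "\<And>i. 1 \<le> i \<Longrightarrow> i \<le> 2 * m + 1 \<Longrightarrow> i dvd D" "D > 0" and m: "m > 0"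
  shows "4 ^ m \<le> D"
proof -
  define S where "S = (\<Sum>j\<le>m. (-1) ^ j * int (m choose j) * int (D div (m + j + 1)))"
  define c where "c = real (2 * m + 1) * real ((2 * m) choose m)"
  have c0: "c > 0" by (simp add: c_def)
  have "real_of_int S = (\<Sum>j\<le>m. real D * ((-1) ^ j * real (m choose j) / real (m + j + 1)))"
    unfolding S_def of_int_sum by (intro sum.cong) (use D(1) in \<open>auto simp: real_of_nat_div\<close>)
  also have "\<dots> = real D / c"
  proof -
    have "(\<Sum>j\<le>m. (-1) ^ j * real (m choose j) / real (m + j + 1)) * c = 1"
      using beta_sum[where n = m and m = m] by (simp only: c_def mult_2)
    then have "(\<Sum>j\<le>m. (-1) ^ j * real (m choose j) / real (m + j + 1)) = 1 / c"
      using c0 by (intro nonzero_eq_divide_eq[THEN iffD2]) auto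
    then show ?thesis by (simp only: sum_distrib_left[symmetric]) simp
  qed
  finally have S: "real_of_int S = real D / c" .
  then have "real_of_int S > 0" using D(2) c0 by simp
  then have "S \<ge> 1" by simp
  then have "1 \<le> real D / c" using S by (metis of_int_1_le_iff)
  then have "real D \<ge> c" using c0 by (simp add: pos_le_divide_eq)
  moreover have "4 ^ m \<le> c"
  proof -
    have "4 ^ m \<le> 2 * real m * real ((2 * m) choose m)"
      using central_binomial_lower_bound[OF m] m by (simp add: field_simps)
    also have "\<dots> \<le> c" unfolding c_def by (intro mult_right_mono) auto
    finally show ?thesis .
  qed
  ultimately have "4 ^ m \<le> real D" by linarith
  then show ?thesis by simp
qed

text \<open>Without a prime in the range, the least common multiple of the numbers up to
  \<open>2 * m + 1\<close> would be a product of at most \<open>b\<close> prime powers, each at most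
  \<open>2 * m + 1\<close>, too small for the lower bound \<open>4 ^ m\<close>.\<close>

lemma prime_between:
  assumes m: "m > 0" and lt: "(2 * m + 1) ^ b < (4::nat) ^ m"
  shows "\<exists>p. prime p \<and> b < p \<and> p \<le> 2 * m + 1"
proof (rule ccontr)
  assume no: "\<not> ?thesis"
  define N where "N = 2 * m + 1"
  define P where "P = {p. prime p \<and> p \<le> N}"
  define f where "f p = (GREATEST e. p ^ e \<le> N)" for p
  have fin: "finite P" unfolding P_def by (rule finite_subset[of _ "{..N}"]) auto
  have p2: "2 \<le> p" if "p \<in> P" for p
    using that by (simp add: P_def prime_ge_2_nat)
  have fb: "e \<le> f p" if "p \<in> P" "p ^ e \<le> N" for p e
    unfolding f_def
  proof (rule Greatest_le_nat[where b = N])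
    fix y assume "p ^ y \<le> N"
    moreover have "2 ^ y \<le> p ^ y" using p2[OF that(1)] by (intro power_mono) auto
    ultimately show "y \<le> N" using less_exp[of y] by linarith
  qed (rule that)
  have fN: "p ^ f p \<le> N" if "p \<in> P" for p
    unfolding f_def
  proof (rule GreatestI_nat[where b = N and k = 0])
    fix y assume "p ^ y \<le> N"
    moreover have "2 ^ y \<le> p ^ y" using p2[OF that] by (intro power_mono) auto
    ultimately show "y \<le> N" using less_exp[of y] by linarith
  qed (simp add: N_def)
  let ?D = "\<Prod>p\<in>P. p ^ f p"
  have "4 ^ m \<le> ?D"
  proof (rule lcm_lower_bound[OF _ _ m])
    fix i assume i: "1 \<le> i" "i \<le> 2 * m + 1"
    show "i dvd ?D"
    proof (rule multiplicity_le_imp_dvd)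
      fix p :: nat assume p: "prime p"
      have "p ^ multiplicity p i \<le> N" using dvd_imp_le[OF multiplicity_dvd[of p i]] i by (simp add: N_def)
      show "multiplicity p i \<le> multiplicity p ?D"
      proof (cases "p \<in> P")
        case True
        then show ?thesis
          using fb[OF True \<open>p ^ multiplicity p i \<le> N\<close>] fin p by (subst multiplicity_prod_prime_powers) (auto simp: P_def)
      next
        case False
        then have "\<not> p dvd i" using i p by (auto simp: P_def N_def dest: dvd_imp_le)
        then show ?thesis by (simp add: not_dvd_imp_multiplicity_0)
      qed
    qed (use i in simp)
  qed (auto simp: P_def prime_gt_0_nat intro!: prod_pos)
  also have "?D \<le> (\<Prod>p\<in>P. N)" by (intro prod_mono) (use fN in auto)
  also have "\<dots> = N ^ card P" by simp
  also have "\<dots> \<le> N ^ b"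
  proof (rule power_increasing)
    have "p \<le> b" if "p \<in> P" for p
    proof (rule ccontr)
      assume "\<not> p \<le> b"
      then have "b < p" by simp
      with that no show False by (auto simp: P_def N_def)
    qed
    then have "P \<subseteq> {1..b}" using p2 by fastforce
    then show "card P \<le> b" using card_mono[of "{1..b}" P] by simp
  qed (simp add: N_def)
  finally show False using lt by (simp add: N_def)
qed

text \<open>With \<open>m = b * l\<close> the upper end \<open>2 * m + 1\<close> stays below
  \<open>4 ^ l\<close>, so its \<open>b\<close>-th power stays below \<open>4 ^ m\<close>. The prime
  exceeds \<open>b\<close> by a logarithmic factor only, which keeps the sieve affordable.\<close>

lemma prime_between_log:
  assumes "2 * b < 2 ^ l" "b > 0"
  shows "\<exists>p. prime p \<and> b < p \<and> p \<le> 2 * (b * l) + 1"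
proof (rule prime_between)
  have l: "l > 0" using assms by (intro gr0I) auto
  then show "b * l > 0" using assms by simp
  have ll: "2 * l \<le> 2 ^ l" using Suc_leI[OF less_exp[of "l - 1"]] l by (cases l) auto
  have "2 * (b * l) + 1 \<le> (2 * b + 1) * l" using l by simp
  also have "\<dots> \<le> 2 ^ l * l" using assms by (intro mult_le_mono1) simp
  finally have f: "2 * (b * l) + 1 \<le> 2 ^ l * l" .
  have "2 * (2 * (b * l) + 1) \<le> 2 * (2 ^ l * l)" using f by (rule mult_le_mono2)
  also have "\<dots> = 2 ^ l * (2 * l)" by simp
  also have "\<dots> \<le> 2 ^ l * 2 ^ l" using ll by (rule mult_le_mono2)
  finally have "2 * (2 * (b * l) + 1) \<le> 2 ^ l * 2 ^ l" .
  then have "2 * (b * l) + 1 < 2 ^ (2 * l)" by (simp add: mult_2 power_add)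
  then have "(2 * (b * l) + 1) ^ b < (2 ^ (2 * l)) ^ b" using assms by (intro power_strict_mono) auto
  also have "(2 ^ (2 * l)) ^ b = (2 ^ 2 :: nat) ^ (b * l)" by (simp only: power_mult[symmetric] mult_ac)
  also have "\<dots> = 4 ^ (b * l)" by simp
  finally show "(2 * (b * l) + 1) ^ b < 4 ^ (b * l)" .
qed

text \<open>A dyadic interval contributes at most \<open>t\<close>: it has \<open>2 ^ e\<close>
  members, each with quotient at most \<open>t div 2 ^ e\<close>.\<close>

lemma sum_div_le: "(\<Sum>z = 1..<2 ^ e. t div z) \<le> e * (t::nat)"
proof (induction e)
  case (Suc e)
  have "(\<Sum>z = 1..<2 ^ Suc e. t div z) = (\<Sum>z = 1..<2 ^ e. t div z) + (\<Sum>z = 2 ^ e..<2 ^ Suc e. t div z)"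
    by (rule sum.atLeastLessThan_concat[symmetric]) auto
  also have "(\<Sum>z = 2 ^ e..<2 ^ Suc e. t div z) \<le> (\<Sum>z = 2 ^ e..<(2::nat) ^ Suc e. t div 2 ^ e)"
    by (intro sum_mono div_le_mono2) auto
  also have "\<dots> \<le> t" by simp
  finally show ?case using Suc by simp
qed simp

section \<open>Random weights\<close>

primrec solvable :: "nat \<Rightarrow> (nat \<Rightarrow> nat) \<Rightarrow> nat \<Rightarrow> (nat \<Rightarrow> nat) \<Rightarrow> bool" where
  "solvable k x 0 a \<longleftrightarrow> a = (\<lambda>_. 0)"
| "solvable k x (Suc j) a \<longleftrightarrow> solvable k x j a \<or>
     (x j \<noteq> 0 \<and> (\<exists>i<k. x j \<le> a i \<and> solvable k x j (a(i := a i - x j))))"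

lemma solutions_unsolvable: "\<not> solvable k x j a \<Longrightarrow> solutions k x r j a = 0"
  by (induction j arbitrary: a) (auto simp: shift_def intro!: sum.neutral)

lemma solutions_cong:
  "(\<And>l i. l < j \<Longrightarrow> i < k \<Longrightarrow> r l i = r' l i) \<Longrightarrow> solutions k x r j a = solutions k x r' j a"
  by (induction j arbitrary: a) (auto simp: shift_def intro!: sum.cong)

lemma prob_pair_le:
  assumes "\<And>y. measure_pmf.prob M {x. Q x y} \<le> \<delta>" "\<delta> \<ge> 0"
  shows "measure_pmf.prob (pair_pmf M N) {(x, y). Q x y} \<le> \<delta>"
proof -
  have "pair_pmf M N = bind_pmf N (\<lambda>y. map_pmf (\<lambda>x. (x, y)) M)"
    unfolding pair_pmf_def by (subst bind_commute_pmf) (simp add: map_pmf_def)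
  then have "emeasure (pair_pmf M N) {(x, y). Q x y} = (\<integral>\<^sup>+y. emeasure (measure_pmf M) {x. Q x y} \<partial>N)"
    by (simp add: vimage_def)
  also have "\<dots> \<le> (\<integral>\<^sup>+y. ennreal \<delta> \<partial>N)"
    using assms by (intro nn_integral_mono) (simp add: measure_pmf.emeasure_eq_measure ennreal_leI)
  also have "\<dots> = ennreal \<delta>" by simp
  finally show ?thesis
    using assms(2) by (simp add: measure_pmf.emeasure_eq_measure)
qed

lemma prob_Pi_insert_le:
  assumes "finite I" "x \<notin> I" "\<delta> \<ge> 0"
    and "\<And>f. measure_pmf.prob U {y. Q (f(x := y))} \<le> \<delta>"
  shows "measure_pmf.prob (Pi_pmf (insert x I) d (\<lambda>_. U)) {f. Q f} \<le> \<delta>"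
proof -
  have "measure_pmf.prob (Pi_pmf (insert x I) d (\<lambda>_. U)) {f. Q f} =
      measure_pmf.prob (pair_pmf U (Pi_pmf I d (\<lambda>_. U))) {(y, f). Q (f(x := y))}"
    by (subst Pi_pmf_insert[OF assms(1,2)]) (simp add: vimage_def case_prod_unfold)
  also have "\<dots> \<le> \<delta>"
    by (rule prob_pair_le[OF assms(4,3)])
  finally show ?thesis .
qed

text \<open>A random word is not exactly uniform modulo \<open>p\<close>. A residue class contains
  at most \<open>2 ^ w div p + 1\<close> words, which is at most \<open>2 * 2 ^ w / p\<close>; hence
  the factor 2.\<close>

lemma prob_residue_le:
  fixes p w :: nat
  assumes p: "prime p" "p \<le> 2 ^ w" and c: "\<not> int p dvd c"
  shows "measure_pmf.prob (pmf_of_set {..<2 ^ w}) {y. int p dvd c * int (y mod p) + d} \<le> 2 / real p"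
proof -
  let ?S = "{y. y < 2 ^ w \<and> int p dvd c * int (y mod p) + d}"
  have p0: "p > 0" using p prime_gt_0_nat by blast
  have eq: "y mod p = y' mod p" if "y \<in> ?S" "y' \<in> ?S" for y y'
  proof -
    have "int p dvd (c * int (y mod p) + d) - (c * int (y' mod p) + d)"
      using that by (intro dvd_diff) simp_all
    moreover have "(c * int (y mod p) + d) - (c * int (y' mod p) + d) = c * (int (y mod p) - int (y' mod p))"
      by (simp only: right_diff_distrib add_diff_cancel_right)
    ultimately have "int p dvd c * (int (y mod p) - int (y' mod p))" by simp
    then have "int p dvd int (y mod p) - int (y' mod p)"
      using p(1) c by (simp add: prime_dvd_mult_iff)
    moreover have "\<bar>int (y mod p) - int (y' mod p)\<bar> < int p"
      using p0 mod_less_divisor[of p y] mod_less_divisor[of p y'] by linarith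
    ultimately have "int (y mod p) - int (y' mod p) = 0"
      using dvd_imp_le_int[of "int (y mod p) - int (y' mod p)" "int p"] by linarith
    then show ?thesis by simp
  qed
  \<comment> \<open>All elements of \<open>?S\<close> have the same remainder, so their quotients
    tell them apart.\<close>
  have "inj_on (\<lambda>y. y div p) ?S"
  proof (rule inj_onI)
    fix y y' assume h: "y \<in> ?S" "y' \<in> ?S" "y div p = y' div p"
    have "y = y div p * p + y mod p" by simp
    also have "\<dots> = y' div p * p + y' mod p" unfolding eq[OF h(1,2)] h(3) ..
    finally show "y = y'" by simp
  qed
  moreover have "(\<lambda>y. y div p) ` ?S \<subseteq> {..2 ^ w div p}" by (auto intro: div_le_mono)
  ultimately have "card ?S \<le> card {..2 ^ w div p}"
    by (rule card_inj_on_le) simp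
  then have "card ?S \<le> 2 ^ w div p + 1" by simp
  then have "real (card ?S) \<le> real (2 ^ w div p) + 1" by linarith
  also have "\<dots> \<le> 2 ^ w / real p + 1"
  proof -
    have "real (2 ^ w div p * p) \<le> real (2 ^ w)"
      by (simp only: of_nat_le_iff div_times_less_eq_dividend)
    then show ?thesis using p0 by (simp add: pos_le_divide_eq)
  qed
  also have "\<dots> \<le> 2 * 2 ^ w / real p"
  proof -
    have "real p \<le> 2 ^ w" using p(2) by (metis of_nat_le_iff of_nat_numeral of_nat_power)
    then show ?thesis using p0 by (simp add: field_simps)
  qed
  finally have "real (card ?S) / 2 ^ w \<le> 2 / real p"
    by (simp add: field_simps)
  moreover have "{..<2 ^ w} \<inter> {y. int p dvd c * int (y mod p) + d} = ?S" by auto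
  moreover have "0 \<in> {..<(2::nat) ^ w}" by simp
  then have "{..<(2::nat) ^ w} \<noteq> {}" by blast
  ultimately show ?thesis
    by (subst measure_pmf_of_set) auto
qed

text \<open>Schwartz--Zippel for the multilinear polynomial \<open>solutions\<close>; a solution uses at most
  \<open>\<Sum>i<k. a i\<close> elements since elements are positive.\<close>

lemma prob_solutions_zero:
  fixes pos :: "nat \<Rightarrow> nat \<Rightarrow> nat"
  assumes p: "prime p" "p \<le> 2 ^ w" and I: "finite I" "\<And>l i. l < n \<Longrightarrow> i < k \<Longrightarrow> pos l i \<in> I"
    and inj: "\<And>l i l' i'. l < n \<Longrightarrow> i < k \<Longrightarrow> l' < n \<Longrightarrow> i' < k \<Longrightarrow> pos l i = pos l' i' \<Longrightarrow> l = l' \<and> i = i'"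
    and "j \<le> n" "solvable k x j a"
  shows "measure_pmf.prob (Pi_pmf I 0 (\<lambda>_. pmf_of_set {..<2 ^ w}))
      {f. int p dvd solutions k x (\<lambda>l i. int (f (pos l i) mod p)) j a} \<le> real (\<Sum>i<k. a i) * (2 / real p)"
  using assms(6,7)
proof (induction j arbitrary: a)
  case 0
  then have "\<not> int p dvd solutions k x (\<lambda>l i. int (f (pos l i) mod p)) 0 a" for f
    using p(1) by auto
  then show ?case by (simp add: sum_nonneg)
next
  case (Suc j)
  let ?U = "pmf_of_set {..<2 ^ w} :: nat pmf" and ?\<mu> = "measure_pmf.prob (Pi_pmf I 0 (\<lambda>_. pmf_of_set {..<2 ^ w}))"
  let ?r = "\<lambda>f l i. int (f (pos l i) mod p)"
  show ?case
  \<comment> \<open>If element \<open>j\<close> can take a colour \<open>i\<close> in some solution,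
    the coefficient is linear in the weight at \<open>pos j i\<close>. Its slope \<open>?c\<close>
    belongs to the smaller target and is nonzero with the probability given by induction. Otherwise
    element \<open>j\<close> contributes nothing.\<close>
  proof (cases "x j \<noteq> 0 \<and> (\<exists>i<k. x j \<le> a i \<and> solvable k x j (a(i := a i - x j)))")
    case True
    then obtain i where i: "x j \<noteq> 0" "i < k" "x j \<le> a i" "solvable k x j (a(i := a i - x j))" by blast
    let ?a = "a(i := a i - x j)" and ?q = "pos j i"
    let ?c = "\<lambda>f. solutions k x (?r f) j ?a"
    let ?d = "\<lambda>f. solutions k x (?r f) j a + (\<Sum>i'\<in>{..<k} - {i}. ?r f j i' * shift (x j) i' (solutions k x (?r f) j) a)"
    have q: "?q \<in> I" "insert ?q (I - {?q}) = I" using I(2)[of j i] Suc.prems i by auto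
    have upd: "?r (f(?q := y)) l i' = ?r f l i'" if "l < n" "i' < k" "(l, i') \<noteq> (j, i)" for f y l i'
      using inj[of l i' j i] that Suc.prems(1) i by auto
    have cu: "solutions k x (?r (f(?q := y))) j b = solutions k x (?r f) j b" for f y b
      using Suc.prems(1) by (intro solutions_cong upd) auto
    have sh: "shift z i' (solutions k x (?r (f(?q := y))) j) b = shift z i' (solutions k x (?r f) j) b" for f y z i' b
      by (simp only: shift_def cu)
    have du: "?d (f(?q := y)) = ?d f" for f y
      using Suc.prems(1) by (intro arg_cong2[of _ _ _ _ "(+)"] cu sum.cong refl arg_cong2[of _ _ _ _ "(*)"] upd sh) auto
    have split: "solutions k x (?r f) (Suc j) a = ?c f * int (f ?q mod p) + ?d f" for f
      using i by (simp add: sum.remove[of "{..<k}" i] shift_def)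
    have sum: "(\<Sum>i<k. a i) = (\<Sum>i<k. ?a i) + x j"
      using i by (simp add: sum.remove[of "{..<k}" i])
    have p0: "real p > 0" using p prime_gt_0_nat by simp
    have "?\<mu> {f. int p dvd solutions k x (?r f) (Suc j) a} \<le>
        ?\<mu> ({f. int p dvd ?c f} \<union> {f. \<not> int p dvd ?c f \<and> int p dvd ?c f * int (f ?q mod p) + ?d f})"
      unfolding split by (intro measure_pmf.finite_measure_mono) auto
    also have "\<dots> \<le> ?\<mu> {f. int p dvd ?c f} + ?\<mu> {f. \<not> int p dvd ?c f \<and> int p dvd ?c f * int (f ?q mod p) + ?d f}"
      by (rule measure_Un_le) auto
    also have "?\<mu> {f. int p dvd ?c f} \<le> real (\<Sum>i<k. ?a i) * (2 / real p)"
      by (rule Suc.IH) (use Suc.prems in simp, rule i(4))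
    also have "?\<mu> {f. \<not> int p dvd ?c f \<and> int p dvd ?c f * int (f ?q mod p) + ?d f} \<le> 2 / real p"
    proof -
      have "measure_pmf.prob ?U {y. \<not> int p dvd ?c (f(?q := y)) \<and>
          int p dvd ?c (f(?q := y)) * int ((f(?q := y)) ?q mod p) + ?d (f(?q := y))} \<le> 2 / real p" for f
      proof (cases "int p dvd ?c f")
        case False
        then show ?thesis
          unfolding du unfolding cu using prob_residue_le[OF p False, of "?d f"] by simp
      next
        case True
        then show ?thesis unfolding du unfolding cu using p0 by simp
      qed
      then have "measure_pmf.prob (Pi_pmf (insert ?q (I - {?q})) 0 (\<lambda>_. ?U))
          {f. \<not> int p dvd ?c f \<and> int p dvd ?c f * int (f ?q mod p) + ?d f} \<le> 2 / real p"
        using I(1) p0 by (intro prob_Pi_insert_le) auto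
      then show ?thesis unfolding q(2) .
    qed
    also have "real (\<Sum>i<k. ?a i) * (2 / real p) + 2 / real p \<le> real (\<Sum>i<k. a i) * (2 / real p)"
    proof -
      \<comment> \<open>A coloured element is at least 1, so the total of the target drops by at
        least 1 and pays for one more summand \<open>2 / real p\<close>.\<close>
      have "real (\<Sum>i<k. ?a i) + 1 \<le> real (\<Sum>i<k. a i)" unfolding sum using i(1) by simp
      then have "(real (\<Sum>i<k. ?a i) + 1) * (2 / real p) \<le> real (\<Sum>i<k. a i) * (2 / real p)"
        by (rule mult_right_mono) simp
      then show ?thesis by (simp only: distrib_right mult_1_left)
    qed
    finally show ?thesis by simp
  next
    case False
    then have e: "solutions k x r (Suc j) a = solutions k x r j a" for r
      using solutions_unsolvable by (auto simp: shift_def intro!: sum.neutral)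
    show ?thesis
      unfolding e by (rule Suc.IH) (use Suc.prems False in auto)
  qed
qed

text \<open>Serves to separate the rounds, which read disjoint stretches of the tape.\<close>

lemma prob_Pi_indep:
  assumes "finite A" "finite B" "A \<inter> B = {}"
    and E: "\<And>f g. (\<And>i. i \<in> A \<Longrightarrow> f i = g i) \<Longrightarrow> E f = E g"
    and F: "\<And>f g. (\<And>i. i \<in> B \<Longrightarrow> f i = g i) \<Longrightarrow> F f = F g"
  shows "measure_pmf.prob (Pi_pmf (A \<union> B) d (\<lambda>_. U)) {f. E f \<and> F f} =
    measure_pmf.prob (Pi_pmf (A \<union> B) d (\<lambda>_. U)) {f. E f} * measure_pmf.prob (Pi_pmf (A \<union> B) d (\<lambda>_. U)) {f. F f}"
proof -
  let ?A = "Pi_pmf A d (\<lambda>_. U)" and ?B = "Pi_pmf B d (\<lambda>_. U)"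
  let ?h = "\<lambda>(f, g) x. if x \<in> A then f x else g x"
  have e: "E (\<lambda>x. if x \<in> A then f x else g x) = E f" for f g by (rule E) simp
  have f: "F (\<lambda>x. if x \<in> A then f x else g x) = F g" for f g
    by (rule F) (use assms(3) in auto)
  have *: "measure_pmf.prob (Pi_pmf (A \<union> B) d (\<lambda>_. U)) {f. Q f} =
      measure_pmf.prob (pair_pmf ?A ?B) {x. Q (?h x)}" for Q
    by (subst Pi_pmf_union[OF assms(1-3)]) (simp add: vimage_def)
  have pr: "measure_pmf.prob (pair_pmf ?A ?B) (X \<times> Y) = measure_pmf.prob ?A X * measure_pmf.prob ?B Y" for X Y
  proof -
    have "measure_pmf.prob (pair_pmf ?A ?B) (X \<times> Y) =
        measure_pmf.prob (pair_pmf ?A ?B) ((X \<inter> set_pmf ?A) \<times> (Y \<inter> set_pmf ?B))"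
      by (subst measure_Int_set_pmf[symmetric]) (simp add: Times_Int_Times)
    also have "\<dots> = measure_pmf.prob ?A (X \<inter> set_pmf ?A) * measure_pmf.prob ?B (Y \<inter> set_pmf ?B)"
      by (rule measure_pmf_prob_product) (auto intro: countable_subset[OF _ countable_set_pmf])
    finally show ?thesis by (simp add: measure_Int_set_pmf)
  qed
  have s: "{x. E (?h x) \<and> F (?h x)} = {f. E f} \<times> {f. F f}" "{x. E (?h x)} = {f. E f} \<times> UNIV"
    "{x. F (?h x)} = UNIV \<times> {f. F f}"
    by (auto simp: e f)
  show ?thesis unfolding * s pr by simp
qed

section \<open>One round of the algorithm\<close>

abbreviation (input) "rB \<equiv> 6 :: nat"
abbreviation (input) "rNM \<equiv> 7 :: nat"
abbreviation (input) "rRD \<equiv> 8 :: nat"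
abbreviation (input) "rI \<equiv> 20 :: nat"
abbreviation (input) "rJ \<equiv> 21 :: nat"
abbreviation (input) "rZ \<equiv> 22 :: nat"
abbreviation (input) "rQ \<equiv> 23 :: nat"
abbreviation (input) "rQN \<equiv> 24 :: nat"
abbreviation (input) "rC \<equiv> 25 :: nat"
abbreviation (input) "rRound \<equiv> 26 :: nat"
abbreviation (input) "rE \<equiv> 27 :: nat"
abbreviation (input) "rA \<equiv> 28 :: nat"
abbreviation (input) "aXS \<equiv> 0 :: nat"
abbreviation (input) "aTS \<equiv> 1 :: nat"
abbreviation (input) "aRND \<equiv> 2 :: nat"
abbreviation (input) "aINV \<equiv> 3 :: nat"
abbreviation (input) "aG \<equiv> 5 :: nat"
abbreviation (input) "aF \<equiv> 6 :: nat"
abbreviation (input) "aH \<equiv> 9 :: nat"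

primrec esum :: "nat \<Rightarrow> (nat \<Rightarrow> ex) \<Rightarrow> ex" where
  "esum 0 f = Nm 0"
| "esum (Suc k) f = esum k f +. f k"

primrec epow :: "ex \<Rightarrow> nat \<Rightarrow> ex" where
  "epow e 0 = Nm 1"
| "epow e (Suc i) = e *. epow e i"

lemma ev_esum [simp]: "ev (esum k f) v a = (\<Sum>i<k. ev (f i) v a)"
  by (induction k) auto

lemma ev_epow [simp]: "ev (epow e i) v a = ev e v a ^ i"
  by (induction i) auto

definition digE :: "nat \<Rightarrow> nat \<Rightarrow> nat \<Rightarrow> ex" where
  "digE c q i = (Vr c /. epow (Vr q) i) %. Vr q"

definition geomE :: "nat \<Rightarrow> ex" where
  "geomE k = ite (Vr rC)
     ((Vr rP -. esum k (\<lambda>i. ite (digE rC rQ i)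
        ((Ar aRND ((Vr rRound *. Vr rN +. Vr rE) *. Nm k +. Nm i) *. Ar aH (Vr rC -. epow (Vr rQ) i)) %. Vr rP)
        (Nm 0)) %. Vr rP) %. Vr rP)
     (Nm 1)"

definition idxE :: "nat \<Rightarrow> ex" where
  "idxE k = esum k (\<lambda>i. (Vr rZ *. digE rC rQ i) *. epow (Vr rB) i)"

text \<open>For one element \<open>z\<close>: \<open>aH\<close> receives the geometric series at all
  multiplicity vectors, numbered in base \<open>q\<close>, and \<open>- z\<close> times it is added
  to \<open>aG\<close> at the code of the multiplied vector. The shift of \<open>rJ\<close> by one
  skips the zero vector.\<close>

definition elem :: "nat \<Rightarrow> cmd" where
  "elem k = Sq (Asg rQ (Vr rT /. Vr rZ +. Nm 1)) (Sq (Asg rQN (epow (Vr rQ) k))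
     (Sq (For rC (Vr rQN) (Sto aH (Vr rC) (geomE k)))
     (For rJ (Vr rQN -. Nm 1) (Sq (Asg rC (Vr rJ +. Nm 1))
        (Sto aG (idxE k) ((Ar aG (idxE k) +. (Vr rP -. ((Vr rZ *. Ar aH (Vr rC)) %. Vr rP))) %. Vr rP))))))"

definition elems :: "nat \<Rightarrow> cmd" where
  "elems k = For rE (Vr rN) (Sq (Asg rZ (Ar aXS (Vr rE))) (If (Vr rZ) (elem k) Nop))"

definition find_lowbit :: cmd where
  "find_lowbit = Wh (((Vr rI /. Ar aPOW (Vr rV)) %. Nm 2) =. Nm 0) (Asg rV (Vr rV +. Nm 1))"

text \<open>Two factors of \<open>4 * rA\<close> cells each, padded with zeros: the
  \<open>rA\<close> entries of \<open>aF\<close> before \<open>rI\<close>, and the first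
  \<open>2 * rA\<close> entries of \<open>aG\<close>. Subtracting 1 from \<open>4 * rA\<close> turns
  the strict comparison into a weak one.\<close>

definition load_blocks :: cmd where
  "load_blocks = For rX (Nm 8 *. Vr rA) (Sto aU (Vr rX)
     (ite (Vr rX <. Vr rA) (Ar aF (Vr rI -. Vr rA +. Vr rX))
       (ite (((Nm 4 *. Vr rA -. Nm 1) <. Vr rX) *. (Vr rX <. Nm 6 *. Vr rA)) (Ar aG (Vr rX -. Nm 4 *. Vr rA)) (Nm 0))))"

text \<open>The product entries from \<open>rA\<close> to \<open>2 * rA - 1\<close> are the full
  contribution of the block to the next \<open>rA\<close> entries of \<open>aF\<close>. The factor
  \<open>rSc\<close> divides out the power of two left by the transform.\<close>

definition add_block :: cmd where
  "add_block = For rX (Vr rA) (Sto aF (Vr rI +. Vr rX)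
     ((Ar aF (Vr rI +. Vr rX) +. (Ar aU (Vr rA +. Vr rX) *. Vr rSc)) %. Vr rP))"

text \<open>Turns the completed sum into a coefficient by dividing by the total degree. Entries
  having a digit above \<open>t\<close> are reset to 0, which maintains the padding that prevents
  carries.\<close>

definition finishE :: "nat \<Rightarrow> ex" where
  "finishE k = ite (esum k (\<lambda>i. Vr rT <. digE rI rB i)) (Nm 0)
     ((Ar aINV (esum k (digE rI rB)) *. Ar aF (Vr rI)) %. Vr rP)"

definition conv_step :: "nat \<Rightarrow> cmd" where
  "conv_step k = Sq (Asg rI (Vr rJ +. Nm 1)) (Sq (Asg rV (Nm 0)) (Sq find_lowbit (Sq (Asg rA (Ar aPOW (Vr rV)))
     (Sq load_blocks (Sq mul (Sq add_block (Sto aF (Vr rI) (finishE k))))))))"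

text \<open>Twice \<open>B ^ k\<close> cells, because blocks near the end read and write up to twice
  their index. The initial 1 is the constant coefficient of the product.\<close>

definition clear :: cmd where
  "clear = Sq (For rI (Nm 2 *. Vr rNM) (Sto aG (Vr rI) (Nm 0))) (Sq (For rI (Nm 2 *. Vr rNM) (Sto aF (Vr rI) (Nm 0)))
     (Sto aF (Nm 0) (Nm 1)))"

definition round_cmd :: "nat \<Rightarrow> cmd" where
  "round_cmd k = Sq clear (Sq (elems k) (Sq (For rJ (Vr rNM -. Nm 1) (conv_step k))
     (If (Ar aF (esum k (\<lambda>i. Ar aTS (Nm i) *. epow (Vr rB) i))) (Asg 0 (Nm 1)) Nop)))"

lemma mv_elem [simp]: "mv (elem k) = {rQ, rQN, rC, rJ}" and ma_elem [simp]: "ma (elem k) = {aH, aG}"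
  by (auto simp: elem_def)

lemma mv_elems [simp]: "mv (elems k) = {rQ, rQN, rC, rJ, rE, rZ}" and ma_elems [simp]: "ma (elems k) = {aH, aG}"
  by (auto simp: elems_def)

lemma mv_find_lowbit [simp]: "mv find_lowbit = {rV}" and ma_find_lowbit [simp]: "ma find_lowbit = {}"
  by (auto simp: find_lowbit_def)

lemma mv_load_blocks [simp]: "mv load_blocks = {rX}" and ma_load_blocks [simp]: "ma load_blocks = {aU}"
  by (auto simp: load_blocks_def)

lemma mv_add_block [simp]: "mv add_block = {rX}" and ma_add_block [simp]: "ma add_block = {aF}"
  by (auto simp: add_block_def)

lemma mv_conv_step [simp]: "mv (conv_step k) = {rI, rV, rA, rX, rK, rL, rM, rLen, rH, rMu, rD, rSc}"
  and ma_conv_step [simp]: "ma (conv_step k) = {aF, aU, aW}"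
  by (auto simp: conv_step_def)

lemma mv_clear [simp]: "mv clear = {rI}" and ma_clear [simp]: "ma clear = {aG, aF}"
  by (auto simp: clear_def)

lemma mv_round_cmd [simp]: "mv (round_cmd k) = {0, rI, rJ, rV, rA, rX, rK, rL, rM, rLen, rH, rMu, rD, rSc, rQ, rQN, rC, rE, rZ}"
  and ma_round_cmd [simp]: "ma (round_cmd k) = {aF, aG, aH, aU, aW}"
  by (auto simp: round_cmd_def)

lemma lowbit_pow_le: "i > 0 \<Longrightarrow> d \<le> lowexp i \<Longrightarrow> 2 ^ d \<le> i"
  using lowbit_le[of i] power_increasing[of d "lowexp i" "2::nat"] by linarith

text \<open>What a round needs from the setup. The weights \<open>R\<close> are arbitrary residues:
  a round is verified as a deterministic computation, and probability enters only when they are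
  identified with tape cells.\<close>

locale solver = ram +
  fixes k n t p B :: nat and x ts R IV PW :: "nat \<Rightarrow> nat"
  assumes k: "k \<ge> 1" and p: "prime p" "p > 2" "k * t < p" "p \<le> X"
    and B: "B = 2 * t + 1"
    and x: "\<And>j. j < n \<Longrightarrow> x j \<le> t"
    and R: "\<And>j. R j < p"
    and IV: "\<And>j. 1 \<le> j \<Longrightarrow> j \<le> k * t \<Longrightarrow> (IV j * j) mod p = 1"
    and PW: "\<And>i. 2 ^ i < 8 * B ^ k \<Longrightarrow> PW i = 2 ^ i"
    and X: "8 * B ^ k < X" "n < X"
    and XM: "\<And>v. 2 ^ v \<le> B ^ k \<Longrightarrow> 2 * (2 ^ nbits v * rowlen v) < X"
    and ts: "\<And>i. i < k \<Longrightarrow> ts i \<le> t"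
begin

definition glob :: "vars \<Rightarrow> arrs \<Rightarrow> bool" where
  "glob v a \<longleftrightarrow> v rN = n \<and> v rT = t \<and> v rP = p \<and> v rI2 = (p + 1) div 2 \<and> v rB = B \<and> v rNM = B ^ k \<and>
     a aXS = x \<and> a aTS = ts \<and> a aRND = R \<and> a aINV = IV \<and> a aPOW = PW"

lemma glob_frame:
  assumes "glob v a" "\<And>z. z \<in> {2..7} \<Longrightarrow> v' z = v z" "\<And>r. r \<in> {0..4} \<Longrightarrow> a' r = a r"
  shows "glob v' a'"
  using assms by (simp add: glob_def)

definition wt :: "nat \<Rightarrow> nat \<Rightarrow> nat \<Rightarrow> int" where
  "wt rd j i = int (R ((rd * n + j) * k + i))"

lemma p0: "p > 0" "p \<ge> 2" using p by auto

lemma X1: "1 < X" "0 < X" "1 < p" using X2 p by auto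

lemma BX: "B < X" "t < X"
proof -
  have "B \<le> B ^ k" using k by (intro self_le_power) (auto simp: B)
  then show "B < X" using X(1) by linarith
  then show "t < X" by (simp add: B)
qed

lemma res_X: "res p y < X"
  using res_less[OF p0(1), of y] p(4) by linarith

lemma res_1: "res p 1 = 1"
  using p(2) by (simp add: res_def nat_mod_distrib)

lemma res_of_nat: "res p (int m) = m mod p"
  by (simp add: res_def nat_mod_as_int)

lemma res_sum_mod: "(\<Sum>i\<in>S. res p (f i)) mod p = res p (\<Sum>i\<in>S. f i)"
  by (rule res_eqI[OF p0(1)]) (simp add: int_res[OF p0(1)] mod_sum_eq)

lemma res_mult_add: "(res p y + res p z * res p u) mod p = res p (y + z * u)"
proof -
  have "(res p y + res p z * res p u) mod p = (res p y + (res p z * res p u) mod p) mod p"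
    by (simp add: mod_add_right_eq)
  then show ?thesis by (simp only: res_mult[OF p0(1)] res_add[OF p0(1)])
qed

lemma runs_geom:
  assumes g: "glob v a" and z: "v rQ = q" "v rQN = q ^ k" "v rRound = rd" "v rE = e" "q ^ k < X"
  shows "runs (For rC (Vr rQN) (Sto aH (Vr rC) (geomE k))) v a (5 * q ^ k + 3)
    (\<lambda>v' a'. \<forall>c<q ^ k. a' aH c = res p (geom k (wt rd e) (dig q k c)))"
proof -
  let ?G = "\<lambda>c. res p (geom k (wt rd e) (dig q k c))"
  let ?I = "\<lambda>j (v'::vars) (a'::arrs). \<forall>c<j. a' aH c = ?G c"
  have "runs (For rC (Vr rQN) (Sto aH (Vr rC) (geomE k))) v a ((\<Sum>j<q ^ k. 1 + 4) + 3) (?I (q ^ k))"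
  proof (rule runs_For[where Inv = ?I])
    fix c v' a' assume c: "c < q ^ k" and I: "?I c v' a'" and vc: "v' rC = c"
      and f: "\<And>x. x \<notin> mv (Sto aH (Vr rC) (geomE k)) \<Longrightarrow> x \<noteq> rC \<Longrightarrow> v' x = v x"
        "\<And>r. r \<notin> ma (Sto aH (Vr rC) (geomE k)) \<Longrightarrow> a' r = a r"
    have v': "v' rQ = q" "v' rRound = rd" "v' rE = e" "v' rN = n" "v' rP = p" "a' aRND = R"
      using f z g by (auto simp: glob_def)
    have e: "ev (geomE k) v' a' = ?G c"
    proof (cases "c = 0")
      case True
      then show ?thesis using vc by (simp add: geomE_def geom_0 res_1)
    next
      case False
      let ?t = "\<lambda>i. wt rd e i * (if 0 < c div q ^ i mod q then geom k (wt rd e) (dig q k (c - q ^ i)) else 0)"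
      have t: "ev (ite (digE rC rQ i) ((Ar aRND ((Vr rRound *. Vr rN +. Vr rE) *. Nm k +. Nm i) *.
          Ar aH (Vr rC -. epow (Vr rQ) i)) %. Vr rP) (Nm 0)) v' a' = res p (?t i)" for i
      proof (cases "0 < c div q ^ i mod q")
        case True
        have "q \<noteq> 0" using c k by (intro notI) (auto simp: power_0_left split: if_splits)
        then have "q ^ i \<noteq> 0" by simp
        then have "c - q ^ i < c" using False by simp
        then have "a' aH (c - q ^ i) = ?G (c - q ^ i)" using I by blast
        moreover have "R ((rd * n + e) * k + i) = res p (wt rd e i)"
          unfolding wt_def res_of_nat using R by simp
        ultimately show ?thesis
          using True v' vc by (simp add: digE_def res_mult p0)
      qed (use v' vc in \<open>simp add: digE_def\<close>)
      have "ev (geomE k) v' a' = (p - (\<Sum>i<k. res p (?t i)) mod p) mod p"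
        unfolding geomE_def using False vc v' by (simp del: ev_ite add: ev_ite[of "Vr rC"] t)
      also have "\<dots> = ?G c"
        unfolding res_sum_mod res_minus[OF p0(1)] using geom_code[of c q k "wt rd e"] False c by simp
      finally show ?thesis .
    qed
    show "runs (Sto aH (Vr rC) (geomE k)) v' a' 1 (\<lambda>v'' a''. ?I (Suc c) (v''(rC := Suc c)) a'')"
      by (rule runs_Sto) (use e I vc res_X in \<open>auto simp: less_Suc_eq\<close>)
  qed (use z in auto)
  then show ?thesis by (rule runs_time) simp
qed

lemma runs_elem:
  assumes g: "glob v a" and z: "v rZ = z" "0 < z" "z \<le> t" "v rRound = rd" "v rE = e"
    and G: "\<And>y. y < 2 * B ^ k \<Longrightarrow> a aG y = res p (G y)"
  shows "runs (elem k) v a (12 * (t div z + 1) ^ k + 11)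
    (\<lambda>v' a'. \<forall>y<2 * B ^ k. a' aG y = res p (G y + sol_arr t B k (logder k z (wt rd e)) y))"
proof -
  define q where "q = t div z + 1"
  have qk: "q ^ k < X" "q < X" "q ^ k \<ge> 1"
  proof -
    have "t div z \<le> t" by simp
    then have "q \<le> B" unfolding q_def B by linarith
    then show "q < X" using BX by simp
    from \<open>q \<le> B\<close> have "q ^ k \<le> B ^ k" by (rule power_mono) simp
    then show "q ^ k < X" using X(1) by linarith
    show "q ^ k \<ge> 1" by (simp add: q_def)
  qed
  let ?c = "\<lambda>c. - int z * geom k (wt rd e) (dig q k c)" and ?ix = "\<lambda>c. enc B k (\<lambda>i. z * dig q k c i)"
  let ?S = "\<lambda>j y. \<Sum>c = 1..<j. of_bool (?ix c = y) * ?c c"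
  let ?body = "Sq (Asg rC (Vr rJ +. Nm 1)) (Sto aG (idxE k) ((Ar aG (idxE k) +. (Vr rP -. ((Vr rZ *. Ar aH (Vr rC)) %. Vr rP))) %. Vr rP))"
  have main: "runs (For rJ (Vr rQN -. Nm 1) ?body) v1 a1 (7 * q ^ k + 3)
      (\<lambda>v' a'. \<forall>y<2 * B ^ k. a' aG y = res p (G y + sol_arr t B k (logder k z (wt rd e)) y))"
    if h: "glob v1 a1" "v1 rZ = z" "v1 rQ = q" "v1 rQN = q ^ k" "\<And>y. y < 2 * B ^ k \<Longrightarrow> a1 aG y = res p (G y)"
      "\<forall>c<q ^ k. a1 aH c = res p (geom k (wt rd e) (dig q k c))" for v1 a1
  proof -
    let ?I = "\<lambda>j (v'::vars) (a'::arrs). \<forall>y<2 * B ^ k. a' aG y = res p (G y + ?S (Suc j) y)"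
    have "runs (For rJ (Vr rQN -. Nm 1) ?body) v1 a1 ((\<Sum>j<q ^ k - 1. (1 + 1 + 1) + 4) + 3)
      (\<lambda>v' a'. \<forall>y<2 * B ^ k. a' aG y = res p (G y + sol_arr t B k (logder k z (wt rd e)) y))"
    proof (rule runs_For[where Inv = ?I])
      fix j v' a' assume j: "j < q ^ k - 1" and I: "?I j v' a'" and vj: "v' rJ = j"
        and f: "\<And>x. x \<notin> mv ?body \<Longrightarrow> x \<noteq> rJ \<Longrightarrow> v' x = v1 x" "\<And>r. r \<notin> ma ?body \<Longrightarrow> a' r = a1 r"
      define v2 where "v2 = v'(rC := Suc j)"
      have v2: "v2 rQ = q" "v2 rZ = z" "v2 rP = p" "v2 rB = B" "v2 rC = Suc j" "a' aH (Suc j) = res p (geom k (wt rd e) (dig q k (Suc j)))"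
        using f h j by (auto simp: glob_def v2_def)
      have ix: "ev (idxE k) v2 a' = ?ix (Suc j)"
        using v2 by (simp add: idxE_def digE_def enc_def dig_def)
      have val: "ev ((Ar aG (idxE k) +. (Vr rP -. ((Vr rZ *. Ar aH (Vr rC)) %. Vr rP))) %. Vr rP) v2 a' =
          res p (G (?ix (Suc j)) + ?S (Suc (Suc j)) (?ix (Suc j)))" if lt: "?ix (Suc j) < 2 * B ^ k"
      proof -
        have zz: "z mod p = res p (int z)" by (simp add: res_of_nat)
        have "(z * res p (geom k (wt rd e) (dig q k (Suc j)))) mod p = res p (int z * geom k (wt rd e) (dig q k (Suc j)))"
          by (metis zz mod_mult_left_eq res_mult[OF p0(1)])
        moreover have "ev ((Ar aG (idxE k) +. (Vr rP -. ((Vr rZ *. Ar aH (Vr rC)) %. Vr rP))) %. Vr rP) v2 a' =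
            (a' aG (ev (idxE k) v2 a') + (v2 rP - (v2 rZ * a' aH (v2 rC)) mod v2 rP)) mod v2 rP" by simp
        ultimately have "ev ((Ar aG (idxE k) +. (Vr rP -. ((Vr rZ *. Ar aH (Vr rC)) %. Vr rP))) %. Vr rP) v2 a' =
            (res p (G (?ix (Suc j)) + ?S (Suc j) (?ix (Suc j))) + (p - res p (int z * geom k (wt rd e) (dig q k (Suc j))))) mod p"
          unfolding ix v2 I[rule_format, OF lt] by simp
        also have "\<dots> = res p (G (?ix (Suc j)) + ?S (Suc j) (?ix (Suc j)) - int z * geom k (wt rd e) (dig q k (Suc j)))"
          by (rule res_diff[OF p0(1)])
        also have "G (?ix (Suc j)) + ?S (Suc j) (?ix (Suc j)) - int z * geom k (wt rd e) (dig q k (Suc j)) =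
            G (?ix (Suc j)) + ?S (Suc (Suc j)) (?ix (Suc j))"
          by (subst (2) sum.atLeastLessThan_Suc) simp_all
        finally show ?thesis .
      qed
      have lt: "?ix (Suc j) < B ^ k"
      proof (rule enc_less)
        fix i
        have "dig q k (Suc j) i \<le> t div z" using dig_less[of q k "Suc j" i] by (simp add: q_def)
        then have "z * dig q k (Suc j) i \<le> t" by (meson le_trans mult_le_mono2 times_div_less_eq_dividend)
        then show "z * dig q k (Suc j) i < B" by (simp add: B)
      qed
      have valX: "ev ((Ar aG (idxE k) +. (Vr rP -. ((Vr rZ *. Ar aH (Vr rC)) %. Vr rP))) %. Vr rP) v2 a' < X"
        using val lt res_X by simp
      have "Suc j < X" using j qk by linarith
      moreover have "?I (Suc j) (v2(rJ := Suc j)) (a'(aG := (a' aG)(?ix (Suc j) := res p (G (?ix (Suc j)) + ?S (Suc (Suc j)) (?ix (Suc j))))))"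
        using I by (auto simp: sum.atLeastLessThan_Suc)
      then have "runs (Sto aG (idxE k) ((Ar aG (idxE k) +. (Vr rP -. ((Vr rZ *. Ar aH (Vr rC)) %. Vr rP))) %. Vr rP)) v2 a' 1
         (\<lambda>v'' a''. ?I (Suc j) (v''(rJ := Suc j)) a'')"
        using valX val lt ix by (intro runs_Sto) simp_all
      ultimately show "runs ?body v' a' (1 + 1 + 1) (\<lambda>v'' a''. ?I (Suc j) (v''(rJ := Suc j)) a'')"
        using vj by (intro runs_Sq runs_Asg) (simp_all add: v2_def)
    next
      fix v' a' assume "?I (q ^ k - 1) v' a'"
      moreover have "?S (Suc (q ^ k - 1)) y = sol_arr t B k (logder k z (wt rd e)) y" for y
      proof -
        have "Suc (q ^ k - 1) = q ^ k" using qk(3) by simp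
        moreover have "t < B" using B by simp
        ultimately show ?thesis
          using sol_arr_logder[OF z(2,3) q_def, of B k y "wt rd e"] by simp
      qed
      ultimately show "\<forall>y<2 * B ^ k. a' aG y = res p (G y + sol_arr t B k (logder k z (wt rd e)) y)" by simp
    qed (use h qk in \<open>auto simp: glob_def\<close>)
    then show ?thesis by (rule runs_time) simp
  qed
  define v1 where "v1 = v(rQ := q, rQN := q ^ k)"
  have v1: "glob v1 a" "v1 rQ = q" "v1 rQN = q ^ k" "v1 rRound = rd" "v1 rE = e" "v1 rZ = z"
    using z by (auto simp: v1_def intro: glob_frame[OF g])
  have "v rT = t" using g by (simp add: glob_def)
  have q': "Suc (t div z) = q" by (simp add: q_def)
  have "runs (Sq (For rC (Vr rQN) (Sto aH (Vr rC) (geomE k))) (For rJ (Vr rQN -. Nm 1) ?body)) v1 a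
      (12 * q ^ k + 6 + 1) (\<lambda>v' a'. \<forall>y<2 * B ^ k. a' aG y = res p (G y + sol_arr t B k (logder k z (wt rd e)) y))"
  proof (rule runs_seq, rule runs_geom[OF v1(1-5) qk(1)])
    fix v2 a2 assume h: "\<forall>c<q ^ k. a2 aH c = res p (geom k (wt rd e) (dig q k c))"
      and f: "\<And>x. x \<notin> mv (For rC (Vr rQN) (Sto aH (Vr rC) (geomE k))) \<Longrightarrow> v2 x = v1 x"
        "\<And>r. r \<notin> ma (For rC (Vr rQN) (Sto aH (Vr rC) (geomE k))) \<Longrightarrow> a2 r = a r"
    show "runs (For rJ (Vr rQN -. Nm 1) ?body) v2 a2 (7 * q ^ k + 3)
      (\<lambda>v' a'. \<forall>y<2 * B ^ k. a' aG y = res p (G y + sol_arr t B k (logder k z (wt rd e)) y))"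
    proof (rule main)
      show "glob v2 a2" by (rule glob_frame[OF v1(1)]) (use f in auto)
    qed (use f v1 h G in auto)
  qed simp
  then have "runs (elem k) v a (12 * q ^ k + 6 + 1 + 2 + 2)
      (\<lambda>v' a'. \<forall>y<2 * B ^ k. a' aG y = res p (G y + sol_arr t B k (logder k z (wt rd e)) y))"
    unfolding elem_def
  proof (intro runs_asg_seq)
    have e: "ev (Vr rT /. Vr rZ +. Nm 1) v a = q" using z \<open>v rT = t\<close> by (simp add: q_def)
    have e2: "ev (epow (Vr rQ) k) (v(rQ := q)) a = q ^ k" by simp
    show "ev (Vr rT /. Vr rZ +. Nm 1) v a < X" unfolding e by (rule qk)
    show "ev (epow (Vr rQ) k) (v(rQ := ev (Vr rT /. Vr rZ +. Nm 1) v a)) a < X" unfolding e e2 by (rule qk)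
    assume H: "runs (Sq (For rC (Vr rQN) (Sto aH (Vr rC) (geomE k))) (For rJ (Vr rQN -. Nm 1) ?body)) v1 a
      (12 * q ^ k + 6 + 1) (\<lambda>v' a'. \<forall>y<2 * B ^ k. a' aG y = res p (G y + sol_arr t B k (logder k z (wt rd e)) y))"
    show "runs (Sq (For rC (Vr rQN) (Sto aH (Vr rC) (geomE k))) (For rJ (Vr rQN -. Nm 1) ?body))
       (v(rQ := ev (Vr rT /. Vr rZ +. Nm 1) v a, rQN := ev (epow (Vr rQ) k) (v(rQ := ev (Vr rT /. Vr rZ +. Nm 1) v a)) a)) a
       (12 * q ^ k + 6 + 1) (\<lambda>v' a'. \<forall>y<2 * B ^ k. a' aG y = res p (G y + sol_arr t B k (logder k z (wt rd e)) y))"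
      using H unfolding e e2 v1_def .
  qed simp_all
  then show ?thesis by (rule runs_time) (simp add: q_def)
qed

definition elem_cost :: nat where
  "elem_cost = (\<Sum>e<n. if x e = 0 then 0 else (t div x e + 1) ^ k)"

lemma runs_elems:
  assumes g: "glob v a" and z: "v rRound = rd" and G: "\<And>y. y < 2 * B ^ k \<Longrightarrow> a aG y = 0"
  shows "runs (elems k) v a (12 * elem_cost + 20 * n + 3)
    (\<lambda>v' a'. \<forall>y<2 * B ^ k. a' aG y = res p (sol_arr t B k (logder_sum k x (wt rd) n) y))"
proof -
  let ?I = "\<lambda>j (v'::vars) (a'::arrs). \<forall>y<2 * B ^ k. a' aG y = res p (sol_arr t B k (logder_sum k x (wt rd) j) y)"
  let ?body = "Sq (Asg rZ (Ar aXS (Vr rE))) (If (Vr rZ) (elem k) Nop)"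
  let ?tb = "\<lambda>e. (if x e = 0 then 0 else 12 * (t div x e + 1) ^ k + 11) + 1 + 2"
  have "runs (elems k) v a ((\<Sum>e<n. ?tb e + 4) + 3) (?I n)"
    unfolding elems_def
  proof (rule runs_For[where Inv = ?I])
    show "?I 0 (v(rE := 0)) a" using G by (auto simp: logder_sum_def sol_arr_def)
  next
    fix e v' a' assume e: "e < n" and I: "?I e v' a'" and ve: "v' rE = e"
      and f: "\<And>x. x \<notin> mv ?body \<Longrightarrow> x \<noteq> rE \<Longrightarrow> v' x = v x" "\<And>r. r \<notin> ma ?body \<Longrightarrow> a' r = a r"
    define v2 where "v2 = v'(rZ := x e)"
    have g2: "glob v2 a'" by (rule glob_frame[OF g]) (use f in \<open>auto simp: v2_def\<close>)
    have v2: "v2 rZ = x e" "v2 rRound = rd" "v2 rE = e" using f z ve by (auto simp: v2_def)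
    have S: "sol_arr t B k (logder_sum k x (wt rd) (Suc e)) y = sol_arr t B k (logder_sum k x (wt rd) e) y +
        (if x e = 0 then 0 else sol_arr t B k (logder k (x e) (wt rd e)) y)" for y
      unfolding sol_arr_def logder_sum_def sum.lessThan_Suc by auto
    have "runs (If (Vr rZ) (elem k) Nop) v2 a' ((if x e = 0 then 0 else 12 * (t div x e + 1) ^ k + 11) + 1)
        (\<lambda>v'' a''. ?I (Suc e) (v''(rE := Suc e)) a'')"
    proof (rule runs_If)
      assume "ev (Vr rZ) v2 a' \<noteq> 0"
      then have nz: "x e \<noteq> 0" using v2 by simp
      have "runs (elem k) v2 a' (12 * (t div x e + 1) ^ k + 11)
        (\<lambda>v' a'. \<forall>y<2 * B ^ k. a' aG y = res p (sol_arr t B k (logder_sum k x (wt rd) e) y + sol_arr t B k (logder k (x e) (wt rd e)) y))"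
        by (rule runs_elem[OF g2 v2(1) _ _ v2(2,3)]) (use nz x[OF e] I in auto)
      then show "runs (elem k) v2 a' (if x e = 0 then 0 else 12 * (t div x e + 1) ^ k + 11) (\<lambda>v'' a''. ?I (Suc e) (v''(rE := Suc e)) a'')"
        by (rule runs_weaken) (use nz S in auto)
    next
      assume "ev (Vr rZ) v2 a' = 0"
      then have "x e = 0" using v2 by simp
      then show "runs Nop v2 a' (if x e = 0 then 0 else 12 * (t div x e + 1) ^ k + 11) (\<lambda>v'' a''. ?I (Suc e) (v''(rE := Suc e)) a'')"
        using I S by (intro runs_time[OF runs_Nop]) auto
    qed
    moreover have "a' aXS = x" "x e < X" using f g x[OF e] BX by (auto simp: glob_def)
    ultimately show "runs ?body v' a' (?tb e) (\<lambda>v'' a''. ?I (Suc e) (v''(rE := Suc e)) a'')"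
      using ve by (intro runs_asg_seq) (simp_all add: v2_def)
  qed (use g X in \<open>auto simp: glob_def\<close>)
  then show ?thesis
  proof (rule runs_time)
    have "(\<Sum>e<n. ?tb e + 4) \<le> (\<Sum>e<n. 12 * (if x e = 0 then 0 else (t div x e + 1) ^ k) + 20)"
      by (intro sum_mono) auto
    also have "\<dots> = 12 * elem_cost + 20 * n" by (simp add: elem_cost_def sum.distrib sum_distrib_left)
    finally show "(\<Sum>e<n. ?tb e + 4) + 3 \<le> 12 * elem_cost + 20 * n + 3" by simp
  qed
qed

lemma runs_find_lowbit:
  assumes g: "glob v a" and i: "v rI = i" "0 < i" "i < B ^ k" "v rV = 0"
  shows "runs find_lowbit v a (3 * lowexp i + 1) (\<lambda>v' a'. v' rV = lowexp i)"
proof -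
  let ?I = "\<lambda>j (v'::vars) (a'::arrs). v' rV = j"
  have pw: "PW d = 2 ^ d" if "d \<le> lowexp i" for d
    using lowbit_pow_le[OF i(2) that] i(3) by (intro PW) linarith
  have "runs find_lowbit v a ((\<Sum>j<lowexp i. 1 + 2) + 1) (\<lambda>v' a'. v' rV = lowexp i)"
    unfolding find_lowbit_def
  proof (rule runs_Wh[where Inv = ?I])
    fix j v' a' assume j: "j < lowexp i" and I: "?I j v' a'"
      and f: "\<And>x. x \<notin> mv (Asg rV (Vr rV +. Nm 1)) \<Longrightarrow> v' x = v x" "\<And>r. r \<notin> ma (Asg rV (Vr rV +. Nm 1)) \<Longrightarrow> a' r = a r"
    have 1: "v' rI = i" "a' aPOW = PW" using f g i by (auto simp: glob_def)
    have "Suc j < 2 ^ Suc j" by (rule less_exp)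
    also have "\<dots> \<le> i" using lowbit_pow_le[OF i(2), of "Suc j"] j by simp
    finally have "Suc j < X" using i(3) X(1) by linarith
    then have "runs (Asg rV (Vr rV +. Nm 1)) v' a' 1 (?I (Suc j))"
      using I by (intro runs_Asg) auto
    then show "ev (((Vr rI /. Ar aPOW (Vr rV)) %. Nm 2) =. Nm 0) v' a' \<noteq> 0 \<and> runs (Asg rV (Vr rV +. Nm 1)) v' a' 1 (?I (Suc j))"
      using 1 I j even_div_lowexp[OF j] pw by simp
  next
    fix v' a' assume I: "?I (lowexp i) v' a'"
      and f: "\<And>x. x \<notin> mv (Asg rV (Vr rV +. Nm 1)) \<Longrightarrow> v' x = v x" "\<And>r. r \<notin> ma (Asg rV (Vr rV +. Nm 1)) \<Longrightarrow> a' r = a r"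
    have "v' rI = i" "a' aPOW = PW" using f g i by (auto simp: glob_def)
    moreover have "i div lowbit i mod 2 = 1" using odd_div_lowbit[OF i(2)] by presburger
    ultimately show "ev (((Vr rI /. Ar aPOW (Vr rV)) %. Nm 2) =. Nm 0) v' a' = 0 \<and> v' rV = lowexp i"
      using I pw[of "lowexp i"] by simp
  qed (use i in simp)
  then show ?thesis by (rule runs_time) simp
qed

text \<open>\<open>partial i m\<close> is what has been added to entry \<open>m\<close> after the first \<open>i\<close> steps.\<close>

definition partial :: "(nat \<Rightarrow> int) \<Rightarrow> (nat \<Rightarrow> int) \<Rightarrow> nat \<Rightarrow> nat \<Rightarrow> int" where
  "partial F G i m = (\<Sum>i' | 0 < i' \<and> i' \<le> i \<and> i' \<le> m \<and> m < i' + lowbit i'. \<Sum>l = i' - lowbit i'..<i'. F l * G (m - l))"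

section \<open>The online convolution step\<close>

lemma partial_0: "partial F G 0 m = 0"
  by (simp add: partial_def)

lemma partial_step:
  assumes "0 < i"
  shows "partial F G i m = partial F G (i - 1) m +
    (if i \<le> m \<and> m < i + lowbit i then \<Sum>l = i - lowbit i..<i. F l * G (m - l) else 0)"
proof -
  let ?S = "\<lambda>i. {i'. 0 < i' \<and> i' \<le> i \<and> i' \<le> m \<and> m < i' + lowbit i'}"
  have fin: "finite (?S j)" for j by (rule finite_subset[of _ "{..j}"]) auto
  have "?S i = ?S (i - 1) \<union> (if i \<le> m \<and> m < i + lowbit i then {i} else {})"
  proof (rule set_eqI)
    fix j
    have "j \<le> i \<longleftrightarrow> j \<le> i - 1 \<or> j = i" using assms by auto
    then show "j \<in> ?S i \<longleftrightarrow> j \<in> ?S (i - 1) \<union> (if i \<le> m \<and> m < i + lowbit i then {i} else {})"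
      using assms by auto
  qed
  moreover have "?S (i - 1) \<inter> (if i \<le> m \<and> m < i + lowbit i then {i} else {}) = {}"
    using assms by auto
  ultimately show ?thesis
    unfolding partial_def using fin by (simp add: sum.union_disjoint)
qed

lemma partial_full: "partial F G m m = (\<Sum>l<m. F l * G (m - l))"
  unfolding partial_def using fenwick_sum[where m = m and g = "\<lambda>l. F l * G (m - l)"] by simp

lemma runs_load_blocks:
  assumes "v rI = i" "v rA = b" "b \<le> i" "8 * b < X"
  shows "runs load_blocks v a (40 * b + 3) (\<lambda>v' a'. \<forall>y<8 * b. a' aU y =
    (if y < b then a aF (i - b + y) else if 4 * b \<le> y \<and> y < 6 * b then a aG (y - 4 * b) else 0))"
proof (rule runs_bounded)
  assume aX: "\<And>r j. a r j < X"
  let ?f = "\<lambda>y. if y < b then a aF (i - b + y) else if 4 * b \<le> y \<and> y < 6 * b then a aG (y - 4 * b) else 0"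
  have "runs load_blocks v a (5 * (8 * b) + 3) (\<lambda>v' a'. \<forall>y<8 * b. a' aU y = ?f y)"
    unfolding load_blocks_def
  proof (rule runs_map[where d = 0 and f = ?f])
    fix j a' assume "j < 8 * b"
    have "4 * b - 1 < j \<longleftrightarrow> 4 * b \<le> j \<and> b > 0 \<or> b = 0 \<and> 0 < j" by auto
    then show "ev (ite (Vr rX <. Vr rA) (Ar aF (Vr rI -. Vr rA +. Vr rX))
       (ite (((Nm 4 *. Vr rA -. Nm 1) <. Vr rX) *. (Vr rX <. Nm 6 *. Vr rA)) (Ar aG (Vr rX -. Nm 4 *. Vr rA)) (Nm 0)))
       (v(rX := j)) (a(aU := a')) = ?f j \<and> ?f j < X"
      using assms \<open>j < 8 * b\<close> aX X1 by (auto simp: of_bool_def)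
  qed (use assms in auto)
  then show "runs load_blocks v a (40 * b + 3) (\<lambda>v' a'. \<forall>y<8 * b. a' aU y = ?f y)"
    by (rule runs_time) simp
qed

lemma runs_add_block:
  assumes "v rI = i" "v rA = b" "v rP = p" "v rSc = s" "b < X"
  shows "runs add_block v a (5 * b + 3) (\<lambda>v' a'. \<forall>m. a' aF m =
    (if i \<le> m \<and> m < i + b then (a aF m + a aU (b + (m - i)) * s) mod p else a aF m))"
  unfolding add_block_def
proof (rule runs_map[where d = i and f = "\<lambda>j. (a aF (i + j) + a aU (b + j) * s) mod p"])
  fix j a' assume "j < b" "\<And>x. x < i \<or> i + j \<le> x \<Longrightarrow> a' x = a aF x"
  moreover have "(a aF (i + j) + a aU (b + j) * s) mod p < X"
    using mod_less_divisor[OF p0(1)] p(4) by (rule less_le_trans)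
  ultimately show "ev ((Ar aF (Vr rI +. Vr rX) +. (Ar aU (Vr rA +. Vr rX) *. Vr rSc)) %. Vr rP) (v(rX := j)) (a(aF := a')) =
      (a aF (i + j) + a aU (b + j) * s) mod p \<and> (a aF (i + j) + a aU (b + j) * s) mod p < X"
    using assms by simp
qed (use assms in auto)

text \<open>\<open>(p + 1) div 2\<close> is the inverse of 2 modulo the odd number \<open>p\<close>,
  so its powers cancel the powers of two.\<close>

lemma res_half_pow: "res p (y + 2 ^ e * c * int ((p + 1) div 2) ^ e) = res p (y + c)"
proof -
  have "odd p" using p(1,2) prime_odd_nat by blast
  then have "2 * ((p + 1) div 2) = p + 1" by simp
  then have "2 * int ((p + 1) div 2) = int p + 1" by linarith
  then have "2 ^ e * int ((p + 1) div 2) ^ e = (int p + 1) ^ e"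
    by (simp add: power_mult_distrib[symmetric])
  then have eq: "2 ^ e * c * int ((p + 1) div 2) ^ e = (int p + 1) ^ e * c"
    by (metis mult.commute mult.left_commute)
  have "(int p + 1) ^ e mod int p = 1 mod int p"
    by (metis mod_add_self1 power_mod power_one)
  then have "((int p + 1) ^ e * c) mod int p = c mod int p"
    by (metis mod_mult_left_eq mult_1)
  then have "(y + (int p + 1) ^ e * c) mod int p = (y + c) mod int p"
    by (metis mod_add_right_eq)
  then show ?thesis unfolding res_def eq by (rule arg_cong[of _ _ nat])
qed

definition sols :: "nat \<Rightarrow> nat \<Rightarrow> int" where
  "sols rd = sol_arr t B k (solutions k x (wt rd) n)"

definition logs :: "nat \<Rightarrow> nat \<Rightarrow> int" where
  "logs rd = sol_arr t B k (logder_sum k x (wt rd) n)"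

text \<open>Entries up to \<open>i\<close> are final coefficients. Later ones are incomplete sums
  which have not been divided by their total degree.\<close>

definition conv_inv :: "nat \<Rightarrow> nat \<Rightarrow> arrs \<Rightarrow> bool" where
  "conv_inv rd i a \<longleftrightarrow> (\<forall>y<2 * B ^ k. a aG y = res p (logs rd y)) \<and> (\<forall>m\<le>i. a aF m = res p (sols rd m)) \<and>
     (\<forall>m. i < m \<longrightarrow> m < 2 * B ^ k \<longrightarrow> a aF m = res p (partial (sols rd) (logs rd) i m))"

definition step_cost :: "nat \<Rightarrow> nat" where
  "step_cost i = mul_cost (lowexp i) + 50 * lowbit i + 3 * lowexp i + 40"

text \<open>Once step \<open>i\<close> has added its block, the sum at entry \<open>i\<close> is
  complete, and by the recurrence it is the total degree times the coefficient. For a positive code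
  with small digits this degree lies between 1 and \<open>k * t\<close>, the range of the table of
  inverses.\<close>

lemma finish_value:
  assumes i: "0 < i" "i < B ^ k" and g: "glob v a" "v rI = i"
    and F: "a aF i = res p (partial (sols rd) (logs rd) i i)"
  shows "ev (finishE k) v a = res p (sols rd i)"
proof -
  have v: "v rT = t" "v rB = B" "v rP = p" "a aINV = IV" using g by (auto simp: glob_def)
  have d: "ev (digE rI rB j) v a = dig B k i j" if "j < k" for j
    using that v g(2) by (simp add: digE_def dig_def)
  have s: "ev (esum k (\<lambda>i. Vr rT <. digE rI rB i)) v a = (\<Sum>j<k. of_bool (t < dig B k i j))"
    using v d by (simp add: d)
  show ?thesis
  proof (cases "small_digits t B k i")
    case True
    let ?d = "\<Sum>j<k. dig B k i j"
    have "(\<Sum>j<k. of_bool (t < dig B k i j)) = (0::nat)"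
      using True by (intro sum.neutral) (auto simp: not_less[symmetric] dest: leD)
    then have e: "ev (finishE k) v a = (IV ?d * a aF i) mod p"
      unfolding finishE_def using s v g(2) d by (simp del: ev_esum add: ev_esum[of k "digE rI rB"])
    have "?d \<le> (\<Sum>j<k. t)" using True by (intro sum_mono) auto
    then have d2: "?d \<le> k * t" by simp
    have d1: "1 \<le> ?d"
    proof (rule ccontr)
      assume "\<not> 1 \<le> ?d"
      then have "?d = 0" by linarith
      then have "\<forall>j<k. dig B k i j = 0" by simp
      then have "enc B k (dig B k i) = 0" by (simp add: enc_def)
      then have "i = 0" using enc_dig[OF i(2)] by simp
      then show False using i by simp
    qed
    have B2: "B > 2 * t" using B by simp
    have "partial (sols rd) (logs rd) i i = int ?d * sols rd i"
      unfolding partial_full sols_def logs_def using sol_arr_rec[OF B2 i(2) True] by simp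
    then have "(IV ?d * a aF i) mod p = res p (int (IV ?d) * (int ?d * sols rd i))"
      unfolding F by (metis mod_mult_left_eq res_mult[OF p0(1)] res_of_nat)
    also have "\<dots> = res p (1 * sols rd i)"
    proof -
      have "int (IV ?d) * int ?d mod int p = 1 mod int p"
        using IV[OF d1 d2, THEN arg_cong[of _ _ int]] p(2) by (simp add: zmod_int)
      then have "int (IV ?d) * int ?d * sols rd i mod int p = 1 * sols rd i mod int p"
        by (metis mod_mult_left_eq)
      then show ?thesis unfolding res_def by (simp add: mult.assoc)
    qed
    finally show ?thesis using e by simp
  next
    case False
    then obtain j where j: "j < k" "t < dig B k i j" by auto
    then have "1 \<le> (\<Sum>j<k. of_bool (t < dig B k i j) :: nat)"
      using member_le_sum[of j "{..<k}" "\<lambda>j. of_bool (t < dig B k i j) :: nat"] by simp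
    then have "ev (esum k (\<lambda>i. Vr rT <. digE rI rB i)) v a \<noteq> 0" unfolding s by linarith
    then have "ev (finishE k) v a = 0"
      unfolding finishE_def by (simp del: ev_esum)
    moreover have "\<not> (i < B ^ k \<and> small_digits t B k i)" using False by blast
    then have "sols rd i = 0" unfolding sols_def sol_arr_def by (rule if_not_P)
    ultimately show ?thesis by simp
  qed
qed

text \<open>The block has \<open>lowbit i\<close> entries and the other factor twice as many, so
  degrees stay below \<open>3 * lowbit i\<close>, while the transform has length
  \<open>4 * lowbit i\<close>: nothing wraps around. The offset \<open>lowbit i\<close> converts
  positions counted from the start of the block into positions counted from
  \<open>i\<close>.\<close>

lemma block_product:
  assumes i: "0 < i" and s: "s < lowbit i"
    and A: "A = (\<lambda>y. if y < lowbit i then F (i - lowbit i + y) else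
      if 4 * lowbit i \<le> y \<and> y < 6 * lowbit i then G (y - 4 * lowbit i) else 0)"
  shows "row_mult (lowexp i) 1 A (lowbit i + s) =
    2 ^ scale (lowexp i) * (\<Sum>l = i - lowbit i..<i. F l * G (i + s - l))"
proof -
  let ?b = "lowbit i"
  have N: "rowlen (lowexp i) = 4 * ?b" by (simp add: rowlen_def)
  have bi: "?b \<le> i" using lowbit_le[OF i] .
  have "row_mult (lowexp i) 1 A (?b + s) = 2 ^ scale (lowexp i) * (\<Sum>j\<le>?b + s. A j * A (4 * ?b + (?b + s - j)))"
    using row_mult_conv[of "?b + s" "lowexp i" A] s unfolding N A by auto
  also have "(\<Sum>j\<le>?b + s. A j * A (4 * ?b + (?b + s - j))) = (\<Sum>j<?b. F (i - ?b + j) * G (?b + s - j))"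
    by (rule sum.mono_neutral_cong_right) (use s in \<open>auto simp: A\<close>)
  also have "\<dots> = (\<Sum>l = i - ?b..<i. F l * G (i + s - l))"
  proof (rule sum.reindex_bij_witness[of _ "\<lambda>l. l - (i - ?b)" "\<lambda>j. i - ?b + j"])
    fix j assume "j \<in> {..<?b}"
    then have "i + s - (i - ?b + j) = ?b + s - j" using bi by auto
    then show "F (i - ?b + j) * G (i + s - (i - ?b + j)) = F (i - ?b + j) * G (?b + s - j)" by simp
  qed (use bi in auto)
  finally show ?thesis .
qed

lemma runs_conv_step:
  assumes g: "glob v a" and i: "0 < i" "i < B ^ k" "v rJ = i - 1" and I: "conv_inv rd (i - 1) a"
  shows "runs (conv_step k) v a (step_cost i) (\<lambda>v' a'. conv_inv rd i a')"
proof -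
  let ?b = "lowbit i" and ?u = "lowexp i" and ?F = "sols rd" and ?G = "logs rd"
  define A where "A = (\<lambda>y. if y < ?b then ?F (i - ?b + y) else if 4 * ?b \<le> y \<and> y < 6 * ?b then ?G (y - 4 * ?b) else 0)"
  have bi: "?b \<le> i" using lowbit_le[OF i(1)] .
  have bX: "8 * ?b < X" "i < X" using bi i X by linarith+
  have N: "rowlen ?u = 4 * ?b" by (simp add: rowlen_def)
  have pw: "PW d = 2 ^ d" if "d \<le> ?u + 3" for d
  proof (rule PW)
    have "(2::nat) ^ d \<le> 2 ^ (?u + 3)" using that by (intro power_increasing) auto
    also have "\<dots> = 8 * ?b" by (simp add: power_add)
    finally show "2 ^ d < 8 * B ^ k" using bi i by linarith
  qed
  have Fa: "a aF m = res p (?F m)" if "m < i" for m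
    using I that i by (simp add: conv_inv_def)
  have Fp: "a aF m = res p (partial ?F ?G (i - 1) m)" if "i \<le> m" "m < 2 * B ^ k" for m
    using I that i by (simp add: conv_inv_def)
  have Ga: "a aG y = res p (?G y)" if "y < 2 * B ^ k" for y
    using I that by (simp add: conv_inv_def)
  \<comment> \<open>From here the commands of the step are verified backwards, starting with the
    last one.\<close>
  have c5: "runs (Sto aF (Vr rI) (finishE k)) v5 a5 1 (\<lambda>v' a'. conv_inv rd i a')"
    if h: "glob v5 a5" "v5 rI = i" "a5 aG = a aG"
      "\<And>m. a5 aF m = (if i \<le> m \<and> m < i + ?b then res p (partial ?F ?G i m) else a aF m)" for v5 a5
  proof (rule runs_Sto)
    have e: "ev (finishE k) v5 a5 = res p (?F i)"
      by (rule finish_value[OF i(1,2) h(1,2)]) (simp add: h(4))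
    then show "ev (finishE k) v5 a5 < X" using res_X by simp
    have P: "a aF m = res p (partial ?F ?G i m)" if "m \<ge> i + ?b" "m < 2 * B ^ k" for m
      using Fp[of m] partial_step[OF i(1), of ?F ?G m] that by simp
    show "conv_inv rd i (a5(aF mod 16 := (a5 (aF mod 16))(ev (Vr rI) v5 a5 := ev (finishE k) v5 a5)))"
      unfolding conv_inv_def using e h P Fa Ga by (auto simp: le_less not_less)
  qed
  have c4: "runs (Sq add_block (Sto aF (Vr rI) (finishE k))) v4 a4 (5 * ?b + 5) (\<lambda>v' a'. conv_inv rd i a')"
    if h: "glob v4 a4" "v4 rI = i" "v4 rA = ?b" "a4 aG = a aG" "a4 aF = a aF"
      "holds p (4 * ?b) (a4 aU) (row_mult ?u 1 A)" "v4 rSc = res p (int ((p + 1) div 2) ^ scale ?u)" for v4 a4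
  proof (rule runs_seq, rule runs_add_block[OF h(2,3) _ h(7)])
    show "v4 rP = p" using h(1) by (simp add: glob_def)
    show "?b < X" using bX by simp
    fix v5 a5 assume s5: "\<forall>m. a5 aF m = (if i \<le> m \<and> m < i + ?b then (a4 aF m + a4 aU (?b + (m - i)) *
          res p (int ((p + 1) div 2) ^ scale ?u)) mod p else a4 aF m)"
      and f5: "\<And>x. x \<notin> mv add_block \<Longrightarrow> v5 x = v4 x" "\<And>r. r \<notin> ma add_block \<Longrightarrow> a5 r = a4 r"
    show "runs (Sto aF (Vr rI) (finishE k)) v5 a5 1 (\<lambda>v' a'. conv_inv rd i a')"
    proof (rule c5)
      show "glob v5 a5" by (rule glob_frame[OF h(1)]) (use f5 in auto)
      show "v5 rI = i" "a5 aG = a aG" using f5 h by auto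
      fix m
      show "a5 aF m = (if i \<le> m \<and> m < i + ?b then res p (partial ?F ?G i m) else a aF m)"
      proof (cases "i \<le> m \<and> m < i + ?b")
        case True
        define s where "s = m - i"
        have s: "m = i + s" "s < ?b" using True by (auto simp: s_def)
        have "m < 2 * B ^ k" using True bi i by linarith
        then have F: "a aF m = res p (partial ?F ?G (i - 1) m)" using Fp True by blast
        have U: "a4 aU (?b + (m - i)) = res p (2 ^ scale ?u * (\<Sum>l = i - ?b..<i. ?F l * ?G (m - l)))"
          using holdsD[OF h(6), of "?b + s"] s block_product[OF i(1) s(2) A_def] by simp
        have "a5 aF m = (a aF m + a4 aU (?b + (m - i)) * res p (int ((p + 1) div 2) ^ scale ?u)) mod p"
          using s5 True h(5) by simp
        also have "\<dots> = res p (partial ?F ?G (i - 1) m + 2 ^ scale ?u * (\<Sum>l = i - ?b..<i. ?F l * ?G (m - l)) * int ((p + 1) div 2) ^ scale ?u)"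
          unfolding F U by (rule res_mult_add)
        also have "\<dots> = res p (partial ?F ?G i m)"
          unfolding res_half_pow partial_step[OF i(1), of ?F ?G m] using True by simp
        finally show ?thesis using True by simp
      qed (use s5 h(5) in auto)
    qed
  qed simp
  have c3: "runs (Sq mul (Sq add_block (Sto aF (Vr rI) (finishE k)))) v3 a3 (mul_cost ?u + 5 * ?b + 6) (\<lambda>v' a'. conv_inv rd i a')"
    if h: "glob v3 a3" "v3 rI = i" "v3 rA = ?b" "v3 rV = ?u" "a3 aG = a aG" "a3 aF = a aF"
      "\<forall>y<8 * ?b. a3 aU y = (if y < ?b then a aF (i - ?b + y) else if 4 * ?b \<le> y \<and> y < 6 * ?b then a aG (y - 4 * ?b) else 0)" for v3 a3
  proof (rule runs_seq, rule runs_mul[where V = ?u and p = p and ?i2.0 = "int ((p + 1) div 2)" and A = A])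
    show "v3 rP = p" using h(1) by (simp add: glob_def)
    show "v3 rI2 = res p (int ((p + 1) div 2))" using h(1) p(2) by (simp add: glob_def res_of_nat)
    show "a3 aPOW d = 2 ^ d" if "d \<le> ?u + 3" for d using h(1) pw[OF that] by (simp add: glob_def)
    show "holds p (2 * rowlen ?u) (a3 aU) A"
      unfolding holds_def N
    proof (intro allI impI)
      fix y assume y: "y < 2 * (4 * ?b)"
      show "a3 aU y = res p (A y)"
      proof (cases "4 * ?b \<le> y \<and> y < 6 * ?b")
        case True
        then have "y - 4 * ?b < 2 * B ^ k" using bi i by linarith
        then show ?thesis using True h(7) y Ga by (auto simp: A_def)
      next
        case False
        have "i - ?b + y < i" if "y < ?b" using that bi by linarith
        then show ?thesis using False h(7) y Fa by (auto simp: A_def)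
      qed
    qed
    show "2 * (2 ^ nbits ?u * rowlen ?u) < X" using bi i by (intro XM) linarith
    fix v4 a4 assume s4: "holds p (rowlen ?u) (a4 aU) (row_mult ?u 1 A) \<and> v4 rSc = res p (int ((p + 1) div 2) ^ scale ?u)"
      and f4: "\<And>x. x \<notin> mv mul \<Longrightarrow> v4 x = v3 x" "\<And>r. r \<notin> ma mul \<Longrightarrow> a4 r = a3 r"
    show "runs (Sq add_block (Sto aF (Vr rI) (finishE k))) v4 a4 (5 * ?b + 5) (\<lambda>v' a'. conv_inv rd i a')"
    proof (rule c4)
      show "glob v4 a4" by (rule glob_frame[OF h(1)]) (use f4 in auto)
    qed (use s4 f4 h N in auto)
  qed (use h p in auto)
  have c2: "runs (Sq load_blocks (Sq mul (Sq add_block (Sto aF (Vr rI) (finishE k))))) v2 a (mul_cost ?u + 45 * ?b + 10) (\<lambda>v' a'. conv_inv rd i a')"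
    if h: "glob v2 a" "v2 rI = i" "v2 rA = ?b" "v2 rV = ?u" for v2
  proof (rule runs_seq, rule runs_load_blocks[OF h(2,3) bi bX(1)])
    fix v3 a3 assume s3: "\<forall>y<8 * ?b. a3 aU y = (if y < ?b then a aF (i - ?b + y) else if 4 * ?b \<le> y \<and> y < 6 * ?b then a aG (y - 4 * ?b) else 0)"
      and f3: "\<And>x. x \<notin> mv load_blocks \<Longrightarrow> v3 x = v2 x" "\<And>r. r \<notin> ma load_blocks \<Longrightarrow> a3 r = a r"
    show "runs (Sq mul (Sq add_block (Sto aF (Vr rI) (finishE k)))) v3 a3 (mul_cost ?u + 5 * ?b + 6) (\<lambda>v' a'. conv_inv rd i a')"
    proof (rule c3)
      show "glob v3 a3" by (rule glob_frame[OF h(1)]) (use f3 in auto)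
    qed (use s3 f3 h in auto)
  qed simp
  define v0 where "v0 = v(rI := i, rV := 0)"
  have v0: "glob v0 a" "v0 rI = i" "v0 rV = 0" by (auto simp: v0_def intro: glob_frame[OF g])
  let ?rest = "Sq load_blocks (Sq mul (Sq add_block (Sto aF (Vr rI) (finishE k))))"
  have "runs (Sq find_lowbit (Sq (Asg rA (Ar aPOW (Vr rV))) ?rest)) v0 a (3 * ?u + mul_cost ?u + 45 * ?b + 14) (\<lambda>v' a'. conv_inv rd i a')"
  proof (rule runs_seq, rule runs_find_lowbit[OF v0(1,2) i(1,2) v0(3)])
    fix v1 a1 assume s1: "v1 rV = ?u" and f1: "\<And>x. x \<notin> mv find_lowbit \<Longrightarrow> v1 x = v0 x" "\<And>r. r \<notin> ma find_lowbit \<Longrightarrow> a1 r = a r"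
    have a1: "a1 = a" using f1 by auto
    have g2: "glob (v1(rA := ?b)) a" by (rule glob_frame[OF v0(1)]) (use f1 in auto)
    have "a aPOW ?u = ?b" using g pw[of ?u] by (simp add: glob_def)
    moreover have "runs ?rest (v1(rA := ?b)) a (mul_cost ?u + 45 * ?b + 10) (\<lambda>v' a'. conv_inv rd i a')"
      by (rule c2[OF g2]) (use f1 v0 s1 in auto)
    moreover have "?b < X" using bX by simp
    ultimately have "runs (Sq (Asg rA (Ar aPOW (Vr rV))) ?rest) v1 a1 (mul_cost ?u + 45 * ?b + 10 + 2) (\<lambda>v' a'. conv_inv rd i a')"
      using s1 a1 by (intro runs_asg_seq) simp_all
    then show "runs (Sq (Asg rA (Ar aPOW (Vr rV))) ?rest) v1 a1 (mul_cost ?u + 45 * ?b + 12) (\<lambda>v' a'. conv_inv rd i a')"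
      by (rule runs_time) simp
  qed simp
  then have "runs (conv_step k) v a (3 * ?u + mul_cost ?u + 45 * ?b + 14 + 2 + 2) (\<lambda>v' a'. conv_inv rd i a')"
    unfolding conv_step_def using i bX X1 by (intro runs_asg_seq) (simp_all add: v0_def)
  then show ?thesis by (rule runs_time) (simp add: step_cost_def)
qed

definition tvec :: "nat \<Rightarrow> nat" where
  "tvec i = (if i < k then ts i else 0)"

definition round_cost :: nat where
  "round_cost = (\<Sum>i = 1..<B ^ k. step_cost i) + 12 * elem_cost + 20 * n + 30 * B ^ k + 60"

lemma tvec_less: "tvec i < B"
proof -
  have "tvec i \<le> t" using ts[of i] by (simp add: tvec_def)
  then show ?thesis by (simp add: B)
qed

lemma sols_tvec: "sols rd (enc B k tvec) = solutions k x (wt rd) n tvec"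
proof -
  have lt: "tvec i < B" for i by (rule tvec_less)
  have "dig B k (enc B k tvec) = tvec" using lt by (intro dig_enc) (simp add: supp_def tvec_def)
  moreover have "enc B k tvec < B ^ k" using lt by (intro enc_less)
  ultimately show ?thesis using ts by (simp add: sols_def sol_arr_def tvec_def)
qed

text \<open>Register 0 is set by a nonzero coefficient and never cleared, so successive rounds form
  a disjunction.\<close>

lemma runs_round:
  assumes g: "glob v a" and rd: "v rRound = rd"
  shows "runs (round_cmd k) v a round_cost
    (\<lambda>v' a'. v' 0 = (if int p dvd solutions k x (wt rd) n tvec then v 0 else 1))" (is "runs _ _ _ _ ?Q")
proof -
  let ?tE = "esum k (\<lambda>i. Ar aTS (Nm i) *. epow (Vr rB) i)"
  let ?e = "enc B k tvec"
  have NX: "2 * B ^ k < X" using X by simp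
  have Bk: "B ^ k \<ge> 1" using B by simp
  have c4: "runs (If (Ar aF ?tE) (Asg 0 (Nm 1)) Nop) v4 a4 2 ?Q"
    if h: "glob v4 a4" "conv_inv rd (B ^ k - 1) a4" "v4 0 = v 0" for v4 a4
  proof -
    have lt: "tvec i < B" for i by (rule tvec_less)
    have "?e < B ^ k" using lt by (intro enc_less)
    then have F: "a4 aF ?e = res p (sols rd ?e)" using h(2) by (simp add: conv_inv_def)
    have e: "ev ?tE v4 a4 = ?e" using h(1) by (simp add: glob_def enc_def tvec_def)
    have z: "res p y = 0 \<longleftrightarrow> int p dvd y" for y
      using int_res[OF p0(1), of y] by (metis dvd_eq_mod_eq_0 of_nat_eq_0_iff)
    have "runs (If (Ar aF ?tE) (Asg 0 (Nm 1)) Nop) v4 a4 (1 + 1) ?Q"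
    proof (rule runs_If)
      assume "ev (Ar aF ?tE) v4 a4 \<noteq> 0"
      then have "\<not> int p dvd solutions k x (wt rd) n tvec" using F e z[of "sols rd ?e"] sols_tvec by (simp del: ev_esum)
      then show "runs (Asg 0 (Nm 1)) v4 a4 1 ?Q" using X1 by (intro runs_Asg) auto
    next
      assume "ev (Ar aF ?tE) v4 a4 = 0"
      then have "int p dvd solutions k x (wt rd) n tvec" using F e z[of "sols rd ?e"] sols_tvec by (simp del: ev_esum)
      then show "runs Nop v4 a4 1 ?Q" using h by (intro runs_time[OF runs_Nop]) auto
    qed
    then show ?thesis by (rule runs_time) simp
  qed
  have c3: "runs (Sq (For rJ (Vr rNM -. Nm 1) (conv_step k)) (If (Ar aF ?tE) (Asg 0 (Nm 1)) Nop)) v3 a3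
      ((\<Sum>j<B ^ k - 1. step_cost (Suc j) + 4) + 6) ?Q"
    if h: "glob v3 a3" "conv_inv rd 0 a3" "v3 0 = v 0" for v3 a3
  proof (rule runs_seq)
    show "runs (For rJ (Vr rNM -. Nm 1) (conv_step k)) v3 a3 ((\<Sum>j<B ^ k - 1. step_cost (Suc j) + 4) + 3)
      (\<lambda>v' a'. conv_inv rd (B ^ k - 1) a')"
    proof (rule runs_For[where Inv = "\<lambda>j v' a'. conv_inv rd j a'"])
      fix j v' a' assume j: "j < B ^ k - 1" and I: "conv_inv rd j a'" and vj: "v' rJ = j"
        and f: "\<And>x. x \<notin> mv (conv_step k) \<Longrightarrow> x \<noteq> rJ \<Longrightarrow> v' x = v3 x" "\<And>r. r \<notin> ma (conv_step k) \<Longrightarrow> a' r = a3 r"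
      have "glob v' a'" by (rule glob_frame[OF h(1)]) (use f in auto)
      then show "runs (conv_step k) v' a' (step_cost (Suc j)) (\<lambda>v'' a''. conv_inv rd (Suc j) a'')"
        using j I vj by (intro runs_conv_step) auto
    qed (use h X in \<open>auto simp: glob_def\<close>)
    fix v4 a4 assume "conv_inv rd (B ^ k - 1) a4" and f: "\<And>x. x \<notin> mv (For rJ (Vr rNM -. Nm 1) (conv_step k)) \<Longrightarrow> v4 x = v3 x"
      "\<And>r. r \<notin> ma (For rJ (Vr rNM -. Nm 1) (conv_step k)) \<Longrightarrow> a4 r = a3 r"
    moreover have "glob v4 a4" by (rule glob_frame[OF h(1)]) (use f in auto)
    ultimately show "runs (If (Ar aF ?tE) (Asg 0 (Nm 1)) Nop) v4 a4 2 ?Q" using h by (intro c4) auto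
  qed simp
  let ?rest = "Sq (For rJ (Vr rNM -. Nm 1) (conv_step k)) (If (Ar aF ?tE) (Asg 0 (Nm 1)) Nop)"
  let ?T3 = "(\<Sum>j<B ^ k - 1. step_cost (Suc j) + 4) + 6"
  have c2: "runs (Sq (elems k) ?rest) v2 a2 (12 * elem_cost + 20 * n + 4 + ?T3) ?Q"
    if h: "glob v2 a2" "v2 0 = v 0" "v2 rRound = rd" "\<And>y. y < 2 * B ^ k \<Longrightarrow> a2 aG y = 0"
      "\<And>y. y < 2 * B ^ k \<Longrightarrow> a2 aF y = (if y = 0 then 1 else 0)" for v2 a2
  proof (rule runs_seq, rule runs_elems[OF h(1,3,4)])
    fix v3 a3 assume s: "\<forall>y<2 * B ^ k. a3 aG y = res p (sol_arr t B k (logder_sum k x (wt rd) n) y)"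
      and f: "\<And>x. x \<notin> mv (elems k) \<Longrightarrow> v3 x = v2 x" "\<And>r. r \<notin> ma (elems k) \<Longrightarrow> a3 r = a2 r"
    have "0 < 2 * B ^ k" using Bk by linarith
    then have a0: "a3 aF 0 = 1" using f h(5)[of 0] by simp
    have F0: "a3 aF y = 0" if "0 < y" "y < 2 * B ^ k" for y using that f h(5)[of y] by simp
    have "B > 0" by (simp add: B)
    then have "sols rd 0 = 1" by (simp add: sols_def sol_arr_def solutions_0)
    then have "conv_inv rd 0 a3"
      using s a0 F0 res_1 by (auto simp: conv_inv_def logs_def partial_0)
    moreover have "glob v3 a3" by (rule glob_frame[OF h(1)]) (use f in auto)
    ultimately show "runs ?rest v3 a3 ?T3 ?Q" using f h by (intro c3) auto
  qed simp_all
  have "runs (round_cmd k) v a (20 * B ^ k + 10 + (12 * elem_cost + 20 * n + 4 + ?T3)) ?Q"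
    unfolding round_cmd_def
  proof (rule runs_seq)
    have v: "v rNM = B ^ k" using g by (simp add: glob_def)
    have "runs clear v a (5 * (2 * B ^ k) + 3 + 1 + (5 * (2 * B ^ k) + 3 + 1 + 1))
      (\<lambda>v' a'. \<forall>y<2 * B ^ k. a' aG y = 0 \<and> a' aF y = (if y = 0 then 1 else 0))"
      unfolding clear_def
    proof (rule runs_Sq, rule runs_map[where f = "\<lambda>_. 0" and d = 0 and n = "2 * B ^ k"])
      let ?v = "v(rI := 2 * B ^ k)" and ?a = "a(aG := (\<lambda>x. if 0 \<le> x \<and> x < 0 + 2 * B ^ k then 0 else a aG x))"
      show "runs (Sq (For rI (Nm 2 *. Vr rNM) (Sto aF (Vr rI) (Nm 0))) (Sto aF (Nm 0) (Nm 1))) ?v ?a (5 * (2 * B ^ k) + 3 + 1 + 1)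
        (\<lambda>v' a'. \<forall>y<2 * B ^ k. a' aG y = 0 \<and> a' aF y = (if y = 0 then 1 else 0))"
      proof (rule runs_Sq, rule runs_map[where f = "\<lambda>_. 0" and d = 0 and n = "2 * B ^ k"])
        let ?a' = "?a(aF := (\<lambda>x. if 0 \<le> x \<and> x < 0 + 2 * B ^ k then 0 else ?a aF x))"
        show "runs (Sto aF (Nm 0) (Nm 1)) (?v(rI := 2 * B ^ k)) ?a' 1
          (\<lambda>v' a'. \<forall>y<2 * B ^ k. a' aG y = 0 \<and> a' aF y = (if y = 0 then 1 else 0))"
          using X1 by (intro runs_Sto) auto
      qed (use v NX X1 in auto)
    qed (use v NX X1 in auto)
    then show "runs clear v a (20 * B ^ k + 9)
      (\<lambda>v' a'. \<forall>y<2 * B ^ k. a' aG y = 0 \<and> a' aF y = (if y = 0 then 1 else 0))"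
      by (rule runs_time) simp
    fix v2 a2 assume s: "\<forall>y<2 * B ^ k. a2 aG y = 0 \<and> a2 aF y = (if y = 0 then 1 else 0)"
      and f: "\<And>x. x \<notin> mv clear \<Longrightarrow> v2 x = v x" "\<And>r. r \<notin> ma clear \<Longrightarrow> a2 r = a r"
    have "glob v2 a2" by (rule glob_frame[OF g]) (use f in auto)
    then show "runs (Sq (elems k) ?rest) v2 a2 (12 * elem_cost + 20 * n + 4 + ?T3) ?Q"
      using f rd s by (intro c2) auto
  qed simp
  then show ?thesis
  proof (rule runs_time)
    have "(\<Sum>j<B ^ k - 1. step_cost (Suc j)) = (\<Sum>i = 1..<B ^ k. step_cost i)"
      using Bk by (intro sum.reindex_bij_witness[of _ "\<lambda>i. i - 1" Suc]) auto
    moreover have "(\<Sum>j<B ^ k - 1. step_cost (Suc j) + 4) = (\<Sum>j<B ^ k - 1. step_cost (Suc j)) + (B ^ k - 1) * 4"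
      unfolding sum.distrib by simp
    moreover have "(B ^ k - 1) * 4 \<le> 4 * B ^ k" by simp
    ultimately show "20 * B ^ k + 10 + (12 * elem_cost + 20 * n + 4 + ?T3) \<le> round_cost"
      unfolding round_cost_def by linarith
  qed
qed

end

section \<open>Preprocessing\<close>

abbreviation (input) "rLim \<equiv> 30 :: nat"
abbreviation (input) "aM \<equiv> 10 :: nat"

lemma less_nbits: "d < nbits v \<longleftrightarrow> 2 ^ d \<le> v"
  by (simp add: less_nbits_iff div_greater_zero_iff)
lemma less_pow_nbits: "v < 2 ^ nbits v"
  using less_nbits[of "nbits v" v] by (metis less_irrefl not_le)

lemma nbits_mono: "v \<le> v' \<Longrightarrow> nbits v \<le> nbits v'"
  using less_nbits[of "nbits v'" v] less_nbits[of "nbits v'" v'] by (metis le_trans not_le less_irrefl)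

lemma nbits_le_pow: "v < 2 ^ m \<Longrightarrow> nbits v \<le> m"
  using less_nbits[of m v] by (metis not_le)

text \<open>As subtraction is truncated, \<open>rT + (rZ - rT)\<close> is the maximum of
  both.\<close>

definition load_targets :: "nat \<Rightarrow> cmd" where
  "load_targets k = Sq (Asg rT (Nm 0)) (For rI (Nm k) (Sq (Inp rZ (Vr rI +. Nm 1))
     (Sq (Sto aTS (Vr rI) (Vr rZ)) (Asg rT (Vr rT +. (Vr rZ -. Vr rT))))))"

text \<open>An element above the largest target occurs in no solution. It is replaced by 0, which
  the counting ignores, so stored values remain small however large the elements are.\<close>

definition load_elements :: "nat \<Rightarrow> cmd" where
  "load_elements k = For rI (Vr rN) (Sq (Get rZ (Vr rI +. Nm (k + 1)) (Vr rT +. Nm 1)) (Sto aXS (Vr rI) (Vr rZ)))"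

text \<open>Allots \<open>c\<close> rounds to each binary digit of \<open>n + t + 1\<close>. Errors
  of at most 1/2 per round then multiply to at most the \<open>c\<close>-th power of
  \<open>1 / (n + t + 2)\<close>.\<close>

definition count_rounds :: "nat \<Rightarrow> cmd" where
  "count_rounds c = Sq (Asg rZ (Nm 1)) (Sq (Asg rRD (Nm 0)) (Wh (Vr rZ <. Vr rN +. Vr rT +. Nm 2)
     (Sq (Asg rZ (Nm 2 *. Vr rZ)) (Asg rRD (Vr rRD +. Nm c)))))"

definition powers :: cmd where
  "powers = Sq (Asg rZ (Nm 1)) (Sq (Asg rA (Nm 0)) (Wh (Vr rZ <. Nm 8 *. Vr rNM)
     (Sq (Sto aPOW (Vr rA) (Vr rZ)) (Sq (Asg rZ (Nm 2 *. Vr rZ)) (Asg rA (Vr rA +. Nm 1))))))"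

text \<open>The sieve runs over all \<open>d\<close>, prime or not; by the harmonic sum this is
  still linear time up to a logarithm.\<close>

definition mark_multiples :: cmd where
  "mark_multiples = For rC (Vr rQN +. Nm 1) (If (Nm 1 <. Vr rC)
     (For rJ (Vr rQN /. Vr rC -. Nm 1) (Sto aM (Vr rC *. (Vr rJ +. Nm 2)) (Nm 1))) Nop)"

definition pick_prime :: cmd where
  "pick_prime = For rC (Vr rQN +. Nm 1) (If ((Vr rQ <. Vr rC) *. (Ar aM (Vr rC) =. Nm 0)) (Asg rP (Vr rC)) Nop)"

definition inverses :: "nat \<Rightarrow> cmd" where
  "inverses k = For rC (Nm k *. Vr rT +. Nm 1) (Sto aINV (Vr rC)
     (ite (Nm 1 <. Vr rC) (((Vr rP -. Vr rP /. Vr rC) *. Ar aINV (Vr rP %. Vr rC)) %. Vr rP) (Vr rC)))"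

lemma mv_pre [simp]: "mv (load_targets k) = {rT, rI, rZ}" "mv (load_elements k) = {rI, rZ}"
    "mv (count_rounds c) = {rZ, rRD}" "mv powers = {rZ, rA}" "mv mark_multiples = {rC, rJ}"
    "mv pick_prime = {rC, rP}" "mv (inverses k) = {rC}"
  by (auto simp: load_targets_def load_elements_def count_rounds_def powers_def mark_multiples_def pick_prime_def inverses_def)

lemma ma_pre [simp]: "ma (load_targets k) = {aTS}" "ma (load_elements k) = {aXS}"
    "ma (count_rounds c) = {}" "ma powers = {aPOW}" "ma mark_multiples = {aM}"
    "ma pick_prime = {}" "ma (inverses k) = {aINV}"
  by (auto simp: load_targets_def load_elements_def count_rounds_def powers_def mark_multiples_def pick_prime_def inverses_def)

text \<open>Modulo \<open>p\<close>, the division \<open>p = (p div i) * i + p mod i\<close>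
  expresses the inverse of \<open>i\<close> by that of the smaller number \<open>p mod i\<close>.
  The table of inverses is thus filled with constant effort per entry.\<close>

lemma inverse_mod_step:
  fixes p i y :: nat
  assumes "i \<le> p" "i > 0" "(y * (p mod i)) mod p = 1"
  shows "((p - p div i) * y mod p * i) mod p = 1"
proof -
  let ?q = "p div i" and ?r = "p mod i"
  have "?q \<le> p" by simp
  then have "(p - ?q) * i + ?q * i = p * i" by (simp add: algebra_simps flip: add_mult_distrib)
  moreover have "?q * i + ?r = p" by simp
  ultimately have "(p - ?q) * i + p = p * i + ?r" by linarith
  then have "((p - ?q) * i + p) * y = (p * i + ?r) * y" by simp
  then have "(p - ?q) * y * i + p * y = y * ?r + p * (i * y)" by (simp add: algebra_simps)
  then have "((p - ?q) * y * i + p * y) mod p = (y * ?r + p * (i * y)) mod p" by simp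
  then have "((p - ?q) * y * i) mod p = (y * ?r) mod p" by simp
  then show ?thesis using assms(3) by (simp add: mod_mult_left_eq)
qed

lemma prime_if_no_factors:
  fixes m :: nat
  assumes "1 < m" "\<And>d q. 1 < d \<Longrightarrow> 1 < q \<Longrightarrow> m \<noteq> d * q"
  shows "prime m"
  unfolding prime_nat_iff
proof (intro conjI allI impI)
  fix d assume "d dvd m"
  then obtain q where q: "m = d * q" by (auto simp: dvd_def)
  moreover have "d \<noteq> 0" "q \<noteq> 0" using q assms(1) by (auto intro: ccontr)
  moreover have "\<not> (1 < d \<and> 1 < q)" using assms(2) q by blast
  ultimately show "d = 1 \<or> d = m" by (cases "d = 1") (auto simp: not_less le_Suc_eq)
qed (use assms in simp)

context ram
begin

lemma runs_inp_seq:
  assumes "x \<noteq> 1" "ev e v a < base" "inp (ev e v a) < X" "runs q (v(x := inp (ev e v a))) a T Q"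
  shows "runs (Sq (Inp x e) q) v a (T + 2) Q"
proof -
  have "runs (Sq (Inp x e) q) v a (1 + 1 + T) Q"
    by (rule runs_Sq, rule runs_Inp) (use assms in auto)
  then show ?thesis by (rule runs_time) simp
qed

lemma runs_sto_seq:
  assumes "ev e v a < X" "runs q v (a(r mod 16 := (a (r mod 16))(ev i v a := ev e v a))) T Q"
  shows "runs (Sq (Sto r i e) q) v a (T + 2) Q"
proof -
  have "runs (Sq (Sto r i e) q) v a (1 + 1 + T) Q"
    by (rule runs_Sq, rule runs_Sto) (use assms in auto)
  then show ?thesis by (rule runs_time) simp
qed

lemma runs_load_targets:
  assumes k: "k < X" "k < base" and t: "\<And>i. i < k \<Longrightarrow> inp (Suc i) \<le> t" "i0 < k" "inp (Suc i0) = t" "t < X"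
  shows "runs (load_targets k) v a (9 * k + 5) (\<lambda>v' a'. v' rT = t \<and> (\<forall>i<k. a' aTS i = inp (Suc i)))"
proof -
  let ?I = "\<lambda>j (v'::vars) (a'::arrs). (\<forall>i<j. a' aTS i = inp (Suc i) \<and> inp (Suc i) \<le> v' rT) \<and> v' rT \<le> t"
  let ?body = "Sq (Inp rZ (Vr rI +. Nm 1)) (Sq (Sto aTS (Vr rI) (Vr rZ)) (Asg rT (Vr rT +. (Vr rZ -. Vr rT))))"
  have "runs (For rI (Nm k) ?body) (v(rT := 0)) a ((\<Sum>j<k. (1 + 2 + 2) + 4) + 3)
    (\<lambda>v' a'. v' rT = t \<and> (\<forall>i<k. a' aTS i = inp (Suc i)))"
  proof (rule runs_For[where Inv = ?I])
    fix j v' a' assume j: "j < k" and I: "?I j v' a'" and vj: "v' rI = j"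
    have b: "Suc j < base" "inp (Suc j) \<le> t" "inp (Suc j) < X" using j k t(1)[OF j] t(4) by auto
    have m: "v' rT + (inp (Suc j) - v' rT) < X" using I b t(4) by (cases "inp (Suc j) \<le> v' rT") auto
    show "runs ?body v' a' (1 + 2 + 2) (\<lambda>v'' a''. ?I (Suc j) (v''(rI := Suc j)) a'')"
    proof (rule runs_inp_seq, simp_all only: ev.simps bop.simps vj Suc_eq_plus1[symmetric])
      show "runs (Sq (Sto aTS (Vr rI) (Vr rZ)) (Asg rT (Vr rT +. (Vr rZ -. Vr rT)))) (v'(rZ := inp (Suc j))) a' (1 + 2)
        (\<lambda>v'' a''. ?I (Suc j) (v''(rI := Suc j)) a'')"
      proof (rule runs_sto_seq, simp add: b, rule runs_Asg)
        show "ev (Vr rT +. (Vr rZ -. Vr rT)) (v'(rZ := inp (Suc j))) (a'(aTS mod 16 := (a' (aTS mod 16))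
          (ev (Vr rI) (v'(rZ := inp (Suc j))) a' := ev (Vr rZ) (v'(rZ := inp (Suc j))) a'))) < X"
          using m by simp
      qed (use I b vj in \<open>auto simp: less_Suc_eq intro: le_trans\<close>)
    qed (use b in auto)
  next
    fix v' a' assume I: "?I k v' a'"
    then have "t \<le> v' rT" using t(2,3) by auto
    then show "v' rT = t \<and> (\<forall>i<k. a' aTS i = inp (Suc i))" using I by auto
  qed (use k in auto)
  then have "runs (load_targets k) v a ((\<Sum>j<k. (1 + 2 + 2) + 4) + 3 + 2)
    (\<lambda>v' a'. v' rT = t \<and> (\<forall>i<k. a' aTS i = inp (Suc i)))"
    unfolding load_targets_def using X2 by (intro runs_asg_seq) simp_all
  then show ?thesis by (rule runs_time) simp
qed

lemma runs_load_elements: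
  assumes v: "v rN = n" "v rT = t" and n: "n < X" "t < X" "base = n + k + 1" "\<And>i. i < n \<Longrightarrow> inp (i + (k + 1)) < 2 ^ w"
  shows "runs (load_elements k) v a (7 * n + 3)
    (\<lambda>v' a'. \<forall>i<n. a' aXS i = (if inp (i + (k + 1)) \<le> t then inp (i + (k + 1)) else 0))"
proof -
  let ?x = "\<lambda>i. if inp (i + (k + 1)) \<le> t then inp (i + (k + 1)) else 0"
  let ?body = "Sq (Get rZ (Vr rI +. Nm (k + 1)) (Vr rT +. Nm 1)) (Sto aXS (Vr rI) (Vr rZ))"
  have "runs (load_elements k) v a ((\<Sum>j<n. (1 + 1 + 1) + 4) + 3) (\<lambda>v' a'. \<forall>i<n. a' aXS i = ?x i)"
    unfolding load_elements_def
  proof (rule runs_For[where Inv = "\<lambda>j v' a'. \<forall>i<j. a' aXS i = ?x i"])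
    fix j v' a' assume j: "j < n" and I: "\<forall>i<j. a' aXS i = ?x i" and vj: "v' rI = j"
      and f: "\<And>x. x \<notin> mv ?body \<Longrightarrow> x \<noteq> rI \<Longrightarrow> v' x = v x" "\<And>r. r \<notin> ma ?body \<Longrightarrow> a' r = a r"
    have vT: "v' rT = t" using f v by simp
    have x: "(if inp (j + (k + 1)) < t + 1 then inp (j + (k + 1)) else 0) = ?x j" by auto
    have "?x j < X" using n(2) by auto
    then have st: "runs (Sto aXS (Vr rI) (Vr rZ)) (v'(rZ := ?x j)) a' 1 (\<lambda>v'' a''. \<forall>i<Suc j. a'' aXS i = ?x i)"
      using I vj by (intro runs_Sto) (auto simp: less_Suc_eq)
    have e: "ev (Vr rI +. Nm (k + 1)) v' a' = j + (k + 1)" "ev (Vr rT +. Nm 1) v' a' = t + 1"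
      using vj vT by simp_all
    show "runs ?body v' a' (1 + 1 + 1) (\<lambda>v'' a''. \<forall>i<Suc j. a'' aXS i = ?x i)"
      by (rule runs_Sq, rule runs_Get, unfold e x) (use st j n in auto)
  qed (use v n in auto)
  then show ?thesis by (rule runs_time) simp
qed

lemma runs_count_rounds:
  assumes v: "v rN = n" "v rT = t" and b: "2 * (n + t + 2) < X" "c * nbits (n + t + 1) < X"
  shows "runs (count_rounds c) v a (5 * nbits (n + t + 1) + 5) (\<lambda>v' a'. v' rRD = c * nbits (n + t + 1))"
proof -
  let ?L = "nbits (n + t + 1)" and ?v = "v(rZ := 1, rRD := 0)"
  let ?body = "Sq (Asg rZ (Nm 2 *. Vr rZ)) (Asg rRD (Vr rRD +. Nm c))"
  have "runs (Wh (Vr rZ <. Vr rN +. Vr rT +. Nm 2) ?body) ?v a ((\<Sum>j<?L. (1 + 2) + 2) + 1) (\<lambda>v' a'. v' rRD = c * ?L)"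
  proof (rule runs_Wh[where Inv = "\<lambda>j v' a'. v' rZ = 2 ^ j \<and> v' rRD = c * j"])
    fix j v' a' assume j: "j < ?L" and I: "v' rZ = 2 ^ j \<and> v' rRD = c * j"
      and f: "\<And>x. x \<notin> mv ?body \<Longrightarrow> v' x = ?v x" "\<And>r. r \<notin> ma ?body \<Longrightarrow> a' r = a r"
    have l: "2 ^ j \<le> n + t + 1" using j less_nbits by blast
    have "c * Suc j \<le> c * ?L" using j by (intro mult_le_mono2) simp
    then have "c * j + c < X" using b by simp
    moreover have "2 * 2 ^ j < X"
      by (rule le_less_trans[OF mult_le_mono2[OF l]]) (use b in simp)
    ultimately have "runs ?body v' a' (1 + 2) (\<lambda>v'' a''. v'' rZ = 2 ^ Suc j \<and> v'' rRD = c * Suc j)"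
      using I by (intro runs_asg_seq runs_Asg) simp_all
    then show "ev (Vr rZ <. Vr rN +. Vr rT +. Nm 2) v' a' \<noteq> 0 \<and> runs ?body v' a' (1 + 2) (\<lambda>v'' a''. v'' rZ = 2 ^ Suc j \<and> v'' rRD = c * Suc j)"
      using I l f v by simp
  next
    fix v' a' assume I: "v' rZ = 2 ^ ?L \<and> v' rRD = c * ?L"
      and f: "\<And>x. x \<notin> mv ?body \<Longrightarrow> v' x = ?v x" "\<And>r. r \<notin> ma ?body \<Longrightarrow> a' r = a r"
    then show "ev (Vr rZ <. Vr rN +. Vr rT +. Nm 2) v' a' = 0 \<and> v' rRD = c * ?L"
      using less_pow_nbits[of "n + t + 1"] v by simp
  qed simp
  then have "runs (count_rounds c) v a ((\<Sum>j<?L. (1 + 2) + 2) + 1 + 2 + 2) (\<lambda>v' a'. v' rRD = c * ?L)"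
    unfolding count_rounds_def using X2 by (intro runs_asg_seq) simp_all
  then show ?thesis by (rule runs_time) simp
qed

lemma runs_powers:
  assumes v: "v rNM = N" "N > 0" and b: "16 * N < X"
  shows "runs powers v a (7 * nbits (8 * N - 1) + 5)
    (\<lambda>v' a'. v' rA = nbits (8 * N - 1) \<and> (\<forall>i. 2 ^ i < 8 * N \<longrightarrow> a' aPOW i = 2 ^ i))"
proof -
  let ?L = "nbits (8 * N - 1)" and ?v = "v(rZ := 1, rA := 0)"
  let ?I = "\<lambda>j (v'::vars) (a'::arrs). v' rZ = 2 ^ j \<and> v' rA = j \<and> (\<forall>i<j. a' aPOW i = 2 ^ i)"
  let ?Q = "\<lambda>(v'::vars) (a'::arrs). v' rA = ?L \<and> (\<forall>i. 2 ^ i < 8 * N \<longrightarrow> a' aPOW i = 2 ^ i)"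
  let ?body = "Sq (Sto aPOW (Vr rA) (Vr rZ)) (Sq (Asg rZ (Nm 2 *. Vr rZ)) (Asg rA (Vr rA +. Nm 1)))"
  have lt: "d < ?L \<longleftrightarrow> 2 ^ d < 8 * N" for d using less_nbits[of d "8 * N - 1"] v(2) by linarith
  have "runs (Wh (Vr rZ <. Nm 8 *. Vr rNM) ?body) ?v a ((\<Sum>j<?L. (1 + 2 + 2) + 2) + 1) ?Q"
  proof (rule runs_Wh[where Inv = ?I])
    fix j v' a' assume j: "j < ?L" and I: "?I j v' a'"
      and f: "\<And>x. x \<notin> mv ?body \<Longrightarrow> v' x = ?v x" "\<And>r. r \<notin> ma ?body \<Longrightarrow> a' r = a r"
    have l: "2 ^ j < 8 * N" using j lt by blast
    have "j < 2 ^ j" by (rule less_exp)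
    then have "Suc j < X" "2 * 2 ^ j < X" "2 ^ j < X" using b l by linarith+
    then have "runs ?body v' a' (1 + 2 + 2) (?I (Suc j))"
      using I by (intro runs_sto_seq runs_asg_seq runs_Asg) (simp_all add: less_Suc_eq)
    then show "ev (Vr rZ <. Nm 8 *. Vr rNM) v' a' \<noteq> 0 \<and> runs ?body v' a' (1 + 2 + 2) (?I (Suc j))"
      using I l f v by simp
  next
    fix v' a' assume I: "?I ?L v' a'"
      and f: "\<And>x. x \<notin> mv ?body \<Longrightarrow> v' x = ?v x" "\<And>r. r \<notin> ma ?body \<Longrightarrow> a' r = a r"
    have "\<not> 2 ^ ?L < 8 * N" using lt[of ?L] by simp
    then show "ev (Vr rZ <. Nm 8 *. Vr rNM) v' a' = 0 \<and> ?Q v' a'"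
      using I f v lt by simp
  qed simp
  then have "runs powers v a ((\<Sum>j<?L. (1 + 2 + 2) + 2) + 1 + 2 + 2) ?Q"
    unfolding powers_def using X2 by (intro runs_asg_seq) simp_all
  then show ?thesis by (rule runs_time) simp
qed

lemma runs_mark_multiples:
  assumes v: "v rQN = S" "S + 1 < X" and a: "\<And>m. a aM m = 0"
  shows "runs mark_multiples v a ((\<Sum>d<S + 1. 5 * (S div d) + 8) + 3)
    (\<lambda>v' a'. \<forall>m\<le>S. a' aM m = 0 \<longleftrightarrow> \<not> (\<exists>d q. (1::nat) < d \<and> 1 < q \<and> m = d * q))"
proof -
  define P where "P = (\<lambda>j m. \<exists>d q. d < j \<and> 1 < d \<and> 1 < q \<and> m = d * q \<and> m \<le> S)"
  let ?I = "\<lambda>j (v'::vars) (a'::arrs). \<forall>m. a' aM m \<noteq> 0 \<longleftrightarrow> P j m"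
  let ?inner = "For rJ (Vr rQN /. Vr rC -. Nm 1) (Sto aM (Vr rC *. (Vr rJ +. Nm 2)) (Nm 1))"
  let ?body = "If (Nm 1 <. Vr rC) ?inner Nop"
  have "runs mark_multiples v a ((\<Sum>d<S + 1. (5 * (S div d) + 3 + 1) + 4) + 3)
    (\<lambda>v' a'. \<forall>m\<le>S. a' aM m = 0 \<longleftrightarrow> \<not> (\<exists>d q. (1::nat) < d \<and> 1 < q \<and> m = d * q))"
    unfolding mark_multiples_def
  proof (rule runs_For[where Inv = ?I])
    fix d v' a' assume d: "d < S + 1" and I: "?I d v' a'" and vd: "v' rC = d"
      and f: "\<And>x. x \<notin> mv ?body \<Longrightarrow> x \<noteq> rC \<Longrightarrow> v' x = v x" "\<And>r. r \<notin> ma ?body \<Longrightarrow> a' r = a r"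
    have vS: "v' rQN = S" using f v by simp
    let ?J = "\<lambda>j (v''::vars) (a''::arrs). \<forall>m. a'' aM m \<noteq> 0 \<longleftrightarrow> P d m \<or> (\<exists>q. 1 < q \<and> q < j + 2 \<and> m = d * q)"
    show "runs ?body v' a' (5 * (S div d) + 3 + 1) (\<lambda>v'' a''. ?I (Suc d) (v''(rC := Suc d)) a'')"
    proof (rule runs_If)
      assume "ev (Nm 1 <. Vr rC) v' a' \<noteq> 0"
      then have d1: "1 < d" using vd by (simp split: if_splits)
      have "runs ?inner v' a' ((\<Sum>j<S div d - 1. 1 + 4) + 3) (\<lambda>v'' a''. ?I (Suc d) (v''(rC := Suc d)) a'')"
      proof (rule runs_For[where Inv = ?J])
        fix j v2 a2 assume j: "j < S div d - 1" and J: "?J j v2 a2" and vj: "v2 rJ = j"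
          and f2: "\<And>x. x \<notin> mv (Sto aM (Vr rC *. (Vr rJ +. Nm 2)) (Nm 1)) \<Longrightarrow> x \<noteq> rJ \<Longrightarrow> v2 x = v' x"
        have "v2 rC = d" using f2 vd by simp
        then have "?J (Suc j) (v2(rJ := Suc j)) (a2(aM := (a2 aM)(d * (j + 2) := 1)))"
          using J d1 by (auto simp: less_Suc_eq)
        then show "runs (Sto aM (Vr rC *. (Vr rJ +. Nm 2)) (Nm 1)) v2 a2 1 (\<lambda>v'' a''. ?J (Suc j) (v''(rJ := Suc j)) a'')"
          using X2 vj \<open>v2 rC = d\<close> by (intro runs_Sto) simp_all
      next
        fix v2 a2 assume J: "?J (S div d - 1) v2 a2"
        have eq: "q < S div d - 1 + 2 \<longleftrightarrow> d * q \<le> S" if "1 < q" for q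
        proof -
          have "q < S div d - 1 + 2 \<longleftrightarrow> q \<le> S div d" using that by linarith
          also have "\<dots> \<longleftrightarrow> d * q \<le> S" using d1 by (simp add: less_eq_div_iff_mult_less_eq mult.commute)
          finally show ?thesis .
        qed
        show "?I (Suc d) (v2(rC := Suc d)) a2"
        proof
          fix m
          have "a2 aM m \<noteq> 0 \<longleftrightarrow> P d m \<or> (\<exists>q. 1 < q \<and> q < S div d - 1 + 2 \<and> m = d * q)" using J by (rule spec)
          also have "(\<exists>q. 1 < q \<and> q < S div d - 1 + 2 \<and> m = d * q) \<longleftrightarrow> (\<exists>q. 1 < q \<and> m = d * q \<and> m \<le> S)"
          proof (intro ex_cong1)
            fix q
            show "(1 < q \<and> q < S div d - 1 + 2 \<and> m = d * q) = (1 < q \<and> m = d * q \<and> m \<le> S)"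
            proof (cases "1 < q \<and> m = d * q")
              case True
              then show ?thesis using eq[of q] by simp
            qed argo
          qed
          also have "P d m \<or> \<dots> \<longleftrightarrow> P (Suc d) m" using d1 by (auto simp: P_def less_Suc_eq)
          finally show "a2 aM m \<noteq> 0 \<longleftrightarrow> P (Suc d) m" .
        qed
      next
        have "S div d \<le> S" by simp
        then show "S div d - 1 < X" using v by linarith
      qed (use I vd vS in auto)
      then show "runs ?inner v' a' (5 * (S div d) + 3) (\<lambda>v'' a''. ?I (Suc d) (v''(rC := Suc d)) a'')"
        by (rule runs_time) simp
    next
      assume "ev (Nm 1 <. Vr rC) v' a' = 0"
      then have "\<not> 1 < d" using vd by (simp split: if_splits)
      then have "P (Suc d) m \<longleftrightarrow> P d m" for m by (auto simp: P_def less_Suc_eq)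
      then show "runs Nop v' a' (5 * (S div d) + 3) (\<lambda>v'' a''. ?I (Suc d) (v''(rC := Suc d)) a'')"
        using I by (intro runs_time[OF runs_Nop]) simp_all
    qed
  next
    fix v' a' assume I: "?I (S + 1) v' a'"
    have "P (S + 1) m \<longleftrightarrow> (\<exists>d q. 1 < d \<and> 1 < q \<and> m = d * q)" if "m \<le> S" for m
    proof -
      have "d < S + 1" if "1 < q" "d * q \<le> S" for d q
      proof -
        have "d \<le> d * q" using that(1) by simp
        then show ?thesis using that(2) by linarith
      qed
      then show ?thesis using that by (auto simp: P_def)
    qed
    then show "\<forall>m\<le>S. a' aM m = 0 \<longleftrightarrow> \<not> (\<exists>d q. (1::nat) < d \<and> 1 < q \<and> m = d * q)" using I by metis
  qed (use v a in \<open>auto simp: P_def\<close>)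
  then show ?thesis by (rule runs_time) (rule add_right_mono, rule sum_mono, simp)
qed

lemma runs_pick_prime:
  assumes v: "v rQN = S" "S + 1 < X" "v rQ = b" "1 < b"
    and a: "\<forall>m\<le>S. a aM m = 0 \<longleftrightarrow> \<not> (\<exists>d q. (1::nat) < d \<and> 1 < q \<and> m = d * q)"
    and q: "prime q" "b < q" "q \<le> S"
  shows "runs pick_prime v a (6 * S + 9) (\<lambda>v' a'. prime (v' rP) \<and> b < v' rP \<and> v' rP \<le> S)"
proof -
  have pr: "prime m" if "1 < m" "m \<le> S" "a aM m = 0" for m
  proof (rule prime_if_no_factors[OF that(1)])
    fix d e :: nat assume de: "1 < d" "1 < e"
    show "m \<noteq> d * e"
    proof
      assume "m = d * e"
      with de have "\<exists>d q. (1::nat) < d \<and> 1 < q \<and> m = d * q" by (intro exI conjI)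
      then show False using a[rule_format, OF that(2)] that(3) by metis
    qed
  qed
  have q0: "a aM q = 0"
  proof (rule ccontr)
    assume "a aM q \<noteq> 0"
    then have "\<exists>d e. (1::nat) < d \<and> 1 < e \<and> q = d * e" using a[rule_format, OF q(3)] by metis
    then obtain d e where de: "1 < d" "1 < e" "q = d * e" by metis
    then have "d dvd q" by simp
    then have "d = 1 \<or> d = q" by (rule conjunct2[OF iffD1[OF prime_nat_iff q(1)], rule_format])
    then show False using de by auto
  qed
  let ?I = "\<lambda>j (v'::vars) (a'::arrs). q < j \<longrightarrow> b < v' rP \<and> v' rP \<le> S \<and> a aM (v' rP) = 0"
  let ?body = "If ((Vr rQ <. Vr rC) *. (Ar aM (Vr rC) =. Nm 0)) (Asg rP (Vr rC)) Nop"
  have "runs pick_prime v a ((\<Sum>j<S + 1. (1 + 1) + 4) + 3) (\<lambda>v' a'. prime (v' rP) \<and> b < v' rP \<and> v' rP \<le> S)"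
    unfolding pick_prime_def
  proof (rule runs_For[where Inv = ?I])
    fix j v' a' assume j: "j < S + 1" and I: "?I j v' a'" and vj: "v' rC = j"
      and f: "\<And>x. x \<notin> mv ?body \<Longrightarrow> x \<noteq> rC \<Longrightarrow> v' x = v x" "\<And>r. r \<notin> ma ?body \<Longrightarrow> a' r = a r"
    have e: "ev ((Vr rQ <. Vr rC) *. (Ar aM (Vr rC) =. Nm 0)) v' a' = of_bool (b < j) * of_bool (a aM j = 0)"
      using f v vj by simp
    show "runs ?body v' a' (1 + 1) (\<lambda>v'' a''. ?I (Suc j) (v''(rC := Suc j)) a'')"
    proof (rule runs_If)
      assume "ev ((Vr rQ <. Vr rC) *. (Ar aM (Vr rC) =. Nm 0)) v' a' \<noteq> 0"
      then have "b < j" "a aM j = 0" unfolding e by (simp_all split: if_splits)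
      then show "runs (Asg rP (Vr rC)) v' a' 1 (\<lambda>v'' a''. ?I (Suc j) (v''(rC := Suc j)) a'')"
        using j vj v by (intro runs_Asg) auto
    next
      assume "ev ((Vr rQ <. Vr rC) *. (Ar aM (Vr rC) =. Nm 0)) v' a' = 0"
      then have "\<not> (b < j \<and> a aM j = 0)" unfolding e by auto
      then have "j \<noteq> q" using q q0 by auto
      then show "runs Nop v' a' 1 (\<lambda>v'' a''. ?I (Suc j) (v''(rC := Suc j)) a'')"
        using I by (intro runs_time[OF runs_Nop]) (auto simp: less_Suc_eq)
    qed
  next
    fix v' a' assume "?I (S + 1) v' a'"
    then show "prime (v' rP) \<and> b < v' rP \<and> v' rP \<le> S" using q(3) pr v(4) by auto
  qed (use v in auto)
  then show ?thesis by (rule runs_time) simp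
qed

lemma runs_inverses:
  assumes v: "v rP = p" "v rT = t" and p: "prime p" "k * t + 1 < p" "p \<le> X"
  shows "runs (inverses k) v a (5 * (k * t) + 8) (\<lambda>v' a'. \<forall>j. 1 \<le> j \<longrightarrow> j \<le> k * t \<longrightarrow> (a' aINV j * j) mod p = 1)"
proof -
  let ?I = "\<lambda>i (v'::vars) (a'::arrs). \<forall>j. 1 \<le> j \<longrightarrow> j < i \<longrightarrow> (a' aINV j * j) mod p = 1"
  let ?e = "ite (Nm 1 <. Vr rC) (((Vr rP -. Vr rP /. Vr rC) *. Ar aINV (Vr rP %. Vr rC)) %. Vr rP) (Vr rC)"
  have p1: "1 < p" using p by linarith
  have "runs (inverses k) v a ((\<Sum>j<k * t + 1. 1 + 4) + 3) (\<lambda>v' a'. \<forall>j. 1 \<le> j \<longrightarrow> j \<le> k * t \<longrightarrow> (a' aINV j * j) mod p = 1)"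
    unfolding inverses_def
  proof (rule runs_For[where Inv = ?I])
    fix i v' a' assume i: "i < k * t + 1" and I: "?I i v' a'" and vi: "v' rC = i"
      and f: "\<And>x. x \<notin> mv (Sto aINV (Vr rC) ?e) \<Longrightarrow> x \<noteq> rC \<Longrightarrow> v' x = v x"
    have vp: "v' rP = p" using f v by simp
    let ?y = "ev ?e v' a'"
    have lt: "?y < X"
    proof (cases "1 < i")
      case True
      have "((p - p div i) * a' aINV (p mod i)) mod p < p" using p1 by simp
      then show ?thesis using True vi vp p(3) by simp
    next
      case False
      then show ?thesis using vi X2 by simp
    qed
    have y: "(?y * i) mod p = 1" if "1 \<le> i"
    proof (cases "1 < i")
      case True
      have ip: "i < p" using i p(2) by linarith
      have "\<not> i dvd p" using conjunct2[OF iffD1[OF prime_nat_iff p(1)], rule_format, of i] True ip by auto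
      then have "1 \<le> p mod i" by (simp add: Suc_leI dvd_eq_mod_eq_0)
      moreover have "p mod i < i" using True by simp
      ultimately have "(a' aINV (p mod i) * (p mod i)) mod p = 1" using I by blast
      then have "((p - p div i) * a' aINV (p mod i) mod p * i) mod p = 1"
        using ip True by (intro inverse_mod_step) auto
      then show ?thesis using True vi vp by simp
    next
      case False
      then have "i = 1" using that by simp
      then show ?thesis using vi p1 by simp
    qed
    show "runs (Sto aINV (Vr rC) ?e) v' a' 1 (\<lambda>v'' a''. ?I (Suc i) (v''(rC := Suc i)) a'')"
    proof (rule runs_Sto[OF lt])
      show "?I (Suc i) (v'(rC := Suc i)) (a'(aINV mod 16 := (a' (aINV mod 16))(ev (Vr rC) v' a' := ?y)))"
        using I y vi by (auto simp: less_Suc_eq simp del: ev_ite)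
    qed
  qed (use v p in auto)
  then show ?thesis by (rule runs_time) simp
qed

end

section \<open>The complete program\<close>

text \<open>The bound of \<open>prime_between_log\<close> for \<open>b = 4 * k * t + 4\<close>. Its
  logarithm is taken to be the length of the table of powers of two plus \<open>k\<close>, a number
  that is already at hand when the sieve starts.\<close>

definition sieve_size :: "nat \<Rightarrow> nat \<Rightarrow> nat" where
  "sieve_size k t = 2 * ((4 * k * t + 4) * (nbits (8 * (2 * t + 1) ^ k - 1) + k)) + 1"

definition finish_setup :: "nat \<Rightarrow> cmd" where
  "finish_setup k = Sq (Asg rI2 ((Vr rP +. Nm 1) /. Nm 2)) (Sq (Asg rLim (Vr rN *. Nm k *. Vr rRD)) (Asg rI (Nm 0)))"

definition find_prime :: "nat \<Rightarrow> cmd" where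
  "find_prime k = Sq (Asg rQ (Nm (4 * k) *. Vr rT +. Nm 4)) (Sq (Asg rQN (Nm 2 *. (Vr rQ *. (Vr rA +. Nm k)) +. Nm 1))
     (Sq mark_multiples pick_prime))"

definition sizes :: "nat \<Rightarrow> cmd" where
  "sizes k = Sq (Asg rB (Nm 2 *. Vr rT +. Nm 1)) (Sq (Asg rNM (epow (Vr rB) k)) powers)"

definition pre :: "nat \<Rightarrow> nat \<Rightarrow> cmd" where
  "pre k c = Sq (Inp rN (Nm 0)) (Sq (load_targets k) (Sq (load_elements k) (Sq (count_rounds c)
     (Sq (sizes k) (Sq (find_prime k) (Sq (inverses k) (finish_setup k)))))))"

lemma mv_setup [simp]: "mv (finish_setup k) = {rI2, rLim, rI}" "mv (find_prime k) = {rQ, rQN, rC, rJ, rP}"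
    "mv (sizes k) = {rB, rNM, rZ, rA}"
  and ma_setup [simp]: "ma (finish_setup k) = {}" "ma (find_prime k) = {aM}" "ma (sizes k) = {aPOW}"
  by (auto simp: finish_setup_def find_prime_def sizes_def)

text \<open>Written directly in the machine language: a drawn word may exceed \<open>X\<close> until
  it is reduced modulo \<open>p\<close> in the next command, so the state in between violates
  \<open>cond_st\<close>.\<close>

definition draw :: prog where
  "draw = While (cx (Vr rI <. Vr rLim)) (Seq (Rand 29) (Seq (Assign 29 (Bin Mod (Reg 29) (Reg rP)))
     (Seq (cc (Sto aRND (Vr rI) (Vr 29))) (cc (Asg rI (Vr rI +. Nm 1))))))"

definition rounds :: "nat \<Rightarrow> cmd" where
  "rounds k = For rRound (Vr rRD) (round_cmd k)"

text \<open>The first assignment puts the first address after the input into register 1: cell 0 is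
  followed by \<open>k\<close> targets and \<open>n\<close> elements.\<close>

definition program :: "nat \<Rightarrow> nat \<Rightarrow> prog" where
  "program k c = Seq (Assign 1 (Bin Plus (Load (Const 0)) (Const (k + 1)))) (Seq (cc (pre k c)) (Seq draw (cc (rounds k))))"

lemma exec_one: "exec w \<omega> \<tau> p s m s' \<Longrightarrow> m \<le> 1 \<Longrightarrow> p \<noteq> Skip \<Longrightarrow> m = 1"
  by (erule reach.cases) auto

text \<open>An iteration takes exactly 9 steps and draws in the second of them, so it is known
  beforehand which tape cell becomes weight \<open>i\<close>. This is where bounds on step counts
  are not enough; \<open>exec_one\<close> makes them exact.\<close>

lemma (in ram) exec_draw:
  assumes E: "plv draw \<le> E" and p: "0 < p" "p \<le> X" and lm: "lm < X"
    and "st s v a" "v rI = j" "v rLim = lm" "v rP = p" "j \<le> lm"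
  shows "\<exists>s' v'. exec w \<omega> \<tau> draw s (9 * (lm - j) + 1) s' \<and>
    st s' v' (a(aRND := (\<lambda>i. if j \<le> i \<and> i < lm then \<omega> (\<tau> + 9 * (i - j) + 1) mod p else a aRND i))) \<and>
    (\<forall>x. x \<noteq> rI \<longrightarrow> x \<noteq> 29 \<longrightarrow> v' x = v x)"
  using assms(5-9)
proof (induction "lm - j" arbitrary: s v a j \<tau>)
  case 0
  then have j: "j = lm" by simp
  have pe: "lv (cx (Vr rI <. Vr rLim)) \<le> E" using E by (simp add: draw_def)
  have "eval_expr w (cx (Vr rI <. Vr rLim)) s = 0"
    using eval_cx[OF "0.prems"(1) pe] "0.prems" j by simp
  then have "exec w \<omega> \<tau> draw s 1 s" unfolding draw_def by (rule exec_While_False)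
  moreover have "a(aRND := (\<lambda>i. if j \<le> i \<and> i < lm then \<omega> (\<tau> + 9 * (i - j) + 1) mod p else a aRND i)) = a"
    using j by (auto simp: fun_eq_iff)
  ultimately show ?case using 0 j by (intro exI[of _ s] exI[of _ v]) auto
next
  case (Suc d)
  have j: "j < lm" using Suc.hyps(2) by simp
  have pe: "lv (cx (Vr rI <. Vr rLim)) \<le> E" "plv (cc (Sto aRND (Vr rI) (Vr 29))) \<le> E"
    "plv (cc (Asg rI (Vr rI +. Nm 1))) \<le> E" using E by (simp_all add: draw_def)
  have c: "eval_expr w (cx (Vr rI <. Vr rLim)) s \<noteq> 0"
    using eval_cx[OF Suc.prems(1) pe(1)] Suc.prems j by simp
  define r where "r = \<omega> (\<tau> + 1) mod p"
  define v2 where "v2 = v(29 := r)"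
  let ?s1 = "s\<lparr>regs := v(29 := \<omega> (\<tau> + 1))\<rparr>" and ?s2 = "s\<lparr>regs := v2\<rparr>"
  have rs: "regs s = v" using Suc.prems(1) by (simp add: cond_st_def)
  have rX: "r < X" using p unfolding r_def by (meson mod_less_divisor less_le_trans)
  have e1: "exec w \<omega> (\<tau> + 1) (Rand 29) s 1 ?s1" by (rule exec_dstep) (simp_all add: rs)
  have e2: "exec w \<omega> \<tau>' (Assign 29 (Bin Mod (Reg 29) (Reg rP))) ?s1 1 ?s2" for \<tau>'
    by (rule exec_dstep) (simp_all add: r_def v2_def Suc.prems(4))
  have st2: "st ?s2 v2 a" unfolding v2_def by (rule st_upd_var[OF Suc.prems(1) _ rX]) simp
  define a3 where "a3 = a(aRND := (a aRND)(j := r))"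
  have "runs (Sto aRND (Vr rI) (Vr 29)) v2 a 1 (\<lambda>v' a'. v' = v2 \<and> a' = a3)"
    by (rule runs_Sto) (use rX Suc.prems in \<open>auto simp: v2_def a3_def\<close>)
  from runsE[OF this pe(2) st2] obtain m3 s3 where m3: "m3 \<le> 1"
    "\<And>\<omega> \<tau>. exec w \<omega> \<tau> (cc (Sto aRND (Vr rI) (Vr 29))) ?s2 m3 s3" "st s3 v2 a3" by metis
  have e3: "exec w \<omega> \<tau>' (cc (Sto aRND (Vr rI) (Vr 29))) ?s2 1 s3" for \<tau>'
    using exec_one[OF m3(2) m3(1)] m3(2) by simp
  have "runs (Asg rI (Vr rI +. Nm 1)) v2 a3 1 (\<lambda>v' a'. v' = v2(rI := Suc j) \<and> a' = a3)"
    by (rule runs_Asg) (use j lm Suc.prems in \<open>auto simp: v2_def\<close>)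
  from runsE[OF this pe(3) m3(3)] obtain m4 s4 where m4: "m4 \<le> 1"
    "\<And>\<omega> \<tau>. exec w \<omega> \<tau> (cc (Asg rI (Vr rI +. Nm 1))) s3 m4 s4" "st s4 (v2(rI := Suc j)) a3" by metis
  have e4: "exec w \<omega> \<tau>' (cc (Asg rI (Vr rI +. Nm 1))) s3 1 s4" for \<tau>'
    using exec_one[OF m4(2) m4(1)] m4(2) by simp
  have body: "exec w \<omega> (\<tau> + 1) (Seq (Rand 29) (Seq (Assign 29 (Bin Mod (Reg 29) (Reg rP)))
     (Seq (cc (Sto aRND (Vr rI) (Vr 29))) (cc (Asg rI (Vr rI +. Nm 1)))))) s (1 + 1 + (1 + 1 + (1 + 1 + 1))) s4"
    by (rule exec_Seq[OF e1], rule exec_Seq[OF e2], rule exec_Seq[OF e3], rule e4)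
  have "d = lm - Suc j" using Suc.hyps(2) by simp
  from Suc.hyps(1)[OF this m4(3), of "\<tau> + (1 + 1 + (1 + 1 + (1 + 1 + 1))) + 2"]
  obtain s' v' where I: "exec w \<omega> (\<tau> + (1 + 1 + (1 + 1 + (1 + 1 + 1))) + 2) draw s4 (9 * (lm - Suc j) + 1) s'"
    "st s' v' (a3(aRND := (\<lambda>i. if Suc j \<le> i \<and> i < lm
      then \<omega> (\<tau> + (1 + 1 + (1 + 1 + (1 + 1 + 1))) + 2 + 9 * (i - Suc j) + 1) mod p else a3 aRND i)))"
    "\<forall>x. x \<noteq> rI \<longrightarrow> x \<noteq> 29 \<longrightarrow> v' x = (v2(rI := Suc j)) x"
    using Suc.prems j by (auto simp: v2_def)
  have "exec w \<omega> \<tau> draw s (1 + 1 + (1 + 1 + (1 + 1 + 1)) + 2 + (9 * (lm - Suc j) + 1)) s'"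
    unfolding draw_def by (rule exec_While_True[OF c body]) (use I(1) in \<open>simp add: draw_def\<close>)
  moreover have "1 + 1 + (1 + 1 + (1 + 1 + 1)) + 2 + (9 * (lm - Suc j) + 1) = 9 * (lm - j) + 1" using j by linarith
  ultimately have "exec w \<omega> \<tau> draw s (9 * (lm - j) + 1) s'" by metis
  moreover have "a3(aRND := (\<lambda>i. if Suc j \<le> i \<and> i < lm
      then \<omega> (\<tau> + (1 + 1 + (1 + 1 + (1 + 1 + 1))) + 2 + 9 * (i - Suc j) + 1) mod p else a3 aRND i)) =
    a(aRND := (\<lambda>i. if j \<le> i \<and> i < lm then \<omega> (\<tau> + 9 * (i - j) + 1) mod p else a aRND i))"
  proof -
    have "(if Suc j \<le> i \<and> i < lm then \<omega> (\<tau> + (1 + 1 + (1 + 1 + (1 + 1 + 1))) + 2 + 9 * (i - Suc j) + 1) mod p else a3 aRND i) =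
      (if j \<le> i \<and> i < lm then \<omega> (\<tau> + 9 * (i - j) + 1) mod p else a aRND i)" for i
    proof (cases "Suc j \<le> i \<and> i < lm")
      case True
      then have 1: "j \<le> i \<and> i < lm" by simp
      have 2: "\<tau> + (1 + 1 + (1 + 1 + (1 + 1 + 1))) + 2 + 9 * (i - Suc j) + 1 = \<tau> + 9 * (i - j) + 1"
        using True by linarith
      show ?thesis unfolding if_P[OF True] if_P[OF 1] 2 ..
    next
      case False
      then show ?thesis using j by (cases "i = j") (auto simp: a3_def r_def)
    qed
    then show ?thesis by (simp only: a3_def fun_upd_upd)
  qed
  ultimately show ?case using I(2,3) by (intro exI[of _ s'] exI[of _ v']) (auto simp: v2_def)
qed

locale input = ram +
  fixes n t k c :: nat
  assumes k: "k \<ge> 1" and base: "base = n + k + 1"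
    and inp: "inp 0 = n" "\<And>i. i < k \<Longrightarrow> inp (Suc i) \<le> t" "\<exists>i<k. inp (Suc i) = t"
      "\<And>i. i < n \<Longrightarrow> inp (i + (k + 1)) < 2 ^ w"
    and bnd: "n + k + 1 < X" "2 * (n + t + 2) < X" "c * nbits (n + t + 1) < X" "16 * (2 * t + 1) ^ k < X"
      "8 * ((2 * t + 1) ^ k)\<^sup>2 < X" "sieve_size k t + 1 < X" "n * k * (c * nbits (n + t + 1)) < X"
begin

abbreviation "NM \<equiv> (2 * t + 1) ^ k"
abbreviation "LG \<equiv> nbits (8 * NM - 1)"
abbreviation "K \<equiv> c * nbits (n + t + 1)"
abbreviation "S \<equiv> sieve_size k t"

definition pre_cost :: nat where
  "pre_cost = (\<Sum>d<S + 1. 5 * (S div d) + 8) + 6 * S + 5 * (k * t) + 7 * LG + 5 * nbits (n + t + 1) + 7 * n + 9 * k + 60"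

definition ready :: "vars \<Rightarrow> arrs \<Rightarrow> bool" where
  "ready v a \<longleftrightarrow> v rN = n \<and> v rT = t \<and> v rRD = K \<and> v rB = 2 * t + 1 \<and> v rNM = NM \<and>
     prime (v rP) \<and> 4 * k * t + 4 < v rP \<and> v rP \<le> S \<and> v rI2 = (v rP + 1) div 2 \<and> v rLim = n * k * K \<and> v rI = 0 \<and> v 0 = 0 \<and>
     (\<forall>i<k. a aTS i = inp (Suc i)) \<and> (\<forall>i<n. a aXS i = (if inp (i + (k + 1)) \<le> t then inp (i + (k + 1)) else 0)) \<and>
     (\<forall>i. 2 ^ i < 8 * NM \<longrightarrow> a aPOW i = 2 ^ i) \<and> (\<forall>j. 1 \<le> j \<longrightarrow> j \<le> k * t \<longrightarrow> (a aINV j * j) mod v rP = 1) \<and>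
     a aRND = (\<lambda>_. 0)"

lemma NM_ge: "2 * t + 1 \<le> NM"
  using k by (intro self_le_power) auto

lemma prime_exists: "\<exists>q. prime q \<and> 4 * k * t + 4 < q \<and> q \<le> S"
  unfolding sieve_size_def
proof (rule prime_between_log)
  have "8 * NM \<le> 2 ^ LG" using less_pow_nbits[of "8 * NM - 1"] by linarith
  then have "8 * (2 * t + 1) \<le> 2 ^ LG" by (rule le_trans[OF mult_le_mono2[OF NM_ge]])
  moreover have "k + 1 \<le> 2 ^ k" using less_exp[of k] by (simp add: Suc_leI)
  ultimately have "8 * (2 * t + 1) * (k + 1) \<le> 2 ^ LG * 2 ^ k" by (rule mult_le_mono)
  moreover have "8 * (2 * t + 1) * (k + 1) = 16 * (k * t) + 16 * t + 8 * k + 8" by (simp add: algebra_simps)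
  ultimately show "2 * (4 * k * t + 4) < 2 ^ (LG + k)" unfolding power_add using k by simp
qed simp

lemma runs_find_prime:
  assumes v: "v rT = t" "v rA = LG" and a: "\<And>m. a aM m = 0"
  shows "runs (find_prime k) v a ((\<Sum>d<S + 1. 5 * (S div d) + 8) + 6 * S + 17)
    (\<lambda>v' a'. prime (v' rP) \<and> 4 * k * t + 4 < v' rP \<and> v' rP \<le> S)"
proof -
  obtain q where q: "prime q" "4 * k * t + 4 < q" "q \<le> S" using prime_exists by blast
  define v2 where "v2 = v(rQ := 4 * k * t + 4, rQN := S)"
  have v2: "v2 rQN = S" "v2 rQ = 4 * k * t + 4" by (simp_all add: v2_def)
  have b: "S + 1 < X" using bnd by simp
  have "runs (Sq mark_multiples pick_prime) v2 a ((\<Sum>d<S + 1. 5 * (S div d) + 8) + 6 * S + 13)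
    (\<lambda>v' a'. prime (v' rP) \<and> 4 * k * t + 4 < v' rP \<and> v' rP \<le> S)"
  proof (rule runs_seq, rule runs_mark_multiples[where v = v2 and a = a and S = S, OF v2(1) b a])
    fix v3 :: vars and a3 :: arrs assume m: "\<forall>m\<le>S. a3 aM m = 0 \<longleftrightarrow> \<not> (\<exists>d q. 1 < d \<and> 1 < q \<and> m = d * q)"
      and f: "\<And>x. x \<notin> mv mark_multiples \<Longrightarrow> v3 x = v2 x"
    show "runs pick_prime v3 a3 (6 * S + 9) (\<lambda>v' a'. prime (v' rP) \<and> 4 * k * t + 4 < v' rP \<and> v' rP \<le> S)"
      by (rule runs_pick_prime[where v = v3 and a = a3 and S = S and b = "4 * k * t + 4" and q = q, OF _ b _ _ m q]) (use f v2 in auto)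
  qed simp
  then have r: "runs (Sq mark_multiples pick_prime) (v(rQ := 4 * k * t + 4, rQN := S)) a ((\<Sum>d<S + 1. 5 * (S div d) + 8) + 6 * S + 13)
    (\<lambda>v' a'. prime (v' rP) \<and> 4 * k * t + 4 < v' rP \<and> v' rP \<le> S)" unfolding v2_def .
  have e: "ev (Nm (4 * k) *. Vr rT +. Nm 4) v a = 4 * k * t + 4" using v by simp
  have e2: "ev (Nm 2 *. (Vr rQ *. (Vr rA +. Nm k)) +. Nm 1) (v(rQ := 4 * k * t + 4)) a = S"
    using v by (simp add: sieve_size_def)
  have lt: "4 * k * t + 4 < X" using q b by linarith
  have "runs (find_prime k) v a ((\<Sum>d<S + 1. 5 * (S div d) + 8) + 6 * S + 13 + 2 + 2)
    (\<lambda>v' a'. prime (v' rP) \<and> 4 * k * t + 4 < v' rP \<and> v' rP \<le> S)"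
    unfolding find_prime_def
    by (rule runs_asg_seq, simp, unfold e, rule lt, rule runs_asg_seq, simp, unfold e2) (use b r in simp_all)
  then show ?thesis by (rule runs_time) simp
qed

lemma runs_sizes:
  assumes v: "v rT = t"
  shows "runs (sizes k) v a (7 * LG + 9) (\<lambda>v' a'. v' rA = LG \<and> v' rB = 2 * t + 1 \<and> v' rNM = NM \<and>
    (\<forall>i. 2 ^ i < 8 * NM \<longrightarrow> a' aPOW i = 2 ^ i))"
proof -
  define v2 where "v2 = v(rB := 2 * t + 1, rNM := NM)"
  let ?Q = "\<lambda>(v'::vars) (a'::arrs). v' rA = LG \<and> v' rB = 2 * t + 1 \<and> v' rNM = NM \<and> (\<forall>i. 2 ^ i < 8 * NM \<longrightarrow> a' aPOW i = 2 ^ i)"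
  have "runs powers v2 a (7 * LG + 5) (\<lambda>v' a'. v' rA = LG \<and> (\<forall>i. 2 ^ i < 8 * NM \<longrightarrow> a' aPOW i = 2 ^ i))"
    by (rule runs_powers) (use bnd in \<open>auto simp: v2_def\<close>)
  then have r: "runs powers (v(rB := 2 * t + 1, rNM := NM)) a (7 * LG + 5) ?Q"
    unfolding v2_def[symmetric] by (rule runs_weaken) (simp_all add: v2_def)
  have e: "ev (Nm 2 *. Vr rT +. Nm 1) v a = 2 * t + 1" using v by simp
  have e2: "ev (epow (Vr rB) k) (v(rB := 2 * t + 1)) a = NM" by simp
  have lt: "2 * t + 1 < X" "NM < X" using bnd by auto
  have "runs (sizes k) v a (7 * LG + 5 + 2 + 2) ?Q"
    unfolding sizes_def
    by (rule runs_asg_seq, simp, unfold e, rule lt, rule runs_asg_seq, simp, unfold e2, rule lt, rule r)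
  then show ?thesis by (rule runs_time) simp
qed

lemma runs_pre:
  assumes v0: "v 0 = 0" and a0: "a = (\<lambda>_ _. 0)"
  shows "runs (pre k c) v a pre_cost ready"
proof -
  let ?M = "\<Sum>d<S + 1. 5 * (S div d) + 8"
  have tX: "t < X" "n < X" "k < X" "k < base"
    using le_less_trans[OF _ bnd(2), of t] le_less_trans[OF _ bnd(2), of n] le_less_trans[OF _ bnd(1), of k] base by simp_all
  have kt: "k * t + 1 < 4 * k * t + 4" by simp
  have s7: "runs (finish_setup k) v' a' 5 ready"
    if h: "v' rN = n" "v' rT = t" "v' rRD = K" "v' rB = 2 * t + 1" "v' rNM = NM" "prime (v' rP)" "4 * k * t + 4 < v' rP"
     "v' rP \<le> S" "v' 0 = 0" "\<forall>i<k. a' aTS i = inp (Suc i)"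
     "\<forall>i<n. a' aXS i = (if inp (i + (k + 1)) \<le> t then inp (i + (k + 1)) else 0)"
     "\<forall>i. 2 ^ i < 8 * NM \<longrightarrow> a' aPOW i = 2 ^ i" "\<forall>j. 1 \<le> j \<longrightarrow> j \<le> k * t \<longrightarrow> (a' aINV j * j) mod v' rP = 1"
     "a' aRND = (\<lambda>_. 0)" for v' a'
  proof -
    have lt: "(v' rP + 1) div 2 < X" using h(8) bnd(6) by linarith
    define v3 where "v3 = v'(rI2 := (v' rP + 1) div 2, rLim := n * k * K, rI := 0)"
    have rd: "ready v3 a'" unfolding ready_def using h by (simp add: v3_def)
    have e1: "ev ((Vr rP +. Nm 1) /. Nm 2) v' a' = (v' rP + 1) div 2" by simp
    have e2: "ev (Vr rN *. Nm k *. Vr rRD) (v'(rI2 := (v' rP + 1) div 2)) a' = n * k * K" using h by simp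
    have r: "runs (Asg rI (Nm 0)) (v'(rI2 := (v' rP + 1) div 2, rLim := n * k * K)) a' 1 ready"
      by (rule runs_Asg) (use X2 rd in \<open>simp_all add: v3_def\<close>)
    have "runs (finish_setup k) v' a' (1 + 2 + 2) ready"
      unfolding finish_setup_def
      by (rule runs_asg_seq, simp, unfold e1, rule lt, rule runs_asg_seq, simp, unfold e2, rule bnd(7), rule r)
    then show ?thesis by (rule runs_time) simp
  qed
  show ?thesis
    unfolding pre_def
  proof (rule runs_seq, rule runs_Inp[where Q = "\<lambda>v' a'. v' rN = n \<and> a' = a"])
    show "inp (ev (Nm 0) v a) < X" "(v(rN := inp (ev (Nm 0) v a))) rN = n \<and> a = a" "ev (Nm 0) v a < base"
      using inp(1) tX base by auto
    fix v1 a1 assume s1: "v1 rN = n \<and> a1 = a" and f1: "\<And>x. x \<notin> mv (Inp rN (Nm 0)) \<Longrightarrow> v1 x = v x"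
    obtain i0 where i0: "i0 < k" "inp (Suc i0) = t" using inp(3) by blast
    show "runs (Sq (load_targets k) (Sq (load_elements k) (Sq (count_rounds c) (Sq (sizes k) (Sq (find_prime k) (Sq (inverses k) (finish_setup k)))))))
      v1 a1 (?M + 6 * S + 5 * (k * t) + 7 * LG + 5 * nbits (n + t + 1) + 7 * n + 9 * k + 58) ready"
    proof (rule runs_seq, rule runs_load_targets[OF tX(3,4) inp(2) i0 tX(1)])
      fix v2 a2 assume s2: "v2 rT = t \<and> (\<forall>i<k. a2 aTS i = inp (Suc i))"
        and f2: "\<And>x. x \<notin> mv (load_targets k) \<Longrightarrow> v2 x = v1 x" "\<And>r. r \<notin> ma (load_targets k) \<Longrightarrow> a2 r = a1 r"
      have v2: "v2 rN = n" "v2 rT = t" "v2 0 = 0" using s1 s2 f1 f2 v0 by auto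
      show "runs (Sq (load_elements k) (Sq (count_rounds c) (Sq (sizes k) (Sq (find_prime k) (Sq (inverses k) (finish_setup k))))))
        v2 a2 (?M + 6 * S + 5 * (k * t) + 7 * LG + 5 * nbits (n + t + 1) + 7 * n + 52) ready"
      proof (rule runs_seq, rule runs_load_elements[OF v2(1,2) tX(2,1) base inp(4)])
        fix v3 a3 assume s3: "\<forall>i<n. a3 aXS i = (if inp (i + (k + 1)) \<le> t then inp (i + (k + 1)) else 0)"
          and f3: "\<And>x. x \<notin> mv (load_elements k) \<Longrightarrow> v3 x = v2 x" "\<And>r. r \<notin> ma (load_elements k) \<Longrightarrow> a3 r = a2 r"
        have v3: "v3 rN = n" "v3 rT = t" "v3 0 = 0" using v2 f3 by auto
        show "runs (Sq (count_rounds c) (Sq (sizes k) (Sq (find_prime k) (Sq (inverses k) (finish_setup k)))))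
          v3 a3 (?M + 6 * S + 5 * (k * t) + 7 * LG + 5 * nbits (n + t + 1) + 48) ready"
        proof (rule runs_seq, rule runs_count_rounds[OF v3(1,2) bnd(2,3)])
          fix v4 a4 assume s4: "v4 rRD = K"
            and f4: "\<And>x. x \<notin> mv (count_rounds c) \<Longrightarrow> v4 x = v3 x" "\<And>r. r \<notin> ma (count_rounds c) \<Longrightarrow> a4 r = a3 r"
          have v4: "v4 rN = n" "v4 rT = t" "v4 0 = 0" using v3 f4 by auto
          show "runs (Sq (sizes k) (Sq (find_prime k) (Sq (inverses k) (finish_setup k)))) v4 a4 (?M + 6 * S + 5 * (k * t) + 7 * LG + 42) ready"
          proof (rule runs_seq, rule runs_sizes[where v = v4 and a = a4, OF v4(2)])
            fix v5 a5 assume s5: "v5 rA = LG \<and> v5 rB = 2 * t + 1 \<and> v5 rNM = NM \<and> (\<forall>i. 2 ^ i < 8 * NM \<longrightarrow> a5 aPOW i = 2 ^ i)"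
              and f5: "\<And>x. x \<notin> mv (sizes k) \<Longrightarrow> v5 x = v4 x" "\<And>r. r \<notin> ma (sizes k) \<Longrightarrow> a5 r = a4 r"
            have v5: "v5 rN = n" "v5 rT = t" "v5 0 = 0" "v5 rRD = K" using v4 s4 f5 by auto
            have A5: "\<forall>i<k. a5 aTS i = inp (Suc i)" "\<forall>i<n. a5 aXS i = (if inp (i + (k + 1)) \<le> t then inp (i + (k + 1)) else 0)"
                "a5 aRND = (\<lambda>_. 0)" "a5 aM = (\<lambda>_. 0)"
              using s1 s2 s3 f2 f3 f4 f5 a0 by auto
            have m5: "\<And>m. a5 aM m = 0" using A5(4) by simp
            have a5: "v5 rA = LG" using s5 by simp
            show "runs (Sq (find_prime k) (Sq (inverses k) (finish_setup k))) v5 a5 (?M + 6 * S + 5 * (k * t) + 32) ready"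
            proof (rule runs_seq, rule runs_find_prime[where v = v5 and a = a5, OF v5(2) a5 m5])
              fix v6 a6 assume s6: "prime (v6 rP) \<and> 4 * k * t + 4 < v6 rP \<and> v6 rP \<le> S"
                and f6: "\<And>x. x \<notin> mv (find_prime k) \<Longrightarrow> v6 x = v5 x" "\<And>r. r \<notin> ma (find_prime k) \<Longrightarrow> a6 r = a5 r"
              have v6: "v6 rT = t" using v5 f6 by auto
              show "runs (Sq (inverses k) (finish_setup k)) v6 a6 (5 * (k * t) + 14) ready"
              proof (rule runs_seq, rule runs_inverses[where v = v6 and a = a6 and p = "v6 rP" and t = t and k = k, OF refl v6])
                show "prime (v6 rP)" "k * t + 1 < v6 rP" "v6 rP \<le> X" using s6 kt bnd(6) by linarith+
                fix v7 a7 assume s7': "\<forall>j. 1 \<le> j \<longrightarrow> j \<le> k * t \<longrightarrow> (a7 aINV j * j) mod v6 rP = 1"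
                  and f7: "\<And>x. x \<notin> mv (inverses k) \<Longrightarrow> v7 x = v6 x" "\<And>r. r \<notin> ma (inverses k) \<Longrightarrow> a7 r = a6 r"
                show "runs (finish_setup k) v7 a7 5 ready"
                proof (rule s7)
                  show "\<forall>j. 1 \<le> j \<longrightarrow> j \<le> k * t \<longrightarrow> (a7 aINV j * j) mod v7 rP = 1" using s7' f7 by simp
                  show "v7 rN = n" "v7 rT = t" "v7 rRD = K" "v7 rB = 2 * t + 1" "v7 rNM = NM" "v7 0 = 0"
                    using v5 s5 f6 f7 by auto
                  show "prime (v7 rP)" "4 * k * t + 4 < v7 rP" "v7 rP \<le> S" using s6 f7 by auto
                  show "\<forall>i<k. a7 aTS i = inp (Suc i)" "\<forall>i<n. a7 aXS i = (if inp (i + (k + 1)) \<le> t then inp (i + (k + 1)) else 0)"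
                    "\<forall>i. 2 ^ i < 8 * NM \<longrightarrow> a7 aPOW i = 2 ^ i" "a7 aRND = (\<lambda>_. 0)" using A5 s5 f6 f7 by auto
                qed
              qed simp
            qed simp
          qed simp
        qed simp
      qed simp_all
    qed simp_all
  qed (simp_all add: pre_cost_def)
qed

end

context solver
begin

lemma runs_rounds:
  assumes g: "glob v a" and v: "v rRD = K" "v 0 = 0" "K < X"
  shows "runs (rounds k) v a (K * (round_cost + 4) + 3)
    (\<lambda>v' a'. v' 0 = (if \<forall>rd<K. int p dvd solutions k x (wt rd) n tvec then 0 else 1))"
proof -
  have "runs (rounds k) v a ((\<Sum>j<K. round_cost + 4) + 3)
    (\<lambda>v' a'. v' 0 = (if \<forall>rd<K. int p dvd solutions k x (wt rd) n tvec then 0 else 1))"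
    unfolding rounds_def
  proof (rule runs_For[where Inv = "\<lambda>j v' a'. v' 0 = (if \<forall>rd<j. int p dvd solutions k x (wt rd) n tvec then 0 else 1)"])
    fix j v' a' assume j: "j < K" and I: "v' 0 = (if \<forall>rd<j. int p dvd solutions k x (wt rd) n tvec then 0 else 1)"
      and vj: "v' rRound = j" and f: "\<And>x. x \<notin> mv (round_cmd k) \<Longrightarrow> x \<noteq> rRound \<Longrightarrow> v' x = v x"
        "\<And>r. r \<notin> ma (round_cmd k) \<Longrightarrow> a' r = a r"
    have "glob v' a'" by (rule glob_frame[OF g]) (use f in auto)
    from runs_round[OF this vj]
    show "runs (round_cmd k) v' a' round_cost (\<lambda>v'' a''. (v''(rRound := Suc j)) 0 =
        (if \<forall>rd<Suc j. int p dvd solutions k x (wt rd) n tvec then 0 else 1))"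
      by (rule runs_weaken) (use I in \<open>auto simp: less_Suc_eq\<close>)
  qed (use v in auto)
  then show ?thesis by (rule runs_time) simp
qed

end

section \<open>Summing the costs of a round\<close>

lemma sum_odd_even:
  fixes f :: "nat \<Rightarrow> nat"
  shows "N \<ge> 1 \<Longrightarrow> (\<Sum>i = 1..<2 * N. f i) = (\<Sum>j<N. f (2 * j + 1)) + (\<Sum>j = 1..<N. f (2 * j))"
proof (induction N rule: nat_induct_at_least)
  case (Suc N)
  have "{1..<2 * Suc N} = insert (2 * N) (insert (2 * N + 1) {1..<2 * N})" using Suc(1) by auto
  then have "(\<Sum>i = 1..<2 * Suc N. f i) = f (2 * N) + (f (2 * N + 1) + (\<Sum>i = 1..<2 * N. f i))" by simp
  moreover have "(\<Sum>j = 1..<Suc N. f (2 * j)) = (\<Sum>j = 1..<N. f (2 * j)) + f (2 * N)"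
    using Suc(1) by simp
  ultimately show ?case using Suc.IH by simp
qed (simp add: numeral_2_eq_2)

text \<open>Odd numbers contribute 1 each, and the even ones are doubled copies of the lower half of
  the range. The blocks of the online convolution thus have nearly linear total length.\<close>

lemma sum_lowbit_le: "(\<Sum>i = 1..<2 ^ m. lowbit i) \<le> m * 2 ^ m"
proof (induction m)
  case (Suc m)
  have "(\<Sum>i = 1..<2 ^ Suc m. lowbit i) = (\<Sum>j<2 ^ m. lowbit (2 * j + 1)) + (\<Sum>j = 1..<2 ^ m. lowbit (2 * j))"
    using sum_odd_even[of "2 ^ m" lowbit] by simp
  also have "(\<Sum>j<2 ^ m. lowbit (2 * j + 1)) = 2 ^ m"
  proof -
    have "lowbit (2 * j + 1) = 1" for j by (subst lowexp.simps) simp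
    then show ?thesis by simp
  qed
  also have "(\<Sum>j = 1..<2 ^ m. lowbit (2 * j)) = (\<Sum>j = 1..<2 ^ m. 2 * lowbit j)"
  proof (intro sum.cong refl)
    fix j :: nat assume "j \<in> {1..<2 ^ m}"
    then show "lowbit (2 * j) = 2 * lowbit j" by (subst lowexp.simps) simp
  qed
  also have "\<dots> = 2 * (\<Sum>j = 1..<2 ^ m. lowbit j)" by (simp add: sum_distrib_left)
  finally show ?case using Suc by (simp add: algebra_simps)
qed simp

text \<open>The recursion depth is only logarithmic in \<open>v\<close>, so padding enlarges the
  arrays by at most \<open>2 ^ nbits v \<le> 2 * m\<close>. Of the three factors \<open>m\<close>,
  one pays for the levels, one for the stages of a level and one for this padding.\<close>

lemma mul_cost_le:
  assumes "v < m"
  shows "mul_cost v \<le> 1200 * m ^ 3 * 2 ^ v"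
proof -
  have m1: "1 \<le> m" using assms by simp
  have P: "(1::nat) \<le> 2 ^ v" by simp
  have nb: "2 ^ nbits v \<le> 2 * m"
  proof (cases "v = 0")
    case True
    then show ?thesis using m1 nbits_le[of 0] by simp
  next
    case False
    then show ?thesis using pow_nbits_le[of v] assms by linarith
  qed
  have a: "2 * nbits v + 1 \<le> 2 * m" using nbits_le[of v] assms by linarith
  have mm: "m \<le> m * m" using m1 by simp
  have "2 ^ nbits v * rowlen v \<le> 2 * m * (4 * 2 ^ v)"
    unfolding rowlen_def by (rule mult_le_mono[OF nb]) (simp add: power_add)
  also have "2 * m * (4 * 2 ^ v) = 8 * (m * 2 ^ v)" by simp
  finally have "2 ^ nbits v * rowlen v \<le> 8 * (m * 2 ^ v)" .
  moreover have "1 \<le> m * 2 ^ v" using mult_le_mono[OF m1 P] by (simp only: mult_1_left)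
  ultimately have b: "20 * (2 ^ nbits v * rowlen v) + 20 \<le> 180 * (m * 2 ^ v)" by linarith
  have "(v + 3) * (20 * (2 ^ nbits v * rowlen v) + 20) + 60 \<le> 3 * m * (180 * (m * 2 ^ v)) + 60"
    by (intro add_right_mono mult_le_mono[OF _ b]) (use assms in linarith)
  also have "\<dots> = 540 * (m * m * 2 ^ v) + 60" by simp
  also have "\<dots> \<le> 600 * (m * m * 2 ^ v)"
  proof -
    have "1 * 1 \<le> m * m * 2 ^ v" by (rule mult_le_mono) (use m1 P mm in linarith)+
    then show ?thesis by linarith
  qed
  finally have "mul_cost v \<le> 2 * m * (600 * (m * m * 2 ^ v))" unfolding mul_cost_def by (intro mult_le_mono a)
  then show ?thesis by (simp add: power3_eq_cube algebra_simps)
qed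

definition round_bound :: "nat \<Rightarrow> nat \<Rightarrow> nat \<Rightarrow> nat" where
  "round_bound k n t = 1300 * nbits ((2 * t + 1) ^ k) ^ 4 * 2 ^ nbits ((2 * t + 1) ^ k) +
     12 * (2 ^ k * t ^ k * nbits t) + 20 * n + 30 * (2 * t + 1) ^ k + 60"

context solver
begin

lemma step_cost_le:
  assumes "0 < i" "i < B ^ k"
  shows "step_cost i \<le> 1300 * nbits (B ^ k) ^ 3 * lowbit i"
proof -
  let ?v = "lowexp i" and ?m = "nbits (B ^ k)"
  have "2 ^ ?v \<le> B ^ k" using lowbit_le[OF assms(1)] assms(2) by linarith
  then have v: "?v < ?m" by (simp add: less_nbits)
  then have "1 \<le> ?m" by simp
  then have "?m \<le> ?m ^ 3" "1 \<le> ?m ^ 3" by (simp_all add: self_le_power)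
  then have c: "50 + 3 * ?v + 40 \<le> 100 * ?m ^ 3" using v by linarith
  have "step_cost i = mul_cost ?v + (50 * 2 ^ ?v + (3 * ?v + 40) * 1)" by (simp add: step_cost_def)
  also have "\<dots> \<le> 1200 * ?m ^ 3 * 2 ^ ?v + (50 * 2 ^ ?v + (3 * ?v + 40) * 2 ^ ?v)"
    by (intro add_mono mul_cost_le[OF v] order_refl mult_le_mono2) simp
  also have "\<dots> = 1200 * ?m ^ 3 * 2 ^ ?v + (50 + 3 * ?v + 40) * 2 ^ ?v" by (simp add: algebra_simps)
  also have "\<dots> \<le> 1200 * ?m ^ 3 * 2 ^ ?v + 100 * ?m ^ 3 * 2 ^ ?v"
    by (intro add_left_mono mult_le_mono1 c)
  finally show ?thesis by (simp add: algebra_simps)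
qed

text \<open>As nonzero elements are distinct, the sum is at most one over all numbers up to
  \<open>t\<close>. There \<open>(t div z + 1) ^ k\<close> is at most
  \<open>2 ^ k * t ^ (k - 1) * (t div z)\<close>, and the last factor sums harmonically.\<close>

lemma elem_cost_le:
  assumes inj: "\<And>i j. i < n \<Longrightarrow> j < n \<Longrightarrow> x i = x j \<Longrightarrow> x i \<noteq> 0 \<Longrightarrow> i = j"
  shows "elem_cost \<le> 2 ^ k * t ^ k * nbits t"
proof -
  let ?A = "{e. e < n \<and> x e \<noteq> 0}"
  have pk: "y ^ k = y ^ (k - 1) * y" for y :: nat using k by (cases k) auto
  have "elem_cost = (\<Sum>e\<in>?A. (t div x e + 1) ^ k)"
    unfolding elem_cost_def by (rule sum.mono_neutral_cong_right) auto
  also have "\<dots> = (\<Sum>z\<in>x ` ?A. (t div z + 1) ^ k)"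
    by (subst sum.reindex) (auto simp: inj_on_def inj)
  also have "\<dots> \<le> (\<Sum>z\<in>x ` ?A. 2 ^ k * t ^ (k - 1) * (t div z))"
  proof (rule sum_mono)
    fix z assume "z \<in> x ` ?A"
    then have z: "0 < z" "z \<le> t" using x by auto
    let ?q = "t div z"
    have q: "1 \<le> ?q" "?q \<le> t" using z by (simp_all add: Suc_le_eq div_greater_zero_iff)
    have "(?q + 1) ^ k \<le> (2 * ?q) ^ k" using q by (intro power_mono) auto
    also have "\<dots> = 2 ^ k * (?q ^ (k - 1) * ?q)" by (simp only: power_mult_distrib pk[of ?q])
    also have "\<dots> \<le> 2 ^ k * (t ^ (k - 1) * ?q)" using q by (intro mult_le_mono2 mult_le_mono1 power_mono) auto
    finally show "(?q + 1) ^ k \<le> 2 ^ k * t ^ (k - 1) * ?q" by (simp add: mult.assoc)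
  qed
  also have "\<dots> \<le> (\<Sum>z = 1..<2 ^ nbits t. 2 ^ k * t ^ (k - 1) * (t div z))"
  proof (rule sum_mono2)
    have "x e < 2 ^ nbits t" if "e < n" for e using x[OF that] less_pow_nbits[of t] by (rule le_less_trans)
    then show "x ` ?A \<subseteq> {1..<2 ^ nbits t}" by auto
  qed auto
  also have "\<dots> = 2 ^ k * t ^ (k - 1) * (\<Sum>z = 1..<2 ^ nbits t. t div z)" by (simp only: sum_distrib_left)
  also have "\<dots> \<le> 2 ^ k * t ^ (k - 1) * (nbits t * t)" by (intro mult_le_mono2 sum_div_le)
  also have "\<dots> = 2 ^ k * t ^ k * nbits t" unfolding pk[of t] by (simp only: mult.assoc mult.left_commute mult.commute)
  finally show ?thesis .
qed

lemma round_cost_le: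
  assumes inj: "\<And>i j. i < n \<Longrightarrow> j < n \<Longrightarrow> x i = x j \<Longrightarrow> x i \<noteq> 0 \<Longrightarrow> i = j"
  shows "round_cost \<le> round_bound k n t"
proof -
  let ?m = "nbits (B ^ k)"
  have "(\<Sum>i = 1..<B ^ k. step_cost i) \<le> (\<Sum>i = 1..<B ^ k. 1300 * ?m ^ 3 * lowbit i)"
    by (intro sum_mono step_cost_le) auto
  also have "\<dots> = 1300 * ?m ^ 3 * (\<Sum>i = 1..<B ^ k. lowbit i)" by (simp only: sum_distrib_left)
  also have "\<dots> \<le> 1300 * ?m ^ 3 * (\<Sum>i = 1..<2 ^ ?m. lowbit i)"
    using less_pow_nbits[of "B ^ k"] by (intro mult_le_mono2 sum_mono2) auto
  also have "\<dots> \<le> 1300 * ?m ^ 3 * (?m * 2 ^ ?m)" by (intro mult_le_mono2 sum_lowbit_le)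
  also have "\<dots> = 1300 * ?m ^ 4 * 2 ^ ?m" by (simp add: power4_eq_xxxx power3_eq_cube)
  finally have s: "(\<Sum>i = 1..<B ^ k. step_cost i) \<le> 1300 * ?m ^ 4 * 2 ^ ?m" .
  have e: "elem_cost \<le> 2 ^ k * t ^ k * nbits t" by (rule elem_cost_le) (rule inj)
  show ?thesis
    unfolding round_cost_def round_bound_def B[symmetric]
    by (intro add_right_mono add_mono[OF s mult_le_mono2[OF e]])
qed

end

lemma solutions_cong_elems:
  "(\<And>l. l < j \<Longrightarrow> x l = x' l) \<Longrightarrow> solutions k x r j a = solutions k x' r j a"
  by (induction j arbitrary: a) (auto simp: shift_def intro!: sum.cong)

context input
begin

section \<open>The answer as a function of the tape\<close>

definition els :: "nat \<Rightarrow> nat" where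
  "els i = (if inp (i + (k + 1)) \<le> t then inp (i + (k + 1)) else 0)"

definition tgt :: "nat \<Rightarrow> nat" where
  "tgt i = (if i < k then inp (Suc i) else 0)"

definition total_cost :: nat where
  "total_cost = pre_cost + 9 * (n * k * K) + K * (round_bound k n t + 4) + 20"

lemma index_less: "rd < r \<Longrightarrow> l < n \<Longrightarrow> i < k \<Longrightarrow> (rd * n + l) * k + i < n * k * r"
proof -
  assume h: "rd < r" "l < n" "i < k"
  have "(rd * n + l) * k + i < (rd * n + l + 1) * k" using h by simp
  also have "\<dots> \<le> (Suc rd * n) * k" using h by (intro mult_le_mono1) simp
  also have "\<dots> \<le> (r * n) * k" using h by (intro mult_le_mono1) simp
  finally show ?thesis by (simp add: ac_simps)
qed

text \<open>\<open>\<tau>\<close> and \<open>p\<close> are chosen before the tape, so the answer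
  depends on tape cells fixed in advance, spaced 9 apart; the probability of an error can then be
  computed from the product distribution.\<close>

lemma exec_program:
  assumes E: "plv (program k c) \<le> E"
    and init: "regs s0 = (\<lambda>_. 0)" "\<And>i. i < base \<Longrightarrow> mem s0 i = inp i" "\<And>i. base \<le> i \<Longrightarrow> mem s0 i = 0"
    and inj: "\<And>i j. i < n \<Longrightarrow> j < n \<Longrightarrow> inp (i + (k + 1)) = inp (j + (k + 1)) \<Longrightarrow> i = j"
  shows "\<exists>\<tau> p. prime p \<and> 4 * k * t + 4 < p \<and> p \<le> X \<and> \<tau> \<le> pre_cost + 4 \<and>
    (\<forall>\<omega>. \<exists>m s'. m \<le> total_cost \<and> exec w \<omega> 0 (program k c) s0 m s' \<and>
      regs s' 0 = (if \<forall>rd<K. int p dvd solutions k els (\<lambda>l i. int (\<omega> (\<tau> + 9 * ((rd * n + l) * k + i)) mod p)) n tgt then 0 else 1))"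
proof -
  have pl: "plv (cc (pre k c)) \<le> E" "plv draw \<le> E" "plv (cc (rounds k)) \<le> E" "1 \<le> E"
    using E by (simp_all add: program_def)
  have Xw: "X \<le> 2 ^ w" using pow_le[OF pl(4)] by simp
  let ?v1 = "(\<lambda>_. 0)(1 := base)" and ?a1 = "\<lambda>_ _. 0 :: nat"
  let ?s1 = "s0\<lparr>regs := ?v1\<rparr>"
  have bX: "base < X" using bnd(1) base by simp
  have b1: "n + (k + 1) < 2 ^ w" "k + 1 < 2 ^ w" using bX Xw base by simp_all
  have e1: "exec w \<omega> \<tau> (Assign 1 (Bin Plus (Load (Const 0)) (Const (k + 1)))) s0 1 ?s1" for \<omega> \<tau>
    by (rule exec_dstep) (use init(1) init(2)[of 0] inp(1) base b1 in \<open>simp_all add: ac_simps\<close>)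
  have st1: "st ?s1 ?v1 ?a1"
    using init bX X2 by (auto simp: cond_st_def view_def fun_eq_iff)
  \<comment> \<open>\<open>m1\<close> is the same for all tapes, and so is the time at which drawing
    starts.\<close>
  from runsE[OF runs_pre[of ?v1 ?a1] pl(1) st1]
  obtain m1 s2 v2 a2 where 2: "m1 \<le> pre_cost" "\<And>\<omega> \<tau>. exec w \<omega> \<tau> (cc (pre k c)) ?s1 m1 s2" "st s2 v2 a2" "ready v2 a2"
    by (metis fun_upd_other zero_neq_one)
  define p where "p = v2 rP"
  have p: "prime p" "4 * k * t + 4 < p" "p \<le> S" using 2(4) by (auto simp: ready_def p_def)
  have pX: "0 < p" "p \<le> X" using p bnd(6) by auto
  have kp: "k * t < p" "2 < p" using p(2) by auto
  let ?R = "\<lambda>\<omega> i. if 0 \<le> i \<and> i < n * k * K then \<omega> (2 + m1 + 1 + 9 * (i - 0) + 1) mod p else a2 aRND i"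
  have main: "\<exists>m s'. m \<le> total_cost \<and> exec w \<omega> 0 (program k c) s0 m s' \<and>
      regs s' 0 = (if \<forall>rd<K. int p dvd solutions k els (\<lambda>l i. int (\<omega> (m1 + 4 + 9 * ((rd * n + l) * k + i)) mod p)) n tgt then 0 else 1)" for \<omega>
  proof -
    have "\<exists>s' v'. exec w \<omega> (2 + m1 + 1) draw s2 (9 * (n * k * K - 0) + 1) s' \<and> st s' v' (a2(aRND := ?R \<omega>)) \<and>
      (\<forall>x. x \<noteq> rI \<longrightarrow> x \<noteq> 29 \<longrightarrow> v' x = v2 x)"
      by (rule exec_draw[OF pl(2) pX bnd(7) 2(3)]) (use 2(4) in \<open>auto simp: ready_def p_def\<close>)
    then obtain s3 v3 where 3: "exec w \<omega> (2 + m1 + 1) draw s2 (9 * (n * k * K - 0) + 1) s3" "st s3 v3 (a2(aRND := ?R \<omega>))"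
      "\<And>x. x \<noteq> rI \<Longrightarrow> x \<noteq> 29 \<Longrightarrow> v3 x = v2 x" by blast
    interpret sv: solver w X E base inp k n t p "2 * t + 1" "a2 aXS" "a2 aTS" "?R \<omega>" "a2 aINV" "a2 aPOW"
    proof unfold_locales
      show "k \<ge> 1" "prime p" "p > 2" "k * t < p" "p \<le> X" using k p kp pX by auto
      show "a2 aXS j \<le> t" if "j < n" for j using 2(4) that by (simp add: ready_def)
      show "?R \<omega> j < p" for j using pX 2(4) by (simp add: ready_def)
      show "a2 aINV j * j mod p = 1" if "1 \<le> j" "j \<le> k * t" for j using 2(4) that by (simp add: ready_def p_def)
      show "a2 aPOW i = 2 ^ i" if "2 ^ i < 8 * NM" for i using 2(4) that by (simp add: ready_def)
      show "8 * NM < X" using bnd(4) by simp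
      show "n < X" using bnd(1) by simp
      show "a2 aTS i \<le> t" if "i < k" for i using 2(4) inp(2) that by (simp add: ready_def)
      fix v assume v: "(2::nat) ^ v \<le> NM"
      have "(2::nat) ^ nbits v \<le> 2 ^ v" using nbits_le by (rule power_increasing) simp
      then have nb: "2 ^ nbits v \<le> NM" using v by (rule le_trans)
      have "2 ^ nbits v * rowlen v \<le> NM * (4 * NM)"
        unfolding rowlen_def by (rule mult_le_mono[OF nb]) (use v in \<open>simp add: power_add\<close>)
      then have "2 * (2 ^ nbits v * rowlen v) \<le> 2 * (NM * (4 * NM))" by (rule mult_le_mono2)
      also have "\<dots> = 8 * NM\<^sup>2" by (simp add: power2_eq_square)
      finally show "2 * (2 ^ nbits v * rowlen v) < X" using bnd(5) by (rule le_less_trans)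
    qed simp_all
    have g: "sv.glob v3 (a2(aRND := ?R \<omega>))"
      unfolding sv.glob_def using 2(4) 3(3) by (simp add: ready_def p_def)
    have v3: "v3 rRD = K" "v3 0 = 0" using 2(4) 3(3) by (simp_all add: ready_def)
    obtain m4 s4 v4 a4 where 4: "m4 \<le> K * (sv.round_cost + 4) + 3" "\<And>\<omega> \<tau>. exec w \<omega> \<tau> (cc (rounds k)) s3 m4 s4" "st s4 v4 a4"
      "v4 0 = (if \<forall>rd<K. int p dvd solutions k (a2 aXS) (sv.wt rd) n sv.tvec then 0 else 1)"
      by (rule runsE[OF sv.runs_rounds[OF g v3 bnd(3)] pl(3) 3(2)]) (rule that, assumption, blast, assumption, assumption)
    have x: "a2 aXS l = els l" if "l < n" for l using 2(4) that by (simp add: ready_def els_def)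
    have ts: "a2 aTS i = inp (Suc i)" if "i < k" for i using 2(4) that by (simp add: ready_def)
    have tv: "sv.tvec = tgt"
    proof
      fix i
      show "sv.tvec i = tgt i" unfolding sv.tvec_def tgt_def using ts[of i] by (cases "i < k") simp_all
    qed
    have sol: "solutions k (a2 aXS) (sv.wt rd) n sv.tvec =
      solutions k els (\<lambda>l i. int (\<omega> (m1 + 4 + 9 * ((rd * n + l) * k + i)) mod p)) n tgt" if rd: "rd < K" for rd
    proof -
      have "solutions k (a2 aXS) (sv.wt rd) n sv.tvec = solutions k els (sv.wt rd) n tgt"
        unfolding tv by (rule solutions_cong_elems) (rule x)
      also have "\<dots> = solutions k els (\<lambda>l i. int (\<omega> (m1 + 4 + 9 * ((rd * n + l) * k + i)) mod p)) n tgt"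
      proof (rule solutions_cong)
        fix l i assume "l < n" "i < k"
        from index_less[OF rd this] have I: "0 \<le> (rd * n + l) * k + i \<and> (rd * n + l) * k + i < n * k * K"
          by (simp only: le0 simp_thms)
        have e: "2 + m1 + 1 + 9 * ((rd * n + l) * k + i - 0) + 1 = m1 + 4 + 9 * ((rd * n + l) * k + i)" by simp
        show "sv.wt rd l i = int (\<omega> (m1 + 4 + 9 * ((rd * n + l) * k + i)) mod p)"
          unfolding sv.wt_def if_P[OF I] e ..
      qed
      finally show ?thesis .
    qed
    have "sv.round_cost \<le> round_bound k n t"
      by (rule sv.round_cost_le) (use x inj in \<open>auto simp: els_def split: if_splits\<close>)
    then have m4: "m4 \<le> K * (round_bound k n t + 4) + 3" using 4(1) by (meson add_le_mono1 le_trans mult_le_mono2)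
    have "exec w \<omega> 0 (program k c) s0 (1 + 1 + (m1 + 1 + (9 * (n * k * K - 0) + 1 + 1 + m4))) s4"
      unfolding program_def
    proof (rule exec_Seq[OF e1], rule exec_Seq[OF 2(2)], rule exec_Seq)
      show "exec w \<omega> (0 + 1 + 1 + m1 + 1) draw s2 (9 * (n * k * K - 0) + 1) s3" using 3(1) by simp
    qed (rule 4(2))
    moreover have "1 + 1 + (m1 + 1 + (9 * (n * k * K - 0) + 1 + 1 + m4)) \<le> total_cost"
      unfolding total_cost_def using 2(1) m4 by simp
    moreover have "regs s4 0 = v4 0" using 4(3) by (simp add: cond_st_def)
    ultimately show ?thesis using 4(4) sol by (intro exI[of _ "1 + 1 + (m1 + 1 + (9 * (n * k * K - 0) + 1 + 1 + m4))"] exI[of _ s4]) simp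
  qed
  show ?thesis
    by (intro exI[of _ "m1 + 4"] exI[of _ p]) (use p pX 2(1) main in auto)
qed

text \<open>Round \<open>r\<close> reads tape cells from \<open>\<tau> + 9 * (n * k * r)\<close> on,
  the earlier rounds only cells below, so the rounds are independent. A single one fails with
  probability at most \<open>k * t * (2 / p)\<close>, which is at most 1/2 by the choice of
  \<open>p\<close>.\<close>

lemma prob_rounds:
  assumes p: "prime p" "p \<le> 2 ^ w" "4 * k * t < p" and T: "\<tau> + 9 * (n * k * r) \<le> T" and sol: "solvable k els n tgt"
  shows "measure_pmf.prob (tape_pmf w T) {\<omega>. \<forall>rd<r. int p dvd solutions k els
      (\<lambda>l i. int (\<omega> (\<tau> + 9 * ((rd * n + l) * k + i)) mod p)) n tgt} \<le> (1 / 2) ^ r"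
  using T
proof (induction r)
  case (Suc r)
  let ?F = "\<lambda>rd \<omega>. int p dvd solutions k els (\<lambda>l i. int (\<omega> (\<tau> + 9 * ((rd * n + l) * k + i)) mod p)) n tgt"
  let ?b = "\<tau> + 9 * (n * k * r)"
  have bT: "?b \<le> T" using Suc.prems by simp
  have split: "{..<T} = {..<?b} \<union> {?b..<T}" using bT by auto
  have ge: "?b \<le> \<tau> + 9 * ((r * n + l) * k + i)" for l i
  proof -
    have "(r * n + l) * k + i = n * k * r + (l * k + i)" by (simp add: algebra_simps)
    then show ?thesis by simp
  qed
  have lt: "\<tau> + 9 * ((r * n + l) * k + i) < T" if "l < n" "i < k" for l i
  proof -
    have "9 * ((r * n + l) * k + i) < 9 * (n * k * Suc r)"
      by (rule mult_strict_left_mono[OF index_less]) (use that in simp_all)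
    then show ?thesis by (rule less_le_trans[OF add_strict_left_mono Suc.prems])
  qed
  have "measure_pmf.prob (tape_pmf w T) {\<omega>. (\<forall>rd<r. ?F rd \<omega>) \<and> ?F r \<omega>} =
    measure_pmf.prob (tape_pmf w T) {\<omega>. \<forall>rd<r. ?F rd \<omega>} * measure_pmf.prob (tape_pmf w T) {\<omega>. ?F r \<omega>}"
    unfolding split
  proof (rule prob_Pi_indep)
    fix f g :: "nat \<Rightarrow> nat" assume fg: "\<And>i. i \<in> {..<?b} \<Longrightarrow> f i = g i"
    have "?F rd f = ?F rd g" if "rd < r" for rd
    proof -
      have "solutions k els (\<lambda>l i. int (f (\<tau> + 9 * ((rd * n + l) * k + i)) mod p)) n tgt =
        solutions k els (\<lambda>l i. int (g (\<tau> + 9 * ((rd * n + l) * k + i)) mod p)) n tgt"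
      proof (rule solutions_cong)
        fix l i assume li: "l < n" "i < k"
        have "\<tau> + 9 * ((rd * n + l) * k + i) < ?b"
          by (rule add_strict_left_mono[OF mult_strict_left_mono[OF index_less[OF that li]]]) simp
        then have "f (\<tau> + 9 * ((rd * n + l) * k + i)) = g (\<tau> + 9 * ((rd * n + l) * k + i))"
          by (intro fg) (simp only: lessThan_iff)
        then show "int (f (\<tau> + 9 * ((rd * n + l) * k + i)) mod p) = int (g (\<tau> + 9 * ((rd * n + l) * k + i)) mod p)"
          by (simp only:)
      qed
      then show ?thesis by simp
    qed
    then show "(\<forall>rd<r. ?F rd f) = (\<forall>rd<r. ?F rd g)" by blast
  next
    fix f g :: "nat \<Rightarrow> nat" assume fg: "\<And>i. i \<in> {?b..<T} \<Longrightarrow> f i = g i"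
    have "solutions k els (\<lambda>l i. int (f (\<tau> + 9 * ((r * n + l) * k + i)) mod p)) n tgt =
      solutions k els (\<lambda>l i. int (g (\<tau> + 9 * ((r * n + l) * k + i)) mod p)) n tgt"
    proof (rule solutions_cong)
      fix l i assume li: "l < n" "i < k"
      have "f (\<tau> + 9 * ((r * n + l) * k + i)) = g (\<tau> + 9 * ((r * n + l) * k + i))"
        by (rule fg) (use ge lt[OF li] in \<open>simp only: atLeastLessThan_iff simp_thms\<close>)
      then show "int (f (\<tau> + 9 * ((r * n + l) * k + i)) mod p) = int (g (\<tau> + 9 * ((r * n + l) * k + i)) mod p)"
        by (simp only:)
    qed
    then show "?F r f = ?F r g" by simp
  qed auto
  also have "\<dots> \<le> (1 / 2) ^ r * (1 / 2)"
  proof (rule mult_mono)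
    show "measure_pmf.prob (tape_pmf w T) {\<omega>. \<forall>rd<r. ?F rd \<omega>} \<le> (1 / 2) ^ r" using Suc.IH bT by blast
    have "measure_pmf.prob (tape_pmf w T) {\<omega>. ?F r \<omega>} \<le> real (\<Sum>i<k. tgt i) * (2 / real p)"
    proof (rule prob_solutions_zero[where n = n, OF p(1,2) _ _ _ _ sol])
      fix l i l' i' assume h: "l < n" "i < k" "l' < n" "i' < k"
        "\<tau> + 9 * ((r * n + l) * k + i) = \<tau> + 9 * ((r * n + l') * k + i')"
      then have e: "i + (r * n + l) * k = i' + (r * n + l') * k" by simp
      then have "(i + (r * n + l) * k) mod k = (i' + (r * n + l') * k) mod k" "(i + (r * n + l) * k) div k = (i' + (r * n + l') * k) div k"
        by simp_all
      then show "l = l' \<and> i = i'" using h by simp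
    qed (use lt in auto)
    also have "\<dots> \<le> real (k * t) * (2 / real p)"
    proof -
      have "(\<Sum>i<k. tgt i) \<le> (\<Sum>i<k. t)" using inp(2) by (intro sum_mono) (simp add: tgt_def)
      then have "(\<Sum>i<k. tgt i) \<le> k * t" by simp
      then show ?thesis by (intro mult_right_mono of_nat_mono) auto
    qed
    also have "\<dots> \<le> 1 / 2"
    proof -
      have p0: "0 < real p" using p(3) by simp
      have "real (4 * k * t) \<le> real p" using p(3) by (simp only: of_nat_le_iff less_imp_le)
      then have "real (4 * k * t) / real p \<le> 1" using p0 by (simp only: divide_le_eq_1_pos)
      then have "real (4 * k * t) / real p / 2 \<le> 1 / 2" by (rule divide_right_mono) simp
      moreover have "real (k * t) * (2 / real p) = real (4 * k * t) / real p / 2" by simp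
      ultimately show ?thesis by (simp only:)
    qed
    finally show "measure_pmf.prob (tape_pmf w T) {\<omega>. ?F r \<omega>} \<le> 1 / 2" .
  qed auto
  finally have fin: "measure_pmf.prob (tape_pmf w T) {\<omega>. (\<forall>rd<r. ?F rd \<omega>) \<and> ?F r \<omega>} \<le> (1 / 2) ^ r * (1 / 2)" .
  have eq: "(\<forall>rd<Suc r. ?F rd \<omega>) \<longleftrightarrow> (\<forall>rd<r. ?F rd \<omega>) \<and> ?F r \<omega>" for \<omega> unfolding less_Suc_eq by blast
  show ?case unfolding eq power_Suc2 by (rule fin)
qed simp

end

section \<open>Solvability and running time\<close>

text \<open>\<open>g\<close> assigns a colour to each element, where colours from \<open>k\<close>
  on mean that the element is left out.\<close>

lemma solvable_iff: "solvable k x j a \<longleftrightarrow> (\<exists>g. \<forall>i. a i = (if i < k then \<Sum>l<j. if g l = i then x l else 0 else 0))"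
proof (induction j arbitrary: a)
  case 0
  then show ?case by (auto simp: fun_eq_iff)
next
  case (Suc j)
  show ?case
  proof
    assume "solvable k x (Suc j) a"
    then consider "solvable k x j a" | i where "i < k" "x j \<le> a i" "solvable k x j (a(i := a i - x j))" by auto
    then show "\<exists>g. \<forall>i. a i = (if i < k then \<Sum>l<Suc j. if g l = i then x l else 0 else 0)"
    proof cases
      case 1
      then obtain g where g: "\<forall>i. a i = (if i < k then \<Sum>l<j. if g l = i then x l else 0 else 0)" using Suc.IH by blast
      have "(\<Sum>l<j. if (g(j := k)) l = i then x l else 0) = (\<Sum>l<j. if g l = i then x l else 0)" for i
        by (intro sum.cong) auto
      then have "\<forall>i. a i = (if i < k then \<Sum>l<Suc j. if (g(j := k)) l = i then x l else 0 else 0)" using g by auto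
      then show ?thesis by blast
    next
      case (2 i)
      then obtain g where g: "\<forall>i'. (a(i := a i - x j)) i' = (if i' < k then \<Sum>l<j. if g l = i' then x l else 0 else 0)"
        using Suc.IH by blast
      have s: "(\<Sum>l<j. if (g(j := i)) l = i' then x l else 0) = (\<Sum>l<j. if g l = i' then x l else 0)" for i'
        by (intro sum.cong) auto
      have "a i' = (if i' < k then \<Sum>l<Suc j. if (g(j := i)) l = i' then x l else 0 else 0)" for i'
        using g[rule_format, of i'] 2(1,2) s[of i'] by (cases "i' = i") auto
      then show ?thesis by blast
    qed
  next
    assume "\<exists>g. \<forall>i. a i = (if i < k then \<Sum>l<Suc j. if g l = i then x l else 0 else 0)"
    then obtain g where "\<forall>i. a i = (if i < k then \<Sum>l<Suc j. if g l = i then x l else 0 else 0)" by blast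
    then have g: "a i = (if i < k then (\<Sum>l<j. if g l = i then x l else 0) + (if g j = i then x j else 0) else 0)" for i
      unfolding sum.lessThan_Suc by (rule spec)
    show "solvable k x (Suc j) a"
    proof (cases "g j < k \<and> x j \<noteq> 0")
      case False
      then have "a i = (if i < k then \<Sum>l<j. if g l = i then x l else 0 else 0)" for i using g[of i] by auto
      then show ?thesis using Suc.IH by auto
    next
      case True
      have "(a(g j := a (g j) - x j)) i = (if i < k then \<Sum>l<j. if g l = i then x l else 0 else 0)" for i
        using g[of i] True by (cases "i = g j") auto
      then have "solvable k x j (a(g j := a (g j) - x j))" using Suc.IH by blast
      then show ?thesis using True g[of "g j"] by auto
    qed
  qed
qed

text \<open>As the elements are distinct, disjoint subsets and colourings determine each other. A
  set with sum at most \<open>t\<close> contains no element above \<open>t\<close>, so zeroing these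
  loses no solution.\<close>

lemma solvable_k_subset_sum:
  assumes xs: "distinct xs" "set xs = Z" and t: "\<And>i. i < length ts \<Longrightarrow> ts ! i \<le> t"
  shows "solvable (length ts) (\<lambda>i. if i < length xs \<and> xs ! i \<le> t then xs ! i else 0) (length xs)
     (\<lambda>i. if i < length ts then ts ! i else 0) \<longleftrightarrow> k_subset_sum Z ts"
proof -
  let ?k = "length ts" and ?n = "length xs"
  let ?x = "\<lambda>i. if i < ?n \<and> xs ! i \<le> t then xs ! i else 0"
  let ?a = "\<lambda>i. if i < ?k then ts ! i else 0"
  have inj: "inj_on ((!) xs) {..<?n}" using xs(1) by (auto simp: inj_on_def nth_eq_iff_index_eq)
  have Z: "Z = (!) xs ` {..<?n}" using xs(2) by (auto simp: set_conv_nth)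
  show ?thesis
    unfolding solvable_iff
  proof
    assume "\<exists>g. \<forall>i. ?a i = (if i < ?k then \<Sum>l<?n. if g l = i then ?x l else 0 else 0)"
    then obtain g where g0: "\<forall>i. ?a i = (if i < ?k then \<Sum>l<?n. if g l = i then ?x l else 0 else 0)" by blast
    have g: "ts ! i = (\<Sum>l<?n. if g l = i then ?x l else 0)" if "i < ?k" for i
      using spec[OF g0, of i] unfolding if_P[OF that] .
    define S where "S = (\<lambda>i. (!) xs ` {l. l < ?n \<and> g l = i \<and> xs ! l \<le> t})"
    have "\<Sum>(S i) = ts ! i" if "i < ?k" for i
    proof -
      have "\<Sum>(S i) = (\<Sum>l | l < ?n \<and> g l = i \<and> xs ! l \<le> t. xs ! l)"
        unfolding S_def by (subst sum.reindex) (auto intro: inj_on_subset[OF inj])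
      also have "\<dots> = (\<Sum>l<?n. if g l = i then ?x l else 0)"
        by (rule sum.mono_neutral_cong_left) auto
      finally show ?thesis using g[OF that] by simp
    qed
    moreover have "S i \<subseteq> Z" for i using Z by (auto simp: S_def)
    moreover have "disjoint_family_on S {..<?k}"
      unfolding disjoint_family_on_def
    proof (intro ballI impI equals0I)
      fix i j z assume "i \<noteq> j" "z \<in> S i \<inter> S j"
      then obtain l l' where "l < ?n" "g l = i" "l' < ?n" "g l' = j" "xs ! l = xs ! l'" unfolding S_def by force
      then show False using \<open>i \<noteq> j\<close> nth_eq_iff_index_eq[OF xs(1)] by auto
    qed
    ultimately show "k_subset_sum Z ts" unfolding k_subset_sum_def by blast
  next
    assume "k_subset_sum Z ts"
    then obtain S where S: "\<And>i. i < ?k \<Longrightarrow> S i \<subseteq> Z" "\<And>i. i < ?k \<Longrightarrow> \<Sum>(S i) = ts ! i" "disjoint_family_on S {..<?k}"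
      unfolding k_subset_sum_def by blast
    define g where "g = (\<lambda>l. if \<exists>i<?k. xs ! l \<in> S i then (SOME i. i < ?k \<and> xs ! l \<in> S i) else ?k)"
    have g: "g l = i \<longleftrightarrow> xs ! l \<in> S i" if i: "i < ?k" for l i
    proof
      assume "g l = i"
      then have "\<exists>i<?k. xs ! l \<in> S i" using i by (auto simp: g_def split: if_splits)
      from someI_ex[OF this] show "xs ! l \<in> S i" using \<open>g l = i\<close> i by (auto simp: g_def split: if_splits)
    next
      assume l: "xs ! l \<in> S i"
      then have ex: "\<exists>i<?k. xs ! l \<in> S i" using i by blast
      from someI_ex[OF this] have "g l < ?k" "xs ! l \<in> S (g l)" using ex by (simp_all add: g_def)
      then show "g l = i" using S(3) l i by (auto simp: disjoint_family_on_def)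
    qed
    have "ts ! i = (\<Sum>l<?n. if g l = i then ?x l else 0)" if i: "i < ?k" for i
    proof -
      have fin: "finite (S i)" using S(1)[OF i] Z finite_subset by blast
      have le: "z \<le> t" if "z \<in> S i" for z
        using member_le_sum[OF that _ fin, of "\<lambda>z. z"] S(2)[OF i] t[OF i] by simp
      have "S i = (!) xs ` {l. l < ?n \<and> xs ! l \<in> S i}" using S(1)[OF i] Z by auto
      then have "\<Sum>(S i) = \<Sum>((!) xs ` {l. l < ?n \<and> xs ! l \<in> S i})" by simp
      also have "\<dots> = (\<Sum>l | l < ?n \<and> xs ! l \<in> S i. xs ! l)"
        by (subst sum.reindex) (auto intro: inj_on_subset[OF inj])
      also have "\<dots> = (\<Sum>l<?n. if g l = i then ?x l else 0)"
        by (rule sum.mono_neutral_cong_left) (auto simp: g[OF i] le)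
      finally show ?thesis using S(2)[OF i] by simp
    qed
    then show "\<exists>g. \<forall>i. ?a i = (if i < ?k then \<Sum>l<?n. if g l = i then ?x l else 0 else 0)"
      by (intro exI[of _ g]) auto
  qed
qed

section \<open>Asymptotic bounds on running time and word size\<close>

definition sieve_const :: "nat \<Rightarrow> nat" where
  "sieve_const k = 2 * ((4 * k + 4) * (3 * k + 4)) + 1"

definition pre_const :: "nat \<Rightarrow> nat" where
  "pre_const k = 5 * ((sieve_const k + 2) * sieve_const k) + 8 * (sieve_const k + 1) + 6 * sieve_const k + 5 * k + 7 * (2 * k + 4) + 5 + 7 + 9 * k + 60"

definition round_const :: "nat \<Rightarrow> nat" where
  "round_const k = 1300 * (2 * k + 1) ^ 4 * (2 * 3 ^ k) + 12 * 2 ^ k + 20 + 30 * 3 ^ k + 60"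

text \<open>Of the five logarithmic factors, three come from the multiplication, one from the online
  convolution and one from the number of rounds. The setup is cheaper, being dominated by the
  sieve.\<close>

lemma (in input) total_cost_le:
  fixes N l
  defines "N \<equiv> n + t ^ k + 1" and "l \<equiv> nbits N"
  shows "total_cost \<le> (pre_const k + 9 * (k * c) + c * (round_const k + 4) + 20) * (N * l ^ 5)"
proof -
  let ?Q = "N * l ^ 5"
  have N1: "1 \<le> N" by (simp add: N_def)
  have l1: "1 \<le> l" using less_nbits[of 0 N] N1 by (simp add: l_def)
  have Nl: "N < 2 ^ l" unfolding l_def by (rule less_pow_nbits)
  have lp: "1 \<le> l ^ i" for i using l1 by simp
  have lle: "l ^ i \<le> l ^ j" if "i \<le> j" for i j using that l1 by (intro power_increasing) auto
  have Q: "N * l ^ i \<le> ?Q" if "i \<le> 5" for i using lle[OF that] by (rule mult_le_mono2)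
  have Q0: "N \<le> ?Q" "N * l \<le> ?Q" "N * (l * l) \<le> ?Q" using Q[of 0] Q[of 1] Q[of 2] by (simp_all add: power2_eq_square)
  have Q1: "1 \<le> ?Q" using N1 Q0(1) by (rule le_trans)
  have lQ: "l \<le> ?Q"
  proof -
    have "l \<le> N * l" using N1 by simp
    then show ?thesis using Q0(2) by (rule le_trans)
  qed
  have tk: "t \<le> t ^ k" using k by (cases "t = 0") (auto intro: self_le_power)
  have tN: "t \<le> N" "t ^ k \<le> N" "n \<le> N" "n + t + 1 \<le> N" using tk by (simp_all add: N_def)
  have NM3: "NM \<le> 3 ^ k * N"
  proof (cases "t = 0")
    case True
    have "1 * 1 \<le> 3 ^ k * N" by (rule mult_le_mono) (use N1 in simp_all)
    then show ?thesis using True by simp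
  next
    case False
    then have "NM \<le> (3 * t) ^ k" by (intro power_mono) auto
    also have "\<dots> = 3 ^ k * t ^ k" by (simp add: power_mult_distrib)
    also have "\<dots> \<le> 3 ^ k * N" using tN by simp
    finally show ?thesis .
  qed
  have NM1: "1 \<le> NM" by simp
  have p3: "(3::nat) ^ k \<le> 2 ^ (2 * k)" unfolding power_mult by (rule power_mono) simp_all
  have NMl: "NM < 2 ^ (2 * k + l)"
  proof -
    have "NM \<le> 2 ^ (2 * k) * N" by (rule le_trans[OF NM3 mult_le_mono1[OF p3]])
    also have "\<dots> < 2 ^ (2 * k) * 2 ^ l" using Nl by simp
    finally show ?thesis by (simp add: power_add)
  qed
  have kl: "k \<le> k * l" using l1 by simp
  have m: "nbits NM \<le> (2 * k + 1) * l"
  proof -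
    have "nbits NM \<le> 2 * k + l" by (rule nbits_le_pow[OF NMl])
    also have "\<dots> \<le> 2 * (k * l) + l" using kl by linarith
    finally show ?thesis by (simp add: algebra_simps)
  qed
  have pm: "2 ^ nbits NM \<le> 2 * 3 ^ k * N"
  proof -
    have "2 ^ nbits NM \<le> 2 * NM" using NM1 by (intro pow_nbits_le) simp
    also have "\<dots> \<le> 2 * (3 ^ k * N)" by (rule mult_le_mono2[OF NM3])
    finally show ?thesis by (simp add: mult.assoc)
  qed
  have LGl: "LG + k \<le> (3 * k + 4) * l" "LG \<le> (2 * k + 4) * l"
  proof -
    have "8 * NM - 1 < 8 * 2 ^ (2 * k + l)" using NMl by (simp add: less_imp_diff_less)
    then have "8 * NM - 1 < 2 ^ (3 + (2 * k + l))" by (simp add: power_add)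
    then have "LG \<le> 3 + (2 * k + l)" by (rule nbits_le_pow)
    moreover have "3 + (2 * k + l) \<le> 3 * l + (2 * (k * l) + l)" using kl l1 by linarith
    ultimately have a: "LG \<le> 4 * l + 2 * (k * l)" by linarith
    then show "LG \<le> (2 * k + 4) * l" by (simp add: algebra_simps)
    have "LG + k \<le> 4 * l + 2 * (k * l) + k * l" by (rule add_mono[OF a kl])
    also have "\<dots> = (3 * k + 4) * l" by (simp add: algebra_simps)
    finally show "LG + k \<le> (3 * k + 4) * l" .
  qed
  let ?s = "sieve_const k"
  have S: "S \<le> ?s * (N * l)"
  proof -
    have "4 * k * t + 4 \<le> 4 * k * N + 4 * N" using N1 tN by (intro add_mono) simp_all
    then have "4 * k * t + 4 \<le> (4 * k + 4) * N" by (simp add: algebra_simps)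
    then have "(4 * k * t + 4) * (LG + k) \<le> (4 * k + 4) * N * ((3 * k + 4) * l)" using LGl(1) by (rule mult_le_mono)
    then have "S \<le> 2 * ((4 * k + 4) * N * ((3 * k + 4) * l)) + 1" unfolding sieve_size_def by simp
    also have "\<dots> = 2 * ((4 * k + 4) * (3 * k + 4)) * (N * l) + 1" by (simp only: mult.assoc mult.left_commute mult.commute)
    also have "\<dots> \<le> ?s * (N * l)"
    proof -
      have "1 * 1 \<le> N * l" by (rule mult_le_mono[OF N1 l1])
      then show ?thesis unfolding sieve_const_def add_mult_distrib by simp
    qed
    finally show ?thesis .
  qed
  have nS: "nbits S \<le> (?s + 2) * l"
  proof -
    have "?s * (N * l) < 2 ^ ?s * (2 ^ l * 2 ^ l)"
    proof (rule mult_strict_mono)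
      show "?s < 2 ^ ?s" by (rule less_exp)
      show "N * l < 2 ^ l * 2 ^ l" by (rule mult_strict_mono[OF Nl less_exp]) simp_all
    qed simp_all
    then have "S < 2 ^ (?s + (l + l))" unfolding power_add by (rule le_less_trans[OF S])
    then have "nbits S \<le> ?s + (l + l)" by (rule nbits_le_pow)
    also have "\<dots> \<le> ?s * l + (l + l)" using l1 by (intro add_right_mono) simp
    also have "\<dots> = (?s + 2) * l" by (simp add: algebra_simps)
    finally show ?thesis .
  qed
  have SQ: "S \<le> ?s * ?Q" by (rule le_trans[OF S mult_le_mono2[OF Q0(2)]])
  have sum: "(\<Sum>d<S + 1. 5 * (S div d) + 8) \<le> (5 * ((?s + 2) * ?s) + 8 * (?s + 1)) * ?Q"
  proof -
    have "(\<Sum>d<S + 1. S div d) \<le> (\<Sum>d = 1..<2 ^ nbits S. S div d)"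
    proof -
      have "(\<Sum>d<S + 1. S div d) = (\<Sum>d = 1..<S + 1. S div d)"
        by (rule sum.mono_neutral_right) (auto simp: not_le)
      also have "\<dots> \<le> (\<Sum>d = 1..<2 ^ nbits S. S div d)"
        using less_pow_nbits[of S] by (intro sum_mono2) auto
      finally show ?thesis .
    qed
    also have "\<dots> \<le> nbits S * S" by (rule sum_div_le)
    also have "\<dots> \<le> (?s + 2) * l * (?s * (N * l))" by (rule mult_le_mono[OF nS S])
    also have "\<dots> = (?s + 2) * ?s * (N * (l * l))" by (simp only: mult.assoc mult.left_commute mult.commute)
    also have "\<dots> \<le> (?s + 2) * ?s * ?Q" by (rule mult_le_mono2[OF Q0(3)])
    finally have a: "(\<Sum>d<S + 1. S div d) \<le> (?s + 2) * ?s * ?Q" .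
    have "(\<Sum>d<S + 1. 5 * (S div d) + 8) = 5 * (\<Sum>d<S + 1. S div d) + 8 * (S + 1)"
      unfolding sum.distrib sum_distrib_left[symmetric] by simp
    also have "\<dots> \<le> 5 * ((?s + 2) * ?s * ?Q) + 8 * (?s * ?Q + ?Q)"
      by (intro add_mono mult_le_mono2 a SQ Q1)
    also have "\<dots> = (5 * ((?s + 2) * ?s) + 8 * (?s + 1)) * ?Q"
      by (simp only: add_mult_distrib add_mult_distrib2 mult.assoc mult_1_left)
    finally show ?thesis .
  qed
  have nl: "nbits (n + t + 1) \<le> l" unfolding l_def by (rule nbits_mono[OF tN(4)])
  have pre: "pre_cost \<le> pre_const k * ?Q"
  proof -
    have c1: "6 * S \<le> 6 * ?s * ?Q" using SQ by (simp add: mult.assoc)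
    have c2: "5 * (k * t) \<le> 5 * k * ?Q" using le_trans[OF tN(1) Q0(1)] by (simp add: mult.assoc)
    have c3: "7 * LG \<le> 7 * (2 * k + 4) * ?Q"
      unfolding mult.assoc by (rule mult_le_mono2[OF le_trans[OF LGl(2) mult_le_mono2[OF lQ]]])
    have c4: "5 * nbits (n + t + 1) \<le> 5 * ?Q" using le_trans[OF nl lQ] by simp
    have c5: "7 * n \<le> 7 * ?Q" using le_trans[OF tN(3) Q0(1)] by simp
    have c6: "9 * k \<le> 9 * k * ?Q" using Q1 by simp
    have c7: "60 \<le> 60 * ?Q" using Q1 by simp
    have "pre_cost \<le> (5 * ((?s + 2) * ?s) + 8 * (?s + 1)) * ?Q + 6 * ?s * ?Q + 5 * k * ?Q + 7 * (2 * k + 4) * ?Q + 5 * ?Q + 7 * ?Q + 9 * k * ?Q + 60 * ?Q"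
      unfolding pre_cost_def by (intro add_mono sum c1 c2 c3 c4 c5 c6 c7)
    then show ?thesis unfolding pre_const_def add_mult_distrib .
  qed
  have K: "K \<le> c * l" by (rule mult_le_mono2[OF nl])
  have tl: "nbits t \<le> l" unfolding l_def by (rule nbits_mono[OF tN(1)])
  have rb: "round_bound k n t \<le> round_const k * (N * l ^ 4)"
  proof -
    let ?R = "N * l ^ 4"
    have R: "N * l ^ i \<le> ?R" if "i \<le> 4" for i using lle[OF that] by (rule mult_le_mono2)
    have R0: "N \<le> ?R" "N * l \<le> ?R" using R[of 0] R[of 1] by simp_all
    have R1: "1 \<le> ?R" using N1 R0(1) by (rule le_trans)
    have "nbits NM ^ 4 \<le> ((2 * k + 1) * l) ^ 4" using m by (rule power_mono) simp
    then have "nbits NM ^ 4 * 2 ^ nbits NM \<le> ((2 * k + 1) * l) ^ 4 * (2 * 3 ^ k * N)" using pm by (rule mult_le_mono)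
    also have "\<dots> = (2 * k + 1) ^ 4 * (2 * 3 ^ k) * ?R" by (simp only: power_mult_distrib mult.assoc mult.left_commute mult.commute)
    finally have d1: "1300 * nbits NM ^ 4 * 2 ^ nbits NM \<le> 1300 * (2 * k + 1) ^ 4 * (2 * 3 ^ k) * ?R"
      unfolding mult.assoc by (rule mult_le_mono2)
    have "t ^ k * nbits t \<le> N * l" by (rule mult_le_mono[OF tN(2) tl])
    then have "2 ^ k * (t ^ k * nbits t) \<le> 2 ^ k * ?R" using R0(2) by (intro mult_le_mono2) linarith
    then have d2: "12 * (2 ^ k * t ^ k * nbits t) \<le> 12 * 2 ^ k * ?R" unfolding mult.assoc by (rule mult_le_mono2)
    have d3: "20 * n \<le> 20 * ?R" using le_trans[OF tN(3) R0(1)] by simp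
    have "NM \<le> 3 ^ k * ?R" by (rule le_trans[OF NM3 mult_le_mono2[OF R0(1)]])
    then have d4: "30 * NM \<le> 30 * 3 ^ k * ?R" unfolding mult.assoc by (rule mult_le_mono2)
    have d5: "60 \<le> 60 * ?R" using R1 by simp
    show ?thesis unfolding round_bound_def round_const_def add_mult_distrib by (intro add_mono d1 d2 d3 d4 d5)
  qed
  have e1: "9 * (n * k * K) \<le> 9 * (k * c) * ?Q"
  proof -
    have "n * k * K \<le> N * k * (c * l)" by (intro mult_le_mono K tN order_refl)
    also have "\<dots> = k * c * (N * l)" by (simp only: mult.assoc mult.left_commute mult.commute)
    also have "\<dots> \<le> k * c * ?Q" by (rule mult_le_mono2[OF Q0(2)])
    finally show ?thesis unfolding mult.assoc by (rule mult_le_mono2)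
  qed
  have e2: "K * (round_bound k n t + 4) \<le> c * (round_const k + 4) * ?Q"
  proof -
    have "1 * 1 \<le> N * l ^ 4" by (rule mult_le_mono[OF N1 lp])
    then have "round_bound k n t + 4 \<le> round_const k * (N * l ^ 4) + 4 * (N * l ^ 4)" using rb by linarith
    then have "round_bound k n t + 4 \<le> (round_const k + 4) * (N * l ^ 4)" unfolding add_mult_distrib .
    then have "K * (round_bound k n t + 4) \<le> c * l * ((round_const k + 4) * (N * l ^ 4))" by (rule mult_le_mono[OF K])
    also have "\<dots> = c * (round_const k + 4) * (N * (l ^ 4 * l))" by (simp only: mult.assoc mult.left_commute mult.commute)
    also have "l ^ 4 * l = l ^ 5" by (simp add: power_eq_if)
    finally show ?thesis .
  qed
  have e3: "20 \<le> 20 * ?Q" using Q1 by simp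
  show ?thesis unfolding total_cost_def add_mult_distrib
    by (intro add_mono pre e1 e2[unfolded add_mult_distrib] e3)
qed

text \<open>All quantities are polynomial in \<open>U\<close> with a degree that depends on
  \<open>k\<close> and \<open>c\<close> only. Numerical constants are absorbed by
  \<open>2 \<le> U\<close>, and \<open>k\<close> and \<open>c\<close> themselves by
  \<open>k + 1 \<le> 2 ^ k\<close> and \<open>c \<le> 2 ^ c\<close>.\<close>

lemma word_bounds:
  fixes n t k c :: nat
  defines "U \<equiv> n + t + 2"
  defines "X \<equiv> U ^ (13 + 4 * k + c)"
  shows "n + k + 1 < X" "2 * (n + t + 2) < X" "c * nbits (n + t + 1) < X" "16 * (2 * t + 1) ^ k < X"
    "8 * ((2 * t + 1) ^ k)\<^sup>2 < X" "sieve_size k t + 1 < X" "n * k * (c * nbits (n + t + 1)) < X"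
proof -
  let ?N = "(2 * t + 1) ^ k"
  have U2: "2 \<le> U" by (simp add: U_def)
  have U1: "1 \<le> U" using U2 by simp
  have X: "y < X" if "y \<le> U ^ e" "e < 13 + 4 * k + c" for y e
    unfolding X_def by (rule le_less_trans[OF that(1) power_strict_increasing[OF that(2)]]) (use U2 in simp)
  have c2: "y \<le> U ^ e" if "y \<le> 2 ^ e" for y e by (rule le_trans[OF that power_mono[OF U2]]) simp
  have mono: "U ^ e \<le> U ^ e'" if "e \<le> e'" for e e' using that U1 by (rule power_increasing)
  have dbl: "2 * U ^ e \<le> U ^ Suc e" for e using U2 by simp
  have kU: "k + 1 \<le> U ^ k" "k \<le> U ^ k" "c \<le> U ^ c"
    using less_exp[of k] less_exp[of c] by (auto intro!: c2 simp: Suc_leI)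
  have nU: "n \<le> U" "t \<le> U" "nbits (n + t + 1) \<le> U" using nbits_le[of "n + t + 1"] by (simp_all add: U_def)
  have "(2 * t + 1) \<le> (t + 2)\<^sup>2" by (simp add: power2_eq_square)
  also have "\<dots> \<le> U\<^sup>2" by (rule power_mono) (simp_all add: U_def)
  finally have N: "?N \<le> U ^ (2 * k)" unfolding power_mult by (rule power_mono) simp
  have "n + (k + 1) \<le> U ^ 1 + U ^ k" using nU(1) kU(1) by (intro add_mono) simp_all
  also have "\<dots> \<le> U ^ (k + 1) + U ^ (k + 1)" by (intro add_mono mono) simp_all
  also have "\<dots> \<le> U ^ Suc (k + 1)" by (rule le_trans[OF _ dbl]) simp
  finally show "n + k + 1 < X" by (intro X[of _ "Suc (k + 1)"]) simp_all
  have "2 * (n + t + 2) \<le> U ^ Suc 1" using dbl[of 1] by (simp add: U_def)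
  then show "2 * (n + t + 2) < X" by (rule X) simp
  have cn: "c * nbits (n + t + 1) \<le> U ^ c * U" by (rule mult_le_mono[OF kU(3) nU(3)])
  then have "c * nbits (n + t + 1) \<le> U ^ (c + 1)" by (simp only: power_add power_one_right)
  then show "c * nbits (n + t + 1) < X" by (rule X) simp
  have "16 * ?N \<le> U ^ 4 * U ^ (2 * k)" by (rule mult_le_mono[OF c2 N]) simp
  then show "16 * ?N < X" unfolding power_add[symmetric] by (rule X) simp
  have "?N\<^sup>2 \<le> (U ^ (2 * k))\<^sup>2" using N by (rule power_mono) simp
  then have "8 * ?N\<^sup>2 \<le> U ^ 3 * (U ^ (2 * k))\<^sup>2" by (rule mult_le_mono[OF c2, rotated]) simp
  then show "8 * ?N\<^sup>2 < X" unfolding power_add[symmetric] power_mult[symmetric] by (rule X) simp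
  have "8 * ?N \<le> U ^ 3 * U ^ (2 * k)" by (rule mult_le_mono[OF c2 N]) simp
  then have "nbits (8 * ?N - 1) \<le> U ^ (3 + 2 * k)" unfolding power_add using nbits_le[of "8 * ?N - 1"] by linarith
  moreover have "k \<le> U ^ (3 + 2 * k)" by (rule le_trans[OF kU(2) mono]) simp
  ultimately have "nbits (8 * ?N - 1) + k \<le> 2 * U ^ (3 + 2 * k)" by linarith
  then have lg: "nbits (8 * ?N - 1) + k \<le> U ^ (4 + 2 * k)" using dbl[of "3 + 2 * k"] by (simp add: eval_nat_numeral)
  have "k * t + 1 \<le> k * U + U" by (rule add_mono[OF mult_le_mono2[OF nU(2)] U1])
  also have "\<dots> = (k + 1) * U" by simp
  also have "\<dots> \<le> U ^ k * U" by (rule mult_le_mono1[OF kU(1)])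
  finally have "4 * (k * t + 1) \<le> U ^ 2 * (U ^ k * U)" by (rule mult_le_mono[OF c2, rotated]) simp
  moreover have "4 * (k * t + 1) = 4 * k * t + 4" by simp
  moreover have "U ^ 2 * (U ^ k * U) = U ^ (k + 3)"
    by (simp add: power_add power2_eq_square power3_eq_cube mult.commute mult.left_commute)
  ultimately have "4 * k * t + 4 \<le> U ^ (k + 3)" by (simp only:)
  then have "(4 * k * t + 4) * (nbits (8 * ?N - 1) + k) \<le> U ^ (k + 3) * U ^ (4 + 2 * k)" using lg by (rule mult_le_mono)
  also have "\<dots> = U ^ (7 + 3 * k)" by (simp flip: power_add)
  finally have "sieve_size k t + 1 \<le> 2 * U ^ (7 + 3 * k) + 2 * 1" unfolding sieve_size_def by simp
  also have "\<dots> \<le> 2 * U ^ (7 + 3 * k) + 2 * U ^ (7 + 3 * k)" by (intro add_mono mult_le_mono2) (use U1 in simp_all)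
  also have "\<dots> \<le> U ^ 2 * U ^ (7 + 3 * k)"
  proof -
    have "4 * U ^ (7 + 3 * k) \<le> U ^ 2 * U ^ (7 + 3 * k)" by (rule mult_le_mono1[OF c2]) simp
    then show ?thesis by linarith
  qed
  finally show "sieve_size k t + 1 < X" unfolding power_add[symmetric] by (rule X) simp
  have "n * k * (c * nbits (n + t + 1)) \<le> U * U ^ k * (U ^ c * U)" by (intro mult_le_mono nU kU)
  also have "\<dots> = U ^ (k + c + 2)" by (simp add: power_add power2_eq_square ac_simps)
  finally show "n * k * (c * nbits (n + t + 1)) < X" by (rule X) simp
qed

lemma nbits_le_log:
  assumes "1 \<le> N"
  shows "real (nbits N) \<le> 2 * log 2 (real N + 1)"
proof -
  have "2 ^ nbits N \<le> 2 * N" using assms by (intro pow_nbits_le) simp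
  then have "2 ^ nbits N \<le> real (2 * N)" by (metis of_nat_le_iff of_nat_numeral of_nat_power)
  then have "log 2 (2 ^ nbits N) \<le> log 2 (2 * real N)" by (subst log_le_cancel_iff) (use assms in auto)
  then have "real (nbits N) \<le> 1 + log 2 (real N)" using assms by (simp add: log_mult log_nat_power)
  moreover have "log 2 (real N) \<le> log 2 (real N + 1)" "log 2 2 \<le> log 2 (real N + 1)"
    using assms by (subst log_le_cancel_iff; simp)+
  moreover have "log 2 2 = (1::real)" by simp
  ultimately show ?thesis by linarith
qed

theorem theorem6:
  fixes k :: nat
  assumes "k \<ge> 1"
  shows "\<forall>c :: nat. \<exists>(P :: prog) (\<kappa> :: nat) (C :: real) (d :: nat).
    \<forall>(Z :: nat set) (xs :: nat list) (ts :: nat list) (n :: nat) (t :: nat) (w :: nat).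
      0 \<notin> Z \<and> set xs = Z \<and> distinct xs \<and> n = card Z \<and>
      length ts = k \<and> t = Max (set ts) \<and> word_size_ok w \<kappa> Z n t \<longrightarrow>
      (\<exists>T :: nat.
         real T \<le> C * (real n + real t ^ k + 1) * log 2 (real n + real t ^ k + 2) ^ d \<and>
         halts_within w P (input_state ts xs) T \<and>
         answer_prob w P (input_state ts xs) T (k_subset_sum Z ts)
           \<ge> 1 - 1 / (real n + real t + 2) ^ c)"
proof
  fix c :: nat
  let ?P = "program k c"
  define E where "E = plv ?P"
  define A where "A = pre_const k + 9 * (k * c) + c * (round_const k + 4) + 20"
  have E1: "1 \<le> E" by (simp add: E_def program_def)
  show "\<exists>(P :: prog) (\<kappa> :: nat) (C :: real) (d :: nat).
    \<forall>(Z :: nat set) (xs :: nat list) (ts :: nat list) (n :: nat) (t :: nat) (w :: nat).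
      0 \<notin> Z \<and> set xs = Z \<and> distinct xs \<and> n = card Z \<and>
      length ts = k \<and> t = Max (set ts) \<and> word_size_ok w \<kappa> Z n t \<longrightarrow>
      (\<exists>T :: nat.
         real T \<le> C * (real n + real t ^ k + 1) * log 2 (real n + real t ^ k + 2) ^ d \<and>
         halts_within w P (input_state ts xs) T \<and>
         answer_prob w P (input_state ts xs) T (k_subset_sum Z ts)
           \<ge> 1 - 1 / (real n + real t + 2) ^ c)"
  \<comment> \<open>The word size exponent is that of \<open>X\<close> times \<open>E\<close>, so
    that \<open>X ^ E\<close> fits into a word. The factor 32 is \<open>2 ^ 5\<close>: the binary
    length is at most twice the logarithm, and it enters with exponent 5.\<close>
  proof (rule exI[of _ ?P], rule exI[of _ "(13 + 4 * k + c) * E"], rule exI[of _ "32 * real A"], rule exI[of _ 5], intro allI impI)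
    fix Z xs ts n t w
    assume h: "0 \<notin> Z \<and> set xs = Z \<and> distinct xs \<and> n = card Z \<and>
      length ts = k \<and> t = Max (set ts) \<and> word_size_ok w ((13 + 4 * k + c) * E) Z n t"
    define X where "X = (n + t + 2) ^ (13 + 4 * k + c)"
    have n: "length xs = n" using h distinct_card[of xs] by simp
    have lt: "length ts = k" using h by simp
    have ne: "ts \<noteq> []" using lt assms by auto
    have tsle: "ts ! i \<le> t" if "i < k" for i using h that by simp
    have "t \<in> set ts" using h ne by simp
    then have tsex: "\<exists>i<k. ts ! i = t" using lt by (auto simp: in_set_conv_nth)
    define inp where "inp = (\<lambda>a. if a < length (n # ts @ xs) then (n # ts @ xs) ! a else 0)"
    have inpv: "inp 0 = n" "\<And>i. i < k \<Longrightarrow> inp (Suc i) = ts ! i" "\<And>i. inp (i + (k + 1)) = (if i < n then xs ! i else 0)"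
      using n lt by (auto simp: inp_def nth_append)
    have xw: "xs ! i < 2 ^ w" if "i < n" for i
      using h n nth_mem[of i xs] that by (auto simp: word_size_ok_def)
    have XE: "X ^ E \<le> 2 ^ w" 
    proof -
      have "(n + t + 2) ^ ((13 + 4 * k + c) * E) \<le> 2 ^ w" using h unfolding word_size_ok_def by blast
      then show ?thesis unfolding X_def power_mult .
    qed
    have X2: "2 \<le> X"
    proof -
      have "2 * (n + t + 2) < X" unfolding X_def by (rule word_bounds(2))
      moreover have "2 \<le> 2 * (n + t + 2)" by simp
      ultimately show ?thesis by (meson le_trans less_imp_le)
    qed
    interpret input w X E "n + k + 1" inp n t k c
    proof unfold_locales
      show "inp (i + (k + 1)) < 2 ^ w" if "i < n" for i using xw[OF that] that inpv(3) by simp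
      show "\<exists>i<k. inp (Suc i) = t" using tsex inpv(2) by auto
      show "inp (Suc i) \<le> t" if "i < k" for i using tsle inpv(2) that by simp
    qed (use X2 XE assms inpv word_bounds[where n = n and t = t and k = k and c = c, folded X_def] in simp_all)
    let ?s0 = "input_state ts xs"
    have s0: "regs ?s0 = (\<lambda>_. 0)" "mem ?s0 = inp" using n by (simp_all add: input_state_def inp_def Let_def)
    have "\<exists>\<tau> p. prime p \<and> 4 * k * t + 4 < p \<and> p \<le> X \<and> \<tau> \<le> pre_cost + 4 \<and>
      (\<forall>\<omega>. \<exists>m s'. m \<le> total_cost \<and> exec w \<omega> 0 ?P ?s0 m s' \<and>
        regs s' 0 = (if \<forall>rd<K. int p dvd solutions k els (\<lambda>l i. int (\<omega> (\<tau> + 9 * ((rd * n + l) * k + i)) mod p)) n tgt then 0 else 1))"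
    proof (rule exec_program)
      show "mem ?s0 i = 0" if "n + k + 1 \<le> i" for i using that n lt by (simp add: s0 inp_def)
      show "i = j" if "i < n" "j < n" "inp (i + (k + 1)) = inp (j + (k + 1))" for i j

      proof -
        have "distinct xs" using h by blast
        from nth_eq_iff_index_eq[OF this, unfolded n, OF that(1,2)]
        show ?thesis using that(3) unfolding inpv(3) if_P[OF that(1)] if_P[OF that(2)] by (rule iffD1)
      qed
    qed (simp_all add: s0 E_def)
    then obtain \<tau> p where p: "prime p" "4 * k * t + 4 < p" "p \<le> X" "\<tau> \<le> pre_cost + 4"
      and ex: "\<And>\<omega>. \<exists>m s'. m \<le> total_cost \<and> exec w \<omega> 0 ?P ?s0 m s' \<and>
        regs s' 0 = (if \<forall>rd<K. int p dvd solutions k els (\<lambda>l i. int (\<omega> (\<tau> + 9 * ((rd * n + l) * k + i)) mod p)) n tgt then 0 else 1)"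
      by blast
    let ?F = "\<lambda>\<omega>. \<forall>rd<K. int p dvd solutions k els (\<lambda>l i. int (\<omega> (\<tau> + 9 * ((rd * n + l) * k + i)) mod p)) n tgt"
    let ?T = total_cost
    have D: "\<exists>s'. drun w \<omega> ?T (?P, ?s0) = (Skip, s') \<and> regs s' 0 = (if ?F \<omega> then 0 else 1)" for \<omega>
      using ex[of \<omega>] exec_drun by blast
    have halt: "halted (drun w \<omega> ?T (?P, ?s0))" for \<omega> using D[of \<omega>] by (auto simp: halted_def)
    have acc: "accepting (drun w \<omega> ?T (?P, ?s0)) \<longleftrightarrow> \<not> ?F \<omega>" for \<omega>
    proof -
      obtain s' where s': "drun w \<omega> ?T (?P, ?s0) = (Skip, s')" "regs s' 0 = (if ?F \<omega> then 0 else 1)" using D[of \<omega>] by blast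
      have "(if Q then 0 else 1 :: nat) \<noteq> 0 \<longleftrightarrow> \<not> Q" for Q by simp
      then show ?thesis unfolding accepting_def s'(1) snd_conv s'(2) .
    qed
    have halts: "halts_within w ?P ?s0 ?T"
      unfolding halts_within_def run_eq_map_drun using halt by auto
    have ans: "answer_prob w ?P ?s0 ?T b = measure_pmf.prob (tape_pmf w ?T) {\<omega>. \<not> ?F \<omega> \<longleftrightarrow> b}" for b
      unfolding answer_prob_def run_eq_map_drun measure_map_pmf vimage_def using halt acc by simp
    have els: "els = (\<lambda>i. if i < length xs \<and> xs ! i \<le> t then xs ! i else 0)"
      unfolding els_def inpv(3) n by (auto simp: fun_eq_iff)
    have tgt: "tgt = (\<lambda>i. if i < length ts then ts ! i else 0)"
      by (simp add: fun_eq_iff tgt_def lt inpv(2))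
    have sol: "solvable k els n tgt \<longleftrightarrow> k_subset_sum Z ts"
      using solvable_k_subset_sum[of xs Z ts t] h tsle n unfolding els tgt by simp
    have "answer_prob w ?P ?s0 ?T (k_subset_sum Z ts) \<ge> 1 - 1 / (real n + real t + 2) ^ c"
    \<comment> \<open>Without a solution the coefficient is 0 for all weights and the answer is
      certain; only the other case can err.\<close>
    proof (cases "solvable k els n tgt")
      case False
      then have F: "?F \<omega>" for \<omega> using solutions_unsolvable[OF False] by simp
      have "{\<omega>. \<not> ?F \<omega> \<longleftrightarrow> k_subset_sum Z ts} = UNIV" using F False sol by blast
      then have "answer_prob w ?P ?s0 ?T (k_subset_sum Z ts) = 1" unfolding ans by simp
      then show ?thesis by simp
    next
      case True
      have pw: "p \<le> 2 ^ w" "4 * k * t < p" using p(2,3) pow_le[OF E1] by simp_all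
      have "\<tau> + 9 * (n * k * K) \<le> ?T" using p(4) unfolding total_cost_def by linarith
      from prob_rounds[OF p(1) pw this True]
      have pr: "measure_pmf.prob (tape_pmf w ?T) {\<omega>. ?F \<omega>} \<le> (1 / 2) ^ K" .
      have "{\<omega>. \<not> ?F \<omega> \<longleftrightarrow> k_subset_sum Z ts} = UNIV - {\<omega>. ?F \<omega>}" using True sol by blast
      then have "answer_prob w ?P ?s0 ?T (k_subset_sum Z ts) = 1 - measure_pmf.prob (tape_pmf w ?T) {\<omega>. ?F \<omega>}"
        unfolding ans using measure_pmf.prob_compl[of "{\<omega>. ?F \<omega>}" "tape_pmf w ?T"] by simp
      moreover have "(1 / 2) ^ K \<le> 1 / (real n + real t + 2) ^ c"
      proof -
        have "n + t + 2 \<le> 2 ^ nbits (n + t + 1)" using less_pow_nbits[of "n + t + 1"] by simp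
        then have "real (n + t + 2) \<le> 2 ^ nbits (n + t + 1)" by (metis of_nat_le_iff of_nat_numeral of_nat_power)
        then have "real (n + t + 2) ^ c \<le> (2 ^ nbits (n + t + 1)) ^ c" by (rule power_mono) simp
        also have "\<dots> = 2 ^ K" by (simp add: mult.commute flip: power_mult)
        finally have "(real n + real t + 2) ^ c \<le> 2 ^ K" by (simp add: add_ac)
        then have "1 / 2 ^ K \<le> 1 / (real n + real t + 2) ^ c" by (intro divide_left_mono) auto
        then show ?thesis by (simp add: power_one_over)
      qed
      ultimately show ?thesis using pr by linarith
    qed
    moreover have "real ?T \<le> 32 * real A * (real n + real t ^ k + 1) * log 2 (real n + real t ^ k + 2) ^ 5"
    proof -
      let ?N = "n + t ^ k + 1"
      let ?L = "log 2 (real ?N + 1)"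
      have "real ?T \<le> real (A * (?N * nbits ?N ^ 5))" unfolding A_def by (intro of_nat_mono total_cost_le)
      also have "\<dots> = real A * real ?N * real (nbits ?N) ^ 5" by (simp only: of_nat_mult of_nat_power mult.assoc)
      also have "\<dots> \<le> real A * real ?N * (2 * ?L) ^ 5"
        by (intro mult_left_mono power_mono nbits_le_log) auto
      also have "\<dots> = 32 * real A * real ?N * ?L ^ 5" by (simp add: power_mult_distrib)
      finally show ?thesis by (simp add: add_ac)
    qed
    ultimately show "\<exists>T :: nat.
         real T \<le> 32 * real A * (real n + real t ^ k + 1) * log 2 (real n + real t ^ k + 2) ^ 5 \<and>
         halts_within w ?P ?s0 T \<and>
         answer_prob w ?P ?s0 T (k_subset_sum Z ts) \<ge> 1 - 1 / (real n + real t + 2) ^ c"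
      using halts by blast
  qed
qed

end
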